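(* Let $k$ be a field and let $\Gamma$ be a finite simplicial graph such that the Bestvina-Brady Lie algebra $\mathscr B_\Gamma$ over $k$ is a Poincaré duality Lie algebra of dimension $n$. Then $\mathscr B_\Gamma$ is abelian.
   Context: For a simplicial graph $\Gamma=(V,E)$, the RAAG Lie algebra $\mathscr L_\Gamma$ over $k$ is the graded Lie $k$-algebra with presentation $\langle v\in V\mid [v,w]\text{ for }\{v,w\}\in E\rangle$, generators in degree $1$. The Bestvina-Brady Lie algebra $\mathscr B_\Gamma$ is the kernel of the Lie algebra homomorphism $\mathscr L_\Gamma\to k$ sending every vertex to $1$. A Lie $k$-algebra $\mathscr L$ is a Poincaré duality Lie algebra of dimension $n\in\mathbb N$ if it has cohomological dimension $n$, $H^n(\mathscr L,k)$ is $1$-dimensional, and the cup product defines non-degenerate pairings $H^i(\mathscr L,k)\otimes H^{n-i}(\mathscr L,k)\to H^n(\mathscr L,k)$ for all $i$ (trivial coefficients). *)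

theory Defs
  imports "HOL-Algebra.Module" "HOL-Algebra.AbelCoset" "HOL-Library.Extended_Nat"
begin

section \<open>Lie algebras\<close>

text \<open>The fields \<^const>\<open>mult\<close> and \<^const>\<open>one\<close> inherited from the library's module records carry
  no meaning below and are left \<^const>\<open>undefined\<close>.\<close>

record ('a, 'b) lie_algebra = "('a, 'b) module" +
  bracket :: "'b \<Rightarrow> 'b \<Rightarrow> 'b"

locale lie_algebra = Module.module R L
  for R :: "('a, 'x) ring_scheme" (structure) and L :: "('a, 'b, 'y) lie_algebra_scheme" (structure) +
  assumes bracket_closed:
      "\<lbrakk>x \<in> carrier L; y \<in> carrier L\<rbrakk> \<Longrightarrow> bracket L x y \<in> carrier L"
    and bracket_add_left:
      "\<lbrakk>x \<in> carrier L; y \<in> carrier L; z \<in> carrier L\<rbrakk> \<Longrightarrow>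
        bracket L (x \<oplus>\<^bsub>L\<^esub> y) z = bracket L x z \<oplus>\<^bsub>L\<^esub> bracket L y z"
    and bracket_add_right:
      "\<lbrakk>x \<in> carrier L; y \<in> carrier L; z \<in> carrier L\<rbrakk> \<Longrightarrow>
        bracket L x (y \<oplus>\<^bsub>L\<^esub> z) = bracket L x y \<oplus>\<^bsub>L\<^esub> bracket L x z"
    and bracket_smult_left:
      "\<lbrakk>c \<in> carrier R; x \<in> carrier L; y \<in> carrier L\<rbrakk> \<Longrightarrow>
        bracket L (c \<odot>\<^bsub>L\<^esub> x) y = c \<odot>\<^bsub>L\<^esub> bracket L x y"
    and bracket_smult_right:
      "\<lbrakk>c \<in> carrier R; x \<in> carrier L; y \<in> carrier L\<rbrakk> \<Longrightarrow>
        bracket L x (c \<odot>\<^bsub>L\<^esub> y) = c \<odot>\<^bsub>L\<^esub> bracket L x y"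
    and bracket_self: "x \<in> carrier L \<Longrightarrow> bracket L x x = \<zero>\<^bsub>L\<^esub>"
    and jacobi:
      "\<lbrakk>x \<in> carrier L; y \<in> carrier L; z \<in> carrier L\<rbrakk> \<Longrightarrow>
        bracket L x (bracket L y z) \<oplus>\<^bsub>L\<^esub> (bracket L y (bracket L z x)
          \<oplus>\<^bsub>L\<^esub> bracket L z (bracket L x y)) = \<zero>\<^bsub>L\<^esub>"

definition abelian_lie_algebra :: "('a, 'b, 'y) lie_algebra_scheme \<Rightarrow> bool" where
  "abelian_lie_algebra L \<longleftrightarrow> (\<forall>x\<in>carrier L. \<forall>y\<in>carrier L. bracket L x y = \<zero>\<^bsub>L\<^esub>)"

definition lie_hom :: "('a, 'x) ring_scheme \<Rightarrow> ('a, 'b, 'y) lie_algebra_scheme \<Rightarrow>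
    ('a, 'c, 'z) lie_algebra_scheme \<Rightarrow> ('b \<Rightarrow> 'c) set" where
  "lie_hom k L L' = {\<phi> \<in> carrier L \<rightarrow> carrier L'.
     (\<forall>x\<in>carrier L. \<forall>y\<in>carrier L. \<phi> (x \<oplus>\<^bsub>L\<^esub> y) = \<phi> x \<oplus>\<^bsub>L'\<^esub> \<phi> y) \<and>
     (\<forall>c\<in>carrier k. \<forall>x\<in>carrier L. \<phi> (c \<odot>\<^bsub>L\<^esub> x) = c \<odot>\<^bsub>L'\<^esub> \<phi> x) \<and>
     (\<forall>x\<in>carrier L. \<forall>y\<in>carrier L. \<phi> (bracket L x y) = bracket L' (\<phi> x) (\<phi> y))}"

text \<open>The ground ring as a one-dimensional abelian Lie algebra.\<close>

definition ground_lie_algebra :: "('a, 'x) ring_scheme \<Rightarrow> ('a, 'a) lie_algebra" where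
  "ground_lie_algebra k =
     \<lparr>carrier = carrier k, mult = undefined, one = undefined, zero = \<zero>\<^bsub>k\<^esub>, add = add k,
      smult = mult k, bracket = (\<lambda>_ _. \<zero>\<^bsub>k\<^esub>)\<rparr>"


section \<open>Lie algebras given by generators and relations\<close>

text \<open>The Lie algebra generated by a set \<open>V\<close> subject to the relations \<open>r = 0\<close> for \<open>r \<in> S\<close> is the
  quotient of the algebra of formal expressions over \<open>V\<close> by the smallest congruence which satisfies
  the Lie algebra axioms and kills \<open>S\<close>.\<close>

datatype ('a, 'v) lie_term =
    Gen 'v
  | Zero
  | Add "('a, 'v) lie_term" "('a, 'v) lie_term"
  | Smult 'a "('a, 'v) lie_term"
  | Brack "('a, 'v) lie_term" "('a, 'v) lie_term"

inductive_set lie_terms :: "('a, 'x) ring_scheme \<Rightarrow> 'v set \<Rightarrow> ('a, 'v) lie_term set"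
  for k :: "('a, 'x) ring_scheme" and V :: "'v set" where
  Gen: "v \<in> V \<Longrightarrow> Gen v \<in> lie_terms k V"
| Zero: "Zero \<in> lie_terms k V"
| Add: "\<lbrakk>s \<in> lie_terms k V; t \<in> lie_terms k V\<rbrakk> \<Longrightarrow> Add s t \<in> lie_terms k V"
| Smult: "\<lbrakk>c \<in> carrier k; t \<in> lie_terms k V\<rbrakk> \<Longrightarrow> Smult c t \<in> lie_terms k V"
| Brack: "\<lbrakk>s \<in> lie_terms k V; t \<in> lie_terms k V\<rbrakk> \<Longrightarrow> Brack s t \<in> lie_terms k V"

inductive lie_cong :: "('a, 'x) ring_scheme \<Rightarrow> 'v set \<Rightarrow> ('a, 'v) lie_term set \<Rightarrow>
    ('a, 'v) lie_term \<Rightarrow> ('a, 'v) lie_term \<Rightarrow> bool"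
  for k :: "('a, 'x) ring_scheme" and V :: "'v set" and S :: "('a, 'v) lie_term set" where
  refl: "t \<in> lie_terms k V \<Longrightarrow> lie_cong k V S t t"
| sym: "lie_cong k V S s t \<Longrightarrow> lie_cong k V S t s"
| trans: "\<lbrakk>lie_cong k V S s t; lie_cong k V S t u\<rbrakk> \<Longrightarrow> lie_cong k V S s u"
| cong_Add: "\<lbrakk>lie_cong k V S s s'; lie_cong k V S t t'\<rbrakk> \<Longrightarrow> lie_cong k V S (Add s t) (Add s' t')"
| cong_Smult: "\<lbrakk>c \<in> carrier k; lie_cong k V S t t'\<rbrakk> \<Longrightarrow> lie_cong k V S (Smult c t) (Smult c t')"
| cong_Brack: "\<lbrakk>lie_cong k V S s s'; lie_cong k V S t t'\<rbrakk> \<Longrightarrow>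
    lie_cong k V S (Brack s t) (Brack s' t')"
| add_assoc: "\<lbrakk>s \<in> lie_terms k V; t \<in> lie_terms k V; u \<in> lie_terms k V\<rbrakk> \<Longrightarrow>
    lie_cong k V S (Add (Add s t) u) (Add s (Add t u))"
| add_comm: "\<lbrakk>s \<in> lie_terms k V; t \<in> lie_terms k V\<rbrakk> \<Longrightarrow> lie_cong k V S (Add s t) (Add t s)"
| add_zero: "t \<in> lie_terms k V \<Longrightarrow> lie_cong k V S (Add Zero t) t"
| add_minus: "t \<in> lie_terms k V \<Longrightarrow> lie_cong k V S (Add (Smult (\<ominus>\<^bsub>k\<^esub> \<one>\<^bsub>k\<^esub>) t) t) Zero"
| smult_add_scalar: "\<lbrakk>c \<in> carrier k; d \<in> carrier k; t \<in> lie_terms k V\<rbrakk> \<Longrightarrow>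
    lie_cong k V S (Smult (c \<oplus>\<^bsub>k\<^esub> d) t) (Add (Smult c t) (Smult d t))"
| smult_add: "\<lbrakk>c \<in> carrier k; s \<in> lie_terms k V; t \<in> lie_terms k V\<rbrakk> \<Longrightarrow>
    lie_cong k V S (Smult c (Add s t)) (Add (Smult c s) (Smult c t))"
| smult_assoc: "\<lbrakk>c \<in> carrier k; d \<in> carrier k; t \<in> lie_terms k V\<rbrakk> \<Longrightarrow>
    lie_cong k V S (Smult (c \<otimes>\<^bsub>k\<^esub> d) t) (Smult c (Smult d t))"
| smult_one: "t \<in> lie_terms k V \<Longrightarrow> lie_cong k V S (Smult \<one>\<^bsub>k\<^esub> t) t"
| brack_add_left: "\<lbrakk>s \<in> lie_terms k V; t \<in> lie_terms k V; u \<in> lie_terms k V\<rbrakk> \<Longrightarrow>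
    lie_cong k V S (Brack (Add s t) u) (Add (Brack s u) (Brack t u))"
| brack_add_right: "\<lbrakk>s \<in> lie_terms k V; t \<in> lie_terms k V; u \<in> lie_terms k V\<rbrakk> \<Longrightarrow>
    lie_cong k V S (Brack s (Add t u)) (Add (Brack s t) (Brack s u))"
| brack_smult_left: "\<lbrakk>c \<in> carrier k; s \<in> lie_terms k V; t \<in> lie_terms k V\<rbrakk> \<Longrightarrow>
    lie_cong k V S (Brack (Smult c s) t) (Smult c (Brack s t))"
| brack_smult_right: "\<lbrakk>c \<in> carrier k; s \<in> lie_terms k V; t \<in> lie_terms k V\<rbrakk> \<Longrightarrow>
    lie_cong k V S (Brack s (Smult c t)) (Smult c (Brack s t))"
| brack_self: "t \<in> lie_terms k V \<Longrightarrow> lie_cong k V S (Brack t t) Zero"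
| brack_jacobi: "\<lbrakk>s \<in> lie_terms k V; t \<in> lie_terms k V; u \<in> lie_terms k V\<rbrakk> \<Longrightarrow>
    lie_cong k V S (Add (Brack s (Brack t u)) (Add (Brack t (Brack u s)) (Brack u (Brack s t)))) Zero"
| relator: "\<lbrakk>r \<in> S; r \<in> lie_terms k V\<rbrakk> \<Longrightarrow> lie_cong k V S r Zero"

definition lie_class :: "('a, 'x) ring_scheme \<Rightarrow> 'v set \<Rightarrow> ('a, 'v) lie_term set \<Rightarrow>
    ('a, 'v) lie_term \<Rightarrow> ('a, 'v) lie_term set" where
  "lie_class k V S t = {s. lie_cong k V S t s}"

definition presented_lie_algebra :: "('a, 'x) ring_scheme \<Rightarrow> 'v set \<Rightarrow> ('a, 'v) lie_term set \<Rightarrow>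
    ('a, ('a, 'v) lie_term set) lie_algebra" where
  "presented_lie_algebra k V S =
     \<lparr>carrier = lie_class k V S ` lie_terms k V,
      mult = undefined, one = undefined,
      zero = lie_class k V S Zero,
      add = (\<lambda>X Y. \<Union>s\<in>X. \<Union>t\<in>Y. lie_class k V S (Add s t)),
      smult = (\<lambda>c X. \<Union>s\<in>X. lie_class k V S (Smult c s)),
      bracket = (\<lambda>X Y. \<Union>s\<in>X. \<Union>t\<in>Y. lie_class k V S (Brack s t))\<rparr>"


section \<open>RAAG and Bestvina-Brady Lie algebras of a graph\<close>

definition simplicial_graph :: "'v set \<Rightarrow> 'v set set \<Rightarrow> bool" where
  "simplicial_graph V E \<longleftrightarrow> (\<forall>e\<in>E. \<exists>v\<in>V. \<exists>w\<in>V. v \<noteq> w \<and> e = {v, w})"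

definition raag_relators :: "'v set set \<Rightarrow> ('a, 'v) lie_term set" where
  "raag_relators E = {Brack (Gen v) (Gen w) | v w. {v, w} \<in> E}"

definition raag_lie_algebra :: "('a, 'x) ring_scheme \<Rightarrow> 'v set \<Rightarrow> 'v set set \<Rightarrow>
    ('a, ('a, 'v) lie_term set) lie_algebra" where
  "raag_lie_algebra k V E = presented_lie_algebra k V (raag_relators E)"

definition raag_vertex :: "('a, 'x) ring_scheme \<Rightarrow> 'v set \<Rightarrow> 'v set set \<Rightarrow> 'v \<Rightarrow>
    ('a, 'v) lie_term set" where
  "raag_vertex k V E v = lie_class k V (raag_relators E) (Gen v)"

text \<open>That this homomorphism exists and is unique is \<open>raag_augmentation_ex1\<close> below.\<close>

definition raag_augmentation :: "('a, 'x) ring_scheme \<Rightarrow> 'v set \<Rightarrow> 'v set set \<Rightarrow>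
    ('a, 'v) lie_term set \<Rightarrow> 'a" where
  "raag_augmentation k V E =
     (THE \<phi>. \<phi> \<in> lie_hom k (raag_lie_algebra k V E) (ground_lie_algebra k) \<and>
             \<phi> \<in> extensional (carrier (raag_lie_algebra k V E)) \<and>
             (\<forall>v\<in>V. \<phi> (raag_vertex k V E v) = \<one>\<^bsub>k\<^esub>))"

definition bestvina_brady_lie_algebra :: "('a, 'x) ring_scheme \<Rightarrow> 'v set \<Rightarrow> 'v set set \<Rightarrow>
    ('a, ('a, 'v) lie_term set) lie_algebra" where
  "bestvina_brady_lie_algebra k V E =
     (raag_lie_algebra k V E)
       \<lparr>carrier := a_kernel (raag_lie_algebra k V E) (ground_lie_algebra k) (raag_augmentation k V E)\<rparr>"


section \<open>Modules over a Lie algebra\<close>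

record ('a, 'm, 'b) lie_module = "('a, 'm) module" +
  act :: "'b \<Rightarrow> 'm \<Rightarrow> 'm"

locale lie_module = lie_algebra R L + M: Module.module R M
  for R :: "('a, 'x) ring_scheme" (structure) and L :: "('a, 'b, 'y) lie_algebra_scheme" (structure)
    and M :: "('a, 'm, 'b, 'z) lie_module_scheme" (structure) +
  assumes act_closed: "\<lbrakk>x \<in> carrier L; m \<in> carrier M\<rbrakk> \<Longrightarrow> act M x m \<in> carrier M"
    and act_add_left: "\<lbrakk>x \<in> carrier L; y \<in> carrier L; m \<in> carrier M\<rbrakk> \<Longrightarrow>
        act M (x \<oplus>\<^bsub>L\<^esub> y) m = act M x m \<oplus>\<^bsub>M\<^esub> act M y m"
    and act_add_right: "\<lbrakk>x \<in> carrier L; m \<in> carrier M; m' \<in> carrier M\<rbrakk> \<Longrightarrow>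
        act M x (m \<oplus>\<^bsub>M\<^esub> m') = act M x m \<oplus>\<^bsub>M\<^esub> act M x m'"
    and act_smult_left: "\<lbrakk>c \<in> carrier R; x \<in> carrier L; m \<in> carrier M\<rbrakk> \<Longrightarrow>
        act M (c \<odot>\<^bsub>L\<^esub> x) m = c \<odot>\<^bsub>M\<^esub> act M x m"
    and act_smult_right: "\<lbrakk>c \<in> carrier R; x \<in> carrier L; m \<in> carrier M\<rbrakk> \<Longrightarrow>
        act M x (c \<odot>\<^bsub>M\<^esub> m) = c \<odot>\<^bsub>M\<^esub> act M x m"
    and act_bracket: "\<lbrakk>x \<in> carrier L; y \<in> carrier L; m \<in> carrier M\<rbrakk> \<Longrightarrow>
        act M (bracket L x y) m = act M x (act M y m) \<ominus>\<^bsub>M\<^esub> act M y (act M x m)"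

definition trivial_module :: "('a, 'x) ring_scheme \<Rightarrow> ('a, 'a, 'b) lie_module" where
  "trivial_module k =
     \<lparr>carrier = carrier k, mult = undefined, one = undefined, zero = \<zero>\<^bsub>k\<^esub>, add = add k,
      smult = mult k, act = (\<lambda>_ _. \<zero>\<^bsub>k\<^esub>)\<rparr>"


section \<open>Lie algebra cohomology\<close>

text \<open>Cohomology is taken with the Chevalley-Eilenberg complex of alternating multilinear maps
  \<open>L\<^sup>n \<rightarrow> M\<close>, which over a field of any characteristic computes \<open>Ext\<^sup>n(k, M)\<close> over the
  enveloping algebra of \<open>L\<close>. Alternating means vanishing on tuples with a repeated entry, also in
  characteristic two.
  An \<open>n\<close>-tuple is a list of length \<open>n\<close>; \<^term>\<open>nths xs (- I)\<close> deletes the positions in \<open>I\<close>.\<close>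

definition tuples :: "('b, 'y) partial_object_scheme \<Rightarrow> nat \<Rightarrow> 'b list set" where
  "tuples L n = {xs. length xs = n \<and> set xs \<subseteq> carrier L}"

definition cochains :: "('a, 'x) ring_scheme \<Rightarrow> ('a, 'b, 'y) lie_algebra_scheme \<Rightarrow>
    ('a, 'm, 'b, 'z) lie_module_scheme \<Rightarrow> nat \<Rightarrow> ('b list \<Rightarrow> 'm) set" where
  "cochains k L M n = {f \<in> tuples L n \<rightarrow>\<^sub>E carrier M.
     (\<forall>xs\<in>tuples L n. \<forall>i<n. \<forall>x\<in>carrier L. \<forall>y\<in>carrier L.
        f (xs[i := x \<oplus>\<^bsub>L\<^esub> y]) = f (xs[i := x]) \<oplus>\<^bsub>M\<^esub> f (xs[i := y])) \<and>
     (\<forall>xs\<in>tuples L n. \<forall>i<n. \<forall>c\<in>carrier k. \<forall>x\<in>carrier L.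
        f (xs[i := c \<odot>\<^bsub>L\<^esub> x]) = c \<odot>\<^bsub>M\<^esub> f (xs[i := x])) \<and>
     (\<forall>xs\<in>tuples L n. \<forall>i<n. \<forall>j<n. i \<noteq> j \<and> xs ! i = xs ! j \<longrightarrow> f xs = \<zero>\<^bsub>M\<^esub>)}"

definition cochain_module :: "('a, 'x) ring_scheme \<Rightarrow> ('a, 'b, 'y) lie_algebra_scheme \<Rightarrow>
    ('a, 'm, 'b, 'z) lie_module_scheme \<Rightarrow> nat \<Rightarrow> ('a, 'b list \<Rightarrow> 'm) module" where
  "cochain_module k L M n =
     \<lparr>carrier = cochains k L M n, mult = undefined, one = undefined,
      zero = (\<lambda>xs\<in>tuples L n. \<zero>\<^bsub>M\<^esub>),
      add = (\<lambda>f g. \<lambda>xs\<in>tuples L n. f xs \<oplus>\<^bsub>M\<^esub> g xs),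
      smult = (\<lambda>c f. \<lambda>xs\<in>tuples L n. c \<odot>\<^bsub>M\<^esub> f xs)\<rparr>"

definition sign_pow :: "('a, 'x) ring_scheme \<Rightarrow> nat \<Rightarrow> 'a" where
  "sign_pow k j = (\<ominus>\<^bsub>k\<^esub> \<one>\<^bsub>k\<^esub>) [^]\<^bsub>k\<^esub> j"

text \<open>\<open>(df)(x\<^sub>0,\<dots>,x\<^sub>n) = \<Sum>\<^sub>i (-1)\<^sup>i x\<^sub>i f(\<dots>, x\<^sub>i omitted, \<dots>)
  + \<Sum>\<^sub>i\<^sub><\<^sub>j (-1)\<^sup>i\<^sup>+\<^sup>j f([x\<^sub>i,x\<^sub>j], \<dots>, x\<^sub>i and x\<^sub>j omitted, \<dots>)\<close>\<close>

definition coboundary_map :: "('a, 'x) ring_scheme \<Rightarrow> ('a, 'b, 'y) lie_algebra_scheme \<Rightarrow>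
    ('a, 'm, 'b, 'z) lie_module_scheme \<Rightarrow> nat \<Rightarrow> ('b list \<Rightarrow> 'm) \<Rightarrow> 'b list \<Rightarrow> 'm" where
  "coboundary_map k L M n f = (\<lambda>xs\<in>tuples L (Suc n).
     (\<Oplus>\<^bsub>M\<^esub>i\<in>{..n}. sign_pow k i \<odot>\<^bsub>M\<^esub> act M (xs ! i) (f (nths xs (- {i})))) \<oplus>\<^bsub>M\<^esub>
     (\<Oplus>\<^bsub>M\<^esub>j\<in>{..n}. \<Oplus>\<^bsub>M\<^esub>i\<in>{..<j}.
        sign_pow k (i + j) \<odot>\<^bsub>M\<^esub> f (bracket L (xs ! i) (xs ! j) # nths xs (- {i, j}))))"

definition cocycle_module :: "('a, 'x) ring_scheme \<Rightarrow> ('a, 'b, 'y) lie_algebra_scheme \<Rightarrow>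
    ('a, 'm, 'b, 'z) lie_module_scheme \<Rightarrow> nat \<Rightarrow> ('a, 'b list \<Rightarrow> 'm) module" where
  "cocycle_module k L M n =
     (cochain_module k L M n)
       \<lparr>carrier := {f \<in> cochains k L M n.
          coboundary_map k L M n f = \<zero>\<^bsub>cochain_module k L M (Suc n)\<^esub>}\<rparr>"

fun coboundaries :: "('a, 'x) ring_scheme \<Rightarrow> ('a, 'b, 'y) lie_algebra_scheme \<Rightarrow>
    ('a, 'm, 'b, 'z) lie_module_scheme \<Rightarrow> nat \<Rightarrow> ('b list \<Rightarrow> 'm) set" where
  "coboundaries k L M 0 = {\<zero>\<^bsub>cochain_module k L M 0\<^esub>}"
| "coboundaries k L M (Suc n) = coboundary_map k L M n ` cochains k L M n"

definition cohomology :: "('a, 'x) ring_scheme \<Rightarrow> ('a, 'b, 'y) lie_algebra_scheme \<Rightarrow>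
    ('a, 'm, 'b, 'z) lie_module_scheme \<Rightarrow> nat \<Rightarrow> ('a, ('b list \<Rightarrow> 'm) set) module" where
  "cohomology k L M n = (let Z = cocycle_module k L M n; B = coboundaries k L M n in
     \<lparr>carrier = a_rcosets\<^bsub>Z\<^esub> B, mult = undefined, one = undefined,
      zero = B,
      add = set_add Z,
      smult = (\<lambda>c X. \<Union>f\<in>X. B +>\<^bsub>Z\<^esub> (c \<odot>\<^bsub>Z\<^esub> f))\<rparr>)"

text \<open>The cup product of cochains with trivial coefficients is the shuffle product. The set \<open>S\<close> of
  positions handed to \<open>f\<close> stands for a \<open>(p,q)\<close>-shuffle, whose sign counts the pairs
  \<open>(s, t) \<in> S \<times> - S\<close> with \<open>t < s\<close>.\<close>

definition cup_cochain :: "('a, 'x) ring_scheme \<Rightarrow> ('a, 'b, 'y) lie_algebra_scheme \<Rightarrow> nat \<Rightarrow> nat \<Rightarrow>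
    ('b list \<Rightarrow> 'a) \<Rightarrow> ('b list \<Rightarrow> 'a) \<Rightarrow> 'b list \<Rightarrow> 'a" where
  "cup_cochain k L p q f g = (\<lambda>xs\<in>tuples L (p + q).
     \<Oplus>\<^bsub>k\<^esub>S\<in>{S. S \<subseteq> {..<p + q} \<and> card S = p}.
       sign_pow k (card {(s, t). s \<in> S \<and> t \<notin> S \<and> t < s}) \<otimes>\<^bsub>k\<^esub>
         (f (nths xs S) \<otimes>\<^bsub>k\<^esub> g (nths xs (- S))))"

definition cup_product :: "('a, 'x) ring_scheme \<Rightarrow> ('a, 'b, 'y) lie_algebra_scheme \<Rightarrow> nat \<Rightarrow> nat \<Rightarrow>
    ('b list \<Rightarrow> 'a) set \<Rightarrow> ('b list \<Rightarrow> 'a) set \<Rightarrow> ('b list \<Rightarrow> 'a) set" where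
  "cup_product k L p q X Y = (\<Union>f\<in>X. \<Union>g\<in>Y.
     coboundaries k L (trivial_module k) (p + q)
       +>\<^bsub>cocycle_module k L (trivial_module k) (p + q)\<^esub> cup_cochain k L p q f g)"

text \<open>The cohomological dimension is the supremum of the \<open>n\<close> with \<open>H\<^sup>n(L, M) \<noteq> 0\<close> for some
  \<open>L\<close>-module \<open>M\<close>. HOL forces us to fix a type for the elements of \<open>M\<close>. The type chosen loses
  nothing: if \<open>H\<^sup>n(L, M) \<noteq> 0\<close> for any \<open>M\<close> whatsoever and \<open>n > 0\<close>, then also \<open>H\<^sup>n(L, K) \<noteq> 0\<close>
  for the \<open>n\<close>-th syzygy \<open>K \<subseteq> U(L) \<otimes> \<Lambda>\<^sup>n\<^sup>-\<^sup>1 L\<close> of \<open>k\<close>. The dimension of \<open>K\<close> is at most the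
  cardinality of \<open>'b list\<close>, so \<open>K\<close> is isomorphic to a module on a subset of \<open>'b list \<Rightarrow> 'a\<close>.\<close>

definition cohomological_dimension :: "('a, 'x) ring_scheme \<Rightarrow> ('a, 'b, 'y) lie_algebra_scheme \<Rightarrow>
    enat" where
  "cohomological_dimension k L =
     Sup {enat n | n. \<exists>M :: ('a, 'b list \<Rightarrow> 'a, 'b) lie_module.
            lie_module k L M \<and> carrier (cohomology k L M n) \<noteq> {\<zero>\<^bsub>cohomology k L M n\<^esub>}}"


section \<open>Poincare duality\<close>

definition one_dimensional :: "('a, 'x) ring_scheme \<Rightarrow> ('a, 'm, 'y) module_scheme \<Rightarrow> bool" where
  "one_dimensional k W \<longleftrightarrow>
     (\<exists>w\<in>carrier W. w \<noteq> \<zero>\<^bsub>W\<^esub> \<and> carrier W = {c \<odot>\<^bsub>W\<^esub> w | c. c \<in> carrier k})"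

definition nondegenerate_pairing :: "('a, 'm, 'x) module_scheme \<Rightarrow> ('a, 'n, 'y) module_scheme \<Rightarrow>
    ('a, 'p, 'z) module_scheme \<Rightarrow> ('m \<Rightarrow> 'n \<Rightarrow> 'p) \<Rightarrow> bool" where
  "nondegenerate_pairing A B C \<beta> \<longleftrightarrow>
     (\<forall>x\<in>carrier A. (\<forall>y\<in>carrier B. \<beta> x y = \<zero>\<^bsub>C\<^esub>) \<longrightarrow> x = \<zero>\<^bsub>A\<^esub>) \<and>
     (\<forall>y\<in>carrier B. (\<forall>x\<in>carrier A. \<beta> x y = \<zero>\<^bsub>C\<^esub>) \<longrightarrow> y = \<zero>\<^bsub>B\<^esub>)"

text \<open>For \<open>i > n\<close> the duality condition would read \<open>H\<^sup>i(L, k) = 0\<close>, which is already part of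
  the condition on the cohomological dimension.\<close>

definition poincare_duality_lie_algebra :: "('a, 'x) ring_scheme \<Rightarrow>
    ('a, 'b, 'y) lie_algebra_scheme \<Rightarrow> nat \<Rightarrow> bool" where
  "poincare_duality_lie_algebra k L n \<longleftrightarrow>
     lie_algebra k L \<and>
     cohomological_dimension k L = enat n \<and>
     one_dimensional k (cohomology k L (trivial_module k) n) \<and>
     (\<forall>i\<le>n. nondegenerate_pairing
        (cohomology k L (trivial_module k) i)
        (cohomology k L (trivial_module k) (n - i))
        (cohomology k L (trivial_module k) n)
        (cup_product k L i (n - i)))"


section \<open>Well-definedness\<close>

lemma lie_cong_terms:
  assumes k: "cring k" and st: "lie_cong k V S s t"
  shows "s \<in> lie_terms k V \<and> t \<in> lie_terms k V"
proof -
  interpret cring k by (rule k)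
  show ?thesis
    using st by (induction rule: lie_cong.induct) (auto intro: lie_terms.intros)
qed

lemma lie_class_eq:
  assumes k: "cring k" and st: "lie_cong k V S s t"
  shows "lie_class k V S s = lie_class k V S t"
  using st unfolding lie_class_def by (auto intro: lie_cong.sym lie_cong.trans)

lemma lie_class_self: "t \<in> lie_terms k V \<Longrightarrow> t \<in> lie_class k V S t"
  unfolding lie_class_def by (auto intro: lie_cong.refl)

lemma presented_simps:
  assumes k: "cring k" and s: "s \<in> lie_terms k V" and t: "t \<in> lie_terms k V"
  shows "lie_class k V S s \<oplus>\<^bsub>presented_lie_algebra k V S\<^esub> lie_class k V S t
           = lie_class k V S (Add s t)"
    and "c \<in> carrier k \<Longrightarrow>
           c \<odot>\<^bsub>presented_lie_algebra k V S\<^esub> lie_class k V S t = lie_class k V S (Smult c t)"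
    and "bracket (presented_lie_algebra k V S) (lie_class k V S s) (lie_class k V S t)
           = lie_class k V S (Brack s t)"
proof -
  let ?C = "lie_class k V S"
  have A: "?C (Add s' t') = ?C (Add s t)" if "s' \<in> ?C s" "t' \<in> ?C t" for s' t'
    using that by (intro lie_class_eq[OF k] lie_cong.cong_Add) (auto simp: lie_class_def intro: lie_cong.sym)
  have B: "?C (Brack s' t') = ?C (Brack s t)" if "s' \<in> ?C s" "t' \<in> ?C t" for s' t'
    using that by (intro lie_class_eq[OF k] lie_cong.cong_Brack) (auto simp: lie_class_def intro: lie_cong.sym)
  have M: "?C (Smult c t') = ?C (Smult c t)" if "c \<in> carrier k" "t' \<in> ?C t" for t'
    using that by (intro lie_class_eq[OF k] lie_cong.cong_Smult) (auto simp: lie_class_def intro: lie_cong.sym)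
  note self = lie_class_self[OF s, of S] lie_class_self[OF t, of S]
  have "(\<Union>s'\<in>?C s. \<Union>t'\<in>?C t. ?C (Add s' t')) = (\<Union>s'\<in>?C s. \<Union>t'\<in>?C t. ?C (Add s t))"
    by (intro SUP_cong HOL.refl A)
  also have "\<dots> = ?C (Add s t)" using self by blast
  finally show "?C s \<oplus>\<^bsub>presented_lie_algebra k V S\<^esub> ?C t = ?C (Add s t)"
    by (simp add: presented_lie_algebra_def)
  have "(\<Union>s'\<in>?C s. \<Union>t'\<in>?C t. ?C (Brack s' t')) = (\<Union>s'\<in>?C s. \<Union>t'\<in>?C t. ?C (Brack s t))"
    by (intro SUP_cong HOL.refl B)
  also have "\<dots> = ?C (Brack s t)" using self by blast
  finally show "bracket (presented_lie_algebra k V S) (?C s) (?C t) = ?C (Brack s t)"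
    by (simp add: presented_lie_algebra_def)
  assume c: "c \<in> carrier k"
  have "(\<Union>t'\<in>?C t. ?C (Smult c t')) = (\<Union>t'\<in>?C t. ?C (Smult c t))"
    by (intro SUP_cong HOL.refl M c)
  also have "\<dots> = ?C (Smult c t)" using self by blast
  finally show "c \<odot>\<^bsub>presented_lie_algebra k V S\<^esub> ?C t = ?C (Smult c t)"
    by (simp add: presented_lie_algebra_def)
qed

lemma presented_carrier: "carrier (presented_lie_algebra k V S) = lie_class k V S ` lie_terms k V"
  and presented_zero: "\<zero>\<^bsub>presented_lie_algebra k V S\<^esub> = lie_class k V S Zero"
  by (simp_all add: presented_lie_algebra_def)

lemma lie_algebra_presented:
  assumes k: "cring k"
  shows "lie_algebra k (presented_lie_algebra k V S)"
proof -
  interpret k: cring k by (rule k)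
  let ?P = "presented_lie_algebra k V S"
  note [simp] = presented_simps[OF k] presented_carrier presented_zero
  note [simp, intro] = lie_terms.intros
  note eqs = lie_class_eq[OF k, where S = S]
  have "abelian_group ?P"
  proof (rule abelian_groupI)
    fix x assume "x \<in> carrier ?P"
    then obtain s where s: "s \<in> lie_terms k V" "x = lie_class k V S s" by auto
    show "\<exists>y\<in>carrier ?P. y \<oplus>\<^bsub>?P\<^esub> x = \<zero>\<^bsub>?P\<^esub>"
      by (rule bexI[of _ "lie_class k V S (Smult (\<ominus>\<^bsub>k\<^esub> \<one>\<^bsub>k\<^esub>) s)"])
        (use s in \<open>auto intro!: eqs lie_cong.add_minus\<close>)
  qed (clarsimp; (rule eqs, blast intro: lie_cong.add_assoc lie_cong.add_comm lie_cong.add_zero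
        | blast))+
  then have mod: "Module.module k ?P"
    by (rule moduleI[OF k])
      (clarsimp; (rule eqs, blast intro: lie_cong.smult_add_scalar lie_cong.smult_add
          lie_cong.smult_assoc lie_cong.smult_one | blast))+
  show ?thesis
    by (intro lie_algebra.intro mod lie_algebra_axioms.intro;
        clarsimp; (rule eqs, blast intro: lie_cong.brack_add_left lie_cong.brack_add_right
          lie_cong.brack_smult_left lie_cong.brack_smult_right lie_cong.brack_self
          lie_cong.brack_jacobi | blast))
qed

lemma lie_homD:
  assumes "\<phi> \<in> lie_hom k L L'"
  shows "x \<in> carrier L \<Longrightarrow> \<phi> x \<in> carrier L'"
    and "\<lbrakk>x \<in> carrier L; y \<in> carrier L\<rbrakk> \<Longrightarrow> \<phi> (x \<oplus>\<^bsub>L\<^esub> y) = \<phi> x \<oplus>\<^bsub>L'\<^esub> \<phi> y"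
    and "\<lbrakk>c \<in> carrier k; x \<in> carrier L\<rbrakk> \<Longrightarrow> \<phi> (c \<odot>\<^bsub>L\<^esub> x) = c \<odot>\<^bsub>L'\<^esub> \<phi> x"
    and "\<lbrakk>x \<in> carrier L; y \<in> carrier L\<rbrakk> \<Longrightarrow> \<phi> (bracket L x y) = bracket L' (\<phi> x) (\<phi> y)"
  using assms unfolding lie_hom_def by auto

lemma ground_simps [simp]:
  "carrier (ground_lie_algebra k) = carrier k" "\<zero>\<^bsub>ground_lie_algebra k\<^esub> = \<zero>\<^bsub>k\<^esub>"
  "x \<oplus>\<^bsub>ground_lie_algebra k\<^esub> y = x \<oplus>\<^bsub>k\<^esub> y" "x \<odot>\<^bsub>ground_lie_algebra k\<^esub> y = x \<otimes>\<^bsub>k\<^esub> y"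
  "bracket (ground_lie_algebra k) x y = \<zero>\<^bsub>k\<^esub>"
  by (simp_all add: ground_lie_algebra_def)

lemma raag_augmentation_ex1:
  fixes k :: "('a, 'x) ring_scheme" and V :: "'v set"
  assumes k: "cring k"
  shows "\<exists>!\<phi>. \<phi> \<in> lie_hom k (raag_lie_algebra k V E) (ground_lie_algebra k) \<and>
    \<phi> \<in> extensional (carrier (raag_lie_algebra k V E)) \<and>
    (\<forall>v\<in>V. \<phi> (raag_vertex k V E v) = \<one>\<^bsub>k\<^esub>)" (is "\<exists>!\<phi>. ?Q \<phi>")
proof -
  interpret k: cring k by (rule k)
  let ?S = "raag_relators E :: ('a, 'v) lie_term set"
  let ?P = "presented_lie_algebra k V ?S"
  note [simp] = presented_simps[OF k] presented_carrier presented_zero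
  note [intro] = lie_terms.intros
  define ev where "ev = rec_lie_term (\<lambda>_. \<one>\<^bsub>k\<^esub>) \<zero>\<^bsub>k\<^esub> (\<lambda>_ _ a b. a \<oplus>\<^bsub>k\<^esub> b)
    (\<lambda>c _ a. c \<otimes>\<^bsub>k\<^esub> a) (\<lambda>(_ :: ('a, 'v) lie_term) _ _ _. \<zero>\<^bsub>k\<^esub>)"
  have [simp]: "ev (Gen v) = \<one>\<^bsub>k\<^esub>" "ev Zero = \<zero>\<^bsub>k\<^esub>" "ev (Add s t) = ev s \<oplus>\<^bsub>k\<^esub> ev t"
    "ev (Smult c t) = c \<otimes>\<^bsub>k\<^esub> ev t" "ev (Brack s t) = \<zero>\<^bsub>k\<^esub>" for v s t c
    by (simp_all add: ev_def)
  have ev_closed [simp]: "ev t \<in> carrier k" if "t \<in> lie_terms k V" for t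
    using that by induction auto
  have ev_cong: "ev s = ev t" if "lie_cong k V ?S s t" for s t
    using that
  proof induction
    case (relator r)
    then show ?case by (auto simp: raag_relators_def)
  qed (auto simp: k.a_ac k.l_distr k.r_distr k.m_assoc k.l_minus k.r_neg
        dest: lie_cong_terms[OF k])
  define \<phi> where "\<phi> = (\<lambda>X\<in>carrier ?P. the_elem (ev ` X))"
  have \<phi>: "\<phi> (lie_class k V ?S t) = ev t" if "t \<in> lie_terms k V" for t
  proof -
    have "ev s = ev t" if "s \<in> lie_class k V ?S t" for s
      using ev_cong[of t s] that by (simp add: lie_class_def)
    then have "ev ` lie_class k V ?S t = {ev t}"
      using lie_class_self[OF that, of ?S] by (intro equalityI subsetI) (blast, blast)
    then show ?thesis using that by (simp add: \<phi>_def)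
  qed
  show ?thesis
  proof (rule ex1I[of _ \<phi>])
    show "?Q \<phi>"
      unfolding raag_lie_algebra_def raag_vertex_def lie_hom_def
      by (auto simp: \<phi> lie_terms.intros) (simp add: \<phi>_def)
  next
    fix \<psi> assume Q: "?Q \<psi>"
    then have hom: "\<psi> \<in> lie_hom k ?P (ground_lie_algebra k)"
      and gen: "\<And>v. v \<in> V \<Longrightarrow> \<psi> (lie_class k V ?S (Gen v)) = \<one>\<^bsub>k\<^esub>"
      by (auto simp: raag_lie_algebra_def raag_vertex_def)
    interpret P: lie_algebra k ?P by (rule lie_algebra_presented[OF k])
    have in_P: "lie_class k V ?S t \<in> carrier ?P" if "t \<in> lie_terms k V" for t
      using that by simp
    have "\<psi> (lie_class k V ?S t) = ev t" if "t \<in> lie_terms k V" for t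
      using that
    proof induction
      case Zero
      have "\<psi> (\<zero>\<^bsub>k\<^esub> \<odot>\<^bsub>?P\<^esub> \<zero>\<^bsub>?P\<^esub>) = \<zero>\<^bsub>k\<^esub> \<otimes>\<^bsub>k\<^esub> \<psi> \<zero>\<^bsub>?P\<^esub>"
        using lie_homD(3)[OF hom, of "\<zero>\<^bsub>k\<^esub>" "\<zero>\<^bsub>?P\<^esub>"] P.M.zero_closed by simp
      moreover have "\<psi> \<zero>\<^bsub>?P\<^esub> \<in> carrier k"
        using lie_homD(1)[OF hom P.M.zero_closed] by simp
      ultimately have "\<psi> \<zero>\<^bsub>?P\<^esub> = \<zero>\<^bsub>k\<^esub>"
        using P.smult_l_null[OF P.M.zero_closed] by simp
      then show ?case by simp
    next
      case (Add s t)
      then show ?case using lie_homD(2)[OF hom in_P in_P, of s t] by simp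
    next
      case (Smult c t)
      then show ?case using lie_homD(3)[OF hom _ in_P, of c t] by simp
    next
      case (Brack s t)
      then show ?case using lie_homD(4)[OF hom in_P in_P, of s t] by simp
    qed (use gen in simp)
    then have "\<psi> X = \<phi> X" if "X \<in> carrier ?P" for X
      using that \<phi> by auto
    then show "\<psi> = \<phi>"
      using Q by (intro extensionalityI[of _ "carrier ?P"])
        (auto simp: raag_lie_algebra_def \<phi>_def simp del: presented_carrier)
  qed
qed

lemma raag_augmentation:
  assumes k: "cring k"
  shows "raag_augmentation k V E \<in> lie_hom k (raag_lie_algebra k V E) (ground_lie_algebra k)"
    and "v \<in> V \<Longrightarrow> raag_augmentation k V E (raag_vertex k V E v) = \<one>\<^bsub>k\<^esub>"
  using theI'[OF raag_augmentation_ex1[OF k, of V E]] unfolding raag_augmentation_def by auto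

lemma lie_algebra_bestvina_brady:
  assumes k: "cring k"
  shows "lie_algebra k (bestvina_brady_lie_algebra k V E)"
proof -
  interpret k: cring k by (rule k)
  let ?L = "raag_lie_algebra k V E" and ?B = "bestvina_brady_lie_algebra k V E"
  let ?e = "raag_augmentation k V E"
  interpret L: lie_algebra k ?L
    unfolding raag_lie_algebra_def by (rule lie_algebra_presented[OF k])
  note hom = lie_homD[OF raag_augmentation(1)[OF k, of V E], simplified]
  have B: "carrier ?B = {x \<in> carrier ?L. ?e x = \<zero>\<^bsub>k\<^esub>}"
    by (simp add: bestvina_brady_lie_algebra_def a_kernel_def')
  have [simp]: "\<zero>\<^bsub>?B\<^esub> = \<zero>\<^bsub>?L\<^esub>" "add ?B = add ?L" "smult ?B = smult ?L" "bracket ?B = bracket ?L"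
    by (simp_all add: bestvina_brady_lie_algebra_def)
  have e0: "?e \<zero>\<^bsub>?L\<^esub> = \<zero>\<^bsub>k\<^esub>"
    using hom(3)[OF k.zero_closed L.M.zero_closed] hom(1)[OF L.M.zero_closed]
      L.smult_l_null[OF L.M.zero_closed] by simp
  have "abelian_group ?B"
  proof (rule abelian_groupI)
    fix x assume "x \<in> carrier ?B"
    then have x: "x \<in> carrier ?L" "?e x = \<zero>\<^bsub>k\<^esub>" by (auto simp: B)
    show "\<exists>y\<in>carrier ?B. y \<oplus>\<^bsub>?B\<^esub> x = \<zero>\<^bsub>?B\<^esub>"
    proof (rule bexI[of _ "\<ominus>\<^bsub>?L\<^esub> x"])
      have "?e (\<ominus>\<^bsub>?L\<^esub> x) \<oplus>\<^bsub>k\<^esub> ?e x = \<zero>\<^bsub>k\<^esub>"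
        using hom(2)[of "\<ominus>\<^bsub>?L\<^esub> x" x] x e0 by (simp add: L.M.l_neg)
      then show "\<ominus>\<^bsub>?L\<^esub> x \<in> carrier ?B"
        using x hom(1)[of "\<ominus>\<^bsub>?L\<^esub> x"] by (simp add: B)
    qed (use x in \<open>simp add: L.M.l_neg\<close>)
  qed (auto simp: B hom e0 L.M.a_ac)
  then have mod: "Module.module k ?B"
    by (rule moduleI[OF k])
      (auto simp: B hom L.smult_l_distr L.smult_r_distr L.smult_assoc1)
  show ?thesis
    by (intro lie_algebra.intro mod lie_algebra_axioms.intro)
      (auto simp: B hom L.bracket_closed L.bracket_add_left L.bracket_add_right
        L.bracket_smult_left L.bracket_smult_right L.bracket_self L.jacobi)
qed

end

theory Submission
  imports Defs "HOL-Library.Multiset"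
begin

text \<open>Let \<open>L\<close> be the RAAG Lie algebra, \<open>B\<close> the kernel of the augmentation \<open>\<chi>\<close>, and suppose that \<open>v \<noteq> w\<close> are not
  adjacent. Let \<open>f\<close> represent a generator of \<open>H\<^sup>n(B, k)\<close>. Duality supplies a \<open>g\<close> such that \<open>v\<^sup>* \<union> g\<close> is a nonzero
  multiple of \<open>f\<close>; since \<open>v\<^sup>*\<close> vanishes on the subalgebra \<open>A\<^sub>v\<close> generated by the other vertices, \<open>f\<close> is
  exact on \<open>B \<inter> A\<^sub>v\<close>, and likewise on \<open>B \<inter> A\<^sub>w\<close>. The cocycle \<open>F\<close> of degree \<open>n + 1\<close> on \<open>L\<close> which is zero on \<open>B\<close> and
  restricts to \<open>f\<close> after contraction with a vertex is then exact on \<open>A\<^sub>v\<close> and on \<open>A\<^sub>w\<close>. As \<open>v\<close> and \<open>w\<close> are not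
  adjacent, \<open>L\<close> is the amalgam of \<open>A\<^sub>v\<close> and \<open>A\<^sub>w\<close> over their intersection, which is a retract of \<open>A\<^sub>v\<close>, and the
  Mayer-Vietoris sequence shows that \<open>F\<close> is exact on \<open>L\<close>. On the other hand a vertex \<open>t\<close> acts on \<open>B\<close> as
  the commutator of the Euler derivation and \<open>ad t\<close>, hence as zero on the one-dimensional \<open>H\<^sup>n(B, k)\<close>,
  and then the Gysin sequence of \<open>B \<subseteq> L\<close> turns a primitive of \<open>F\<close> into a primitive of \<open>f\<close>, a contradiction.

  The Mayer-Vietoris sequence is obtained by dimension shifting along coinduced modules, whose acyclicity
  on subalgebras rests on the Poincare-Birkhoff-Witt theorem. In degree \<open>2\<close> it is the universal property
  of \<open>L\<close> applied to the extension of \<open>L\<close> defined by a cocycle.\<close>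

text \<open>General coefficients are needed although the claim concerns trivial ones: a dimension
  shift replaces \<open>M\<close> by a quotient of a coinduced module. The enveloping algebra is
  never built; linear maps from it to \<open>M\<close> are functions on multisets of basis elements,
  so no factorials occur and every characteristic is covered. Acyclicity is needed on
  \<open>L\<close>, on both subalgebras and on their intersection at once, hence one ordered basis
  of \<open>L\<close> that contains a basis of each. This is the obstacle that the retraction
  removes: it makes the basis fit the second subalgebra too. The retraction returns later, when the
  cocycle by which two primitives differ on the intersection is extended to one of the subalgebras.
  The commutator is \<open>[e, ad t] = ad (e t) = ad t\<close>, since the Euler derivation
  \<open>e\<close> fixes the vertex \<open>t\<close>; two operators on a one-dimensional space
  commute, so \<open>ad t\<close> acts as zero. The class \<open>v^*\<close> is nonzero on
  \<open>B\<close> because \<open>v - w\<close> lies in \<open>B\<close>, and the cohomological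
  dimension excludes \<open>n = 0\<close>, where no pairing with \<open>H^1\<close> exists.\<close>

context abelian_group begin

lemma a_inv_zero: "\<ominus> \<zero> = \<zero>"
  using r_neg[of \<zero>] by simp

text \<open>Normal form rules for additive groups, handed to \<open>algebra\<close> so that the sign
  identities between module elements below reduce to rewriting.\<close>

lemmas [algebra abelian_group "zero G" "add G" "a_inv G" "a_minus G"] =
  a_closed zero_closed a_inv_closed minus_closed a_assoc l_zero r_zero l_neg r_neg r_neg1 r_neg2
  a_comm a_lcomm a_inv_zero minus_minus minus_add minus_eq

lemma add_minus_add: "\<lbrakk>a \<in> carrier G; b \<in> carrier G; c \<in> carrier G; e \<in> carrier G\<rbrakk> \<Longrightarrow>
    (a \<oplus> b) \<ominus> (c \<oplus> e) = (a \<ominus> c) \<oplus> (b \<ominus> e)"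
  by algebra

lemma add_minus_cancel: "\<lbrakk>a \<in> carrier G; b \<in> carrier G\<rbrakk> \<Longrightarrow> (a \<oplus> b) \<ominus> b = a"
  by algebra

lemma minus_add_cancel: "\<lbrakk>a \<in> carrier G; b \<in> carrier G\<rbrakk> \<Longrightarrow> (a \<ominus> b) \<oplus> b = a"
  by algebra

lemma minus_zero_right: "a \<in> carrier G \<Longrightarrow> a \<ominus> \<zero> = a"
  by algebra

lemma minus_self: "a \<in> carrier G \<Longrightarrow> a \<ominus> a = \<zero>"
  by algebra

text \<open>The cross terms \<open>p\<close> and \<open>q\<close> cancel. This is the arithmetic of
  a commutator of two operators that are themselves differences: it serves
  \<open>LD_commutator\<close> and the bracket law of the coinduced action.\<close>

lemma commutator_identity:
  "\<lbrakk>a \<in> carrier G; b \<in> carrier G; p \<in> carrier G; q \<in> carrier G; x \<in> carrier G; y \<in> carrier G\<rbrakk> \<Longrightarrow>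
    (a \<ominus> b) \<ominus> (x \<ominus> y) = ((a \<ominus> p) \<ominus> (q \<ominus> y)) \<ominus> ((b \<ominus> q) \<ominus> (p \<ominus> x))"
  by algebra

lemma minus_minus_identity:
  "\<lbrakk>a \<in> carrier G; b \<in> carrier G; p \<in> carrier G; q \<in> carrier G\<rbrakk> \<Longrightarrow>
    a \<ominus> (p \<ominus> q) = (b \<ominus> p) \<ominus> ((b \<ominus> a) \<ominus> q)"
  by algebra

lemma minus_zero_iff: "\<lbrakk>x \<in> carrier G; y \<in> carrier G\<rbrakk> \<Longrightarrow> x \<ominus> y = \<zero> \<longleftrightarrow> x = y"
  by (metis a_minus_def minus_equality minus_minus r_neg a_inv_closed)

end

section \<open>Skew symmetry and the Leibniz form of the Jacobi identity\<close>

context lie_algebra begin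

text \<open>The additive laws of \<open>L\<close> get names of their own, because in
  \<open>lie_module\<close> the qualifier \<open>M\<close> also belongs to the coefficients.\<close>

lemmas L_a_ac = M.a_ac
  and L_l_neg = M.l_neg
  and L_add_minus_cancel = M.add_minus_cancel
  and L_zero_closed = M.zero_closed
  and L_a_inv_zero = M.a_inv_zero
  and L_add_minus_add = M.add_minus_add
  and L_minus_zero_right = M.minus_zero_right
  and L_minus_add_cancel = M.minus_add_cancel

lemma bracket_skew:
  assumes "x \<in> carrier L" "y \<in> carrier L"
  shows "bracket L x y = \<ominus>\<^bsub>L\<^esub> bracket L y x"
proof -
  have "bracket L (x \<oplus>\<^bsub>L\<^esub> y) (x \<oplus>\<^bsub>L\<^esub> y) = bracket L x y \<oplus>\<^bsub>L\<^esub> bracket L y x"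
    using assms bracket_self[of x] bracket_self[of y]
    by (simp add: bracket_add_left bracket_add_right bracket_closed M.a_ac)
  then have "bracket L x y \<oplus>\<^bsub>L\<^esub> bracket L y x = \<zero>\<^bsub>L\<^esub>"
    using bracket_self[of "x \<oplus>\<^bsub>L\<^esub> y"] assms by simp
  then show ?thesis using M.minus_equality assms bracket_closed by simp
qed

lemma bracket_neg_right:
  assumes "x \<in> carrier L" "y \<in> carrier L"
  shows "bracket L x (\<ominus>\<^bsub>L\<^esub> y) = \<ominus>\<^bsub>L\<^esub> bracket L x y"
proof -
  have n: "\<ominus> \<one> \<odot>\<^bsub>L\<^esub> z = \<ominus>\<^bsub>L\<^esub> z" if "z \<in> carrier L" for z
    using smult_l_minus[OF R.one_closed that] that by simp
  show ?thesis
    using bracket_smult_right[OF R.a_inv_closed[OF R.one_closed] assms]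
    unfolding n[OF assms(2)] n[OF bracket_closed[OF assms]] .
qed

lemma bracket_leibniz:
  assumes x: "x \<in> carrier L" and y: "y \<in> carrier L" and z: "z \<in> carrier L"
  shows "bracket L x (bracket L y z) =
    bracket L (bracket L x y) z \<oplus>\<^bsub>L\<^esub> bracket L y (bracket L x z)" (is "?A = ?D \<oplus>\<^bsub>L\<^esub> ?B")
proof -
  have c: "?A \<in> carrier L" "?B \<in> carrier L" "?D \<in> carrier L" using assms bracket_closed by auto
  have 1: "bracket L y (bracket L z x) = \<ominus>\<^bsub>L\<^esub> ?B"
    using bracket_skew[of z x] bracket_neg_right[of y "bracket L x z"] assms bracket_closed by simp
  have 2: "bracket L z (bracket L x y) = \<ominus>\<^bsub>L\<^esub> ?D"
    using bracket_skew[of z "bracket L x y"] assms bracket_closed by simp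
  have "?A \<ominus>\<^bsub>L\<^esub> (?D \<oplus>\<^bsub>L\<^esub> ?B) = \<zero>\<^bsub>L\<^esub>"
    using jacobi[OF x y z] unfolding 1 2 using c by (simp add: a_minus_def M.minus_add M.a_ac)
  then show ?thesis using M.minus_zero_iff c by simp
qed

end

section \<open>Cochains\<close>

text \<open>Takes a bare set, unlike \<open>tuples\<close>, since subalgebras are handled as subsets
  of one ambient algebra.\<close>

definition lists_of :: "'b set \<Rightarrow> nat \<Rightarrow> 'b list set" where
  "lists_of S q = {xs. length xs = q \<and> set xs \<subseteq> S}"

lemma lists_of_0 [simp]: "lists_of S 0 = {[]}"
  by (auto simp: lists_of_def)

lemma Nil_lists_of [simp]: "[] \<in> lists_of S q \<longleftrightarrow> q = 0"
  by (auto simp: lists_of_def)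

lemma Cons_lists_of [simp]: "x # xs \<in> lists_of S (Suc q) \<longleftrightarrow> x \<in> S \<and> xs \<in> lists_of S q"
  by (auto simp: lists_of_def)

lemma lists_of_SucE:
  assumes "xs \<in> lists_of S (Suc q)"
  obtains y ys where "xs = y # ys" "y \<in> S" "ys \<in> lists_of S q"
  using assms by (cases xs) (auto simp: lists_of_def)

lemma lists_of_1E:
  assumes "xs \<in> lists_of S (Suc 0)"
  obtains y where "xs = [y]" "y \<in> S"
  using assms by (rule lists_of_SucE) simp

lemma lists_of_mono: "S \<subseteq> T \<Longrightarrow> xs \<in> lists_of S q \<Longrightarrow> xs \<in> lists_of T q"
  by (auto simp: lists_of_def)

text \<open>The inner product \<open>i\<^sub>x f\<close> is the function \<open>\<lambda>xs. f (x # xs)\<close>. Alternating maps, the Lie derivative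
  and the coboundary operator are defined by recursion on the degree, through
  \<open>i\<^sub>y L\<^sub>\<delta> = L\<^sub>\<delta> i\<^sub>y - i\<^bsub>\<delta> y\<^esub>\<close> and Cartan's formula \<open>i\<^sub>x d = L\<^sub>x - d i\<^sub>x\<close>, which avoids all signs.\<close>

fun cochain :: "('a, 'x) ring_scheme \<Rightarrow> ('a, 'b, 'y) module_scheme \<Rightarrow> ('a, 'm, 'z) module_scheme \<Rightarrow>
    'b set \<Rightarrow> nat \<Rightarrow> ('b list \<Rightarrow> 'm) \<Rightarrow> bool" where
  "cochain R L M S 0 f \<longleftrightarrow> f [] \<in> carrier M"
| "cochain R L M S (Suc q) f \<longleftrightarrow>
     (\<forall>x\<in>S. cochain R L M S q (\<lambda>zs. f (x # zs))) \<and>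
     (\<forall>x\<in>S. \<forall>y\<in>S. \<forall>zs\<in>lists_of S q. f ((x \<oplus>\<^bsub>L\<^esub> y) # zs) = f (x # zs) \<oplus>\<^bsub>M\<^esub> f (y # zs)) \<and>
     (\<forall>c\<in>carrier R. \<forall>x\<in>S. \<forall>zs\<in>lists_of S q. f ((c \<odot>\<^bsub>L\<^esub> x) # zs) = c \<odot>\<^bsub>M\<^esub> f (x # zs)) \<and>
     (\<forall>x\<in>S. \<forall>p. q = Suc p \<longrightarrow> (\<forall>zs\<in>lists_of S p. f (x # x # zs) = \<zero>\<^bsub>M\<^esub>))"

fun lie_der :: "('m, 'z) ring_scheme \<Rightarrow> ('m \<Rightarrow> 'm) \<Rightarrow> ('b \<Rightarrow> 'b) \<Rightarrow> ('b list \<Rightarrow> 'm) \<Rightarrow> 'b list \<Rightarrow> 'm" where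
  "lie_der M a \<delta> f [] = a (f [])"
| "lie_der M a \<delta> f (y # ys) = lie_der M a \<delta> (\<lambda>zs. f (y # zs)) ys \<ominus>\<^bsub>M\<^esub> f (\<delta> y # ys)"

fun cobd :: "('a, 'b, 'y) lie_algebra_scheme \<Rightarrow> ('a, 'm, 'b, 'z) lie_module_scheme \<Rightarrow>
    ('b list \<Rightarrow> 'm) \<Rightarrow> 'b list \<Rightarrow> 'm" where
  "cobd L M f [] = \<zero>\<^bsub>M\<^esub>"
| "cobd L M f (x # xs) = lie_der M (act M x) (bracket L x) f xs \<ominus>\<^bsub>M\<^esub> cobd L M (\<lambda>zs. f (x # zs)) xs"

text \<open>The coefficients remain a module over all of \<open>L\<close>, and only the arguments
  are confined to \<open>S\<close>. Restricting a cochain to a subalgebra then changes the set and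
  not the function.\<close>

locale lie_sub = lie_module R L M
  for R :: "('a, 'x) ring_scheme" (structure) and L :: "('a, 'b, 'y) lie_algebra_scheme" (structure)
    and M :: "('a, 'm, 'b, 'z) lie_module_scheme" (structure) +
  fixes S :: "'b set"
  assumes S_sub: "S \<subseteq> carrier L"
    and S_zero: "\<zero>\<^bsub>L\<^esub> \<in> S"
    and S_add: "\<lbrakk>x \<in> S; y \<in> S\<rbrakk> \<Longrightarrow> x \<oplus>\<^bsub>L\<^esub> y \<in> S"
    and S_smult: "\<lbrakk>c \<in> carrier R; x \<in> S\<rbrakk> \<Longrightarrow> c \<odot>\<^bsub>L\<^esub> x \<in> S"
    and S_bracket: "\<lbrakk>x \<in> S; y \<in> S\<rbrakk> \<Longrightarrow> bracket L x y \<in> S"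
begin

abbreviation "C \<equiv> cochain R L M S"
abbreviation "LS \<equiv> lists_of S"

lemma S_L [simp, intro]: "x \<in> S \<Longrightarrow> x \<in> carrier L"
  using S_sub by blast

lemma C_closed: "\<lbrakk>C q f; xs \<in> LS q\<rbrakk> \<Longrightarrow> f xs \<in> carrier M"
proof (induction q arbitrary: f xs)
  case (Suc q)
  from Suc.prems(2) obtain y ys where xs: "xs = y # ys" "y \<in> S" "ys \<in> LS q" by (rule lists_of_SucE)
  show ?case unfolding xs(1) using Suc.prems(1) xs by (intro Suc.IH) auto
qed auto

text \<open>Cochains are not made extensional here: values outside the tuples from \<open>S\<close>
  are arbitrary and have no influence.\<close>

lemma C_cong: "\<lbrakk>\<And>xs. xs \<in> LS q \<Longrightarrow> f xs = g xs\<rbrakk> \<Longrightarrow> C q f \<longleftrightarrow> C q g"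
proof (induction q arbitrary: f g)
  case (Suc q)
  have "C q (\<lambda>zs. f (x # zs)) \<longleftrightarrow> C q (\<lambda>zs. g (x # zs))" if "x \<in> S" for x
    using that Suc.prems by (intro Suc.IH) auto
  then show ?case
    using Suc.prems S_add S_smult by (auto cong: ball_cong)
qed auto

lemma C_inner: "C (Suc q) f \<Longrightarrow> x \<in> S \<Longrightarrow> C q (\<lambda>zs. f (x # zs))" by simp

lemma C_add_head:
  "\<lbrakk>C (Suc q) f; x \<in> S; y \<in> S; zs \<in> LS q\<rbrakk> \<Longrightarrow> f ((x \<oplus>\<^bsub>L\<^esub> y) # zs) = f (x # zs) \<oplus>\<^bsub>M\<^esub> f (y # zs)" by simp

lemma C_smult_head:
  "\<lbrakk>C (Suc q) f; c \<in> carrier R; x \<in> S; zs \<in> LS q\<rbrakk> \<Longrightarrow> f ((c \<odot>\<^bsub>L\<^esub> x) # zs) = c \<odot>\<^bsub>M\<^esub> f (x # zs)" by simp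

lemma C_self: "\<lbrakk>C (Suc (Suc q)) f; x \<in> S; zs \<in> LS q\<rbrakk> \<Longrightarrow> f (x # x # zs) = \<zero>\<^bsub>M\<^esub>" by simp

lemma S_neg: "x \<in> S \<Longrightarrow> \<ominus>\<^bsub>L\<^esub> x \<in> S"
  using S_smult[of "\<ominus> \<one>" x] smult_l_minus[of \<one> x] by simp

lemma S_minus: "x \<in> S \<Longrightarrow> y \<in> S \<Longrightarrow> x \<ominus>\<^bsub>L\<^esub> y \<in> S"
  by (simp add: a_minus_def S_add S_neg)

lemma C_neg_head:
  assumes "C (Suc q) f" "x \<in> S" "zs \<in> LS q" shows "f ((\<ominus>\<^bsub>L\<^esub> x) # zs) = \<ominus>\<^bsub>M\<^esub> f (x # zs)"
proof -
  have c: "f (x # zs) \<in> carrier M" using C_closed[OF assms(1)] assms by simp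
  have "f ((\<ominus> \<one> \<odot>\<^bsub>L\<^esub> x) # zs) = \<ominus> \<one> \<odot>\<^bsub>M\<^esub> f (x # zs)"
    by (rule C_smult_head[OF assms(1)]) (use assms in auto)
  then show ?thesis using assms c smult_l_minus[of \<one> x] M.smult_l_minus[of \<one> "f (x # zs)"] by simp
qed

lemma C_minus_head:
  assumes "C (Suc q) f" "x \<in> S" "y \<in> S" "zs \<in> LS q"
  shows "f ((x \<ominus>\<^bsub>L\<^esub> y) # zs) = f (x # zs) \<ominus>\<^bsub>M\<^esub> f (y # zs)"
  unfolding a_minus_def using assms C_add_head[OF assms(1,2) S_neg[OF assms(3)]] C_neg_head[OF assms(1)] by simp

lemma C_zero_head:
  assumes "C (Suc q) f" "zs \<in> LS q" shows "f (\<zero>\<^bsub>L\<^esub> # zs) = \<zero>\<^bsub>M\<^esub>"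
proof -
  have c: "f (\<zero>\<^bsub>L\<^esub> # zs) \<in> carrier M" using C_closed[OF assms(1)] assms S_zero by simp
  have "f ((\<zero> \<odot>\<^bsub>L\<^esub> \<zero>\<^bsub>L\<^esub>) # zs) = \<zero> \<odot>\<^bsub>M\<^esub> f (\<zero>\<^bsub>L\<^esub> # zs)"
    by (rule C_smult_head[OF assms(1)]) (use assms S_zero in auto)
  then show ?thesis using c by simp
qed

lemma C_skew:
  assumes f: "C (Suc (Suc q)) f" and xy: "x \<in> S" "y \<in> S" and zs: "zs \<in> LS q"
  shows "f (x # y # zs) = \<ominus>\<^bsub>M\<^esub> f (y # x # zs)"
proof -
  have cl: "f (a # b # zs) \<in> carrier M" if "a \<in> S" "b \<in> S" for a b
    using C_closed[OF f] that zs by simp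
  have i: "C (Suc q) (\<lambda>zs. f (a # zs))" if "a \<in> S" for a using f that by simp
  have "\<zero>\<^bsub>M\<^esub> = f ((x \<oplus>\<^bsub>L\<^esub> y) # (x \<oplus>\<^bsub>L\<^esub> y) # zs)"
    using C_self[OF f] xy zs S_add by simp
  also have "\<dots> = f (x # (x \<oplus>\<^bsub>L\<^esub> y) # zs) \<oplus>\<^bsub>M\<^esub> f (y # (x \<oplus>\<^bsub>L\<^esub> y) # zs)"
    by (rule C_add_head[OF f]) (use xy zs S_add in auto)
  also have "\<dots> = (f (x # x # zs) \<oplus>\<^bsub>M\<^esub> f (x # y # zs)) \<oplus>\<^bsub>M\<^esub> (f (y # x # zs) \<oplus>\<^bsub>M\<^esub> f (y # y # zs))"
    using C_add_head[OF i[OF xy(1)] xy zs] C_add_head[OF i[OF xy(2)] xy zs] by simp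
  also have "\<dots> = f (x # y # zs) \<oplus>\<^bsub>M\<^esub> f (y # x # zs)"
    using C_self[OF f] xy zs cl by simp
  finally show ?thesis using cl xy by (metis M.M.minus_equality)
qed

lemma C_add: "\<lbrakk>C q f; C q g\<rbrakk> \<Longrightarrow> C q (\<lambda>xs. f xs \<oplus>\<^bsub>M\<^esub> g xs)"
proof (induction q arbitrary: f g)
  case (Suc q)
  note cl = C_closed[OF Suc.prems(1)] C_closed[OF Suc.prems(2)]
  show ?case unfolding cochain.simps
  proof (intro conjI ballI allI impI)
    show "C q (\<lambda>zs. f (x # zs) \<oplus>\<^bsub>M\<^esub> g (x # zs))" if "x \<in> S" for x
      using that Suc.prems by (intro Suc.IH) auto
  qed (use Suc.prems cl S_add S_smult in \<open>auto simp: M.smult_r_distr M.M.a_ac\<close>)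
qed auto

lemma C_smult: "\<lbrakk>c \<in> carrier R; C q f\<rbrakk> \<Longrightarrow> C q (\<lambda>xs. c \<odot>\<^bsub>M\<^esub> f xs)"
proof (induction q arbitrary: f)
  case (Suc q)
  note cl = C_closed[OF Suc.prems(2)]
  show ?case unfolding cochain.simps
  proof (intro conjI ballI allI impI)
    show "C q (\<lambda>zs. c \<odot>\<^bsub>M\<^esub> f (x # zs))" if "x \<in> S" for x
      using that Suc.prems by (intro Suc.IH) auto
  next
    fix d x zs assume a: "d \<in> carrier R" "x \<in> S" "zs \<in> LS q"
    have "c \<odot>\<^bsub>M\<^esub> (d \<odot>\<^bsub>M\<^esub> f (x # zs)) = d \<odot>\<^bsub>M\<^esub> (c \<odot>\<^bsub>M\<^esub> f (x # zs))"
      using a cl Suc.prems(1) by (metis Cons_lists_of M.smult_assoc1 R.m_comm)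
    then show "c \<odot>\<^bsub>M\<^esub> f ((d \<odot>\<^bsub>L\<^esub> x) # zs) = d \<odot>\<^bsub>M\<^esub> (c \<odot>\<^bsub>M\<^esub> f (x # zs))"
      using a Suc.prems by simp
  qed (use Suc.prems cl S_add S_smult in \<open>auto simp: M.smult_r_distr\<close>)
qed auto

lemma C_neg: "C q f \<Longrightarrow> C q (\<lambda>xs. \<ominus>\<^bsub>M\<^esub> f xs)"
proof -
  assume f: "C q f"
  have "C q (\<lambda>xs. \<ominus> \<one> \<odot>\<^bsub>M\<^esub> f xs)" by (rule C_smult[OF _ f]) simp
  then show ?thesis
    by (subst C_cong[where g = "\<lambda>xs. \<ominus> \<one> \<odot>\<^bsub>M\<^esub> f xs"])
      (use C_closed[OF f] M.smult_l_minus in auto)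
qed

lemma C_minus: "\<lbrakk>C q f; C q g\<rbrakk> \<Longrightarrow> C q (\<lambda>xs. f xs \<ominus>\<^bsub>M\<^esub> g xs)"
  unfolding a_minus_def by (intro C_add C_neg)

lemma C_zero: "C q (\<lambda>xs. \<zero>\<^bsub>M\<^esub>)"
  by (induction q) auto

end

section \<open>Lie derivatives along pairs of operators, and the coboundary\<close>

context lie_sub begin

text \<open>\<open>a\<close> acts on values and \<open>\<delta>\<close> on arguments. The pair is
  kept more general than \<open>act M x\<close> with \<open>bracket L x\<close>, because the Euler
  derivation with \<open>a = 0\<close> is needed as well. The derivation property enters later, in
  \<open>d_LD\<close>.\<close>

definition admissible :: "('m \<Rightarrow> 'm) \<Rightarrow> ('b \<Rightarrow> 'b) \<Rightarrow> bool" where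
  "admissible a \<delta> \<longleftrightarrow>
     (\<forall>m\<in>carrier M. a m \<in> carrier M) \<and>
     (\<forall>m\<in>carrier M. \<forall>n\<in>carrier M. a (m \<oplus>\<^bsub>M\<^esub> n) = a m \<oplus>\<^bsub>M\<^esub> a n) \<and>
     (\<forall>c\<in>carrier R. \<forall>m\<in>carrier M. a (c \<odot>\<^bsub>M\<^esub> m) = c \<odot>\<^bsub>M\<^esub> a m) \<and>
     (\<forall>x\<in>S. \<delta> x \<in> S) \<and>
     (\<forall>x\<in>S. \<forall>y\<in>S. \<delta> (x \<oplus>\<^bsub>L\<^esub> y) = \<delta> x \<oplus>\<^bsub>L\<^esub> \<delta> y) \<and>
     (\<forall>c\<in>carrier R. \<forall>x\<in>S. \<delta> (c \<odot>\<^bsub>L\<^esub> x) = c \<odot>\<^bsub>L\<^esub> \<delta> x)"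

lemma admissibleD:
  assumes "admissible a \<delta>"
  shows "m \<in> carrier M \<Longrightarrow> a m \<in> carrier M"
    and "\<lbrakk>m \<in> carrier M; n \<in> carrier M\<rbrakk> \<Longrightarrow> a (m \<oplus>\<^bsub>M\<^esub> n) = a m \<oplus>\<^bsub>M\<^esub> a n"
    and "\<lbrakk>c \<in> carrier R; m \<in> carrier M\<rbrakk> \<Longrightarrow> a (c \<odot>\<^bsub>M\<^esub> m) = c \<odot>\<^bsub>M\<^esub> a m"
    and "x \<in> S \<Longrightarrow> \<delta> x \<in> S"
    and "\<lbrakk>x \<in> S; y \<in> S\<rbrakk> \<Longrightarrow> \<delta> (x \<oplus>\<^bsub>L\<^esub> y) = \<delta> x \<oplus>\<^bsub>L\<^esub> \<delta> y"
    and "\<lbrakk>c \<in> carrier R; x \<in> S\<rbrakk> \<Longrightarrow> \<delta> (c \<odot>\<^bsub>L\<^esub> x) = c \<odot>\<^bsub>L\<^esub> \<delta> x"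
  using assms unfolding admissible_def by auto

lemma admissible_zero: "admissible a \<delta> \<Longrightarrow> a \<zero>\<^bsub>M\<^esub> = \<zero>\<^bsub>M\<^esub>"
  using admissibleD(3)[of a \<delta> \<zero> "\<zero>\<^bsub>M\<^esub>"] admissibleD(1)[of a \<delta> "\<zero>\<^bsub>M\<^esub>"] by simp

lemma admissible_act: "x \<in> S \<Longrightarrow> admissible (act M x) (bracket L x)"
  unfolding admissible_def
  by (auto simp: act_closed act_add_right act_smult_right S_bracket bracket_add_right bracket_smult_right)

abbreviation "LD \<equiv> lie_der M"
abbreviation "LX x \<equiv> lie_der M (act M x) (bracket L x)"
abbreviation "d \<equiv> cobd L M"

lemma LD_cong:
  assumes "\<And>x. x \<in> S \<Longrightarrow> \<delta> x \<in> S" "\<And>zs. zs \<in> LS q \<Longrightarrow> f zs = g zs" "xs \<in> LS q"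
  shows "LD a \<delta> f xs = LD a \<delta> g xs"
  using assms(2,3)
proof (induction q arbitrary: f g xs)
  case (Suc q)
  from Suc.prems(2) obtain y ys where xs: "xs = y # ys" "y \<in> S" "ys \<in> LS q" by (rule lists_of_SucE)
  have "LD a \<delta> (\<lambda>zs. f (y # zs)) ys = LD a \<delta> (\<lambda>zs. g (y # zs)) ys"
    by (rule Suc.IH) (use Suc.prems xs in auto)
  then show ?case using Suc.prems(1) xs assms(1) by simp
qed auto

lemma LX_cong: "\<lbrakk>x \<in> S; \<And>zs. zs \<in> LS q \<Longrightarrow> f zs = g zs; xs \<in> LS q\<rbrakk> \<Longrightarrow> LX x f xs = LX x g xs"
  by (rule LD_cong) (auto intro: S_bracket)

lemma LD_closed: "\<lbrakk>admissible a \<delta>; C q f; xs \<in> LS q\<rbrakk> \<Longrightarrow> LD a \<delta> f xs \<in> carrier M"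
proof (induction q arbitrary: f xs)
  case (Suc q)
  from Suc.prems(3) obtain y ys where xs: "xs = y # ys" "y \<in> S" "ys \<in> LS q" by (rule lists_of_SucE)
  have "LD a \<delta> (\<lambda>zs. f (y # zs)) ys \<in> carrier M"
    by (rule Suc.IH) (use Suc.prems xs in auto)
  then show ?case using C_closed[OF Suc.prems(2)] xs admissibleD[OF Suc.prems(1)] by simp
qed (auto simp: admissibleD)

lemma LD_add: "\<lbrakk>admissible a \<delta>; C q f; C q g; xs \<in> LS q\<rbrakk> \<Longrightarrow>
  LD a \<delta> (\<lambda>zs. f zs \<oplus>\<^bsub>M\<^esub> g zs) xs = LD a \<delta> f xs \<oplus>\<^bsub>M\<^esub> LD a \<delta> g xs"
proof (induction q arbitrary: f g xs)
  case (Suc q)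
  from Suc.prems(4) obtain y ys where xs: "xs = y # ys" "y \<in> S" "ys \<in> LS q" by (rule lists_of_SucE)
  note ad = admissibleD[OF Suc.prems(1)]
  have i: "C q (\<lambda>zs. f (y # zs))" "C q (\<lambda>zs. g (y # zs))" using Suc.prems xs by auto
  have "f (\<delta> y # ys) \<in> carrier M" "g (\<delta> y # ys) \<in> carrier M"
    using C_closed[OF Suc.prems(2)] C_closed[OF Suc.prems(3)] xs ad by auto
  moreover note Suc.IH[OF Suc.prems(1) i xs(3)] LD_closed[OF Suc.prems(1) i(1) xs(3)]
    LD_closed[OF Suc.prems(1) i(2) xs(3)]
  ultimately show ?case unfolding xs(1) lie_der.simps by (simp add: M.M.add_minus_add C_add_head)
qed (auto simp: admissibleD)

lemma LD_smult: "\<lbrakk>admissible a \<delta>; c \<in> carrier R; C q f; xs \<in> LS q\<rbrakk> \<Longrightarrow>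
  LD a \<delta> (\<lambda>zs. c \<odot>\<^bsub>M\<^esub> f zs) xs = c \<odot>\<^bsub>M\<^esub> LD a \<delta> f xs"
proof (induction q arbitrary: f xs)
  case (Suc q)
  from Suc.prems(4) obtain y ys where xs: "xs = y # ys" "y \<in> S" "ys \<in> LS q" by (rule lists_of_SucE)
  note ad = admissibleD[OF Suc.prems(1)]
  have i: "C q (\<lambda>zs. f (y # zs))" using Suc.prems xs by auto
  have cl: "f (\<delta> y # ys) \<in> carrier M"
    using C_closed[OF Suc.prems(3)] xs ad by auto
  show ?case unfolding xs(1) lie_der.simps
    using Suc.IH[OF Suc.prems(1,2) i xs(3)] LD_closed[OF Suc.prems(1) i(1) xs(3)] cl Suc.prems(2)
    by (simp add: a_minus_def M.smult_r_distr M.smult_r_minus)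
qed (auto simp: admissibleD)

lemma minus_as_smult: "\<lbrakk>x \<in> carrier M; y \<in> carrier M\<rbrakk> \<Longrightarrow> x \<ominus>\<^bsub>M\<^esub> y = x \<oplus>\<^bsub>M\<^esub> (\<ominus> \<one>) \<odot>\<^bsub>M\<^esub> y"
  by (simp add: a_minus_def M.smult_l_minus)

lemma LD_minus:
  assumes "admissible a \<delta>" "C q f" "C q g" "xs \<in> LS q"
  shows "LD a \<delta> (\<lambda>zs. f zs \<ominus>\<^bsub>M\<^esub> g zs) xs = LD a \<delta> f xs \<ominus>\<^bsub>M\<^esub> LD a \<delta> g xs"
proof -
  have "LD a \<delta> (\<lambda>zs. f zs \<ominus>\<^bsub>M\<^esub> g zs) xs = LD a \<delta> (\<lambda>zs. f zs \<oplus>\<^bsub>M\<^esub> (\<ominus> \<one>) \<odot>\<^bsub>M\<^esub> g zs) xs"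
    by (rule LD_cong[where q = q])
      (use assms C_closed[OF assms(2)] C_closed[OF assms(3)] admissibleD in \<open>auto intro!: minus_as_smult\<close>)
  also have "\<dots> = LD a \<delta> f xs \<oplus>\<^bsub>M\<^esub> (\<ominus> \<one>) \<odot>\<^bsub>M\<^esub> LD a \<delta> g xs"
    using LD_add[OF assms(1,2) C_smult[OF _ assms(3)] assms(4)] LD_smult[OF assms(1) _ assms(3,4)] by simp
  finally show ?thesis using LD_closed[OF assms(1) _ assms(4)] assms by (simp add: minus_as_smult)
qed

lemma LD_zero: "\<lbrakk>admissible a \<delta>; xs \<in> LS q; \<And>zs. zs \<in> LS q \<Longrightarrow> f zs = \<zero>\<^bsub>M\<^esub>\<rbrakk> \<Longrightarrow> LD a \<delta> f xs = \<zero>\<^bsub>M\<^esub>"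
proof (induction q arbitrary: f xs)
  case (Suc q)
  from Suc.prems(2) obtain y ys where xs: "xs = y # ys" "y \<in> S" "ys \<in> LS q" by (rule lists_of_SucE)
  have "LD a \<delta> (\<lambda>zs. f (y # zs)) ys = \<zero>\<^bsub>M\<^esub>"
    by (rule Suc.IH) (use Suc.prems xs in auto)
  then show ?case using Suc.prems(3) xs admissibleD(4)[OF Suc.prems(1)] by (simp add: a_minus_def M.M.a_inv_zero)
qed (auto simp: admissible_zero)

text \<open>Linearity is inherited termwise. Alternation survives because for a repeated argument
  \<open>x\<close> the two terms in which one copy is replaced by \<open>\<delta> x\<close> cancel
  by skew symmetry.\<close>

lemma LD_C: "\<lbrakk>admissible a \<delta>; C q f\<rbrakk> \<Longrightarrow> C q (LD a \<delta> f)"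
proof (induction q arbitrary: f)
  case (Suc q)
  note ad = admissibleD[OF Suc.prems(1)]
  note f = Suc.prems(2)
  have i: "C q (\<lambda>zs. f (x # zs))" if "x \<in> S" for x using f that by auto
  have cl: "f (x # zs) \<in> carrier M" if "x \<in> S" "zs \<in> LS q" for x zs
    using C_closed[OF f] that by simp
  have L: "LD a \<delta> (\<lambda>zs. f (x # zs)) zs \<in> carrier M" if "x \<in> S" "zs \<in> LS q" for x zs
    by (rule LD_closed[OF Suc.prems(1) i[OF that(1)] that(2)])
  show ?case unfolding cochain.simps
  proof (intro conjI ballI allI impI)
    fix x assume x: "x \<in> S"
    show "C q (\<lambda>zs. LD a \<delta> f (x # zs))"
      using Suc.IH[OF Suc.prems(1) i[OF x]] i ad(4)[OF x] by (simp add: C_minus)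
  next
    fix x y zs assume a: "x \<in> S" "y \<in> S" "zs \<in> LS q"
    have "LD a \<delta> (\<lambda>zs. f ((x \<oplus>\<^bsub>L\<^esub> y) # zs)) zs = LD a \<delta> (\<lambda>zs. f (x # zs) \<oplus>\<^bsub>M\<^esub> f (y # zs)) zs"
      by (rule LD_cong[where q = q]) (use ad a f in auto)
    also have "\<dots> = LD a \<delta> (\<lambda>zs. f (x # zs)) zs \<oplus>\<^bsub>M\<^esub> LD a \<delta> (\<lambda>zs. f (y # zs)) zs"
      by (rule LD_add[OF Suc.prems(1) i i]) (use a in auto)
    finally show "LD a \<delta> f ((x \<oplus>\<^bsub>L\<^esub> y) # zs) = LD a \<delta> f (x # zs) \<oplus>\<^bsub>M\<^esub> LD a \<delta> f (y # zs)"
      using cl[OF ad(4), of x zs] cl[OF ad(4), of y zs] L a ad C_add_head[OF f, of "\<delta> x" "\<delta> y" zs]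
      by (simp add: a_minus_def M.M.minus_add M.M.a_ac)
  next
    fix c x zs assume a: "c \<in> carrier R" "x \<in> S" "zs \<in> LS q"
    have "LD a \<delta> (\<lambda>zs. f ((c \<odot>\<^bsub>L\<^esub> x) # zs)) zs = LD a \<delta> (\<lambda>zs. c \<odot>\<^bsub>M\<^esub> f (x # zs)) zs"
      by (rule LD_cong[where q = q]) (use ad a f in auto)
    also have "\<dots> = c \<odot>\<^bsub>M\<^esub> LD a \<delta> (\<lambda>zs. f (x # zs)) zs"
      by (rule LD_smult[OF Suc.prems(1) _ i]) (use a in auto)
    finally show "LD a \<delta> f ((c \<odot>\<^bsub>L\<^esub> x) # zs) = c \<odot>\<^bsub>M\<^esub> LD a \<delta> f (x # zs)"
      using cl[OF ad(4), of x zs] L a ad C_smult_head[OF f, of c "\<delta> x" zs]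
      by (simp add: a_minus_def M.smult_r_distr M.smult_r_minus)
  next
    fix x p zs assume a: "x \<in> S" "q = Suc p" "zs \<in> LS p"
    have "LD a \<delta> (\<lambda>zs. f (x # x # zs)) zs = \<zero>\<^bsub>M\<^esub>"
      by (rule LD_zero[OF Suc.prems(1), where q = p]) (use a f in auto)
    moreover have "f (x # \<delta> x # zs) = \<ominus>\<^bsub>M\<^esub> f (\<delta> x # x # zs)"
      by (rule C_skew) (use a f ad in auto)
    moreover have "f (\<delta> x # x # zs) \<in> carrier M"
      by (rule cl) (use a ad in auto)
    ultimately show "LD a \<delta> f (x # x # zs) = \<zero>\<^bsub>M\<^esub>"
      by (simp add: a_minus_def M.M.l_neg M.M.r_neg M.M.a_inv_zero)
  qed
qed (auto simp: admissibleD)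

lemma LD_op_cong:
  assumes "\<And>m. m \<in> carrier M \<Longrightarrow> a m = a' m" "\<And>x. x \<in> S \<Longrightarrow> \<delta> x = \<delta>' x" "C q f" "xs \<in> LS q"
  shows "LD a \<delta> f xs = LD a' \<delta>' f xs"
  using assms(3,4)
proof (induction q arbitrary: f xs)
  case (Suc q)
  from Suc.prems(2) obtain y ys where xs: "xs = y # ys" "y \<in> S" "ys \<in> LS q" by (rule lists_of_SucE)
  have "LD a \<delta> (\<lambda>zs. f (y # zs)) ys = LD a' \<delta>' (\<lambda>zs. f (y # zs)) ys"
    by (rule Suc.IH) (use Suc.prems xs in auto)
  then show ?case using xs assms(2) by simp
qed (auto simp: assms(1))

lemma LD_op_add:
  assumes "admissible a \<delta>" "admissible a' \<delta>'" "C q f" "xs \<in> LS q"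
  shows "LD (\<lambda>m. a m \<oplus>\<^bsub>M\<^esub> a' m) (\<lambda>x. \<delta> x \<oplus>\<^bsub>L\<^esub> \<delta>' x) f xs = LD a \<delta> f xs \<oplus>\<^bsub>M\<^esub> LD a' \<delta>' f xs"
  using assms(3,4)
proof (induction q arbitrary: f xs)
  case (Suc q)
  from Suc.prems(2) obtain y ys where xs: "xs = y # ys" "y \<in> S" "ys \<in> LS q" by (rule lists_of_SucE)
  have i: "C q (\<lambda>zs. f (y # zs))" using Suc.prems xs by auto
  note ad = admissibleD[OF assms(1)] admissibleD[OF assms(2)]
  have cl: "f (\<delta> y # ys) \<in> carrier M" "f (\<delta>' y # ys) \<in> carrier M"
    using C_closed[OF Suc.prems(1)] xs ad by auto
  show ?case unfolding xs(1) lie_der.simps Suc.IH[OF i xs(3)]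
    using cl LD_closed[OF assms(1) i xs(3)] LD_closed[OF assms(2) i xs(3)] xs ad
      C_add_head[OF Suc.prems(1), of "\<delta> y" "\<delta>' y" ys]
    by (simp add: a_minus_def M.M.minus_add M.M.a_ac)
qed auto

lemma LD_op_smult:
  assumes "admissible a \<delta>" "c \<in> carrier R" "C q f" "xs \<in> LS q"
  shows "LD (\<lambda>m. c \<odot>\<^bsub>M\<^esub> a m) (\<lambda>x. c \<odot>\<^bsub>L\<^esub> \<delta> x) f xs = c \<odot>\<^bsub>M\<^esub> LD a \<delta> f xs"
  using assms(3,4)
proof (induction q arbitrary: f xs)
  case (Suc q)
  from Suc.prems(2) obtain y ys where xs: "xs = y # ys" "y \<in> S" "ys \<in> LS q" by (rule lists_of_SucE)
  have i: "C q (\<lambda>zs. f (y # zs))" using Suc.prems xs by auto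
  note ad = admissibleD[OF assms(1)]
  have cl: "f (\<delta> y # ys) \<in> carrier M"
    using C_closed[OF Suc.prems(1)] xs ad by auto
  show ?case unfolding xs(1) lie_der.simps Suc.IH[OF i xs(3)]
    using cl LD_closed[OF assms(1) i xs(3)] xs ad assms(2)
      C_smult_head[OF Suc.prems(1), of c "\<delta> y" ys]
    by (simp add: a_minus_def M.smult_r_distr M.smult_r_minus)
qed auto

text \<open>Contraction with \<open>y\<close> commutes with \<open>L_\<delta>\<close> up to
  contraction with \<open>\<delta> y\<close>. Applied twice, this gives the same identity in lower
  degree together with cross terms in \<open>\<delta> y\<close> and \<open>\<delta>' y\<close> that
  cancel, and the two remaining contractions combine to the commutator of the argument maps.\<close>

lemma LD_commutator:
  assumes ad1: "admissible a \<delta>" and ad2: "admissible a' \<delta>'" and "C q f" "xs \<in> LS q"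
  shows "LD (\<lambda>m. a (a' m) \<ominus>\<^bsub>M\<^esub> a' (a m)) (\<lambda>x. \<delta> (\<delta>' x) \<ominus>\<^bsub>L\<^esub> \<delta>' (\<delta> x)) f xs
    = LD a \<delta> (LD a' \<delta>' f) xs \<ominus>\<^bsub>M\<^esub> LD a' \<delta>' (LD a \<delta> f) xs"
  using assms(3,4)
proof (induction q arbitrary: f xs)
  case (Suc q)
  from Suc.prems(2) obtain y ys where xs: "xs = y # ys" "y \<in> S" "ys \<in> LS q" by (rule lists_of_SucE)
  note f = Suc.prems(1)
  have i: "C q (\<lambda>zs. f (y # zs))" if "y \<in> S" for y using f that by auto
  note ad = admissibleD[OF ad1] admissibleD[OF ad2]
  have S: "\<delta> y \<in> S" "\<delta>' y \<in> S" "\<delta>' (\<delta> y) \<in> S" "\<delta> (\<delta>' y) \<in> S" using xs ad by auto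
  have cl: "f (z # ys) \<in> carrier M" if "z \<in> S" for z
    using C_closed[OF f] xs that by auto
  note c = LD_closed[OF ad1 i _] LD_closed[OF ad2 i _]
    LD_closed[OF ad1 LD_C[OF ad2 i]] LD_closed[OF ad2 LD_C[OF ad1 i]]
  have 1: "LD a \<delta> (LD a' \<delta>' f) (y # ys) =
     (LD a \<delta> (LD a' \<delta>' (\<lambda>zs. f (y # zs))) ys \<ominus>\<^bsub>M\<^esub> LD a \<delta> (\<lambda>zs. f (\<delta>' y # zs)) ys)
      \<ominus>\<^bsub>M\<^esub> (LD a' \<delta>' (\<lambda>zs. f (\<delta> y # zs)) ys \<ominus>\<^bsub>M\<^esub> f (\<delta>' (\<delta> y) # ys))"
    using LD_minus[OF ad1 LD_C[OF ad2 i] i, of y "\<delta>' y" ys] xs S by simp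
  have 2: "LD a' \<delta>' (LD a \<delta> f) (y # ys) =
     (LD a' \<delta>' (LD a \<delta> (\<lambda>zs. f (y # zs))) ys \<ominus>\<^bsub>M\<^esub> LD a' \<delta>' (\<lambda>zs. f (\<delta> y # zs)) ys)
      \<ominus>\<^bsub>M\<^esub> (LD a \<delta> (\<lambda>zs. f (\<delta>' y # zs)) ys \<ominus>\<^bsub>M\<^esub> f (\<delta> (\<delta>' y) # ys))"
    using LD_minus[OF ad2 LD_C[OF ad1 i] i, of y "\<delta> y" ys] xs S by simp
  have m: "f ((\<delta> (\<delta>' y) \<ominus>\<^bsub>L\<^esub> \<delta>' (\<delta> y)) # ys) = f (\<delta> (\<delta>' y) # ys) \<ominus>\<^bsub>M\<^esub> f (\<delta>' (\<delta> y) # ys)"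
    by (rule C_minus_head[OF f]) (use S xs in auto)
  show ?case unfolding xs(1) 1 2
    unfolding lie_der.simps Suc.IH[OF i[OF xs(2)] xs(3)] m
    using c[OF xs(2) xs(3)] c(1,2)[OF S(1) xs(3)] c(1,2)[OF S(2) xs(3)] cl[OF S(3)] cl[OF S(4)]
    by (intro M.M.commutator_identity)
qed auto

lemma d_cong: "\<lbrakk>\<And>zs. zs \<in> LS q \<Longrightarrow> f zs = g zs; xs \<in> LS (Suc q)\<rbrakk> \<Longrightarrow> d f xs = d g xs"
proof (induction q arbitrary: f g xs)
  case 0
  then obtain x where "xs = [x]" "x \<in> S" by (blast elim: lists_of_1E)
  then show ?case using 0 by simp
next
  case (Suc q)
  from Suc.prems(2) obtain y ys where xs: "xs = y # ys" "y \<in> S" "ys \<in> LS (Suc q)" by (rule lists_of_SucE)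
  have "d (\<lambda>zs. f (y # zs)) ys = d (\<lambda>zs. g (y # zs)) ys"
    by (rule Suc.IH) (use Suc.prems xs in auto)
  moreover have "LX y f ys = LX y g ys"
    by (rule LX_cong) (use Suc.prems xs in auto)
  ultimately show ?case using xs by simp
qed

lemma d_closed: "\<lbrakk>C q f; xs \<in> LS (Suc q)\<rbrakk> \<Longrightarrow> d f xs \<in> carrier M"
proof (induction q arbitrary: f xs)
  case 0
  then obtain x where "xs = [x]" "x \<in> S" by (blast elim: lists_of_1E)
  then show ?case using 0 by (simp add: act_closed)
next
  case (Suc q)
  from Suc.prems(2) obtain y ys where xs: "xs = y # ys" "y \<in> S" "ys \<in> LS (Suc q)" by (rule lists_of_SucE)
  have "d (\<lambda>zs. f (y # zs)) ys \<in> carrier M"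
    by (rule Suc.IH) (use Suc.prems xs in auto)
  moreover have "LX y f ys \<in> carrier M"
    by (rule LD_closed[OF admissible_act]) (use Suc.prems xs in auto)
  ultimately show ?case using xs by simp
qed

lemma d_add: "\<lbrakk>C q f; C q g; xs \<in> LS (Suc q)\<rbrakk> \<Longrightarrow> d (\<lambda>zs. f zs \<oplus>\<^bsub>M\<^esub> g zs) xs = d f xs \<oplus>\<^bsub>M\<^esub> d g xs"
proof (induction q arbitrary: f g xs)
  case 0
  then obtain x where "xs = [x]" "x \<in> S" by (blast elim: lists_of_1E)
  then show ?case using 0 by (simp add: act_closed act_add_right a_minus_def M.M.a_inv_zero)
next
  case (Suc q)
  from Suc.prems(3) obtain y ys where xs: "xs = y # ys" "y \<in> S" "ys \<in> LS (Suc q)" by (rule lists_of_SucE)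
  have i: "C q (\<lambda>zs. f (y # zs))" "C q (\<lambda>zs. g (y # zs))" using Suc.prems xs by auto
  note ad = admissible_act[OF xs(2)]
  show ?case unfolding xs(1) cobd.simps Suc.IH[OF i xs(3)] LD_add[OF ad Suc.prems(1,2) xs(3)]
    using d_closed[OF i(1) xs(3)] d_closed[OF i(2) xs(3)] LD_closed[OF ad Suc.prems(1) xs(3)]
      LD_closed[OF ad Suc.prems(2) xs(3)] by (simp add: M.M.add_minus_add)
qed

lemma d_smult: "\<lbrakk>c \<in> carrier R; C q f; xs \<in> LS (Suc q)\<rbrakk> \<Longrightarrow> d (\<lambda>zs. c \<odot>\<^bsub>M\<^esub> f zs) xs = c \<odot>\<^bsub>M\<^esub> d f xs"
proof (induction q arbitrary: f xs)
  case 0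
  then obtain x where "xs = [x]" "x \<in> S" by (blast elim: lists_of_1E)
  then show ?case using 0 by (simp add: act_closed act_smult_right a_minus_def M.M.a_inv_zero)
next
  case (Suc q)
  from Suc.prems(3) obtain y ys where xs: "xs = y # ys" "y \<in> S" "ys \<in> LS (Suc q)" by (rule lists_of_SucE)
  have i: "C q (\<lambda>zs. f (y # zs))" using Suc.prems xs by auto
  note ad = admissible_act[OF xs(2)]
  show ?case unfolding xs(1) cobd.simps Suc.IH[OF Suc.prems(1) i xs(3)] LD_smult[OF ad Suc.prems(1,2) xs(3)]
    using d_closed[OF i(1) xs(3)] LD_closed[OF ad Suc.prems(2) xs(3)] Suc.prems(1)
    by (simp add: a_minus_def M.smult_r_distr M.smult_r_minus)
qed

lemma d_minus:
  assumes "C q f" "C q g" "xs \<in> LS (Suc q)"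
  shows "d (\<lambda>zs. f zs \<ominus>\<^bsub>M\<^esub> g zs) xs = d f xs \<ominus>\<^bsub>M\<^esub> d g xs"
proof -
  have "d (\<lambda>zs. f zs \<ominus>\<^bsub>M\<^esub> g zs) xs = d (\<lambda>zs. f zs \<oplus>\<^bsub>M\<^esub> (\<ominus> \<one>) \<odot>\<^bsub>M\<^esub> g zs) xs"
    by (rule d_cong[where q = q])
      (use assms C_closed[OF assms(1)] C_closed[OF assms(2)] in \<open>auto intro!: minus_as_smult\<close>)
  also have "\<dots> = d f xs \<oplus>\<^bsub>M\<^esub> (\<ominus> \<one>) \<odot>\<^bsub>M\<^esub> d g xs"
    using d_add[OF assms(1) C_smult[OF _ assms(2)] assms(3)] d_smult[OF _ assms(2,3)] by simp
  finally show ?thesis using d_closed[OF _ assms(3)] assms by (simp add: minus_as_smult)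
qed

lemma d_zero:
  assumes "\<And>zs. zs \<in> LS q \<Longrightarrow> f zs = \<zero>\<^bsub>M\<^esub>" "xs \<in> LS (Suc q)"
  shows "d f xs = \<zero>\<^bsub>M\<^esub>"
proof -
  have C0: "C q (\<lambda>_. \<zero>\<^bsub>M\<^esub>)" by (rule C_zero)
  have "d f xs = d (\<lambda>zs. \<zero> \<odot>\<^bsub>M\<^esub> \<zero>\<^bsub>M\<^esub>) xs"
    by (rule d_cong[where q = q]) (use assms in auto)
  also have "\<dots> = \<zero>\<^bsub>M\<^esub>"
    using d_smult[OF _ C0 assms(2), of \<zero>] d_closed[OF C0 assms(2)] by simp
  finally show ?thesis .
qed

text \<open>For alternation, contracting \<open>d f\<close> twice with \<open>x\<close> leaves
  \<open>L_x i_x f - L_x i_x f\<close>, a contraction with \<open>[x, x] = 0\<close>, and the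
  coboundary of the cochain \<open>i_x i_x f\<close>, which is zero.\<close>

lemma d_C: "C q f \<Longrightarrow> C (Suc q) (d f)"
proof (induction q arbitrary: f)
  case 0
  have c0: "f [] \<in> carrier M" using 0 by simp
  then show ?case
    by (auto simp: act_closed act_add_left act_smult_left a_minus_def M.M.a_inv_zero S_add S_smult)
next
  case (Suc q)
  note f = Suc.prems
  have i: "C q (\<lambda>zs. f (x # zs))" if "x \<in> S" for x using f that by auto
  note ad = admissible_act
  have L: "LX x f zs \<in> carrier M" if "x \<in> S" "zs \<in> LS (Suc q)" for x zs
    by (rule LD_closed[OF ad[OF that(1)] f that(2)])
  have D: "d (\<lambda>zs. f (x # zs)) zs \<in> carrier M" if "x \<in> S" "zs \<in> LS (Suc q)" for x zs
    by (rule d_closed[OF i[OF that(1)] that(2)])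
  show ?case unfolding cochain.simps(2)[of R L M S "Suc q"]
  proof (intro conjI ballI allI impI)
    fix x assume x: "x \<in> S"
    show "C (Suc q) (\<lambda>zs. d f (x # zs))"
      unfolding cobd.simps by (intro C_minus LD_C[OF ad[OF x] f] Suc.IH[OF i[OF x]])
  next
    fix x y zs assume a: "x \<in> S" "y \<in> S" "zs \<in> LS (Suc q)"
    have 1: "d (\<lambda>zs. f ((x \<oplus>\<^bsub>L\<^esub> y) # zs)) zs = d (\<lambda>zs. f (x # zs)) zs \<oplus>\<^bsub>M\<^esub> d (\<lambda>zs. f (y # zs)) zs"
      using d_cong[where q = q and xs = zs and f = "\<lambda>zs. f ((x \<oplus>\<^bsub>L\<^esub> y) # zs)" and g = "\<lambda>zs. f (x # zs) \<oplus>\<^bsub>M\<^esub> f (y # zs)"]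
        d_add[OF i i, of x y zs] a f by simp
    have 2: "LX (x \<oplus>\<^bsub>L\<^esub> y) f zs = LX x f zs \<oplus>\<^bsub>M\<^esub> LX y f zs"
      using LD_op_add[OF ad ad f a(3), of x y] a
        LD_op_cong[of "act M (x \<oplus>\<^bsub>L\<^esub> y)" "\<lambda>m. act M x m \<oplus>\<^bsub>M\<^esub> act M y m" "bracket L (x \<oplus>\<^bsub>L\<^esub> y)"
          "\<lambda>z. bracket L x z \<oplus>\<^bsub>L\<^esub> bracket L y z" "Suc q" f zs, OF _ _ f a(3)]
      by (simp add: act_add_left bracket_add_left)
    show "d f ((x \<oplus>\<^bsub>L\<^esub> y) # zs) = d f (x # zs) \<oplus>\<^bsub>M\<^esub> d f (y # zs)"
      unfolding cobd.simps 1 2 using L[OF a(1,3)] L[OF a(2,3)] D[OF a(1,3)] D[OF a(2,3)] by (simp add: M.M.add_minus_add)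
  next
    fix c x zs assume a: "c \<in> carrier R" "x \<in> S" "zs \<in> LS (Suc q)"
    have 1: "d (\<lambda>zs. f ((c \<odot>\<^bsub>L\<^esub> x) # zs)) zs = c \<odot>\<^bsub>M\<^esub> d (\<lambda>zs. f (x # zs)) zs"
      using d_cong[where q = q and xs = zs and f = "\<lambda>zs. f ((c \<odot>\<^bsub>L\<^esub> x) # zs)" and g = "\<lambda>zs. c \<odot>\<^bsub>M\<^esub> f (x # zs)"]
        d_smult[OF _ i, of c x zs] a f by simp
    have 2: "LX (c \<odot>\<^bsub>L\<^esub> x) f zs = c \<odot>\<^bsub>M\<^esub> LX x f zs"
      using LD_op_smult[OF ad a(1) f a(3), of x] a
        LD_op_cong[of "act M (c \<odot>\<^bsub>L\<^esub> x)" "\<lambda>m. c \<odot>\<^bsub>M\<^esub> act M x m" "bracket L (c \<odot>\<^bsub>L\<^esub> x)"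
          "\<lambda>z. c \<odot>\<^bsub>L\<^esub> bracket L x z" "Suc q" f zs, OF _ _ f a(3)]
      by (simp add: act_smult_left bracket_smult_left)
    show "d f ((c \<odot>\<^bsub>L\<^esub> x) # zs) = c \<odot>\<^bsub>M\<^esub> d f (x # zs)"
      unfolding cobd.simps 1 2 using L[OF a(2,3)] D[OF a(2,3)] a(1)
      by (simp add: a_minus_def M.smult_r_distr M.smult_r_minus)
  next
    fix x p zs assume a: "x \<in> S" "Suc q = Suc p" "zs \<in> LS p"
    have "d (\<lambda>zs. f (x # x # zs)) zs = \<zero>\<^bsub>M\<^esub>"
    proof (cases q)
      case 0 then show ?thesis using a by simp
    next
      case (Suc r) then show ?thesis by (intro d_zero[where q = r]) (use a f in auto)
    qed
    moreover have "f (bracket L x x # zs) = \<zero>\<^bsub>M\<^esub>"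
      using C_zero_head[OF f] a bracket_self by simp
    moreover have "LX x (\<lambda>zs. f (x # zs)) zs \<in> carrier M"
      by (rule LD_closed[OF ad[OF a(1)] i[OF a(1)]]) (use a in simp)
    ultimately show "d f (x # x # zs) = \<zero>\<^bsub>M\<^esub>"
      unfolding cobd.simps lie_der.simps by (simp add: a_minus_def M.M.r_neg M.M.a_inv_zero)
  qed
qed

text \<open>Cartan's formula and induction on the degree reduce the claim to
  \<open>L_(\<delta> x) = [L_\<delta>, L_x]\<close>. The two compatibility assumptions say precisely
  that the operators on arguments and on values satisfy this relation.\<close>

lemma d_LD:
  assumes ad: "admissible a \<delta>"
    and der: "\<And>x y. \<lbrakk>x \<in> S; y \<in> S\<rbrakk> \<Longrightarrow> \<delta> (bracket L x y) = bracket L (\<delta> x) y \<oplus>\<^bsub>L\<^esub> bracket L x (\<delta> y)"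
    and a: "\<And>x m. \<lbrakk>x \<in> S; m \<in> carrier M\<rbrakk> \<Longrightarrow> a (act M x m) = act M (\<delta> x) m \<oplus>\<^bsub>M\<^esub> act M x (a m)"
    and f: "C q f" and xs: "xs \<in> LS (Suc q)"
  shows "d (LD a \<delta> f) xs = LD a \<delta> (d f) xs"
  using f xs
proof (induction q arbitrary: f xs)
  note adD = admissibleD[OF ad]
  have comm: "LX (\<delta> x) f ys = LD a \<delta> (LX x f) ys \<ominus>\<^bsub>M\<^esub> LX x (LD a \<delta> f) ys"
    if x: "x \<in> S" and f: "C q f" and ys: "ys \<in> LS q" for x q f ys
  proof -
    have "LX (\<delta> x) f ys = LD (\<lambda>m. a (act M x m) \<ominus>\<^bsub>M\<^esub> act M x (a m))
        (\<lambda>y. \<delta> (bracket L x y) \<ominus>\<^bsub>L\<^esub> bracket L x (\<delta> y)) f ys"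
    proof (rule LD_op_cong[OF _ _ f ys])
      show "act M (\<delta> x) m = a (act M x m) \<ominus>\<^bsub>M\<^esub> act M x (a m)" if "m \<in> carrier M" for m
        using a[OF x that] adD x that act_closed[of "\<delta> x" m] act_closed[of x "a m"] by (simp add: M.M.add_minus_cancel)
      show "bracket L (\<delta> x) y = \<delta> (bracket L x y) \<ominus>\<^bsub>L\<^esub> bracket L x (\<delta> y)" if "y \<in> S" for y
        using der[OF x that] adD x that bracket_closed[of "\<delta> x" y] bracket_closed[of x "\<delta> y"]
        by (simp add: L_add_minus_cancel)
    qed
    also have "\<dots> = LD a \<delta> (LX x f) ys \<ominus>\<^bsub>M\<^esub> LX x (LD a \<delta> f) ys"
      by (rule LD_commutator[OF ad admissible_act[OF x] f ys])
    finally show ?thesis .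
  qed
  {
    case 0
    then obtain x where xs: "xs = [x]" "x \<in> S" by (blast elim: lists_of_1E)
    show ?case using 0 xs adD
      by (simp add: a_minus_def M.M.a_inv_zero act_closed M.M.minus_add a M.M.a_ac M.M.r_neg M.M.r_neg1)
  next
    case (Suc q)
    from Suc.prems(2) obtain x ys where xs: "xs = x # ys" "x \<in> S" "ys \<in> LS (Suc q)" by (rule lists_of_SucE)
    note f = Suc.prems(1)
    have i: "C q (\<lambda>zs. f (x # zs))" if "x \<in> S" for x using f that by auto
    have dx: "\<delta> x \<in> S" using adD xs by auto
    have 1: "d (LD a \<delta> f) xs = LX x (LD a \<delta> f) ys \<ominus>\<^bsub>M\<^esub>
        (d (LD a \<delta> (\<lambda>zs. f (x # zs))) ys \<ominus>\<^bsub>M\<^esub> d (\<lambda>zs. f (\<delta> x # zs)) ys)"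
      unfolding xs(1) cobd.simps lie_der.simps
      using d_minus[OF LD_C[OF ad i[OF xs(2)]] i[OF dx] xs(3)] by simp
    have 2: "LD a \<delta> (d f) xs = (LD a \<delta> (LX x f) ys \<ominus>\<^bsub>M\<^esub> LD a \<delta> (d (\<lambda>zs. f (x # zs))) ys) \<ominus>\<^bsub>M\<^esub>
        (LX (\<delta> x) f ys \<ominus>\<^bsub>M\<^esub> d (\<lambda>zs. f (\<delta> x # zs)) ys)"
      unfolding xs(1) cobd.simps lie_der.simps
      using LD_minus[OF ad LD_C[OF admissible_act[OF xs(2)] f] d_C[OF i[OF xs(2)]] xs(3)] by simp
    show ?case unfolding 1 2 comm[OF xs(2) f xs(3)] Suc.IH[OF i[OF xs(2)] xs(3)]
      using LD_closed[OF ad LD_C[OF admissible_act f] xs(3), of x]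
        LD_closed[OF admissible_act LD_C[OF ad f] xs(3), of x] xs(2)
        LD_closed[OF ad d_C[OF i] xs(3), of x] d_closed[OF i[OF dx] xs(3)] by (intro M.M.minus_minus_identity)
  }
qed

lemma d_LX:
  assumes x: "x \<in> S" and f: "C q f" and xs: "xs \<in> LS (Suc q)"
  shows "d (LX x f) xs = LX x (d f) xs"
proof (rule d_LD[OF admissible_act[OF x] _ _ f xs])
  fix y z assume yz: "y \<in> S" "z \<in> S"
  show "bracket L x (bracket L y z) = bracket L (bracket L x y) z \<oplus>\<^bsub>L\<^esub> bracket L y (bracket L x z)"
    by (rule bracket_leibniz) (use x yz in auto)
next
  fix y m assume ym: "y \<in> S" "m \<in> carrier M"
  show "act M x (act M y m) = act M (bracket L x y) m \<oplus>\<^bsub>M\<^esub> act M y (act M x m)"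
    using ym x by (simp add: act_bracket act_closed M.M.minus_add_cancel)
qed

text \<open>By Cartan's formula \<open>i_x d d f = L_x d f - d L_x f + d d (i_x f)\<close>. The
  first two terms cancel by \<open>d_LX\<close>, and the last one has lower degree.\<close>

lemma d_d: "\<lbrakk>C q f; xs \<in> LS (Suc (Suc q))\<rbrakk> \<Longrightarrow> d (d f) xs = \<zero>\<^bsub>M\<^esub>"
proof (induction q arbitrary: f xs)
  case 0
  from 0(2) obtain x ys where xs: "xs = x # ys" "x \<in> S" "ys \<in> LS (Suc 0)" by (rule lists_of_SucE)
  have c: "C 0 (LX x f)" by (rule LD_C[OF admissible_act[OF xs(2)] 0(1)])
  have "d (\<lambda>zs. d f (x # zs)) ys = d (LX x f) ys"
    by (rule d_cong[where q = 0]) (use 0 xs in \<open>auto simp: a_minus_def M.M.a_inv_zero act_closed\<close>)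
  also have "\<dots> = LX x (d f) ys" by (rule d_LX[OF xs(2) 0(1) xs(3)])
  finally show ?case unfolding xs(1) cobd.simps(2)[of L M "d f"]
    using LD_closed[OF admissible_act[OF xs(2)] d_C[OF 0(1)] xs(3)] by (simp add: a_minus_def M.M.r_neg)
next
  case (Suc q)
  from Suc.prems(2) obtain x ys where xs: "xs = x # ys" "x \<in> S" "ys \<in> LS (Suc (Suc q))" by (rule lists_of_SucE)
  note f = Suc.prems(1)
  have i: "C q (\<lambda>zs. f (x # zs))" using f xs by auto
  note ad = admissible_act[OF xs(2)]
  have "d (\<lambda>zs. d f (x # zs)) ys = d (\<lambda>zs. LX x f zs \<ominus>\<^bsub>M\<^esub> d (\<lambda>zs. f (x # zs)) zs) ys"
    by simp
  also have "\<dots> = d (LX x f) ys \<ominus>\<^bsub>M\<^esub> d (d (\<lambda>zs. f (x # zs))) ys"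
    by (rule d_minus[OF LD_C[OF ad f] d_C[OF i] xs(3)])
  also have "\<dots> = LX x (d f) ys"
    using Suc.IH[OF i xs(3)] d_LX[OF xs(2) f xs(3)] LD_closed[OF ad d_C[OF f] xs(3)]
    by (simp add: a_minus_def M.M.a_inv_zero)
  finally show ?case unfolding xs(1) cobd.simps(2)[of L M "d f"]
    using LD_closed[OF ad d_C[OF f] xs(3)] by (simp add: a_minus_def M.M.r_neg)
qed

end

section \<open>Linear extension from a well-ordered basis\<close>

text \<open>Linear combinations are lists of coefficient-vector pairs, repetitions allowed, so that
  sums, multiples and substitutions are plain list operations.\<close>

primrec lincomb :: "('a, 'm, 'z) module_scheme \<Rightarrow> ('b \<Rightarrow> 'm) \<Rightarrow> ('a \<times> 'b) list \<Rightarrow> 'm" where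
  "lincomb M h [] = \<zero>\<^bsub>M\<^esub>"
| "lincomb M h (p # ps) = (fst p \<odot>\<^bsub>M\<^esub> h (snd p)) \<oplus>\<^bsub>M\<^esub> lincomb M h ps"

definition linear_map :: "('a, 'x) ring_scheme \<Rightarrow> ('a, 'm, 'y) module_scheme \<Rightarrow> ('a, 'n, 'z) module_scheme \<Rightarrow>
    ('m \<Rightarrow> 'n) \<Rightarrow> bool" where
  "linear_map R M N T \<longleftrightarrow> (\<forall>x\<in>carrier M. T x \<in> carrier N) \<and>
     (\<forall>x\<in>carrier M. \<forall>y\<in>carrier M. T (x \<oplus>\<^bsub>M\<^esub> y) = T x \<oplus>\<^bsub>N\<^esub> T y) \<and>
     (\<forall>c\<in>carrier R. \<forall>x\<in>carrier M. T (c \<odot>\<^bsub>M\<^esub> x) = c \<odot>\<^bsub>N\<^esub> T x)"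

lemma linear_mapD:
  assumes "linear_map R M N T"
  shows "x \<in> carrier M \<Longrightarrow> T x \<in> carrier N"
    and "\<lbrakk>x \<in> carrier M; y \<in> carrier M\<rbrakk> \<Longrightarrow> T (x \<oplus>\<^bsub>M\<^esub> y) = T x \<oplus>\<^bsub>N\<^esub> T y"
    and "\<lbrakk>c \<in> carrier R; x \<in> carrier M\<rbrakk> \<Longrightarrow> T (c \<odot>\<^bsub>M\<^esub> x) = c \<odot>\<^bsub>N\<^esub> T x"
  using assms unfolding linear_map_def by auto

lemma linear_map_zero:
  assumes "Module.module R M" "Module.module R N" "linear_map R M N T"
  shows "T \<zero>\<^bsub>M\<^esub> = \<zero>\<^bsub>N\<^esub>"
proof -
  interpret M: Module.module R M by fact
  interpret N: Module.module R N by fact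
  show ?thesis
    using linear_mapD(3)[OF assms(3), of "\<zero>\<^bsub>R\<^esub>" "\<zero>\<^bsub>M\<^esub>"] linear_mapD(1)[OF assms(3), of "\<zero>\<^bsub>M\<^esub>"] by simp
qed

lemma linear_map_minus:
  assumes "Module.module R M" "Module.module R N" "linear_map R M N T" "x \<in> carrier M" "y \<in> carrier M"
  shows "T (x \<ominus>\<^bsub>M\<^esub> y) = T x \<ominus>\<^bsub>N\<^esub> T y"
proof -
  interpret M: Module.module R M by fact
  interpret N: Module.module R N by fact
  note T = linear_mapD[OF assms(3)]
  have "T (\<ominus>\<^bsub>M\<^esub> y) = \<ominus>\<^bsub>N\<^esub> T y"
    using T(3)[of "\<ominus>\<^bsub>R\<^esub> \<one>\<^bsub>R\<^esub>" y] T(1) assms M.smult_l_minus[of "\<one>\<^bsub>R\<^esub>" y] N.smult_l_minus[of "\<one>\<^bsub>R\<^esub>" "T y"] by simp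
  then show ?thesis using T assms by (simp add: a_minus_def)
qed

lemma linear_map_comp: "\<lbrakk>linear_map R M N T; linear_map R N P U\<rbrakk> \<Longrightarrow> linear_map R M P (\<lambda>x. U (T x))"
  unfolding linear_map_def by auto

lemma lincomb_closed:
  assumes "Module.module R M" "\<And>a. a \<in> X \<Longrightarrow> h a \<in> carrier M" "set l \<subseteq> carrier R \<times> X"
  shows "lincomb M h l \<in> carrier M"
proof -
  interpret M: Module.module R M by fact
  show ?thesis using assms(3) by (induction l) (auto simp: assms(2))
qed

lemma lincomb_append:
  assumes "Module.module R M" "\<And>a. a \<in> X \<Longrightarrow> h a \<in> carrier M" "set l \<subseteq> carrier R \<times> X" "set l' \<subseteq> carrier R \<times> X"
  shows "lincomb M h (l @ l') = lincomb M h l \<oplus>\<^bsub>M\<^esub> lincomb M h l'"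
proof -
  interpret M: Module.module R M by fact
  show ?thesis using assms(3)
    by (induction l) (auto simp: assms(2) lincomb_closed[OF assms(1,2)] assms(4) M.M.a_assoc)
qed

lemma lincomb_scale:
  assumes "Module.module R M" "\<And>a. a \<in> X \<Longrightarrow> h a \<in> carrier M" "set l \<subseteq> carrier R \<times> X" "c \<in> carrier R"
  shows "lincomb M h (map (\<lambda>p. (c \<otimes>\<^bsub>R\<^esub> fst p, snd p)) l) = c \<odot>\<^bsub>M\<^esub> lincomb M h l"
proof -
  interpret M: Module.module R M by fact
  show ?thesis using assms(3)
    by (induction l) (auto simp: assms(2,4) lincomb_closed[OF assms(1,2)] M.smult_r_distr M.smult_assoc1)
qed

lemma lincomb_linear_map:
  assumes "Module.module R M" "Module.module R N" "linear_map R M N T" "\<And>a. a \<in> X \<Longrightarrow> h a \<in> carrier M"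
    "set l \<subseteq> carrier R \<times> X"
  shows "T (lincomb M h l) = lincomb N (\<lambda>a. T (h a)) l"
proof -
  interpret M: Module.module R M by fact
  interpret N: Module.module R N by fact
  note T = linear_mapD[OF assms(3)]
  show ?thesis using assms(5)
    by (induction l) (auto simp: assms(4) T lincomb_closed[OF assms(1,4)] linear_map_zero[OF assms(1-3)])
qed

lemma lincomb_cong: "(\<And>p. p \<in> set l \<Longrightarrow> h (snd p) = g (snd p)) \<Longrightarrow> lincomb M h l = lincomb M g l"
  by (induction l) auto

lemma lincomb_add:
  assumes "Module.module R M" "\<And>a. a \<in> X \<Longrightarrow> h a \<in> carrier M" "\<And>a. a \<in> X \<Longrightarrow> g a \<in> carrier M"
    "set l \<subseteq> carrier R \<times> X"
  shows "lincomb M (\<lambda>a. h a \<oplus>\<^bsub>M\<^esub> g a) l = lincomb M h l \<oplus>\<^bsub>M\<^esub> lincomb M g l"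
proof -
  interpret M: Module.module R M by fact
  show ?thesis using assms(4)
    by (induction l) (auto simp: assms(2,3) lincomb_closed[OF assms(1,2)] lincomb_closed[OF assms(1,3)]
      M.smult_r_distr M.M.a_ac)
qed

lemma lincomb_split:
  assumes "Module.module R M" "\<And>a. a \<in> X \<Longrightarrow> h a \<in> carrier M" "set l \<subseteq> carrier R \<times> X"
  shows "lincomb M h l = lincomb M h (filter P l) \<oplus>\<^bsub>M\<^esub> lincomb M h (filter (\<lambda>p. \<not> P p) l)"
proof -
  interpret M: Module.module R M by fact
  have c: "lincomb M h (filter P l) \<in> carrier M" if "set l \<subseteq> carrier R \<times> X" for l P
    by (rule lincomb_closed[OF assms(1,2)]) (use that in auto)
  show ?thesis using assms(3)
    by (induction l) (auto simp: assms(2) c M.M.a_ac)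
qed

text \<open>Independence is stated in triangular form: no basis element is a combination of smaller
  ones. This is what a greedy choice along a well-order yields, and over a field it amounts to
  linear independence.\<close>

locale ordered_basis = Module.module R N + field R
  for R :: "('a, 'x) ring_scheme" (structure) and N :: "('a, 'b, 'y) module_scheme" (structure) +
  fixes X :: "'b set" and lt :: "'b \<Rightarrow> 'b \<Rightarrow> bool"
  assumes X_sub: "X \<subseteq> carrier N"
    and lt_wf: "wfP lt"
    and lt_trans: "\<lbrakk>lt x y; lt y z\<rbrakk> \<Longrightarrow> lt x z"
    and lt_total: "x \<noteq> y \<Longrightarrow> lt x y \<or> lt y x"
    and basis_indep: "\<lbrakk>a \<in> X; set l \<subseteq> carrier R \<times> {y \<in> X. lt y a}\<rbrakk> \<Longrightarrow> lincomb N id l \<noteq> a"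
    and basis_span: "x \<in> carrier N \<Longrightarrow> \<exists>l. set l \<subseteq> carrier R \<times> X \<and> lincomb N id l = x"
begin

lemma X_closed [simp, intro]: "a \<in> X \<Longrightarrow> a \<in> carrier N"
  using X_sub by blast

lemma ex_lt_min:
  assumes "A \<noteq> {}" shows "\<exists>m\<in>A. \<forall>a\<in>A. \<not> lt a m"
proof -
  have "wf {(x, y). lt x y}" using lt_wf by (simp add: wfp_def)
  moreover obtain x where "x \<in> A" using assms by blast
  ultimately obtain z where "z \<in> A" "\<And>y. (y, z) \<in> {(x, y). lt x y} \<Longrightarrow> y \<notin> A"
    by (rule wfE_min) blast
  then show ?thesis by auto
qed

lemma lt_irrefl [simp]: "\<not> lt x x"
  using ex_lt_min[of "{x}"] by simp

lemma lt_asym: "lt x y \<Longrightarrow> \<not> lt y x"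
  using lt_trans lt_irrefl by blast

lemma ex_lt_max:
  assumes "finite A" "A \<noteq> {}" shows "\<exists>m\<in>A. \<forall>a\<in>A. a \<noteq> m \<longrightarrow> lt a m"
  using assms
proof (induction rule: finite_ne_induct)
  case (insert x F)
  then obtain m where m: "m \<in> F" "\<forall>a\<in>F. a \<noteq> m \<longrightarrow> lt a m" by blast
  show ?case
  proof (cases "lt m x")
    case True
    then have "\<forall>a\<in>F. lt a x" using m(2) lt_trans[of _ m x] by metis
    then show ?thesis by blast
  next
    case False
    then have "m = x \<or> lt x m" using lt_total by blast
    then show ?thesis using m by blast
  qed
qed auto

lemma module_self: "Module.module R N" ..

lemma self_closed: "set l \<subseteq> carrier R \<times> X \<Longrightarrow> lincomb N id l \<in> carrier N"
  by (rule lincomb_closed[OF module_self, where X = X]) auto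

lemma self_append: "\<lbrakk>set l \<subseteq> carrier R \<times> X; set l' \<subseteq> carrier R \<times> X\<rbrakk> \<Longrightarrow>
    lincomb N id (l @ l') = lincomb N id l \<oplus>\<^bsub>N\<^esub> lincomb N id l'"
  by (rule lincomb_append[OF module_self, where X = X]) auto

lemma self_scale: "\<lbrakk>set l \<subseteq> carrier R \<times> X; c \<in> carrier R\<rbrakk> \<Longrightarrow>
    lincomb N id (map (\<lambda>p. (c \<otimes> fst p, snd p)) l) = c \<odot>\<^bsub>N\<^esub> lincomb N id l"
  by (rule lincomb_scale[OF module_self, where X = X]) auto

lemma self_split: "set l \<subseteq> carrier R \<times> X \<Longrightarrow>
    lincomb N id l = lincomb N id (filter P l) \<oplus>\<^bsub>N\<^esub> lincomb N id (filter (\<lambda>p. \<not> P p) l)"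
  by (rule lincomb_split[OF module_self, where X = X]) auto

text \<open>The largest vector occurring in the relation must have total coefficient zero; otherwise
  division by this coefficient would express it through smaller basis elements. Deleting it leaves a
  shorter relation.\<close>

lemma lincomb_wd:
  assumes M: "Module.module R M" and h: "\<And>a. a \<in> X \<Longrightarrow> h a \<in> carrier M"
    and "set l \<subseteq> carrier R \<times> X" "lincomb N id l = \<zero>\<^bsub>N\<^esub>"
  shows "lincomb M h l = \<zero>\<^bsub>M\<^esub>"
  using assms(3,4)
proof (induction "length l" arbitrary: l rule: less_induct)
  case less
  interpret K: Module.module R M by (rule M)
  show ?case
  proof (cases "l = []")
    case False
    obtain m where m: "m \<in> snd ` set l" "\<forall>a\<in>snd ` set l. a \<noteq> m \<longrightarrow> lt a m"
      using ex_lt_max[of "snd ` set l"] False by auto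
    have mX: "m \<in> X" using m(1) less.prems(1) by auto
    define l1 where "l1 = filter (\<lambda>p. snd p = m) l"
    define l2 where "l2 = filter (\<lambda>p. \<not> snd p = m) l"
    have s1: "set l1 \<subseteq> carrier R \<times> X" "snd ` set l1 \<subseteq> {m}" using less.prems(1) by (auto simp: l1_def)
    have s2: "set l2 \<subseteq> carrier R \<times> {y \<in> X. lt y m}"
      using less.prems(1) m(2) unfolding l2_def by fastforce
    then have s2': "set l2 \<subseteq> carrier R \<times> X" by auto
    \<comment> \<open>The total coefficient of \<open>m\<close>, which may occur several times in
      the list.\<close>
    define c where "c = foldr (\<lambda>p s. fst p \<oplus> s) l1 \<zero>"
    have cR: "c \<in> carrier R" using s1 unfolding c_def by (induction l1) auto
    have N1: "lincomb N id l1 = c \<odot>\<^bsub>N\<^esub> m"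
      using s1 unfolding c_def
    proof (induction l1)
      case (Cons p l1)
      have "foldr (\<lambda>p s. fst p \<oplus> s) l1 \<zero> \<in> carrier R" using Cons.prems by (induction l1) auto
      then show ?case using Cons mX by (auto simp: smult_l_distr)
    qed (use mX in simp)
    have M1: "lincomb M h l1 = c \<odot>\<^bsub>M\<^esub> h m"
      using s1 unfolding c_def
    proof (induction l1)
      case (Cons p l1)
      have "foldr (\<lambda>p s. fst p \<oplus> s) l1 \<zero> \<in> carrier R" using Cons.prems by (induction l1) auto
      then show ?case using Cons mX h by (auto simp: K.smult_l_distr)
    qed (use mX h in simp)
    have cl2: "lincomb N id l2 \<in> carrier N" by (rule self_closed[OF s2'])
    have sum: "c \<odot>\<^bsub>N\<^esub> m \<oplus>\<^bsub>N\<^esub> lincomb N id l2 = \<zero>\<^bsub>N\<^esub>"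
      using self_split[OF less.prems(1), of "\<lambda>p. snd p = m"] less.prems N1
      by (auto simp: l1_def l2_def)
    have "c = \<zero>"
    proof (rule ccontr)
      assume c0: "c \<noteq> \<zero>"
      then have u: "c \<in> Units R" using cR field_Units by auto
      let ?e = "\<ominus> (inv c)"
      have e: "?e \<in> carrier R" using u by auto
      have "m = inv c \<odot>\<^bsub>N\<^esub> (c \<odot>\<^bsub>N\<^esub> m)"
        using u cR mX smult_assoc1[of "inv c" c m] by simp
      also have "c \<odot>\<^bsub>N\<^esub> m = \<ominus>\<^bsub>N\<^esub> lincomb N id l2"
        using M.minus_equality[OF sum cl2] cR mX M.minus_minus by simp
      also have "inv c \<odot>\<^bsub>N\<^esub> (\<ominus>\<^bsub>N\<^esub> lincomb N id l2) = ?e \<odot>\<^bsub>N\<^esub> lincomb N id l2"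
        using u cl2 by (simp add: smult_l_minus smult_r_minus)
      also have "\<dots> = lincomb N id (map (\<lambda>p. (?e \<otimes> fst p, snd p)) l2)"
        by (rule self_scale[OF s2' e, symmetric])
      finally have "lincomb N id (map (\<lambda>p. (?e \<otimes> fst p, snd p)) l2) = m" by simp
      moreover have "set (map (\<lambda>p. (?e \<otimes> fst p, snd p)) l2) \<subseteq> carrier R \<times> {y \<in> X. lt y m}"
        using s2 e by auto
      ultimately show False using basis_indep[OF mX] by blast
    qed
    then have "lincomb N id l2 = \<zero>\<^bsub>N\<^esub>" "lincomb M h l1 = \<zero>\<^bsub>M\<^esub>"
      using sum cl2 mX M1 h by auto
    moreover have "length l2 < length l"
    proof -
      obtain p where "p \<in> set l" "snd p = m" using m(1) by auto
      then show ?thesis unfolding l2_def by (intro length_filter_less[of p]) auto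
    qed
    ultimately have "lincomb M h l2 = \<zero>\<^bsub>M\<^esub>" using less.hyps s2' by blast
    then show ?thesis
      using lincomb_split[OF M h less.prems(1), where P = "\<lambda>p. snd p = m"] \<open>lincomb M h l1 = \<zero>\<^bsub>M\<^esub>\<close>
      by (simp add: l1_def l2_def)
  qed simp
qed

definition lext :: "('a, 'm, 'z) module_scheme \<Rightarrow> ('b \<Rightarrow> 'm) \<Rightarrow> 'b \<Rightarrow> 'm" where
  "lext M h x = lincomb M h (SOME l. set l \<subseteq> carrier R \<times> X \<and> lincomb N id l = x)"

text \<open>Two lists with the same value differ by a relation, namely one followed by the negative
  of the other, and \<open>lincomb_wd\<close> applies to it.\<close>

lemma lext_eq:
  assumes M: "Module.module R M" and h: "\<And>a. a \<in> X \<Longrightarrow> h a \<in> carrier M" and l: "set l \<subseteq> carrier R \<times> X"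
  shows "lext M h (lincomb N id l) = lincomb M h l"
proof -
  interpret K: Module.module R M by (rule M)
  define l' where "l' = (SOME l'. set l' \<subseteq> carrier R \<times> X \<and> lincomb N id l' = lincomb N id l)"
  have l': "set l' \<subseteq> carrier R \<times> X" "lincomb N id l' = lincomb N id l"
    using someI[of "\<lambda>l'. set l' \<subseteq> carrier R \<times> X \<and> lincomb N id l' = lincomb N id l" l] l
    unfolding l'_def by auto
  let ?m = "map (\<lambda>p. (\<ominus> \<one> \<otimes> fst p, snd p)) l"
  have m: "set ?m \<subseteq> carrier R \<times> X" using l by auto
  have e2: "lincomb M h (l' @ ?m) = lincomb M h l' \<ominus>\<^bsub>M\<^esub> lincomb M h l"
    using lincomb_append[OF M h l'(1) m] lincomb_scale[OF M h l, where c = "\<ominus> \<one>"] lincomb_closed[OF M h l]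
    by (simp add: a_minus_def K.smult_l_minus)
  have cN: "lincomb N id l \<in> carrier N" by (rule self_closed[OF l])
  have "lincomb N id (l' @ ?m) = \<zero>\<^bsub>N\<^esub>"
    using self_append[OF l'(1) m] self_scale[OF l, of "\<ominus> \<one>"] cN l'(2)
    by (simp add: smult_l_minus M.r_neg)
  then have "lincomb M h (l' @ ?m) = \<zero>\<^bsub>M\<^esub>"
    by (intro lincomb_wd[OF M h]) (use l'(1) m in auto)
  then have "lincomb M h l' = lincomb M h l"
    unfolding e2 using lincomb_closed[OF M h l'(1)] lincomb_closed[OF M h l] by (simp add: K.M.minus_zero_iff)
  then show ?thesis unfolding lext_def l'_def[symmetric] .
qed

lemma lext_linear:
  assumes M: "Module.module R M" and h: "\<And>a. a \<in> X \<Longrightarrow> h a \<in> carrier M"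
  shows "linear_map R N M (lext M h)"
  unfolding linear_map_def
proof (intro conjI ballI)
  fix x assume "x \<in> carrier N"
  then obtain l where l: "set l \<subseteq> carrier R \<times> X" "lincomb N id l = x" using basis_span by blast
  show "lext M h x \<in> carrier M" using lext_eq[OF M h l(1)] lincomb_closed[OF M h l(1)] l(2) by simp
  fix y assume "y \<in> carrier N"
  then obtain l' where l': "set l' \<subseteq> carrier R \<times> X" "lincomb N id l' = y" using basis_span by blast
  have u: "set (l @ l') \<subseteq> carrier R \<times> X" using l l' by auto
  have "x \<oplus>\<^bsub>N\<^esub> y = lincomb N id (l @ l')"
    using self_append[OF l(1) l'(1)] l l' by simp
  then show "lext M h (x \<oplus>\<^bsub>N\<^esub> y) = lext M h x \<oplus>\<^bsub>M\<^esub> lext M h y"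
    using lext_eq[OF M h u] lincomb_append[OF M h l(1) l'(1)] lext_eq[OF M h l(1)] lext_eq[OF M h l'(1)]
      l(2) l'(2) by simp
next
  fix c x assume c: "c \<in> carrier R" and "x \<in> carrier N"
  then obtain l where l: "set l \<subseteq> carrier R \<times> X" "lincomb N id l = x" using basis_span by blast
  have u: "set (map (\<lambda>p. (c \<otimes> fst p, snd p)) l) \<subseteq> carrier R \<times> X" using l c by auto
  have "c \<odot>\<^bsub>N\<^esub> x = lincomb N id (map (\<lambda>p. (c \<otimes> fst p, snd p)) l)"
    using self_scale[OF l(1) c] l by simp
  then show "lext M h (c \<odot>\<^bsub>N\<^esub> x) = c \<odot>\<^bsub>M\<^esub> lext M h x"
    using lext_eq[OF M h u] lincomb_scale[OF M h l(1) c] lext_eq[OF M h l(1)] l(2) by simp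
qed

lemma lext_basis:
  assumes M: "Module.module R M" and h: "\<And>a. a \<in> X \<Longrightarrow> h a \<in> carrier M" and a: "a \<in> X"
  shows "lext M h a = h a"
proof -
  interpret K: Module.module R M by (rule M)
  show ?thesis using lext_eq[OF M h, where l = "[(\<one>, a)]"] a h by simp
qed

lemma lext_cong:
  assumes "Module.module R M" "\<And>a. a \<in> X \<Longrightarrow> h a \<in> carrier M" "\<And>a. a \<in> X \<Longrightarrow> h a = g a" "x \<in> carrier N"
  shows "lext M h x = lext M g x"
proof -
  obtain l where l: "set l \<subseteq> carrier R \<times> X" "lincomb N id l = x" using basis_span assms(4) by blast
  have "lincomb M h l = lincomb M g l" by (rule lincomb_cong) (use l assms(3) in auto)
  then show ?thesis
    using lext_eq[OF assms(1,2) l(1)] lext_eq[OF assms(1) _ l(1), of g] assms(2,3) l(2) by simp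
qed

lemma lext_comp_linear:
  assumes "Module.module R M" "Module.module R M'" "linear_map R M M' T"
    "\<And>a. a \<in> X \<Longrightarrow> h a \<in> carrier M" "x \<in> carrier N"
  shows "T (lext M h x) = lext M' (\<lambda>a. T (h a)) x"
proof -
  obtain l where l: "set l \<subseteq> carrier R \<times> X" "lincomb N id l = x" using basis_span assms(5) by blast
  then show ?thesis
    using lext_eq[OF assms(1,4) l(1)] lext_eq[OF assms(2) _ l(1), of "\<lambda>a. T (h a)"]
      lincomb_linear_map[OF assms(1-4) l(1)] linear_mapD(1)[OF assms(3)] assms(4) by simp
qed

lemma lext_of_linear:
  assumes M: "Module.module R M" and T: "linear_map R N M T" and x: "x \<in> carrier N"
  shows "lext M T x = T x"
proof -
  obtain l where l: "set l \<subseteq> carrier R \<times> X" "lincomb N id l = x" using basis_span x by blast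
  then show ?thesis
    using lext_eq[OF M _ l(1), of T] lincomb_linear_map[OF module_self M T _ l(1), where h = id] linear_mapD(1)[OF T] by simp
qed

lemma linear_eq_on_basis:
  assumes M: "Module.module R M" and T: "linear_map R N M T" and U: "linear_map R N M U"
    and "\<And>a. a \<in> X \<Longrightarrow> T a = U a" "x \<in> carrier N"
  shows "T x = U x"
  using lext_of_linear[OF M T assms(5)] lext_of_linear[OF M U assms(5)]
    lext_cong[OF M _ assms(4,5)] linear_mapD(1)[OF T] by simp

lemma lext_add:
  assumes "Module.module R M" "\<And>a. a \<in> X \<Longrightarrow> h a \<in> carrier M" "\<And>a. a \<in> X \<Longrightarrow> g a \<in> carrier M" "x \<in> carrier N"
  shows "lext M (\<lambda>a. h a \<oplus>\<^bsub>M\<^esub> g a) x = lext M h x \<oplus>\<^bsub>M\<^esub> lext M g x"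
proof -
  interpret K: Module.module R M by fact
  obtain l where l: "set l \<subseteq> carrier R \<times> X" "lincomb N id l = x" using basis_span assms(4) by blast
  show ?thesis
    using lext_eq[OF assms(1) _ l(1), of "\<lambda>a. h a \<oplus>\<^bsub>M\<^esub> g a"] lext_eq[OF assms(1,2) l(1)] lext_eq[OF assms(1,3) l(1)]
      lincomb_add[OF assms(1-3) l(1)] l(2) assms(2,3) by simp
qed

end

section \<open>The operators dual to left multiplication on a Poincare-Birkhoff-Witt basis\<close>

text \<open>Functions are zero rather than undefined outside \<open>I\<close>, so that all
  operations are pointwise without restriction.\<close>

lemma module_funI:
  fixes R :: "('a, 'x) ring_scheme" and M :: "('a, 'm, 'y) module_scheme" and F :: "('a, 'i \<Rightarrow> 'm, 'z) module_scheme"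
  assumes M: "Module.module R M"
    and F: "carrier F = {\<phi>. (\<forall>i\<in>I. \<phi> i \<in> carrier M) \<and> (\<forall>i. i \<notin> I \<longrightarrow> \<phi> i = \<zero>\<^bsub>M\<^esub>)}"
      "\<zero>\<^bsub>F\<^esub> = (\<lambda>_. \<zero>\<^bsub>M\<^esub>)" "add F = (\<lambda>\<phi> \<psi> i. \<phi> i \<oplus>\<^bsub>M\<^esub> \<psi> i)" "smult F = (\<lambda>c \<phi> i. c \<odot>\<^bsub>M\<^esub> \<phi> i)"
  shows "Module.module R F"
proof -
  interpret M: Module.module R M by (rule M)
  have c: "\<phi> i \<in> carrier M" if "\<phi> \<in> carrier F" for \<phi> i
    using that by (cases "i \<in> I") (auto simp: F)
  have "abelian_group F"
  proof (rule abelian_groupI)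
    fix \<phi> assume p: "\<phi> \<in> carrier F"
    show "\<exists>\<psi>\<in>carrier F. \<psi> \<oplus>\<^bsub>F\<^esub> \<phi> = \<zero>\<^bsub>F\<^esub>"
    proof (rule bexI[of _ "\<lambda>i. \<ominus>\<^bsub>M\<^esub> \<phi> i"])
      show "(\<lambda>i. \<ominus>\<^bsub>M\<^esub> \<phi> i) \<oplus>\<^bsub>F\<^esub> \<phi> = \<zero>\<^bsub>F\<^esub>" using c[OF p] by (simp add: F M.M.l_neg)
      show "(\<lambda>i. \<ominus>\<^bsub>M\<^esub> \<phi> i) \<in> carrier F" using p by (auto simp: F M.M.a_inv_zero)
    qed
  next
    fix x y z assume "x \<in> carrier F" "y \<in> carrier F" "z \<in> carrier F"
    then show "(x \<oplus>\<^bsub>F\<^esub> y) \<oplus>\<^bsub>F\<^esub> z = x \<oplus>\<^bsub>F\<^esub> (y \<oplus>\<^bsub>F\<^esub> z)"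
      using c by (simp add: F(3) M.M.a_assoc)
  next
    fix x y assume "x \<in> carrier F" "y \<in> carrier F"
    then show "x \<oplus>\<^bsub>F\<^esub> y = y \<oplus>\<^bsub>F\<^esub> x"
      using c by (simp add: F(3) M.M.a_comm)
  next
    fix x assume "x \<in> carrier F"
    then show "\<zero>\<^bsub>F\<^esub> \<oplus>\<^bsub>F\<^esub> x = x"
      using c by (simp add: F(2,3))
  qed (auto simp: F)
  then show ?thesis
  proof (rule moduleI[OF M.R.is_cring])
    fix a x assume "a \<in> carrier R" "x \<in> carrier F"
    then show "a \<odot>\<^bsub>F\<^esub> x \<in> carrier F" by (auto simp: F)
  next
    fix a b x assume "a \<in> carrier R" "b \<in> carrier R" "x \<in> carrier F"
    then show "(a \<oplus>\<^bsub>R\<^esub> b) \<odot>\<^bsub>F\<^esub> x = a \<odot>\<^bsub>F\<^esub> x \<oplus>\<^bsub>F\<^esub> b \<odot>\<^bsub>F\<^esub> x"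
      and "(a \<otimes>\<^bsub>R\<^esub> b) \<odot>\<^bsub>F\<^esub> x = a \<odot>\<^bsub>F\<^esub> (b \<odot>\<^bsub>F\<^esub> x)"
      using c by (simp_all add: F(3,4) M.smult_l_distr M.smult_assoc1)
  next
    fix a x y assume "a \<in> carrier R" "x \<in> carrier F" "y \<in> carrier F"
    then show "a \<odot>\<^bsub>F\<^esub> (x \<oplus>\<^bsub>F\<^esub> y) = a \<odot>\<^bsub>F\<^esub> x \<oplus>\<^bsub>F\<^esub> a \<odot>\<^bsub>F\<^esub> y"
      using c by (simp add: F(3,4) M.smult_r_distr)
  next
    fix x assume "x \<in> carrier F"
    then show "\<one>\<^bsub>R\<^esub> \<odot>\<^bsub>F\<^esub> x = x" using c by (simp add: F(4))
  qed
qed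

locale pbw = lie_algebra R L + ordered_basis R L X lt + K: Module.module R M
  for R :: "('a, 'x) ring_scheme" (structure) and L :: "('a, 'b, 'y) lie_algebra_scheme" (structure)
    and X :: "'b set" and lt :: "'b \<Rightarrow> 'b \<Rightarrow> bool" and M :: "('a, 'm, 'z) module_scheme" (structure)
begin

text \<open>Stands for the linear maps from the enveloping algebra to \<open>M\<close>. By
  Poincare-Birkhoff-Witt such a map is an arbitrary function on normally ordered monomials, which
  are multisets of basis elements; infinite support is allowed.\<close>

definition fm :: "('a, 'b multiset \<Rightarrow> 'm) module" where
  "fm = \<lparr>carrier = {\<phi>. (\<forall>\<mu>\<in>{\<mu>. set_mset \<mu> \<subseteq> X}. \<phi> \<mu> \<in> carrier M) \<and> (\<forall>\<mu>. \<mu> \<notin> {\<mu>. set_mset \<mu> \<subseteq> X} \<longrightarrow> \<phi> \<mu> = \<zero>\<^bsub>M\<^esub>)},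
     monoid.mult = undefined, one = undefined, zero = (\<lambda>_. \<zero>\<^bsub>M\<^esub>), add = (\<lambda>\<phi> \<psi> \<mu>. \<phi> \<mu> \<oplus>\<^bsub>M\<^esub> \<psi> \<mu>),
     smult = (\<lambda>c \<phi> \<mu>. c \<odot>\<^bsub>M\<^esub> \<phi> \<mu>)\<rparr>"

lemma K_module: "Module.module R M" ..

lemma fm_module: "Module.module R fm"
  by (rule module_funI[OF K_module, where I = "{\<mu>. set_mset \<mu> \<subseteq> X}"]) (simp_all add: fm_def)

sublocale F: Module.module R fm by (rule fm_module)

abbreviation "MS \<equiv> {\<mu>. set_mset \<mu> \<subseteq> X}"

lemma fm_simps: "\<zero>\<^bsub>fm\<^esub> = (\<lambda>_. \<zero>\<^bsub>M\<^esub>)" "\<phi> \<oplus>\<^bsub>fm\<^esub> \<psi> = (\<lambda>\<mu>. \<phi> \<mu> \<oplus>\<^bsub>M\<^esub> \<psi> \<mu>)"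
  "c \<odot>\<^bsub>fm\<^esub> \<phi> = (\<lambda>\<mu>. c \<odot>\<^bsub>M\<^esub> \<phi> \<mu>)"
  by (simp_all add: fm_def)

lemma fm_val [simp]: "\<phi> \<in> carrier fm \<Longrightarrow> \<phi> \<mu> \<in> carrier M"
  unfolding fm_def by (cases "set_mset \<mu> \<subseteq> X") simp_all

lemma fm_out: "\<phi> \<in> carrier fm \<Longrightarrow> \<not> set_mset \<mu> \<subseteq> X \<Longrightarrow> \<phi> \<mu> = \<zero>\<^bsub>M\<^esub>"
  unfolding fm_def by simp

lemma fmI: "\<lbrakk>\<And>\<mu>. set_mset \<mu> \<subseteq> X \<Longrightarrow> \<phi> \<mu> \<in> carrier M; \<And>\<mu>. \<not> set_mset \<mu> \<subseteq> X \<Longrightarrow> \<phi> \<mu> = \<zero>\<^bsub>M\<^esub>\<rbrakk> \<Longrightarrow> \<phi> \<in> carrier fm"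
  unfolding fm_def by simp

lemma fm_eqI: "\<lbrakk>\<phi> \<in> carrier fm; \<psi> \<in> carrier fm; \<And>\<mu>. set_mset \<mu> \<subseteq> X \<Longrightarrow> \<phi> \<mu> = \<psi> \<mu>\<rbrakk> \<Longrightarrow> \<phi> = \<psi>"
proof (rule ext)
  fix \<mu> assume a: "\<phi> \<in> carrier fm" "\<psi> \<in> carrier fm" "\<And>\<mu>. set_mset \<mu> \<subseteq> X \<Longrightarrow> \<phi> \<mu> = \<psi> \<mu>"
  show "\<phi> \<mu> = \<psi> \<mu>"
  proof (cases "set_mset \<mu> \<subseteq> X")
    case False
    then show ?thesis using fm_out[OF a(1)] fm_out[OF a(2)] by simp
  qed (rule a(3))
qed

lemma fm_eval: "linear_map R fm M (\<lambda>\<phi>. \<phi> \<mu>)"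
  unfolding linear_map_def by (simp add: fm_simps)

lemma fm_minus: "\<lbrakk>\<phi> \<in> carrier fm; \<psi> \<in> carrier fm\<rbrakk> \<Longrightarrow> (\<phi> \<ominus>\<^bsub>fm\<^esub> \<psi>) \<mu> = \<phi> \<mu> \<ominus>\<^bsub>M\<^esub> \<psi> \<mu>"
  by (rule linear_map_minus[OF fm_module K_module fm_eval])

text \<open>\<open>below i \<mu>\<close> says that \<open>i \<mu>\<close> is a normally ordered monomial, and \<open>least \<mu>\<close> is the first letter of \<open>\<mu>\<close>.\<close>

definition below :: "'b \<Rightarrow> 'b multiset \<Rightarrow> bool" where
  "below i \<mu> \<longleftrightarrow> (\<forall>a\<in>#\<mu>. \<not> lt a i)"

definition least :: "'b multiset \<Rightarrow> 'b" where
  "least \<mu> = (SOME m. m \<in># \<mu> \<and> below m \<mu>)"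

lemma least:
  assumes "\<mu> \<noteq> {#}" shows "least \<mu> \<in># \<mu>" "below (least \<mu>) \<mu>"
proof -
  have "\<exists>m. m \<in># \<mu> \<and> below m \<mu>"
    using ex_lt_min[of "set_mset \<mu>"] assms unfolding below_def by auto
  from someI_ex[OF this] show "least \<mu> \<in># \<mu>" "below (least \<mu>) \<mu>"
    unfolding least_def by auto
qed

lemma below_add [simp]: "below i (add_mset a \<mu>) \<longleftrightarrow> \<not> lt a i \<and> below i \<mu>"
  by (auto simp: below_def)

lemma below_empty [simp]: "below i {#}"
  by (simp add: below_def)

lemma below_le: "\<lbrakk>lt i j; below j \<mu>\<rbrakk> \<Longrightarrow> below i \<mu>"
  unfolding below_def using lt_trans by blast

lemma least_add:
  assumes "below m \<mu>" shows "least (add_mset m \<mu>) = m"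
proof (rule ccontr)
  let ?l = "least (add_mset m \<mu>)"
  assume ne: "?l \<noteq> m"
  have "?l \<in># add_mset m \<mu>" "below ?l (add_mset m \<mu>)" using least[of "add_mset m \<mu>"] by auto
  then have "\<not> lt ?l m" "\<not> lt m ?l" using assms ne by (auto simp: below_def)
  then show False using lt_total[OF ne] by blast
qed

lemma least_split:
  assumes "\<mu> \<noteq> {#}"
  obtains m \<nu> where "\<mu> = add_mset m \<nu>" "below m \<nu>" "least \<mu> = m"
proof -
  have "\<mu> = add_mset (least \<mu>) (\<mu> - {#least \<mu>#})" using least(1)[OF assms] by simp
  moreover from this have "below (least \<mu>) (\<mu> - {#least \<mu>#})" using least(2)[OF assms] by (metis below_add)
  ultimately show ?thesis using that by blast
qed

text \<open>\<open>pb n i \<phi> \<mu>\<close> is \<open>\<phi>(x\<^sub>i z\<^sub>\<mu>)\<close> for \<open>size \<mu> \<le> n\<close>, where \<open>z\<^sub>\<mu>\<close> is the normally ordered monomial. For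
  \<open>m = least \<mu> < i\<close> and \<open>z\<^sub>\<mu> = x\<^sub>m z\<^sub>\<nu>\<close> it comes from \<open>x\<^sub>i x\<^sub>m z\<^sub>\<nu> = x\<^sub>m x\<^sub>i z\<^sub>\<nu> + [x\<^sub>i, x\<^sub>m] z\<^sub>\<nu>\<close>,
  where the leading term of \<open>x\<^sub>i z\<^sub>\<nu>\<close> is split off to make the recursion well-founded.\<close>

primrec pb :: "nat \<Rightarrow> 'b \<Rightarrow> ('b multiset \<Rightarrow> 'm) \<Rightarrow> 'b multiset \<Rightarrow> 'm" where
  "pb 0 i \<phi> \<mu> = \<phi> (add_mset i \<mu>)"
| "pb (Suc n) i \<phi> \<mu> = (if below i \<mu> then \<phi> (add_mset i \<mu>) else
     \<phi> (add_mset i \<mu>) \<oplus>\<^bsub>M\<^esub>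
       ((pb n i (pb n (least \<mu>) \<phi>) (\<mu> - {#least \<mu>#}) \<ominus>\<^bsub>M\<^esub> pb n (least \<mu>) \<phi> (add_mset i (\<mu> - {#least \<mu>#})))
        \<oplus>\<^bsub>M\<^esub> lext M (\<lambda>l. pb n l \<phi> (\<mu> - {#least \<mu>#})) (bracket L i (least \<mu>))))"

definition valued :: "('b multiset \<Rightarrow> 'm) \<Rightarrow> bool" where
  "valued \<phi> \<longleftrightarrow> (\<forall>\<mu>. set_mset \<mu> \<subseteq> X \<longrightarrow> \<phi> \<mu> \<in> carrier M)"

lemma lext_in: "\<lbrakk>\<And>l. l \<in> X \<Longrightarrow> h l \<in> carrier M; x \<in> carrier L\<rbrakk> \<Longrightarrow> lext M h x \<in> carrier M"
  using linear_mapD(1)[OF lext_linear[OF K_module]] by blast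

lemma least_cases:
  assumes "\<not> below i \<mu>" "set_mset \<mu> \<subseteq> X"
  obtains m \<nu> where "\<mu> = add_mset m \<nu>" "below m \<nu>" "least \<mu> = m" "\<mu> - {#least \<mu>#} = \<nu>" "m \<in> X"
    "set_mset \<nu> \<subseteq> X" "lt m i"
proof -
  from assms(1) have "\<mu> \<noteq> {#}" by (auto simp: below_def)
  then obtain m \<nu> where *: "\<mu> = add_mset m \<nu>" "below m \<nu>" "least \<mu> = m" by (rule least_split)
  have "lt m i"
  proof (rule ccontr)
    assume "\<not> lt m i"
    then have "m = i \<or> lt i m" using lt_total by blast
    then have "below i \<nu>" using *(2) below_le by blast
    with \<open>\<not> lt m i\<close> show False using assms(1) *(1) by simp
  qed
  then show ?thesis using that[of m \<nu>] * assms(2) by auto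
qed

lemma pb_closed: "\<lbrakk>i \<in> X; valued \<phi>; set_mset \<mu> \<subseteq> X\<rbrakk> \<Longrightarrow> pb n i \<phi> \<mu> \<in> carrier M"
proof (induction n arbitrary: i \<phi> \<mu>)
  case (Suc n)
  show ?case
  proof (cases "below i \<mu>")
    case True then show ?thesis using Suc.prems by (simp add: valued_def)
  next
    case False
    then obtain m \<nu> where *: "\<mu> = add_mset m \<nu>" "least \<mu> = m" "\<mu> - {#least \<mu>#} = \<nu>" "m \<in> X" "set_mset \<nu> \<subseteq> X"
      using Suc.prems(3) by (rule least_cases)
    have v: "valued (pb n m \<phi>)" using Suc.IH[OF *(4) Suc.prems(2)] by (simp add: valued_def)
    have "lext M (\<lambda>l. pb n l \<phi> \<nu>) (bracket L i m) \<in> carrier M"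
      by (rule lext_in) (use Suc.IH[OF _ Suc.prems(2) *(5)] * Suc.prems bracket_closed in auto)
    moreover have "pb n i (pb n m \<phi>) \<nu> \<in> carrier M" by (rule Suc.IH[OF Suc.prems(1) v *(5)])
    moreover have "pb n m \<phi> (add_mset i \<nu>) \<in> carrier M" "\<phi> (add_mset i \<mu>) \<in> carrier M"
      using v * Suc.prems unfolding valued_def by auto
    ultimately show ?thesis using False *(2,3) by simp
  qed
qed (simp add: valued_def)

lemma valued_pb: "\<lbrakk>i \<in> X; valued \<phi>\<rbrakk> \<Longrightarrow> valued (pb n i \<phi>)"
  using pb_closed by (simp add: valued_def)

text \<open>Dual form of \<open>x_i z_\<mu> = z_(i \<mu>) + shorter terms\<close>: after removal of
  the leading term, what remains sees \<open>\<phi>\<close> on monomials of size at most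
  \<open>size \<mu>\<close> alone. This is why the recursion has to subtract the leading term before
  it descends to \<open>\<nu>\<close>.\<close>

lemma pb_local:
  assumes "i \<in> X" "valued \<phi>" "valued \<psi>" "set_mset \<mu> \<subseteq> X"
    "\<And>\<nu>. \<lbrakk>set_mset \<nu> \<subseteq> X; size \<nu> \<le> size \<mu>\<rbrakk> \<Longrightarrow> \<phi> \<nu> = \<psi> \<nu>"
  shows "pb n i \<phi> \<mu> \<ominus>\<^bsub>M\<^esub> \<phi> (add_mset i \<mu>) = pb n i \<psi> \<mu> \<ominus>\<^bsub>M\<^esub> \<psi> (add_mset i \<mu>)"
  using assms
proof (induction n arbitrary: i \<phi> \<psi> \<mu>)
  case 0
  then show ?case by (simp add: valued_def K.M.minus_self)
next
  case (Suc n)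
  note cl = Suc.prems(2,3)[unfolded valued_def, rule_format]
  show ?case
  proof (cases "below i \<mu>")
    case True then show ?thesis using Suc.prems cl by (simp add: K.M.minus_self)
  next
    case False
    then obtain m \<nu> where *: "\<mu> = add_mset m \<nu>" "below m \<nu>" "least \<mu> = m" "\<mu> - {#least \<mu>#} = \<nu>" "m \<in> X"
      "set_mset \<nu> \<subseteq> X"
      using Suc.prems(4) by (rule least_cases)
    have agree: "pb n l \<phi> \<rho> = pb n l \<psi> \<rho>" if "l \<in> X" "set_mset \<rho> \<subseteq> X" "size \<rho> \<le> size \<nu>" for l \<rho>
    proof -
      have e: "\<phi> (add_mset l \<rho>) = \<psi> (add_mset l \<rho>)"
        by (rule Suc.prems(5)) (use that * in auto)
      have "pb n l \<phi> \<rho> \<ominus>\<^bsub>M\<^esub> \<phi> (add_mset l \<rho>) = pb n l \<psi> \<rho> \<ominus>\<^bsub>M\<^esub> \<psi> (add_mset l \<rho>)"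
        by (rule Suc.IH[OF that(1) Suc.prems(2,3) that(2)], rule Suc.prems(5)) (use that * in auto)
      moreover have "pb n l \<phi> \<rho> \<in> carrier M" "pb n l \<psi> \<rho> \<in> carrier M" "\<psi> (add_mset l \<rho>) \<in> carrier M"
        using pb_closed Suc.prems that cl by auto
      ultimately show ?thesis unfolding e by (simp add: a_minus_def)
    qed
    have v: "valued (pb n m \<phi>)" "valued (pb n m \<psi>)" using valued_pb * Suc.prems by auto
    have 1: "pb n i (pb n m \<phi>) \<nu> \<ominus>\<^bsub>M\<^esub> pb n m \<phi> (add_mset i \<nu>) = pb n i (pb n m \<psi>) \<nu> \<ominus>\<^bsub>M\<^esub> pb n m \<psi> (add_mset i \<nu>)"
      by (rule Suc.IH[OF Suc.prems(1) v *(6)], rule agree) (use * in auto)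
    have 2: "lext M (\<lambda>l. pb n l \<phi> \<nu>) (bracket L i m) = lext M (\<lambda>l. pb n l \<psi> \<nu>) (bracket L i m)"
      by (rule lext_cong[OF K_module]) (use agree pb_closed[OF _ Suc.prems(2)] pb_closed[OF _ Suc.prems(3)] * Suc.prems bracket_closed in auto)
    let ?A = "(pb n i (pb n m \<psi>) \<nu> \<ominus>\<^bsub>M\<^esub> pb n m \<psi> (add_mset i \<nu>)) \<oplus>\<^bsub>M\<^esub> lext M (\<lambda>l. pb n l \<psi> \<nu>) (bracket L i m)"
    have A: "?A \<in> carrier M"
      using pb_closed[OF _ v(2)] pb_closed[OF _ Suc.prems(3)] * Suc.prems bracket_closed
      by (auto intro!: K.M.a_closed K.M.minus_closed lext_in)
    have "pb (Suc n) i \<phi> \<mu> = \<phi> (add_mset i \<mu>) \<oplus>\<^bsub>M\<^esub> ?A" "pb (Suc n) i \<psi> \<mu> = \<psi> (add_mset i \<mu>) \<oplus>\<^bsub>M\<^esub> ?A"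
      using False *(3,4) 1 2 by simp_all
    moreover have "\<phi> (add_mset i \<mu>) \<in> carrier M" "\<psi> (add_mset i \<mu>) \<in> carrier M" using cl Suc.prems by auto
    ultimately show ?thesis using A by (simp add: K.M.a_comm[of _ ?A] K.M.add_minus_cancel)
  qed
qed

lemma pb_cong:
  assumes "i \<in> X" "valued \<phi>" "valued \<psi>" "set_mset \<mu> \<subseteq> X"
    "\<And>\<nu>. \<lbrakk>set_mset \<nu> \<subseteq> X; size \<nu> \<le> size \<mu>\<rbrakk> \<Longrightarrow> \<phi> \<nu> = \<psi> \<nu>" "\<phi> (add_mset i \<mu>) = \<psi> (add_mset i \<mu>)"
  shows "pb n i \<phi> \<mu> = pb n i \<psi> \<mu>"
  using pb_local[OF assms(1-5), of n] assms(6) pb_closed[OF assms(1,2,4)] pb_closed[OF assms(1,3,4)]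
    assms(1,3,4) by (simp add: a_minus_def valued_def)

text \<open>The index \<open>n\<close> is a recursion bound, and every bound from
  \<open>size \<mu>\<close> on is sufficient. The differences in the recursion are compared with
  \<open>pb_local\<close>, since their leading terms are too large for the induction
  hypothesis.\<close>

lemma pb_stable:
  "\<lbrakk>i \<in> X; valued \<phi>; set_mset \<mu> \<subseteq> X; size \<mu> \<le> n; size \<mu> \<le> n'\<rbrakk> \<Longrightarrow> pb n i \<phi> \<mu> = pb n' i \<phi> \<mu>"
proof (induction n arbitrary: n' i \<phi> \<mu>)
  case 0
  then show ?case by (cases n') auto
next
  case (Suc n)
  show ?case
  proof (cases "below i \<mu>")
    case True then show ?thesis by (cases n') auto
  next
    case False
    then obtain m \<nu> where *: "\<mu> = add_mset m \<nu>" "below m \<nu>" "least \<mu> = m" "\<mu> - {#least \<mu>#} = \<nu>" "m \<in> X"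
      "set_mset \<nu> \<subseteq> X"
      using Suc.prems(3) by (rule least_cases)
    obtain n1 where n1: "n' = Suc n1" using Suc.prems(5) * by (cases n') auto
    have sz: "size \<nu> \<le> n" "size \<nu> \<le> n1" using Suc.prems(4,5) *(1) n1 by auto
    have v: "valued (pb n m \<phi>)" "valued (pb n1 m \<phi>)" using valued_pb * Suc.prems by auto
    have "pb n i (pb n m \<phi>) \<nu> \<ominus>\<^bsub>M\<^esub> pb n m \<phi> (add_mset i \<nu>) = pb n i (pb n1 m \<phi>) \<nu> \<ominus>\<^bsub>M\<^esub> pb n1 m \<phi> (add_mset i \<nu>)"
      by (rule pb_local[OF Suc.prems(1) v *(6)], rule Suc.IH[OF *(5) Suc.prems(2)]) (use sz in auto)
    moreover have "pb n i (pb n1 m \<phi>) \<nu> = pb n1 i (pb n1 m \<phi>) \<nu>"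
      by (rule Suc.IH[OF Suc.prems(1) v(2) *(6) sz])
    moreover have "lext M (\<lambda>l. pb n l \<phi> \<nu>) (bracket L i m) = lext M (\<lambda>l. pb n1 l \<phi> \<nu>) (bracket L i m)"
      by (rule lext_cong[OF K_module])
        (use Suc.IH[OF _ Suc.prems(2) *(6) sz] pb_closed[OF _ Suc.prems(2) *(6)] * Suc.prems bracket_closed in auto)
    ultimately show ?thesis using False *(3,4) n1 by simp
  qed
qed

definition Rb :: "'b \<Rightarrow> ('b multiset \<Rightarrow> 'm) \<Rightarrow> 'b multiset \<Rightarrow> 'm" where
  "Rb i \<phi> \<mu> = (if set_mset \<mu> \<subseteq> X then pb (size \<mu>) i \<phi> \<mu> else \<zero>\<^bsub>M\<^esub>)"

lemma fm_valued: "\<phi> \<in> carrier fm \<Longrightarrow> valued \<phi>"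
  by (simp add: valued_def)

lemma Rb_closed: "\<lbrakk>i \<in> X; \<phi> \<in> carrier fm\<rbrakk> \<Longrightarrow> Rb i \<phi> \<in> carrier fm"
  by (rule fmI) (auto simp: Rb_def pb_closed fm_valued)

lemma Rb_below: "\<lbrakk>below i \<mu>; set_mset \<mu> \<subseteq> X\<rbrakk> \<Longrightarrow> Rb i \<phi> \<mu> = \<phi> (add_mset i \<mu>)"
  unfolding Rb_def by (cases "size \<mu>") auto

lemma Rb_cong:
  assumes "i \<in> X" "\<phi> \<in> carrier fm" "\<psi> \<in> carrier fm"
    "\<And>\<nu>. \<lbrakk>set_mset \<nu> \<subseteq> X; size \<nu> \<le> size \<mu>\<rbrakk> \<Longrightarrow> \<phi> \<nu> = \<psi> \<nu>" "\<phi> (add_mset i \<mu>) = \<psi> (add_mset i \<mu>)"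
  shows "Rb i \<phi> \<mu> = Rb i \<psi> \<mu>"
  unfolding Rb_def using pb_cong[OF assms(1) fm_valued[OF assms(2)] fm_valued[OF assms(3)] _ assms(4,5)] by simp

text \<open>Puts the leading term back: as \<open>m\<close> precedes \<open>i\<close> and the
  letters of \<open>\<nu>\<close>, the term subtracted in the recursion equals
  \<open>\<phi> (add_mset i (add_mset m \<nu>))\<close>, which is the term added there.\<close>

lemma Rb_rec:
  assumes i: "i \<in> X" and m: "m \<in> X" and \<phi>: "\<phi> \<in> carrier fm" and \<nu>: "set_mset \<nu> \<subseteq> X" and b: "below m \<nu>" and l: "lt m i"
  shows "Rb i \<phi> (add_mset m \<nu>) = Rb i (Rb m \<phi>) \<nu> \<oplus>\<^bsub>M\<^esub> lext M (\<lambda>l. Rb l \<phi> \<nu>) (bracket L i m)"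
proof -
  let ?n = "size \<nu>" let ?\<mu> = "add_mset m \<nu>"
  have lm: "least ?\<mu> = m" by (rule least_add[OF b])
  have nb: "\<not> below i ?\<mu>" using l by simp
  note v = fm_valued[OF \<phi>]
  have v1: "valued (pb ?n m \<phi>)" by (rule valued_pb[OF m v])
  have v2: "valued (Rb m \<phi>)" by (rule fm_valued[OF Rb_closed[OF m \<phi>]])
  have 1: "pb ?n i (pb ?n m \<phi>) \<nu> \<ominus>\<^bsub>M\<^esub> pb ?n m \<phi> (add_mset i \<nu>) = pb ?n i (Rb m \<phi>) \<nu> \<ominus>\<^bsub>M\<^esub> Rb m \<phi> (add_mset i \<nu>)"
    by (rule pb_local[OF i v1 v2 \<nu>]) (auto simp: Rb_def intro!: pb_stable m v)
  have "below m (add_mset i \<nu>)" using b l lt_asym by simp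
  then have 2: "Rb m \<phi> (add_mset i \<nu>) = \<phi> (add_mset i ?\<mu>)"
    using Rb_below[of m "add_mset i \<nu>" \<phi>] \<nu> i by (simp add: add_mset_commute)
  have 3: "lext M (\<lambda>l. pb ?n l \<phi> \<nu>) (bracket L i m) = lext M (\<lambda>l. Rb l \<phi> \<nu>) (bracket L i m)"
    by (rule lext_cong[OF K_module]) (use \<nu> i m v bracket_closed in \<open>auto simp: Rb_def pb_closed\<close>)
  have c: "pb ?n i (Rb m \<phi>) \<nu> \<in> carrier M" "\<phi> (add_mset i ?\<mu>) \<in> carrier M"
    "lext M (\<lambda>l. Rb l \<phi> \<nu>) (bracket L i m) \<in> carrier M"
    using pb_closed[OF i v2 \<nu>] \<phi> Rb_closed i m bracket_closed by (auto intro!: lext_in)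
  have id: "p \<oplus>\<^bsub>M\<^esub> ((q \<ominus>\<^bsub>M\<^esub> p) \<oplus>\<^bsub>M\<^esub> s) = q \<oplus>\<^bsub>M\<^esub> s"
    if "p \<in> carrier M" "q \<in> carrier M" "s \<in> carrier M" for p q s
    using that by algebra
  have "Rb i \<phi> ?\<mu> = \<phi> (add_mset i ?\<mu>) \<oplus>\<^bsub>M\<^esub>
      ((pb ?n i (Rb m \<phi>) \<nu> \<ominus>\<^bsub>M\<^esub> \<phi> (add_mset i ?\<mu>)) \<oplus>\<^bsub>M\<^esub> lext M (\<lambda>l. Rb l \<phi> \<nu>) (bracket L i m))"
    using nb \<nu> m l 1 2 3 lm by (simp add: Rb_def[of i \<phi>])
  also have "\<dots> = pb ?n i (Rb m \<phi>) \<nu> \<oplus>\<^bsub>M\<^esub> lext M (\<lambda>l. Rb l \<phi> \<nu>) (bracket L i m)"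
    using id c by simp
  finally show ?thesis using \<nu> by (simp add: Rb_def[of i "Rb m \<phi>"])
qed

end

lemma linear_map_sum:
  assumes "Module.module R M" "Module.module R N" "linear_map R M N T" "linear_map R M N U"
  shows "linear_map R M N (\<lambda>x. T x \<oplus>\<^bsub>N\<^esub> U x)"
proof -
  interpret N: Module.module R N by fact
  show ?thesis
    using linear_mapD[OF assms(3)] linear_mapD[OF assms(4)]
    by (simp add: linear_map_def N.smult_r_distr N.M.a_ac)
qed

lemma linear_map_diff:
  assumes "Module.module R M" "Module.module R N" "linear_map R M N T" "linear_map R M N U"
  shows "linear_map R M N (\<lambda>x. T x \<ominus>\<^bsub>N\<^esub> U x)"
proof -
  interpret N: Module.module R N by fact
  show ?thesis
    using linear_mapD[OF assms(3)] linear_mapD[OF assms(4)]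
    by (simp add: linear_map_def N.smult_r_distr N.M.add_minus_add a_minus_def N.smult_r_minus N.M.minus_add N.M.a_ac)
qed

lemma linear_map_scale:
  assumes "Module.module R M" "c \<in> carrier R"
  shows "linear_map R M M (\<lambda>x. c \<odot>\<^bsub>M\<^esub> x)"
proof -
  interpret M: Module.module R M by fact
  have "c \<odot>\<^bsub>M\<^esub> (e \<odot>\<^bsub>M\<^esub> x) = e \<odot>\<^bsub>M\<^esub> (c \<odot>\<^bsub>M\<^esub> x)" if "e \<in> carrier R" "x \<in> carrier M" for e x
    using M.smult_assoc1[OF that(1) assms(2) that(2)] M.smult_assoc1[OF assms(2) that]
      M.R.m_comm[OF that(1) assms(2)] by simp
  then show ?thesis using assms(2) by (simp add: linear_map_def M.smult_r_distr)
qed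

section \<open>Linearity of the dual operators and their commutation rule\<close>

context pbw begin

lemma Rb_lincomb:
  "\<lbrakk>i \<in> X; c \<in> carrier R; \<phi> \<in> carrier fm; \<psi> \<in> carrier fm; set_mset \<mu> \<subseteq> X\<rbrakk> \<Longrightarrow>
    Rb i (c \<odot>\<^bsub>fm\<^esub> \<phi> \<oplus>\<^bsub>fm\<^esub> \<psi>) \<mu> = c \<odot>\<^bsub>M\<^esub> Rb i \<phi> \<mu> \<oplus>\<^bsub>M\<^esub> Rb i \<psi> \<mu>"
proof (induction "size \<mu>" arbitrary: i \<phi> \<psi> \<mu> rule: less_induct)
  case less
  note i = less.prems(1) and c = less.prems(2) and \<phi> = less.prems(3) and \<psi> = less.prems(4)
  let ?s = "c \<odot>\<^bsub>fm\<^esub> \<phi> \<oplus>\<^bsub>fm\<^esub> \<psi>"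
  have s: "?s \<in> carrier fm" using c \<phi> \<psi> by simp
  show ?case
  proof (cases "below i \<mu>")
    case True then show ?thesis using less.prems by (simp add: Rb_below fm_simps)
  next
    case False
    then obtain m \<nu> where *: "\<mu> = add_mset m \<nu>" "below m \<nu>" "m \<in> X" "set_mset \<nu> \<subseteq> X" "lt m i"
      using less.prems(5) by (rule least_cases)
    have sz: "size \<nu> < size \<mu>" using * by simp
    have R: "Rb m \<phi> \<in> carrier fm" "Rb m \<psi> \<in> carrier fm" "Rb m ?s \<in> carrier fm"
      using Rb_closed * \<phi> \<psi> s by auto
    have IH: "Rb l ?s \<rho> = c \<odot>\<^bsub>M\<^esub> Rb l \<phi> \<rho> \<oplus>\<^bsub>M\<^esub> Rb l \<psi> \<rho>" if "l \<in> X" "set_mset \<rho> \<subseteq> X" "size \<rho> \<le> size \<nu>" for l \<rho>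
      by (rule less.hyps) (use that sz c \<phi> \<psi> in auto)
    have b: "below m (add_mset i \<nu>)" using * lt_asym by simp
    have "Rb i (Rb m ?s) \<nu> = Rb i (c \<odot>\<^bsub>fm\<^esub> Rb m \<phi> \<oplus>\<^bsub>fm\<^esub> Rb m \<psi>) \<nu>"
    proof (rule Rb_cong[OF i R(3)])
      show "Rb m ?s \<rho> = (c \<odot>\<^bsub>fm\<^esub> Rb m \<phi> \<oplus>\<^bsub>fm\<^esub> Rb m \<psi>) \<rho>" if "set_mset \<rho> \<subseteq> X" "size \<rho> \<le> size \<nu>" for \<rho>
        using IH[OF *(3) that] by (simp add: fm_simps)
      show "Rb m ?s (add_mset i \<nu>) = (c \<odot>\<^bsub>fm\<^esub> Rb m \<phi> \<oplus>\<^bsub>fm\<^esub> Rb m \<psi>) (add_mset i \<nu>)"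
        using * i Rb_below[OF b] by (simp add: fm_simps)
    qed (use c R in auto)
    also have "\<dots> = c \<odot>\<^bsub>M\<^esub> Rb i (Rb m \<phi>) \<nu> \<oplus>\<^bsub>M\<^esub> Rb i (Rb m \<psi>) \<nu>"
      by (rule less.hyps[OF sz i c R(1,2) *(4)])
    finally have 1: "Rb i (Rb m ?s) \<nu> = c \<odot>\<^bsub>M\<^esub> Rb i (Rb m \<phi>) \<nu> \<oplus>\<^bsub>M\<^esub> Rb i (Rb m \<psi>) \<nu>" .
    have br: "bracket L i m \<in> carrier L" using i * bracket_closed by auto
    have v: "Rb l \<phi> \<nu> \<in> carrier M" "Rb l \<psi> \<nu> \<in> carrier M" if "l \<in> X" for l
      using Rb_closed[OF that] \<phi> \<psi> by auto
    have "lext M (\<lambda>l. Rb l ?s \<nu>) (bracket L i m) = lext M (\<lambda>l. c \<odot>\<^bsub>M\<^esub> Rb l \<phi> \<nu> \<oplus>\<^bsub>M\<^esub> Rb l \<psi> \<nu>) (bracket L i m)"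
      by (rule lext_cong[OF K_module]) (use IH * br v c s Rb_closed in auto)
    also have "\<dots> = lext M (\<lambda>l. c \<odot>\<^bsub>M\<^esub> Rb l \<phi> \<nu>) (bracket L i m) \<oplus>\<^bsub>M\<^esub> lext M (\<lambda>l. Rb l \<psi> \<nu>) (bracket L i m)"
      by (rule lext_add[OF K_module]) (use v c br in auto)
    also have "lext M (\<lambda>l. c \<odot>\<^bsub>M\<^esub> Rb l \<phi> \<nu>) (bracket L i m) = c \<odot>\<^bsub>M\<^esub> lext M (\<lambda>l. Rb l \<phi> \<nu>) (bracket L i m)"
      by (rule lext_comp_linear[OF K_module K_module linear_map_scale[OF K_module c], symmetric]) (use v br in auto)
    finally have 2: "lext M (\<lambda>l. Rb l ?s \<nu>) (bracket L i m) =
       c \<odot>\<^bsub>M\<^esub> lext M (\<lambda>l. Rb l \<phi> \<nu>) (bracket L i m) \<oplus>\<^bsub>M\<^esub> lext M (\<lambda>l. Rb l \<psi> \<nu>) (bracket L i m)" .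
    have cl: "Rb i (Rb m \<phi>) \<nu> \<in> carrier M" "Rb i (Rb m \<psi>) \<nu> \<in> carrier M"
      "lext M (\<lambda>l. Rb l \<phi> \<nu>) (bracket L i m) \<in> carrier M" "lext M (\<lambda>l. Rb l \<psi> \<nu>) (bracket L i m) \<in> carrier M"
      using Rb_closed[OF i] R br v by (auto intro!: lext_in)
    show ?thesis
      unfolding *(1) Rb_rec[OF i *(3) \<phi> *(4,2,5)] Rb_rec[OF i *(3) \<psi> *(4,2,5)] Rb_rec[OF i *(3) s *(4,2,5)] 1 2
      using cl c by (simp add: K.smult_r_distr K.M.a_ac)
  qed
qed

lemma Rb_linear: assumes i: "i \<in> X" shows "linear_map R fm fm (Rb i)"
proof -
  have z: "Rb i \<zero>\<^bsub>fm\<^esub> \<mu> = \<zero>\<^bsub>M\<^esub>" for \<mu>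
  proof (cases "set_mset \<mu> \<subseteq> X")
    case True
    \<comment> \<open>With both functions zero and coefficient \<open>-1\<close> the right side is
      \<open>- Rb i 0 + Rb i 0\<close>, so the value at the zero function vanishes. Homogeneity is
      then the case of a zero summand.\<close>
    have "Rb i (\<ominus> \<one> \<odot>\<^bsub>fm\<^esub> \<zero>\<^bsub>fm\<^esub> \<oplus>\<^bsub>fm\<^esub> \<zero>\<^bsub>fm\<^esub>) \<mu> = \<ominus> \<one> \<odot>\<^bsub>M\<^esub> Rb i \<zero>\<^bsub>fm\<^esub> \<mu> \<oplus>\<^bsub>M\<^esub> Rb i \<zero>\<^bsub>fm\<^esub> \<mu>"
      by (rule Rb_lincomb[OF i _ _ _ True]) auto
    then show ?thesis using Rb_closed[OF i F.M.zero_closed] K.smult_l_minus[of \<one> "Rb i \<zero>\<^bsub>fm\<^esub> \<mu>"]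
      by (simp add: K.M.l_neg)
  qed (simp add: Rb_def)
  have eq: "Rb i (c \<odot>\<^bsub>fm\<^esub> \<phi> \<oplus>\<^bsub>fm\<^esub> \<psi>) = c \<odot>\<^bsub>fm\<^esub> Rb i \<phi> \<oplus>\<^bsub>fm\<^esub> Rb i \<psi>"
    if "c \<in> carrier R" "\<phi> \<in> carrier fm" "\<psi> \<in> carrier fm" for c \<phi> \<psi>
  proof (rule fm_eqI)
    show "Rb i (c \<odot>\<^bsub>fm\<^esub> \<phi> \<oplus>\<^bsub>fm\<^esub> \<psi>) \<in> carrier fm" "c \<odot>\<^bsub>fm\<^esub> Rb i \<phi> \<oplus>\<^bsub>fm\<^esub> Rb i \<psi> \<in> carrier fm"
      using that i Rb_closed by auto
    show "Rb i (c \<odot>\<^bsub>fm\<^esub> \<phi> \<oplus>\<^bsub>fm\<^esub> \<psi>) \<mu> = (c \<odot>\<^bsub>fm\<^esub> Rb i \<phi> \<oplus>\<^bsub>fm\<^esub> Rb i \<psi>) \<mu>" if "set_mset \<mu> \<subseteq> X" for \<mu>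
      using Rb_lincomb[OF i \<open>c \<in> _\<close> \<open>\<phi> \<in> _\<close> \<open>\<psi> \<in> _\<close> that] by (simp add: fm_simps)
  qed
  have zz: "Rb i \<zero>\<^bsub>fm\<^esub> = \<zero>\<^bsub>fm\<^esub>" using z by (simp add: fm_simps fun_eq_iff)
  show ?thesis unfolding linear_map_def
  proof (intro conjI ballI)
    fix \<phi> \<psi> assume a: "\<phi> \<in> carrier fm" "\<psi> \<in> carrier fm"
    show "Rb i (\<phi> \<oplus>\<^bsub>fm\<^esub> \<psi>) = Rb i \<phi> \<oplus>\<^bsub>fm\<^esub> Rb i \<psi>"
      using eq[OF R.one_closed a] a Rb_closed[OF i] by simp
  next
    fix c \<phi> assume a: "c \<in> carrier R" "\<phi> \<in> carrier fm"
    show "Rb i (c \<odot>\<^bsub>fm\<^esub> \<phi>) = c \<odot>\<^bsub>fm\<^esub> Rb i \<phi>"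
      using eq[OF a F.M.zero_closed] a Rb_closed[OF i] zz by simp
  qed (use Rb_closed[OF i] in auto)
qed

text \<open>The operators act on monomials and \<open>T\<close> acts on values. Needed for the mixed
  terms in the bracket law of the coinduced action, with \<open>T\<close> the action of an element
  on \<open>M\<close>.\<close>

lemma Rb_comp:
  assumes T: "linear_map R M M T"
  shows "\<lbrakk>i \<in> X; \<phi> \<in> carrier fm; set_mset \<mu> \<subseteq> X\<rbrakk> \<Longrightarrow> Rb i (\<lambda>\<mu>. T (\<phi> \<mu>)) \<mu> = T (Rb i \<phi> \<mu>)"
proof (induction "size \<mu>" arbitrary: i \<phi> \<mu> rule: less_induct)
  case less
  note i = less.prems(1) and \<phi> = less.prems(2)
  note TD = linear_mapD[OF T] and T0 = linear_map_zero[OF K_module K_module T]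
  have Tf: "(\<lambda>\<mu>. T (\<psi> \<mu>)) \<in> carrier fm" if "\<psi> \<in> carrier fm" for \<psi>
    by (rule fmI) (use that TD T0 fm_out in auto)
  show ?case
  proof (cases "below i \<mu>")
    case True then show ?thesis using less.prems by (simp add: Rb_below)
  next
    case False
    then obtain m \<nu> where *: "\<mu> = add_mset m \<nu>" "below m \<nu>" "m \<in> X" "set_mset \<nu> \<subseteq> X" "lt m i"
      using less.prems(3) by (rule least_cases)
    have sz: "size \<nu> < size \<mu>" using * by simp
    have R: "Rb m \<phi> \<in> carrier fm" using Rb_closed * \<phi> by auto
    have IH: "Rb l (\<lambda>\<mu>. T (\<phi> \<mu>)) \<rho> = T (Rb l \<phi> \<rho>)" if "l \<in> X" "set_mset \<rho> \<subseteq> X" "size \<rho> \<le> size \<nu>" for l \<rho>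
      by (rule less.hyps) (use that sz \<phi> in auto)
    have b: "below m (add_mset i \<nu>)" using * lt_asym by simp
    have "Rb i (Rb m (\<lambda>\<mu>. T (\<phi> \<mu>))) \<nu> = Rb i (\<lambda>\<mu>. T (Rb m \<phi> \<mu>)) \<nu>"
    proof (rule Rb_cong[OF i Rb_closed[OF *(3) Tf[OF \<phi>]] Tf[OF R]])
      show "Rb m (\<lambda>\<mu>. T (\<phi> \<mu>)) (add_mset i \<nu>) = T (Rb m \<phi> (add_mset i \<nu>))"
        using * i Rb_below[OF b] by simp
    qed (use IH * in auto)
    also have "\<dots> = T (Rb i (Rb m \<phi>) \<nu>)"
      by (rule less.hyps[OF sz i R *(4)])
    finally have 1: "Rb i (Rb m (\<lambda>\<mu>. T (\<phi> \<mu>))) \<nu> = T (Rb i (Rb m \<phi>) \<nu>)" .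
    have br: "bracket L i m \<in> carrier L" using i * bracket_closed by auto
    have v: "Rb l \<phi> \<nu> \<in> carrier M" if "l \<in> X" for l
      using Rb_closed[OF that \<phi>] by auto
    have "lext M (\<lambda>l. Rb l (\<lambda>\<mu>. T (\<phi> \<mu>)) \<nu>) (bracket L i m) = lext M (\<lambda>l. T (Rb l \<phi> \<nu>)) (bracket L i m)"
      by (rule lext_cong[OF K_module]) (use IH * br v TD Rb_closed[OF _ Tf[OF \<phi>]] in auto)
    also have "\<dots> = T (lext M (\<lambda>l. Rb l \<phi> \<nu>) (bracket L i m))"
      by (rule lext_comp_linear[OF K_module K_module T, symmetric]) (use v br in auto)
    finally have 2: "lext M (\<lambda>l. Rb l (\<lambda>\<mu>. T (\<phi> \<mu>)) \<nu>) (bracket L i m) = T (lext M (\<lambda>l. Rb l \<phi> \<nu>) (bracket L i m))" .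
    have cl: "Rb i (Rb m \<phi>) \<nu> \<in> carrier M" "lext M (\<lambda>l. Rb l \<phi> \<nu>) (bracket L i m) \<in> carrier M"
      using Rb_closed[OF i] R br v by (auto intro!: lext_in)
    show ?thesis
      unfolding *(1) Rb_rec[OF i *(3) \<phi> *(4,2,5)] Rb_rec[OF i *(3) Tf[OF \<phi>] *(4,2,5)] 1 2
      using cl TD by simp
  qed
qed

definition Rx :: "'b \<Rightarrow> ('b multiset \<Rightarrow> 'm) \<Rightarrow> 'b multiset \<Rightarrow> 'm" where
  "Rx x \<phi> = lext fm (\<lambda>l. Rb l \<phi>) x"

lemma Rx_linear_left: "\<phi> \<in> carrier fm \<Longrightarrow> linear_map R L fm (\<lambda>x. Rx x \<phi>)"
  unfolding Rx_def by (rule lext_linear[OF fm_module]) (rule Rb_closed)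

lemma Rx_closed: "\<lbrakk>x \<in> carrier L; \<phi> \<in> carrier fm\<rbrakk> \<Longrightarrow> Rx x \<phi> \<in> carrier fm"
  using linear_mapD(1)[OF Rx_linear_left] .

lemma Rx_basis: "\<lbrakk>i \<in> X; \<phi> \<in> carrier fm\<rbrakk> \<Longrightarrow> Rx i \<phi> = Rb i \<phi>"
  unfolding Rx_def by (rule lext_basis[OF fm_module]) (rule Rb_closed)

lemma Rx_eval: "\<lbrakk>x \<in> carrier L; \<phi> \<in> carrier fm\<rbrakk> \<Longrightarrow> Rx x \<phi> \<mu> = lext M (\<lambda>l. Rb l \<phi> \<mu>) x"
  unfolding Rx_def by (rule lext_comp_linear[OF fm_module K_module fm_eval]) (auto intro: Rb_closed)

lemma Rx_below: "\<lbrakk>i \<in> X; \<phi> \<in> carrier fm; below i \<mu>; set_mset \<mu> \<subseteq> X\<rbrakk> \<Longrightarrow> Rx i \<phi> \<mu> = \<phi> (add_mset i \<mu>)"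
  by (simp add: Rx_basis Rb_below)

lemma Rx_linear: assumes x: "x \<in> carrier L" shows "linear_map R fm fm (Rx x)"
  unfolding linear_map_def
proof (intro conjI ballI)
  show "Rx x \<phi> \<in> carrier fm" if "\<phi> \<in> carrier fm" for \<phi> using Rx_closed x that .
  fix \<phi> \<psi> assume a: "\<phi> \<in> carrier fm" "\<psi> \<in> carrier fm"
  have "Rx x (\<phi> \<oplus>\<^bsub>fm\<^esub> \<psi>) = lext fm (\<lambda>l. Rb l \<phi> \<oplus>\<^bsub>fm\<^esub> Rb l \<psi>) x"
    unfolding Rx_def by (rule lext_cong[OF fm_module])
      (use x a linear_mapD[OF Rb_linear] Rb_closed in auto)
  also have "\<dots> = Rx x \<phi> \<oplus>\<^bsub>fm\<^esub> Rx x \<psi>"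
    unfolding Rx_def by (rule lext_add[OF fm_module]) (use x a Rb_closed in auto)
  finally show "Rx x (\<phi> \<oplus>\<^bsub>fm\<^esub> \<psi>) = Rx x \<phi> \<oplus>\<^bsub>fm\<^esub> Rx x \<psi>" .
next
  fix c \<phi> assume a: "c \<in> carrier R" "\<phi> \<in> carrier fm"
  have "Rx x (c \<odot>\<^bsub>fm\<^esub> \<phi>) = lext fm (\<lambda>l. c \<odot>\<^bsub>fm\<^esub> Rb l \<phi>) x"
    unfolding Rx_def by (rule lext_cong[OF fm_module])
      (use x a linear_mapD[OF Rb_linear] Rb_closed in auto)
  also have "\<dots> = c \<odot>\<^bsub>fm\<^esub> Rx x \<phi>"
    unfolding Rx_def
    by (rule lext_comp_linear[OF fm_module fm_module linear_map_scale[OF fm_module a(1)], symmetric])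
      (use x a Rb_closed in auto)
  finally show "Rx x (c \<odot>\<^bsub>fm\<^esub> \<phi>) = c \<odot>\<^bsub>fm\<^esub> Rx x \<phi>" .
qed

lemma Rx_comp:
  assumes T: "linear_map R M M T" and x: "x \<in> carrier L" and \<phi>: "\<phi> \<in> carrier fm"
  shows "Rx x (\<lambda>\<mu>. T (\<phi> \<mu>)) \<mu> = T (Rx x \<phi> \<mu>)"
proof (cases "set_mset \<mu> \<subseteq> X")
  case True
  note TD = linear_mapD[OF T] and T0 = linear_map_zero[OF K_module K_module T]
  have Tf: "(\<lambda>\<mu>. T (\<phi> \<mu>)) \<in> carrier fm"
    by (rule fmI) (use \<phi> TD T0 fm_out in auto)
  have "Rx x (\<lambda>\<mu>. T (\<phi> \<mu>)) \<mu> = lext M (\<lambda>l. T (Rb l \<phi> \<mu>)) x"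
    unfolding Rx_eval[OF x Tf]
    by (rule lext_cong[OF K_module]) (use x \<phi> Tf TD Rb_comp[OF T _ \<phi> True] Rb_closed in auto)
  also have "\<dots> = T (lext M (\<lambda>l. Rb l \<phi> \<mu>) x)"
    by (rule lext_comp_linear[OF K_module K_module T, symmetric]) (use x \<phi> Rb_closed in auto)
  finally show ?thesis unfolding Rx_eval[OF x \<phi>] .
next
  case False
  have "(\<lambda>\<mu>. T (\<phi> \<mu>)) \<in> carrier fm"
    by (rule fmI) (use \<phi> linear_mapD[OF T] linear_map_zero[OF K_module K_module T] fm_out in auto)
  then show ?thesis
    using fm_out[OF Rx_closed[OF x] False] \<phi> linear_map_zero[OF K_module K_module T] by simp
qed

lemma bracket_linear_left: "y \<in> carrier L \<Longrightarrow> linear_map R L L (\<lambda>x. bracket L x y)"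
  by (simp add: linear_map_def bracket_closed bracket_add_left bracket_smult_left)

lemma bracket_linear_right: "y \<in> carrier L \<Longrightarrow> linear_map R L L (bracket L y)"
  by (simp add: linear_map_def bracket_closed bracket_add_right bracket_smult_right)

lemma Rx_eval_linear: "\<phi> \<in> carrier fm \<Longrightarrow> linear_map R L M (\<lambda>x. Rx x \<phi> \<mu>)"
  by (rule linear_map_comp[OF Rx_linear_left fm_eval])

lemma Rx_add: "\<lbrakk>x \<in> carrier L; \<phi> \<in> carrier fm; \<psi> \<in> carrier fm\<rbrakk> \<Longrightarrow>
    Rx x (\<phi> \<oplus>\<^bsub>fm\<^esub> \<psi>) \<mu> = Rx x \<phi> \<mu> \<oplus>\<^bsub>M\<^esub> Rx x \<psi> \<mu>"
  using linear_mapD(2)[OF Rx_linear] by (simp add: fm_simps)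

text \<open>Dual of \<open>x x_m z_\<nu> = x_m x z_\<nu> + [x, x_m] z_\<nu>\<close>. By linearity
  \<open>x\<close> may be a basis element \<open>l\<close>. For \<open>l\<close> above
  \<open>m\<close> this is the defining recursion, for \<open>l = m\<close> both sides are the
  leading value, and for \<open>l\<close> below \<open>m\<close> it is the recursion with
  \<open>l\<close> and \<open>m\<close> exchanged, read backwards.\<close>

lemma Rx_add_mset:
  assumes m: "m \<in> X" and \<nu>: "set_mset \<nu> \<subseteq> X" and b: "below m \<nu>" and \<phi>: "\<phi> \<in> carrier fm" and x: "x \<in> carrier L"
  shows "Rx x \<phi> (add_mset m \<nu>) = Rx x (Rx m \<phi>) \<nu> \<oplus>\<^bsub>M\<^esub> Rx (bracket L x m) \<phi> \<nu>"
proof (rule linear_eq_on_basis[OF K_module _ _ _ x])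
  have mL: "m \<in> carrier L" using m by simp
  have R: "Rx m \<phi> \<in> carrier fm" by (rule Rx_closed[OF mL \<phi>])
  show "linear_map R L M (\<lambda>x. Rx x \<phi> (add_mset m \<nu>))" by (rule Rx_eval_linear[OF \<phi>])
  show "linear_map R L M (\<lambda>x. Rx x (Rx m \<phi>) \<nu> \<oplus>\<^bsub>M\<^esub> Rx (bracket L x m) \<phi> \<nu>)"
    by (intro linear_map_sum module_self K_module Rx_eval_linear[OF R]
        linear_map_comp[OF bracket_linear_left[OF mL] Rx_eval_linear[OF \<phi>]])
  fix l assume l: "l \<in> X"
  have lL: "l \<in> carrier L" using l by simp
  have br: "bracket L l m \<in> carrier L" "bracket L m l \<in> carrier L" using bracket_closed lL mL by auto
  have v: "Rx y \<psi> \<rho> \<in> carrier M" if "y \<in> carrier L" "\<psi> \<in> carrier fm" for y \<psi> \<rho>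
    using Rx_closed[OF that] by simp
  have rec: "Rx i \<phi> (add_mset j \<rho>) = Rx i (Rx j \<phi>) \<rho> \<oplus>\<^bsub>M\<^esub> Rx (bracket L i j) \<phi> \<rho>"
    if "i \<in> X" "j \<in> X" "set_mset \<rho> \<subseteq> X" "below j \<rho>" "lt j i" for i j \<rho>
    using Rb_rec[OF that(1,2) \<phi> that(3-5)] that
    by (simp add: Rx_basis \<phi> Rb_closed Rx_eval bracket_closed)
  consider "lt m l" | "m = l" | "lt l m" using lt_total by blast
  then show "Rx l \<phi> (add_mset m \<nu>) = Rx l (Rx m \<phi>) \<nu> \<oplus>\<^bsub>M\<^esub> Rx (bracket L l m) \<phi> \<nu>"
  proof cases
    case 1 then show ?thesis using rec[OF l m \<nu> b] by simp
  next
    case 2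
    have "Rx \<zero>\<^bsub>L\<^esub> \<phi> \<nu> = \<zero>\<^bsub>M\<^esub>"
      by (rule linear_map_zero[OF module_self K_module Rx_eval_linear[OF \<phi>]])
    then show ?thesis using 2 l b \<nu> \<phi> R by (simp add: Rx_below bracket_self)
  next
    case 3
    have bl: "below l \<nu>" "below l (add_mset m \<nu>)" using below_le[OF 3 b] 3 lt_asym by auto
    have "Rx l (Rx m \<phi>) \<nu> = Rx m \<phi> (add_mset l \<nu>)" by (rule Rx_below[OF l R bl(1) \<nu>])
    also have "\<dots> = Rx m (Rx l \<phi>) \<nu> \<oplus>\<^bsub>M\<^esub> Rx (bracket L m l) \<phi> \<nu>" by (rule rec[OF m l \<nu> bl(1) 3])
    also have "Rx m (Rx l \<phi>) \<nu> = Rx l \<phi> (add_mset m \<nu>)" by (rule Rx_below[OF m Rx_closed[OF lL \<phi>] b \<nu>])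
    finally have 1: "Rx l (Rx m \<phi>) \<nu> = Rx l \<phi> (add_mset m \<nu>) \<oplus>\<^bsub>M\<^esub> Rx (bracket L m l) \<phi> \<nu>" .
    have "Rx (bracket L m l) \<phi> \<nu> \<oplus>\<^bsub>M\<^esub> Rx (bracket L l m) \<phi> \<nu> = Rx (bracket L m l \<oplus>\<^bsub>L\<^esub> bracket L l m) \<phi> \<nu>"
      using linear_mapD(2)[OF Rx_eval_linear[OF \<phi>] br(2,1)] by simp
    also have "bracket L m l \<oplus>\<^bsub>L\<^esub> bracket L l m = \<zero>\<^bsub>L\<^esub>"
      using bracket_skew[OF mL lL] br by (simp add: L_l_neg)
    also have "Rx \<zero>\<^bsub>L\<^esub> \<phi> \<nu> = \<zero>\<^bsub>M\<^esub>"
      by (rule linear_map_zero[OF module_self K_module Rx_eval_linear[OF \<phi>]])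
    finally show ?thesis unfolding 1 using v lL mL br \<phi> by (simp add: K.M.a_assoc)
  qed
qed

lemma Rx_cong_basis:
  assumes "i \<in> X" "\<phi> \<in> carrier fm" "\<psi> \<in> carrier fm"
    "\<And>\<nu>. \<lbrakk>set_mset \<nu> \<subseteq> X; size \<nu> \<le> size \<mu>\<rbrakk> \<Longrightarrow> \<phi> \<nu> = \<psi> \<nu>" "\<phi> (add_mset i \<mu>) = \<psi> (add_mset i \<mu>)"
  shows "Rx i \<phi> \<mu> = Rx i \<psi> \<mu>"
  unfolding Rx_basis[OF assms(1,2)] Rx_basis[OF assms(1,3)] by (rule Rb_cong[OF assms])

text \<open>The consistency at the heart of the Poincare-Birkhoff-Witt theorem; the order is
  reversed because the operators are dual to left multiplication. For basis elements with
  \<open>j\<close> before \<open>i\<close> and before all letters of \<open>\<mu>\<close> it is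
  \<open>Rx_add_mset\<close>. Otherwise the first letter \<open>m\<close> of \<open>\<mu>\<close>
  precedes both; it is pulled to the front, the induction hypothesis treats the shorter monomial,
  and the Jacobi identity combines the brackets with \<open>m\<close>.\<close>

lemma Rx_bracket:
  "\<lbrakk>x \<in> carrier L; y \<in> carrier L; \<phi> \<in> carrier fm; set_mset \<mu> \<subseteq> X\<rbrakk> \<Longrightarrow>
    Rx (bracket L x y) \<phi> \<mu> = Rx y (Rx x \<phi>) \<mu> \<ominus>\<^bsub>M\<^esub> Rx x (Rx y \<phi>) \<mu>"
proof (induction "size \<mu>" arbitrary: x y \<phi> \<mu> rule: less_induct)
  case less
  note \<phi> = less.prems(3)
  have v: "Rx y \<psi> \<rho> \<in> carrier M" if "y \<in> carrier L" "\<psi> \<in> carrier fm" for y \<psi> \<rho>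
    using Rx_closed[OF that] by simp
  have lt_case: "Rx (bracket L i j) \<phi> \<mu> = Rx j (Rx i \<phi>) \<mu> \<ominus>\<^bsub>M\<^esub> Rx i (Rx j \<phi>) \<mu>"
    if i: "i \<in> X" and j: "j \<in> X" and ji: "lt j i" for i j
  proof -
    have L: "i \<in> carrier L" "j \<in> carrier L" using i j by auto
    have ij: "bracket L i j \<in> carrier L" using L bracket_closed by simp
    show ?thesis
    proof (cases "below j \<mu>")
      case True
      have "Rx j (Rx i \<phi>) \<mu> = Rx i \<phi> (add_mset j \<mu>)"
        by (rule Rx_below[OF j Rx_closed[OF L(1) \<phi>] True less.prems(4)])
      also have "\<dots> = Rx i (Rx j \<phi>) \<mu> \<oplus>\<^bsub>M\<^esub> Rx (bracket L i j) \<phi> \<mu>"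
        by (rule Rx_add_mset[OF j less.prems(4) True \<phi> L(1)])
      finally have e: "Rx j (Rx i \<phi>) \<mu> = Rx i (Rx j \<phi>) \<mu> \<oplus>\<^bsub>M\<^esub> Rx (bracket L i j) \<phi> \<mu>" .
      show ?thesis unfolding e
        using v[OF ij \<phi>] v[OF L(1) Rx_closed[OF L(2) \<phi>]] by (simp add: K.M.a_comm K.M.add_minus_cancel)
    next
      case False
      then obtain m \<nu> where *: "\<mu> = add_mset m \<nu>" "below m \<nu>" "m \<in> X" "set_mset \<nu> \<subseteq> X" "lt m j"
        using less.prems(4) by (rule least_cases)
      have mi: "lt m i" using lt_trans[OF *(5) ji] .
      have mL: "m \<in> carrier L" using * by simp
      have sz: "size \<nu> < size \<mu>" using * by simp
      note IH = less.hyps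
      \<comment> \<open>Commutes \<open>m\<close> past \<open>a\<close> underneath
        \<open>Rx b\<close>. Agreement is required up to the size of \<open>\<nu>\<close>, where the
        induction hypothesis gives it, and at the leading monomial \<open>add_mset b \<nu>\<close>,
        which is too long for the hypothesis; but there \<open>m\<close> is still the first letter,
        and \<open>Rx_add_mset\<close> applies.\<close>
      have key: "Rx b (Rx m (Rx a \<phi>)) \<nu> = Rx b (Rx a (Rx m \<phi>)) \<nu> \<oplus>\<^bsub>M\<^esub> Rx b (Rx (bracket L a m) \<phi>) \<nu>"
        if a: "a \<in> X" "lt m a" and b: "b \<in> X" "lt m b" for a b
      proof -
        have aL: "a \<in> carrier L" and bL: "b \<in> carrier L" using a b by auto
        have am: "bracket L a m \<in> carrier L" using aL mL bracket_closed by simp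
        have c: "Rx a (Rx m \<phi>) \<in> carrier fm" "Rx (bracket L a m) \<phi> \<in> carrier fm" "Rx m (Rx a \<phi>) \<in> carrier fm"
          using Rx_closed aL mL am \<phi> by auto
        have "Rx b (Rx m (Rx a \<phi>)) \<nu> = Rx b (Rx a (Rx m \<phi>) \<oplus>\<^bsub>fm\<^esub> Rx (bracket L a m) \<phi>) \<nu>"
        proof (rule Rx_cong_basis[OF b(1) c(3) F.M.a_closed[OF c(1,2)]])
          fix \<rho> assume \<rho>: "set_mset \<rho> \<subseteq> X" "size \<rho> \<le> size \<nu>"
          have "size \<rho> < size \<mu>" using sz \<rho> by simp
          note h = IH[OF this aL mL \<phi> \<rho>(1)]
          show "Rx m (Rx a \<phi>) \<rho> = (Rx a (Rx m \<phi>) \<oplus>\<^bsub>fm\<^esub> Rx (bracket L a m) \<phi>) \<rho>"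
            unfolding fm_simps h using fm_val[OF c(1)] fm_val[OF c(3)]
            by (simp add: K.M.a_comm[of "Rx a (Rx m \<phi>) \<rho>"] K.M.minus_add_cancel)
        next
          have bb: "below m (add_mset b \<nu>)" using * b lt_asym by simp
          have s: "set_mset (add_mset b \<nu>) \<subseteq> X" using * b by simp
          show "Rx m (Rx a \<phi>) (add_mset b \<nu>) = (Rx a (Rx m \<phi>) \<oplus>\<^bsub>fm\<^esub> Rx (bracket L a m) \<phi>) (add_mset b \<nu>)"
            unfolding fm_simps Rx_below[OF *(3) Rx_closed[OF aL \<phi>] bb s]
            by (rule Rx_add_mset[OF *(3) s bb \<phi> aL])
        qed
        also have "\<dots> = Rx b (Rx a (Rx m \<phi>)) \<nu> \<oplus>\<^bsub>M\<^esub> Rx b (Rx (bracket L a m) \<phi>) \<nu>"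
          by (rule Rx_add[OF bL c(1,2)])
        finally show ?thesis .
      qed
      have split: "Rx b (Rx a \<phi>) \<mu> = (Rx b (Rx a (Rx m \<phi>)) \<nu> \<oplus>\<^bsub>M\<^esub> Rx b (Rx (bracket L a m) \<phi>) \<nu>)
          \<oplus>\<^bsub>M\<^esub> Rx (bracket L b m) (Rx a \<phi>) \<nu>"
        if a: "a \<in> X" "lt m a" and b: "b \<in> X" "lt m b" for a b
        unfolding *(1) key[OF a b, symmetric]
        by (rule Rx_add_mset[OF *(3,4,2)]) (use a b \<phi> Rx_closed in auto)
      have im: "bracket L i m \<in> carrier L" and jm: "bracket L j m \<in> carrier L"
        using L mL bracket_closed by auto
      have J: "bracket L (bracket L i j) m = bracket L (bracket L i m) j \<oplus>\<^bsub>L\<^esub> bracket L i (bracket L j m)"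
      proof -
        have "bracket L i (bracket L j m) = bracket L (bracket L i j) m \<oplus>\<^bsub>L\<^esub> bracket L j (bracket L i m)"
          by (rule bracket_leibniz[OF L mL])
        moreover have "bracket L j (bracket L i m) = \<ominus>\<^bsub>L\<^esub> bracket L (bracket L i m) j"
          by (rule bracket_skew[OF L(2) im])
        moreover have "p = q \<oplus>\<^bsub>L\<^esub> (p \<oplus>\<^bsub>L\<^esub> \<ominus>\<^bsub>L\<^esub> q)" if "p \<in> carrier L" "q \<in> carrier L" for p q
          using that by algebra
        ultimately show ?thesis
          using bracket_closed[OF ij mL] bracket_closed[OF im L(2)] by simp
      qed
      have e1: "Rx (bracket L i j) \<phi> \<mu> = Rx (bracket L i j) (Rx m \<phi>) \<nu> \<oplus>\<^bsub>M\<^esub> Rx (bracket L (bracket L i j) m) \<phi> \<nu>"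
        unfolding *(1) by (rule Rx_add_mset[OF *(3,4,2) \<phi> ij])
      have e2: "Rx (bracket L (bracket L i j) m) \<phi> \<nu> =
          Rx (bracket L (bracket L i m) j) \<phi> \<nu> \<oplus>\<^bsub>M\<^esub> Rx (bracket L i (bracket L j m)) \<phi> \<nu>"
        unfolding J by (rule linear_mapD(2)[OF Rx_eval_linear[OF \<phi>]])
          (use L im jm bracket_closed in auto)
      have id: "(a1 \<ominus>\<^bsub>M\<^esub> a2) \<oplus>\<^bsub>M\<^esub> ((b1 \<ominus>\<^bsub>M\<^esub> c2) \<oplus>\<^bsub>M\<^esub> (c1 \<ominus>\<^bsub>M\<^esub> b2)) = ((a1 \<oplus>\<^bsub>M\<^esub> b1) \<oplus>\<^bsub>M\<^esub> c1) \<ominus>\<^bsub>M\<^esub> ((a2 \<oplus>\<^bsub>M\<^esub> b2) \<oplus>\<^bsub>M\<^esub> c2)"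
        if "a1 \<in> carrier M" "a2 \<in> carrier M" "b1 \<in> carrier M" "b2 \<in> carrier M" "c1 \<in> carrier M" "c2 \<in> carrier M"
        for a1 a2 b1 b2 c1 c2
        using that by algebra
      show ?thesis
        unfolding e1 e2 split[OF i mi j *(5)] split[OF j *(5) i mi]
          IH[OF sz L(1,2) Rx_closed[OF mL \<phi>] *(4)] IH[OF sz im L(2) \<phi> *(4)] IH[OF sz L(1) jm \<phi> *(4)]
        by (rule id) (use v Rx_closed L mL im jm \<phi> in auto)
    qed
  qed
  have basis: "Rx (bracket L i j) \<phi> \<mu> = Rx j (Rx i \<phi>) \<mu> \<ominus>\<^bsub>M\<^esub> Rx i (Rx j \<phi>) \<mu>"
    if i: "i \<in> X" and j: "j \<in> X" for i j
  proof -
    have L: "i \<in> carrier L" "j \<in> carrier L" using i j by auto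
    have ji: "bracket L j i \<in> carrier L" using L bracket_closed by simp
    consider "lt j i" | "i = j" | "lt i j" using lt_total by blast
    then show ?thesis
    proof cases
      case 2
      have "Rx \<zero>\<^bsub>L\<^esub> \<phi> \<mu> = \<zero>\<^bsub>M\<^esub>"
        by (rule linear_map_zero[OF module_self K_module Rx_eval_linear[OF \<phi>]])
      then show ?thesis using 2 L v Rx_closed \<phi> by (simp add: bracket_self K.M.minus_self)
    next
      case 3
      have "Rx (bracket L i j) \<phi> \<mu> = \<ominus>\<^bsub>M\<^esub> Rx (bracket L j i) \<phi> \<mu>"
      proof -
        have "Rx (\<zero>\<^bsub>L\<^esub> \<ominus>\<^bsub>L\<^esub> bracket L j i) \<phi> \<mu> = Rx \<zero>\<^bsub>L\<^esub> \<phi> \<mu> \<ominus>\<^bsub>M\<^esub> Rx (bracket L j i) \<phi> \<mu>"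
          by (rule linear_map_minus[OF module_self K_module Rx_eval_linear[OF \<phi>] L_zero_closed ji])
        then show ?thesis
          using bracket_skew[OF L] ji v[OF ji \<phi>] linear_map_zero[OF module_self K_module Rx_eval_linear[OF \<phi>]]
          by (simp add: a_minus_def)
      qed
      then show ?thesis using lt_case[OF j i 3] v Rx_closed L \<phi>
        by (simp add: a_minus_def K.M.minus_add K.M.a_comm)
    qed (rule lt_case[OF i j])
  qed
  have left: "Rx (bracket L x j) \<phi> \<mu> = Rx j (Rx x \<phi>) \<mu> \<ominus>\<^bsub>M\<^esub> Rx x (Rx j \<phi>) \<mu>"
    if j: "j \<in> X" and x: "x \<in> carrier L" for j x
  proof (rule linear_eq_on_basis[OF K_module _ _ _ x])
    have jL: "j \<in> carrier L" using j by simp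
    show "linear_map R L M (\<lambda>x. Rx (bracket L x j) \<phi> \<mu>)"
      by (rule linear_map_comp[OF bracket_linear_left[OF jL] Rx_eval_linear[OF \<phi>]])
    show "linear_map R L M (\<lambda>x. Rx j (Rx x \<phi>) \<mu> \<ominus>\<^bsub>M\<^esub> Rx x (Rx j \<phi>) \<mu>)"
      by (intro linear_map_diff module_self K_module Rx_eval_linear[OF Rx_closed[OF jL \<phi>]]
          linear_map_comp[OF Rx_linear_left[OF \<phi>] linear_map_comp[OF Rx_linear[OF jL] fm_eval]])
  qed (rule basis[OF _ j])
  note x = less.prems(1)
  show ?case
  proof (rule linear_eq_on_basis[OF K_module _ _ _ less.prems(2)])
    show "linear_map R L M (\<lambda>y. Rx (bracket L x y) \<phi> \<mu>)"
      by (rule linear_map_comp[OF bracket_linear_right[OF x] Rx_eval_linear[OF \<phi>]])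
    show "linear_map R L M (\<lambda>y. Rx y (Rx x \<phi>) \<mu> \<ominus>\<^bsub>M\<^esub> Rx x (Rx y \<phi>) \<mu>)"
      by (intro linear_map_diff module_self K_module Rx_eval_linear[OF Rx_closed[OF x \<phi>]]
          linear_map_comp[OF Rx_linear_left[OF \<phi>] linear_map_comp[OF Rx_linear[OF x] fm_eval]])
  qed (rule left[OF _ x])
qed

end

section \<open>Acyclicity of coinduced modules\<close>

lemma cochain_map:
  assumes "lie_sub R L M S" "lie_sub R L N S" and T: "linear_map R M N T"
  shows "cochain R L M S q f \<Longrightarrow> cochain R L N S q (\<lambda>xs. T (f xs))"
proof (induction q arbitrary: f)
  interpret M: lie_sub R L M S by fact
  interpret N: lie_sub R L N S by fact
  note TD = linear_mapD[OF T]
  {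
    case 0 then show ?case using TD by simp
  next
    case (Suc q)
    have T0: "T \<zero>\<^bsub>M\<^esub> = \<zero>\<^bsub>N\<^esub>" by (rule linear_map_zero[OF _ _ T]) (unfold_locales)
    have cl: "f (x # xs) \<in> carrier M" if "x \<in> S" "xs \<in> lists_of S q" for x xs
      using M.C_closed[OF Suc.prems] that by simp
    show ?case using Suc cl TD T0 by simp
  }
qed

lemma lie_der_map:
  assumes "lie_sub R L M S" "lie_sub R L N S" and T: "linear_map R M N T"
    and e: "\<And>m. m \<in> carrier M \<Longrightarrow> T (a m) = b (T m)" and ad: "lie_sub.admissible R L M S a \<delta>"
  shows "\<lbrakk>cochain R L M S q f; xs \<in> lists_of S q\<rbrakk> \<Longrightarrow>
    lie_der N b \<delta> (\<lambda>xs. T (f xs)) xs = T (lie_der M a \<delta> f xs)"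
proof (induction q arbitrary: f xs)
  interpret M: lie_sub R L M S by fact
  interpret N: lie_sub R L N S by fact
  {
    case 0 then show ?case using e by simp
  next
    case (Suc q)
    from Suc.prems(2) obtain y ys where xs: "xs = y # ys" "y \<in> S" "ys \<in> lists_of S q" by (rule lists_of_SucE)
    have i: "cochain R L M S q (\<lambda>zs. f (y # zs))" using Suc.prems xs by simp
    have "T (lie_der M a \<delta> (\<lambda>zs. f (y # zs)) ys \<ominus>\<^bsub>M\<^esub> f (\<delta> y # ys)) =
      T (lie_der M a \<delta> (\<lambda>zs. f (y # zs)) ys) \<ominus>\<^bsub>N\<^esub> T (f (\<delta> y # ys))"
    proof (rule linear_map_minus[OF _ _ T])
      show "lie_der M a \<delta> (\<lambda>zs. f (y # zs)) ys \<in> carrier M" by (rule M.LD_closed[OF ad i xs(3)])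
      show "f (\<delta> y # ys) \<in> carrier M" using M.C_closed[OF Suc.prems(1)] M.admissibleD(4)[OF ad] xs by simp
    qed unfold_locales
    then show ?case using xs Suc.IH[OF i xs(3)] by simp
  }
qed

lemma cobd_map:
  assumes "lie_sub R L M S" "lie_sub R L N S" and T: "linear_map R M N T"
    and e: "\<And>x m. \<lbrakk>x \<in> S; m \<in> carrier M\<rbrakk> \<Longrightarrow> T (act M x m) = act N x (T m)"
  shows "\<lbrakk>cochain R L M S q f; xs \<in> lists_of S (Suc q)\<rbrakk> \<Longrightarrow>
    cobd L N (\<lambda>xs. T (f xs)) xs = T (cobd L M f xs)"
proof (induction q arbitrary: f xs)
  interpret M: lie_sub R L M S by fact
  interpret N: lie_sub R L N S by fact
  have T0: "T \<zero>\<^bsub>M\<^esub> = \<zero>\<^bsub>N\<^esub>" by (rule linear_map_zero[OF _ _ T]) (unfold_locales)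
  have L: "lie_der N (act N x) (bracket L x) (\<lambda>xs. T (f xs)) xs = T (lie_der M (act M x) (bracket L x) f xs)"
    if "x \<in> S" "cochain R L M S q f" "xs \<in> lists_of S q" for x q f xs
    by (rule lie_der_map[OF assms(1,2) T _ M.admissible_act[OF that(1)] that(2,3)]) (rule e[OF that(1)])
  have m: "T (u \<ominus>\<^bsub>M\<^esub> v) = T u \<ominus>\<^bsub>N\<^esub> T v" if "u \<in> carrier M" "v \<in> carrier M" for u v
    by (rule linear_map_minus[OF _ _ T that]) unfold_locales
  {
    case 0
    then obtain x where x: "xs = [x]" "x \<in> S" by (blast elim: lists_of_1E)
    have "T (lie_der M (act M x) (bracket L x) f [] \<ominus>\<^bsub>M\<^esub> \<zero>\<^bsub>M\<^esub>) = T (lie_der M (act M x) (bracket L x) f []) \<ominus>\<^bsub>N\<^esub> T \<zero>\<^bsub>M\<^esub>"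
      by (rule m) (use M.LD_closed[OF M.admissible_act[OF x(2)] 0(1)] in auto)
    then show ?case using x L[OF x(2) 0(1)] T0 by simp
  next
    case (Suc q)
    from Suc.prems(2) obtain y ys where xs: "xs = y # ys" "y \<in> S" "ys \<in> lists_of S (Suc q)" by (rule lists_of_SucE)
    have i: "cochain R L M S q (\<lambda>zs. f (y # zs))" using Suc.prems xs by simp
    have "T (lie_der M (act M y) (bracket L y) f ys \<ominus>\<^bsub>M\<^esub> cobd L M (\<lambda>zs. f (y # zs)) ys) =
      T (lie_der M (act M y) (bracket L y) f ys) \<ominus>\<^bsub>N\<^esub> T (cobd L M (\<lambda>zs. f (y # zs)) ys)"
      by (rule m[OF M.LD_closed[OF M.admissible_act[OF xs(2)] Suc.prems(1) xs(3)] M.d_closed[OF i xs(3)]])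
    then show ?case using xs Suc.IH[OF i xs(3)] L[OF xs(2) Suc.prems(1) xs(3)] by simp
  }
qed

lemma cochain_pullback:
  assumes "\<And>x. x \<in> S \<Longrightarrow> \<rho> x \<in> T"
    "\<And>x y. \<lbrakk>x \<in> S; y \<in> S\<rbrakk> \<Longrightarrow> \<rho> (x \<oplus>\<^bsub>L\<^esub> y) = \<rho> x \<oplus>\<^bsub>L\<^esub> \<rho> y"
    "\<And>c x. \<lbrakk>c \<in> carrier R; x \<in> S\<rbrakk> \<Longrightarrow> \<rho> (c \<odot>\<^bsub>L\<^esub> x) = c \<odot>\<^bsub>L\<^esub> \<rho> x"
  shows "cochain R L M T q f \<Longrightarrow> cochain R L M S q (\<lambda>xs. f (map \<rho> xs))"
proof (induction q arbitrary: f)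
  case (Suc q)
  have m: "map \<rho> zs \<in> lists_of T q" if "zs \<in> lists_of S q" for zs q
    using that assms(1) by (auto simp: lists_of_def)
  show ?case unfolding cochain.simps
  proof (intro conjI ballI allI impI)
    show "cochain R L M S q (\<lambda>zs. f (map \<rho> (x # zs)))" if "x \<in> S" for x
      using Suc.IH[of "\<lambda>zs. f (\<rho> x # zs)"] Suc.prems assms(1) that by simp
  qed (use Suc.prems assms m in auto)
qed simp

section \<open>The coinduced module\<close>

locale pbw_module = lie_module R L M + ordered_basis R L X lt
  for R :: "('a, 'x) ring_scheme" (structure) and L :: "('a, 'b, 'y) lie_algebra_scheme" (structure)
    and M :: "('a, 'm, 'b, 'z) lie_module_scheme" (structure) and X :: "'b set" and lt :: "'b \<Rightarrow> 'b \<Rightarrow> bool"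
begin

sublocale pbw R L X lt M ..

lemma Rb_zero: "i \<in> X \<Longrightarrow> Rb i (\<lambda>_. \<zero>\<^bsub>M\<^esub>) \<mu> = \<zero>\<^bsub>M\<^esub>"
  using linear_map_zero[OF fm_module fm_module Rb_linear] by (simp add: fm_simps)

lemma zero_fm: "(\<lambda>_. \<zero>\<^bsub>M\<^esub>) \<in> carrier fm"
  using F.M.zero_closed by (simp add: fm_simps)

lemma lext_zero: "x \<in> carrier L \<Longrightarrow> lext M (\<lambda>_. \<zero>\<^bsub>M\<^esub>) x = \<zero>\<^bsub>M\<^esub>"
  by (rule lext_of_linear[OF K_module]) (auto simp: linear_map_def)

text \<open>Apart from its leading monomial, \<open>x_i z_\<mu>\<close> has monomials of size at
  most \<open>size \<mu>\<close>, where \<open>\<phi>\<close> vanishes.\<close>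

lemma Rx_lead:
  assumes x: "x \<in> carrier L" and \<phi>: "\<phi> \<in> carrier fm" and \<mu>: "set_mset \<mu> \<subseteq> X"
    and v: "\<And>\<nu>. \<lbrakk>set_mset \<nu> \<subseteq> X; size \<nu> \<le> size \<mu>\<rbrakk> \<Longrightarrow> \<phi> \<nu> = \<zero>\<^bsub>M\<^esub>"
  shows "Rx x \<phi> \<mu> = lext M (\<lambda>i. \<phi> (add_mset i \<mu>)) x"
  unfolding Rx_eval[OF x \<phi>]
proof (rule lext_cong[OF K_module _ _ x])
  fix i assume i: "i \<in> X"
  show "Rb i \<phi> \<mu> \<in> carrier M" using Rb_closed[OF i \<phi>] by simp
  have "pb (size \<mu>) i \<phi> \<mu> \<ominus>\<^bsub>M\<^esub> \<phi> (add_mset i \<mu>) = pb (size \<mu>) i (\<lambda>_. \<zero>\<^bsub>M\<^esub>) \<mu> \<ominus>\<^bsub>M\<^esub> \<zero>\<^bsub>M\<^esub>"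
    by (rule pb_local[OF i fm_valued[OF \<phi>] fm_valued[OF zero_fm] \<mu> v])
  then have "Rb i \<phi> \<mu> \<ominus>\<^bsub>M\<^esub> \<phi> (add_mset i \<mu>) = \<zero>\<^bsub>M\<^esub>"
    using \<mu> Rb_zero[OF i, of \<mu>] by (simp add: Rb_def a_minus_def)
  then show "Rb i \<phi> \<mu> = \<phi> (add_mset i \<mu>)"
    using M.M.minus_zero_iff Rb_closed[OF i \<phi>] \<phi> by simp
qed

text \<open>The product \<open>x_i z_\<mu>\<close> lies in the augmentation ideal, so it has no
  component on the empty monomial, the one place where \<open>\<phi>\<close> may be nonzero.\<close>

lemma Rb_constant:
  "\<lbrakk>i \<in> X; \<phi> \<in> carrier fm; set_mset \<mu> \<subseteq> X; \<And>\<nu>. \<lbrakk>set_mset \<nu> \<subseteq> X; \<nu> \<noteq> {#}\<rbrakk> \<Longrightarrow> \<phi> \<nu> = \<zero>\<^bsub>M\<^esub>\<rbrakk> \<Longrightarrow> Rb i \<phi> \<mu> = \<zero>\<^bsub>M\<^esub>"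
proof (induction "size \<mu>" arbitrary: i \<mu> rule: less_induct)
  case less
  note i = less.prems(1) and \<phi> = less.prems(2) and \<phi>0 = less.prems(4)
  show ?case
  proof (cases "below i \<mu>")
    case True then show ?thesis using less.prems by (simp add: Rb_below)
  next
    case False
    then obtain m \<nu> where *: "\<mu> = add_mset m \<nu>" "below m \<nu>" "m \<in> X" "set_mset \<nu> \<subseteq> X" "lt m i"
      using less.prems(3) by (rule least_cases)
    have IH: "Rb l \<phi> \<rho> = \<zero>\<^bsub>M\<^esub>" if "l \<in> X" "set_mset \<rho> \<subseteq> X" "size \<rho> \<le> size \<nu>" for l \<rho>
      by (rule less.hyps[OF _ that(1) \<phi> that(2) \<phi>0]) (use that * in auto)
    have b: "below m (add_mset i \<nu>)" using * lt_asym by simp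
    have "Rb i (Rb m \<phi>) \<nu> = Rb i (\<lambda>_. \<zero>\<^bsub>M\<^esub>) \<nu>"
      by (rule Rb_cong[OF i Rb_closed[OF *(3) \<phi>] zero_fm])
        (use IH[OF *(3)] Rb_below[OF b, of \<phi>] \<phi>0[of "add_mset m (add_mset i \<nu>)"] *(3,4) i in simp_all)
    moreover have "lext M (\<lambda>l. Rb l \<phi> \<nu>) (bracket L i m) = lext M (\<lambda>_. \<zero>\<^bsub>M\<^esub>) (bracket L i m)"
      by (rule lext_cong[OF K_module]) (use IH *(3,4) i bracket_closed in auto)
    moreover have "bracket L i m \<in> carrier L" using i *(3) bracket_closed by auto
    ultimately show ?thesis unfolding *(1) Rb_rec[OF i *(3) \<phi> *(4,2,5)]
      by (simp add: Rb_zero i lext_zero)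
  qed
qed

lemma Rx_constant:
  assumes "x \<in> carrier L" "\<phi> \<in> carrier fm" "\<And>\<nu>. \<lbrakk>set_mset \<nu> \<subseteq> X; \<nu> \<noteq> {#}\<rbrakk> \<Longrightarrow> \<phi> \<nu> = \<zero>\<^bsub>M\<^esub>"
  shows "Rx x \<phi> \<mu> = \<zero>\<^bsub>M\<^esub>"
proof (cases "set_mset \<mu> \<subseteq> X")
  case True
  have "lext M (\<lambda>l. Rb l \<phi> \<mu>) x = lext M (\<lambda>_. \<zero>\<^bsub>M\<^esub>) x"
    by (rule lext_cong[OF K_module]) (use Rb_constant[OF _ assms(2) True assms(3)] assms in auto)
  then show ?thesis using assms by (simp add: Rx_eval lext_zero)
qed (use fm_out[OF Rx_closed] assms in auto)

text \<open>Linear maps from the enveloping algebra to \<open>M\<close> with the action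
  \<open>(x \<phi>)(u) = x (\<phi> u) - \<phi> (x u)\<close>. The functions supported on the empty
  monomial form a copy of \<open>M\<close> in it.\<close>

definition coind :: "('a, 'b multiset \<Rightarrow> 'm, 'b) lie_module" where
  "coind = \<lparr>carrier = carrier fm, monoid.mult = undefined, one = undefined, zero = zero fm, add = add fm,
     smult = smult fm, act = (\<lambda>x \<phi> \<mu>. act M x (\<phi> \<mu>) \<ominus>\<^bsub>M\<^esub> Rx x \<phi> \<mu>)\<rparr>"

lemma coind_simps:
  "carrier coind = carrier fm" "\<zero>\<^bsub>coind\<^esub> = (\<lambda>_. \<zero>\<^bsub>M\<^esub>)" "\<phi> \<oplus>\<^bsub>coind\<^esub> \<psi> = (\<lambda>\<mu>. \<phi> \<mu> \<oplus>\<^bsub>M\<^esub> \<psi> \<mu>)"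
  "c \<odot>\<^bsub>coind\<^esub> \<phi> = (\<lambda>\<mu>. c \<odot>\<^bsub>M\<^esub> \<phi> \<mu>)" "act coind x \<phi> \<mu> = act M x (\<phi> \<mu>) \<ominus>\<^bsub>M\<^esub> Rx x \<phi> \<mu>"
  by (simp_all add: coind_def fm_simps)

lemma coind_module: "Module.module R coind"
proof (rule module_funI[OF K_module, where I = "{\<mu>. set_mset \<mu> \<subseteq> X}"])
  have f: "carrier coind = carrier fm" "\<zero>\<^bsub>coind\<^esub> = \<zero>\<^bsub>fm\<^esub>" "add coind = add fm" "smult coind = smult fm"
    by (simp_all add: coind_def)
  show "carrier coind = {\<phi>. (\<forall>\<mu>\<in>{\<mu>. set_mset \<mu> \<subseteq> X}. \<phi> \<mu> \<in> carrier M) \<and>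
      (\<forall>\<mu>. \<mu> \<notin> {\<mu>. set_mset \<mu> \<subseteq> X} \<longrightarrow> \<phi> \<mu> = \<zero>\<^bsub>M\<^esub>)}"
    "\<zero>\<^bsub>coind\<^esub> = (\<lambda>_. \<zero>\<^bsub>M\<^esub>)" "add coind = (\<lambda>\<phi> \<psi> \<mu>. \<phi> \<mu> \<oplus>\<^bsub>M\<^esub> \<psi> \<mu>)"
    "smult coind = (\<lambda>c \<phi> \<mu>. c \<odot>\<^bsub>M\<^esub> \<phi> \<mu>)"
    unfolding f unfolding fm_def by simp_all
qed

lemma act_linear: "x \<in> carrier L \<Longrightarrow> linear_map R M M (act M x)"
  by (simp add: linear_map_def act_closed act_add_right act_smult_right)

lemma act_zero: "x \<in> carrier L \<Longrightarrow> act M x \<zero>\<^bsub>M\<^esub> = \<zero>\<^bsub>M\<^esub>"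
  by (rule linear_map_zero[OF K_module K_module act_linear])

lemma coind_eval: "linear_map R coind M (\<lambda>\<phi>. \<phi> \<mu>)"
  by (auto simp: linear_map_def coind_simps)

lemma coind_minus: "\<lbrakk>\<phi> \<in> carrier fm; \<psi> \<in> carrier fm\<rbrakk> \<Longrightarrow> (\<phi> \<ominus>\<^bsub>coind\<^esub> \<psi>) \<mu> = \<phi> \<mu> \<ominus>\<^bsub>M\<^esub> \<psi> \<mu>"
  by (rule linear_map_minus[OF coind_module K_module coind_eval]) (simp_all add: coind_simps)

lemma coind_act_closed: "\<lbrakk>x \<in> carrier L; \<phi> \<in> carrier fm\<rbrakk> \<Longrightarrow> act coind x \<phi> \<in> carrier fm"
  by (rule fmI) (auto simp: coind_simps act_closed Rx_closed fm_out act_zero a_minus_def M.M.a_inv_zero)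

text \<open>The bracket law combines the law in \<open>M\<close> with \<open>Rx_bracket\<close>,
  whose reversed order is compensated by the minus sign in the action; the mixed terms commute by
  \<open>Rx_comp\<close> and cancel.\<close>

lemma coind_lie_module: "lie_module R L coind"
proof -
  interpret C: Module.module R coind by (rule coind_module)
  have v: "Rx x \<phi> \<mu> \<in> carrier M" if "x \<in> carrier L" "\<phi> \<in> carrier fm" for x \<phi> \<mu>
    using Rx_closed[OF that] by simp
  show ?thesis
  proof (intro lie_module.intro lie_module_axioms.intro)
    show "lie_algebra R L" ..
    show "Module.module R coind" ..
  next
    fix x \<phi> assume "x \<in> carrier L" "\<phi> \<in> carrier coind"
    then show "act coind x \<phi> \<in> carrier coind" by (simp add: coind_simps(1) coind_act_closed)
  next
    fix x y \<phi> assume a: "x \<in> carrier L" "y \<in> carrier L" "\<phi> \<in> carrier coind"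
    show "act coind (x \<oplus>\<^bsub>L\<^esub> y) \<phi> = act coind x \<phi> \<oplus>\<^bsub>coind\<^esub> act coind y \<phi>"
    proof (rule ext)
      fix \<mu>
      have "Rx (x \<oplus>\<^bsub>L\<^esub> y) \<phi> \<mu> = Rx x \<phi> \<mu> \<oplus>\<^bsub>M\<^esub> Rx y \<phi> \<mu>"
        using linear_mapD(2)[OF Rx_eval_linear] a by (simp add: coind_simps)
      then show "act coind (x \<oplus>\<^bsub>L\<^esub> y) \<phi> \<mu> = (act coind x \<phi> \<oplus>\<^bsub>coind\<^esub> act coind y \<phi>) \<mu>"
        using a v by (simp add: coind_simps act_add_left M.M.add_minus_add act_closed)
    qed
  next
    fix x \<phi> \<psi> assume a: "x \<in> carrier L" "\<phi> \<in> carrier coind" "\<psi> \<in> carrier coind"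
    show "act coind x (\<phi> \<oplus>\<^bsub>coind\<^esub> \<psi>) = act coind x \<phi> \<oplus>\<^bsub>coind\<^esub> act coind x \<psi>"
    proof (rule ext)
      fix \<mu>
      have "Rx x (\<phi> \<oplus>\<^bsub>fm\<^esub> \<psi>) \<mu> = Rx x \<phi> \<mu> \<oplus>\<^bsub>M\<^esub> Rx x \<psi> \<mu>"
        by (rule Rx_add) (use a in \<open>simp_all add: coind_simps\<close>)
      then show "act coind x (\<phi> \<oplus>\<^bsub>coind\<^esub> \<psi>) \<mu> = (act coind x \<phi> \<oplus>\<^bsub>coind\<^esub> act coind x \<psi>) \<mu>"
        using a v by (simp add: coind_simps fm_simps act_add_right M.M.add_minus_add act_closed)
    qed
  next
    fix c x \<phi> assume a: "c \<in> carrier R" "x \<in> carrier L" "\<phi> \<in> carrier coind"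
    show "act coind (c \<odot>\<^bsub>L\<^esub> x) \<phi> = c \<odot>\<^bsub>coind\<^esub> act coind x \<phi>"
    proof (rule ext)
      fix \<mu>
      have "Rx (c \<odot>\<^bsub>L\<^esub> x) \<phi> \<mu> = c \<odot>\<^bsub>M\<^esub> Rx x \<phi> \<mu>"
        using linear_mapD(3)[OF Rx_eval_linear] a by (simp add: coind_simps)
      then show "act coind (c \<odot>\<^bsub>L\<^esub> x) \<phi> \<mu> = (c \<odot>\<^bsub>coind\<^esub> act coind x \<phi>) \<mu>"
        using a v by (simp add: coind_simps act_smult_left a_minus_def M.smult_r_distr M.smult_r_minus act_closed)
    qed
    show "act coind x (c \<odot>\<^bsub>coind\<^esub> \<phi>) = c \<odot>\<^bsub>coind\<^esub> act coind x \<phi>"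
    proof (rule ext)
      fix \<mu>
      have "Rx x (c \<odot>\<^bsub>fm\<^esub> \<phi>) \<mu> = c \<odot>\<^bsub>M\<^esub> Rx x \<phi> \<mu>"
        using linear_mapD(3)[OF Rx_linear] a by (simp add: coind_simps fm_simps)
      then show "act coind x (c \<odot>\<^bsub>coind\<^esub> \<phi>) \<mu> = (c \<odot>\<^bsub>coind\<^esub> act coind x \<phi>) \<mu>"
        using a v by (simp add: coind_simps fm_simps act_smult_right a_minus_def M.smult_r_distr M.smult_r_minus act_closed)
    qed
  next
    fix x y \<phi> assume a: "x \<in> carrier L" "y \<in> carrier L" "\<phi> \<in> carrier coind"
    then have \<phi>: "\<phi> \<in> carrier fm" by (simp add: coind_simps)
    have xy: "bracket L x y \<in> carrier L" using a bracket_closed by simp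
    have step: "act coind x (act coind y \<phi>) \<mu> =
        (act M x (act M y (\<phi> \<mu>)) \<ominus>\<^bsub>M\<^esub> act M x (Rx y \<phi> \<mu>)) \<ominus>\<^bsub>M\<^esub> (act M y (Rx x \<phi> \<mu>) \<ominus>\<^bsub>M\<^esub> Rx x (Rx y \<phi>) \<mu>)"
      if x: "x \<in> carrier L" and y: "y \<in> carrier L" for x y \<mu>
    proof -
      have af: "(\<lambda>\<mu>. act M y (\<phi> \<mu>)) \<in> carrier fm"
        by (rule fmI) (use y \<phi> act_closed fm_out act_zero in auto)
      have e: "act coind y \<phi> = (\<lambda>\<mu>. act M y (\<phi> \<mu>)) \<ominus>\<^bsub>fm\<^esub> Rx y \<phi>"
        by (rule ext) (use fm_minus[OF af Rx_closed[OF y \<phi>]] in \<open>simp add: coind_simps\<close>)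
      have "Rx x (act coind y \<phi>) \<mu> = Rx x (\<lambda>\<mu>. act M y (\<phi> \<mu>)) \<mu> \<ominus>\<^bsub>M\<^esub> Rx x (Rx y \<phi>) \<mu>"
        unfolding e
        using linear_map_minus[OF fm_module fm_module Rx_linear[OF x] af Rx_closed[OF y \<phi>]]
          fm_minus[OF Rx_closed[OF x af] Rx_closed[OF x Rx_closed[OF y \<phi>]]] by simp
      also have "Rx x (\<lambda>\<mu>. act M y (\<phi> \<mu>)) \<mu> = act M y (Rx x \<phi> \<mu>)"
        by (rule Rx_comp[OF act_linear[OF y] x \<phi>])
      finally have 1: "Rx x (act coind y \<phi>) \<mu> = act M y (Rx x \<phi> \<mu>) \<ominus>\<^bsub>M\<^esub> Rx x (Rx y \<phi>) \<mu>" .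
      have 2: "act M x (act coind y \<phi> \<mu>) = act M x (act M y (\<phi> \<mu>)) \<ominus>\<^bsub>M\<^esub> act M x (Rx y \<phi> \<mu>)"
        unfolding coind_simps(5)
        by (rule linear_map_minus[OF K_module K_module act_linear[OF x]]) (use v \<phi> y act_closed in auto)
      show ?thesis unfolding coind_simps(5)[of x] 1 2 ..
    qed
    show "act coind (bracket L x y) \<phi> = act coind x (act coind y \<phi>) \<ominus>\<^bsub>coind\<^esub> act coind y (act coind x \<phi>)"
    proof (rule ext)
      fix \<mu>
      have m: "(act coind x (act coind y \<phi>) \<ominus>\<^bsub>coind\<^esub> act coind y (act coind x \<phi>)) \<mu> =
          act coind x (act coind y \<phi>) \<mu> \<ominus>\<^bsub>M\<^esub> act coind y (act coind x \<phi>) \<mu>"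
        by (rule coind_minus) (use a \<phi> coind_act_closed in auto)
      show "act coind (bracket L x y) \<phi> \<mu> = (act coind x (act coind y \<phi>) \<ominus>\<^bsub>coind\<^esub> act coind y (act coind x \<phi>)) \<mu>"
      proof (cases "set_mset \<mu> \<subseteq> X")
        case True
        show ?thesis
          unfolding m step[OF a(1,2)] step[OF a(2,1)] coind_simps(5)[of "bracket L x y"]
            Rx_bracket[OF a(1,2) \<phi> True] act_bracket[OF a(1,2) fm_val[OF \<phi>]]
          by (rule M.M.commutator_identity) (use a \<phi> v act_closed Rx_closed in auto)
      next
        case False
        then show ?thesis unfolding m
          using fm_out[OF coind_act_closed[OF xy \<phi>] False] fm_out[OF coind_act_closed[OF a(1) coind_act_closed[OF a(2) \<phi>]] False]
            fm_out[OF coind_act_closed[OF a(2) coind_act_closed[OF a(1) \<phi>]] False]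
          by (simp add: a_minus_def M.M.a_inv_zero)
      qed
    qed
  qed
qed

end

section \<open>The Koszul contraction and acyclicity on subalgebras\<close>

text \<open>The ordered basis of \<open>L\<close> must contain a basis of \<open>S\<close>, because
  the contraction moves letters belonging to \<open>S\<close> in and out of monomials over all of
  \<open>X\<close>. This plays the part of freeness of the enveloping algebra of \<open>L\<close>
  over that of \<open>S\<close>.\<close>

locale pbw_sub = pbw_module R L M X lt + lie_sub R L M S
  for R :: "('a, 'x) ring_scheme" (structure) and L :: "('a, 'b, 'y) lie_algebra_scheme" (structure)
    and M :: "('a, 'm, 'b, 'z) lie_module_scheme" (structure) and X :: "'b set" and lt :: "'b \<Rightarrow> 'b \<Rightarrow> bool"
    and S :: "'b set" +
  assumes S_span: "x \<in> S \<Longrightarrow> \<exists>l. set l \<subseteq> carrier R \<times> (X \<inter> S) \<and> lincomb L id l = x"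
begin

lemma lie_sub_self: "lie_sub R L M S" ..

lemma coind_sub: "lie_sub R L coind S"
  by (intro lie_sub.intro coind_lie_module lie_sub_axioms.intro S_sub S_zero S_add S_smult S_bracket)

abbreviation "CJ \<equiv> cochain R L coind S"

text \<open>Insertion sort: by skew symmetry the new letter travels to the right, until the tuple is
  increasing or two equal letters meet and alternation gives zero.\<close>

lemma sorted_insert:
  "\<lbrakk>C (Suc q) F; x \<in> X \<inter> S; set ys \<subseteq> X \<inter> S; length ys = q; sorted_wrt lt ys;
    \<And>zs. \<lbrakk>set zs \<subseteq> insert x (set ys); length zs = Suc q; sorted_wrt lt zs\<rbrakk> \<Longrightarrow> F zs = \<zero>\<^bsub>M\<^esub>\<rbrakk> \<Longrightarrow> F (x # ys) = \<zero>\<^bsub>M\<^esub>"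
proof (induction q arbitrary: F ys)
  case 0
  then show ?case by simp
next
  case (Suc q)
  note F = Suc.prems(1) and x = Suc.prems(2)
  obtain y ys' where ys: "ys = y # ys'" "length ys' = q" using Suc.prems(4) by (cases ys) auto
  have y: "y \<in> X \<inter> S" and ys': "set ys' \<subseteq> X \<inter> S" "sorted_wrt lt ys'" "\<forall>z\<in>set ys'. lt y z" using Suc.prems ys by auto
  have LS': "ys' \<in> LS q" using ys' ys by (auto simp: lists_of_def)
  consider "lt x y" | "x = y" | "lt y x" using lt_total by blast
  then show ?case
  proof cases
    case 1
    have "sorted_wrt lt (x # ys)" using 1 Suc.prems(5) ys lt_trans by auto
    then show ?thesis by (intro Suc.prems(6)) (use Suc.prems in auto)
  next
    case 2
    then show ?thesis using C_self[OF F] x LS' ys by simp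
  next
    case 3
    have "F (y # x # ys') = \<zero>\<^bsub>M\<^esub>"
    proof (rule Suc.IH[of "\<lambda>zs. F (y # zs)", OF _ x ys'(1) ys(2) ys'(2)])
      show "C (Suc q) (\<lambda>zs. F (y # zs))" by (rule C_inner[OF F]) (use y in simp)
      fix zs assume zs: "set zs \<subseteq> insert x (set ys')" "length zs = Suc q" "sorted_wrt lt zs"
      show "F (y # zs) = \<zero>\<^bsub>M\<^esub>"
        by (rule Suc.prems(6)) (use zs ys ys' 3 in auto)
    qed
    then show ?thesis using C_skew[OF F, of x y ys'] x y LS' ys by (simp add: M.M.a_inv_zero)
  qed
qed

lemma zero_on_basis:
  "\<lbrakk>C q F; \<And>zs. \<lbrakk>set zs \<subseteq> X \<inter> S; length zs = q; sorted_wrt lt zs\<rbrakk> \<Longrightarrow> F zs = \<zero>\<^bsub>M\<^esub>;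
    set xs \<subseteq> X \<inter> S; length xs = q\<rbrakk> \<Longrightarrow> F xs = \<zero>\<^bsub>M\<^esub>"
proof (induction q arbitrary: F xs)
  case (Suc q)
  obtain x ys where xs: "xs = x # ys" "length ys = q" using Suc.prems(4) by (cases xs) auto
  have x: "x \<in> X \<inter> S" and ys: "set ys \<subseteq> X \<inter> S" using Suc.prems(3) xs by auto
  have "F (x # ys) = \<zero>\<^bsub>M\<^esub>"
  proof (rule Suc.IH[of "\<lambda>zs. F (x # zs)", OF _ _ ys xs(2)])
    show "C q (\<lambda>zs. F (x # zs))" by (rule C_inner[OF Suc.prems(1)]) (use x in simp)
    fix zs assume zs: "set zs \<subseteq> X \<inter> S" "length zs = q" "sorted_wrt lt zs"
    show "F (x # zs) = \<zero>\<^bsub>M\<^esub>"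
    proof (rule sorted_insert[OF Suc.prems(1) x zs])
      fix us assume "set us \<subseteq> insert x (set zs)" "length us = Suc q" "sorted_wrt lt us"
      then show "F us = \<zero>\<^bsub>M\<^esub>" using x zs(1) by (intro Suc.prems(2)) blast+
    qed
  qed
  then show ?case using xs by simp
qed simp

lemma zero_of_basis:
  "\<lbrakk>C q F; \<And>zs. \<lbrakk>set zs \<subseteq> X \<inter> S; length zs = q\<rbrakk> \<Longrightarrow> F zs = \<zero>\<^bsub>M\<^esub>; xs \<in> LS q\<rbrakk> \<Longrightarrow> F xs = \<zero>\<^bsub>M\<^esub>"
proof (induction q arbitrary: F xs)
  case (Suc q)
  note F = Suc.prems(1)
  from Suc.prems(3) obtain x ys where xs: "xs = x # ys" "x \<in> S" "ys \<in> LS q" by (rule lists_of_SucE)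
  have b: "F (a # ys) = \<zero>\<^bsub>M\<^esub>" if a: "a \<in> X \<inter> S" for a
    by (rule Suc.IH[of "\<lambda>zs. F (a # zs)", OF C_inner[OF F] _ xs(3)]) (use a Suc.prems(2) in auto)
  obtain l where l: "set l \<subseteq> carrier R \<times> (X \<inter> S)" "lincomb L id l = x" using S_span xs(2) by blast
  have "lincomb L id l \<in> S \<and> F (lincomb L id l # ys) = \<zero>\<^bsub>M\<^esub>"
    using l(1)
  proof (induction l)
    case Nil
    then show ?case using S_zero C_zero_head[OF F xs(3)] by simp
  next
    case (Cons p l)
    have p: "fst p \<in> carrier R" "snd p \<in> X \<inter> S" and l: "set l \<subseteq> carrier R \<times> (X \<inter> S)"
      using Cons.prems by auto
    note IH = Cons.IH[OF l, THEN conjunct1] Cons.IH[OF l, THEN conjunct2]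
    have s: "fst p \<odot>\<^bsub>L\<^esub> snd p \<in> S" using S_smult p by auto
    have "F ((fst p \<odot>\<^bsub>L\<^esub> snd p) # ys) = \<zero>\<^bsub>M\<^esub>"
      using C_smult_head[OF F p(1) _ xs(3), of "snd p"] b[OF p(2)] p by simp
    then show ?case using C_add_head[OF F s IH(1) xs(3)] IH S_add[OF s IH(1)] by simp
  qed
  then show ?case using l xs by simp
qed simp

lemma zero_of_sorted:
  assumes "C q F" "\<And>zs. \<lbrakk>set zs \<subseteq> X \<inter> S; length zs = q; sorted_wrt lt zs\<rbrakk> \<Longrightarrow> F zs = \<zero>\<^bsub>M\<^esub>" "xs \<in> LS q"
  shows "F xs = \<zero>\<^bsub>M\<^esub>"
  by (rule zero_of_basis[OF assms(1) _ assms(3)]) (rule zero_on_basis[OF assms(1,2)])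

lemma CJ_eval: "CJ q f \<Longrightarrow> C q (\<lambda>xs. f xs \<mu>)"
  by (rule cochain_map[OF coind_sub lie_sub_self coind_eval])

lemma CJ_val: "\<lbrakk>CJ q f; xs \<in> LS q\<rbrakk> \<Longrightarrow> f xs \<in> carrier fm"
  using lie_sub.C_closed[OF coind_sub] by (simp add: coind_simps(1))

lemma CJ_I: "\<lbrakk>\<And>\<mu>. set_mset \<mu> \<subseteq> X \<Longrightarrow> C q (\<lambda>xs. f xs \<mu>);
    \<And>xs \<mu>. \<lbrakk>xs \<in> LS q; \<not> set_mset \<mu> \<subseteq> X\<rbrakk> \<Longrightarrow> f xs \<mu> = \<zero>\<^bsub>M\<^esub>\<rbrakk> \<Longrightarrow> CJ q f"
proof (induction q arbitrary: f)
  case 0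
  show ?case by (simp add: coind_simps(1), rule fmI) (use 0 in auto)
next
  case (Suc q)
  have c: "C (Suc q) (\<lambda>xs. f xs \<mu>)" if "set_mset \<mu> \<subseteq> X" for \<mu> using Suc.prems(1)[OF that] .
  show ?case unfolding cochain.simps
  proof (intro conjI ballI allI impI)
    fix x assume x: "x \<in> S"
    show "CJ q (\<lambda>zs. f (x # zs))"
      by (rule Suc.IH) (use c Suc.prems(2) x in auto)
  next
    fix x y zs assume a: "x \<in> S" "y \<in> S" "zs \<in> LS q"
    show "f ((x \<oplus>\<^bsub>L\<^esub> y) # zs) = f (x # zs) \<oplus>\<^bsub>coind\<^esub> f (y # zs)"
    proof (rule ext)
      fix \<mu> show "f ((x \<oplus>\<^bsub>L\<^esub> y) # zs) \<mu> = (f (x # zs) \<oplus>\<^bsub>coind\<^esub> f (y # zs)) \<mu>"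
        using C_add_head[OF c a] Suc.prems(2) a S_add by (cases "set_mset \<mu> \<subseteq> X") (auto simp: coind_simps)
    qed
  next
    fix e x zs assume a: "e \<in> carrier R" "x \<in> S" "zs \<in> LS q"
    show "f ((e \<odot>\<^bsub>L\<^esub> x) # zs) = e \<odot>\<^bsub>coind\<^esub> f (x # zs)"
    proof (rule ext)
      fix \<mu> show "f ((e \<odot>\<^bsub>L\<^esub> x) # zs) \<mu> = (e \<odot>\<^bsub>coind\<^esub> f (x # zs)) \<mu>"
        using C_smult_head[OF c a] Suc.prems(2) a S_smult by (cases "set_mset \<mu> \<subseteq> X") (auto simp: coind_simps)
    qed
  next
    fix x p zs assume a: "x \<in> S" "q = Suc p" "zs \<in> LS p"
    show "f (x # x # zs) = \<zero>\<^bsub>coind\<^esub>"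
    proof (rule ext)
      fix \<mu> show "f (x # x # zs) \<mu> = \<zero>\<^bsub>coind\<^esub> \<mu>"
        using C_self[OF c[unfolded a(2)], of \<mu> x zs] Suc.prems(2) a by (cases "set_mset \<mu> \<subseteq> X") (auto simp: coind_simps)
    qed
  qed
qed

text \<open>The leading part of the coboundary with values in the coinduced module, a Koszul differential.\<close>

fun koszul :: "('b list \<Rightarrow> 'b multiset \<Rightarrow> 'm) \<Rightarrow> 'b list \<Rightarrow> 'b multiset \<Rightarrow> 'm" where
  "koszul K [] \<mu> = \<zero>\<^bsub>M\<^esub>"
| "koszul K (x # xs) \<mu> = \<ominus>\<^bsub>M\<^esub> lext M (\<lambda>i. K xs (add_mset i \<mu>)) x \<ominus>\<^bsub>M\<^esub> koszul (\<lambda>zs. K (x # zs)) xs \<mu>"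

abbreviation "dJ \<equiv> cobd L coind"

text \<open>The bracket terms and the action on \<open>M\<close> evaluate \<open>K\<close> at
  \<open>\<mu>\<close> itself, where it vanishes. What remains of the coinduced action is the
  leading part of \<open>Rx\<close>, by \<open>Rx_lead\<close>.\<close>

lemma lie_der_lead:
  assumes x: "x \<in> S" and \<mu>: "set_mset \<mu> \<subseteq> X" and n: "size \<mu> \<le> n"
  shows "\<lbrakk>CJ q K; \<And>ys \<nu>. \<lbrakk>ys \<in> LS q; set_mset \<nu> \<subseteq> X; size \<nu> \<le> n\<rbrakk> \<Longrightarrow> K ys \<nu> = \<zero>\<^bsub>M\<^esub>; xs \<in> LS q\<rbrakk> \<Longrightarrow>
    lie_der coind (act coind x) (bracket L x) K xs \<mu> = \<ominus>\<^bsub>M\<^esub> lext M (\<lambda>i. K xs (add_mset i \<mu>)) x"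
proof (induction q arbitrary: K xs)
  case 0
  have K: "K [] \<in> carrier fm" using CJ_val[OF 0(1)] by simp
  have "Rx x (K []) \<mu> = lext M (\<lambda>i. K [] (add_mset i \<mu>)) x"
    by (rule Rx_lead[OF _ K \<mu>]) (use 0 x n in auto)
  then show ?case using 0 x \<mu> n Rx_closed[OF _ K, of x] act_zero[of x]
    by (simp add: coind_simps a_minus_def del: fm_val) (metis M.M.l_zero M.M.a_inv_closed fm_val S_L)
next
  case (Suc q)
  interpret J: lie_sub R L coind S by (rule coind_sub)
  from Suc.prems(3) obtain y ys where xs: "xs = y # ys" "y \<in> S" "ys \<in> LS q" by (rule lists_of_SucE)
  have i: "CJ q (\<lambda>zs. K (y # zs))" using Suc.prems(1) xs by simp
  have IH: "lie_der coind (act coind x) (bracket L x) (\<lambda>zs. K (y # zs)) ys \<mu> = \<ominus>\<^bsub>M\<^esub> lext M (\<lambda>i. K (y # ys) (add_mset i \<mu>)) x"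
    by (rule Suc.IH[OF i _ xs(3)]) (use Suc.prems(2) xs in auto)
  have b: "bracket L x y \<in> S" using x xs S_bracket by simp
  have "K (bracket L x y # ys) \<mu> = \<zero>\<^bsub>M\<^esub>" by (rule Suc.prems(2)) (use b xs \<mu> n in auto)
  moreover have "lie_der coind (act coind x) (bracket L x) (\<lambda>zs. K (y # zs)) ys \<in> carrier fm"
    using J.LD_closed[OF J.admissible_act[OF x] i xs(3)] by (simp add: coind_simps(1))
  moreover have "K (bracket L x y # ys) \<in> carrier fm" using CJ_val[OF Suc.prems(1)] b xs by simp
  moreover have "lext M (\<lambda>i. K (y # ys) (add_mset i \<mu>)) x \<in> carrier M"
    by (rule lext_in) (use CJ_val[OF Suc.prems(1)] xs x in auto)
  ultimately show ?case using IH xs by (simp add: coind_minus M.M.minus_zero_right)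
qed

lemma koszul_closed: "\<lbrakk>CJ q K; xs \<in> LS (Suc q)\<rbrakk> \<Longrightarrow> koszul K xs \<mu> \<in> carrier M"
proof (induction q arbitrary: K xs)
  case 0
  then obtain x where x: "xs = [x]" "x \<in> S" by (blast elim: lists_of_1E)
  have "lext M (\<lambda>i. K [] (add_mset i \<mu>)) x \<in> carrier M"
    by (rule lext_in) (use CJ_val[OF 0(1)] x in auto)
  then show ?case using x by simp
next
  case (Suc q)
  from Suc.prems(2) obtain y ys where xs: "xs = y # ys" "y \<in> S" "ys \<in> LS (Suc q)" by (rule lists_of_SucE)
  have i: "CJ q (\<lambda>zs. K (y # zs))" using Suc.prems(1) xs by simp
  have "lext M (\<lambda>i. K ys (add_mset i \<mu>)) y \<in> carrier M"
    by (rule lext_in) (use CJ_val[OF Suc.prems(1)] xs in auto)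
  then show ?case using xs Suc.IH[OF i xs(3)] by simp
qed

lemma cobd_lead:
  assumes \<mu>: "set_mset \<mu> \<subseteq> X" and n: "size \<mu> \<le> n"
  shows "\<lbrakk>CJ q K; \<And>ys \<nu>. \<lbrakk>ys \<in> LS q; set_mset \<nu> \<subseteq> X; size \<nu> \<le> n\<rbrakk> \<Longrightarrow> K ys \<nu> = \<zero>\<^bsub>M\<^esub>; xs \<in> LS (Suc q)\<rbrakk> \<Longrightarrow>
    dJ K xs \<mu> = koszul K xs \<mu>"
proof (induction q arbitrary: K xs)
  interpret J: lie_sub R L coind S by (rule coind_sub)
  {
    case 0
    then obtain x where x: "xs = [x]" "x \<in> S" by (blast elim: lists_of_1E)
    have "lie_der coind (act coind x) (bracket L x) K [] \<mu> = \<ominus>\<^bsub>M\<^esub> lext M (\<lambda>i. K [] (add_mset i \<mu>)) x"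
      by (rule lie_der_lead[OF x(2) \<mu> n 0(1,2)]) auto
    moreover have "lie_der coind (act coind x) (bracket L x) K [] \<in> carrier fm"
      using J.LD_closed[OF J.admissible_act[OF x(2)] 0(1), of "[]"] by (simp add: coind_simps(1))
    ultimately show ?case using x zero_fm unfolding x(1) cobd.simps koszul.simps
      by (simp add: coind_minus coind_simps(2) del: lie_der.simps)
  next
    case (Suc q)
    from Suc.prems(3) obtain y ys where xs: "xs = y # ys" "y \<in> S" "ys \<in> LS (Suc q)" by (rule lists_of_SucE)
    have i: "CJ q (\<lambda>zs. K (y # zs))" using Suc.prems(1) xs by simp
    have "lie_der coind (act coind y) (bracket L y) K ys \<mu> = \<ominus>\<^bsub>M\<^esub> lext M (\<lambda>i. K ys (add_mset i \<mu>)) y"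
      by (rule lie_der_lead[OF xs(2) \<mu> n Suc.prems(1,2) xs(3)]) auto
    moreover have "lie_der coind (act coind y) (bracket L y) K ys \<in> carrier fm"
      using J.LD_closed[OF J.admissible_act[OF xs(2)] Suc.prems(1) xs(3)] by (simp add: coind_simps(1))
    moreover have "dJ (\<lambda>zs. K (y # zs)) ys \<in> carrier fm"
      using J.d_closed[OF i xs(3)] by (simp add: coind_simps(1))
    moreover have "dJ (\<lambda>zs. K (y # zs)) ys \<mu> = koszul (\<lambda>zs. K (y # zs)) ys \<mu>"
      by (rule Suc.IH[OF i _ xs(3)]) (use Suc.prems(2) xs in auto)
    ultimately show ?case unfolding xs(1) cobd.simps koszul.simps by (simp add: coind_minus)
  }
qed

lemma koszul_zero:
  "\<lbrakk>\<And>i ys. \<lbrakk>i \<in> X; ys \<in> LS q\<rbrakk> \<Longrightarrow> K ys (add_mset i \<mu>) = \<zero>\<^bsub>M\<^esub>; xs \<in> LS (Suc q)\<rbrakk> \<Longrightarrow> koszul K xs \<mu> = \<zero>\<^bsub>M\<^esub>"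
proof (induction q arbitrary: K xs)
  case 0
  then obtain x where x: "xs = [x]" "x \<in> S" by (blast elim: lists_of_1E)
  have "lext M (\<lambda>i. K [] (add_mset i \<mu>)) x = lext M (\<lambda>_. \<zero>\<^bsub>M\<^esub>) x"
    by (rule lext_cong[OF K_module]) (use 0 x in auto)
  then show ?case using x by (simp add: lext_zero a_minus_def M.M.a_inv_zero)
next
  case (Suc q)
  from Suc.prems(2) obtain y ys where xs: "xs = y # ys" "y \<in> S" "ys \<in> LS (Suc q)" by (rule lists_of_SucE)
  have "lext M (\<lambda>i. K ys (add_mset i \<mu>)) y = lext M (\<lambda>_. \<zero>\<^bsub>M\<^esub>) y"
    by (rule lext_cong[OF K_module]) (use Suc.prems(1) xs in auto)
  moreover have "koszul (\<lambda>zs. K (y # zs)) ys \<mu> = \<zero>\<^bsub>M\<^esub>"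
    by (rule Suc.IH[OF _ xs(3)]) (use Suc.prems(1) xs in auto)
  ultimately show ?case using xs by (simp add: lext_zero a_minus_def M.M.a_inv_zero)
qed

lemma koszul_basis:
  assumes "CJ q K" "x \<in> X" "xs \<in> LS q"
  shows "koszul K (x # xs) \<mu> = \<ominus>\<^bsub>M\<^esub> K xs (add_mset x \<mu>) \<ominus>\<^bsub>M\<^esub> koszul (\<lambda>zs. K (x # zs)) xs \<mu>"
proof -
  have "lext M (\<lambda>i. K xs (add_mset i \<mu>)) x = K xs (add_mset x \<mu>)"
    by (rule lext_basis[OF K_module _ assms(2)]) (use CJ_val[OF assms(1,3)] in auto)
  then show ?thesis by simp
qed

text \<open>Two different monomials are allowed, since the homotopy below compares a contracted
  cochain at \<open>\<mu>\<close> with the original one at \<open>\<mu>\<close> less a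
  letter.\<close>

lemma koszul_cong:
  "\<lbrakk>CJ q K; CJ q K'; set xs \<subseteq> X \<inter> S; length xs = Suc q;
    \<And>a ys. \<lbrakk>a \<in> set xs; set ys \<subseteq> set xs; length ys = q\<rbrakk> \<Longrightarrow> K ys (add_mset a \<mu>) = K' ys (add_mset a \<mu>')\<rbrakk> \<Longrightarrow>
    koszul K xs \<mu> = koszul K' xs \<mu>'"
proof (induction q arbitrary: K K' xs)
  case 0
  then obtain x where x: "xs = [x]" by (cases xs) auto
  then show ?case using 0 koszul_basis[OF 0(1), of x "[]"] koszul_basis[OF 0(2), of x "[]"] by simp
next
  case (Suc q)
  obtain x ys where xs: "xs = x # ys" "length ys = Suc q" using Suc.prems(4) by (cases xs) auto
  have x: "x \<in> X \<inter> S" and ys: "set ys \<subseteq> X \<inter> S" using Suc.prems(3) xs by auto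
  have LS': "ys \<in> LS (Suc q)" using xs ys by (auto simp: lists_of_def)
  have "koszul (\<lambda>zs. K (x # zs)) ys \<mu> = koszul (\<lambda>zs. K' (x # zs)) ys \<mu>'"
  proof (rule Suc.IH[OF _ _ ys xs(2)])
    show "CJ q (\<lambda>zs. K (x # zs))" "CJ q (\<lambda>zs. K' (x # zs))" using Suc.prems(1,2) x by auto
    fix a zs assume "a \<in> set ys" "set zs \<subseteq> set ys" "length zs = q"
    then show "K (x # zs) (add_mset a \<mu>) = K' (x # zs) (add_mset a \<mu>')"
      using Suc.prems(5)[of a "x # zs"] xs by auto
  qed
  moreover have "K ys (add_mset x \<mu>) = K' ys (add_mset x \<mu>')"
    by (rule Suc.prems(5)) (use xs in auto)
  moreover have "x \<in> X" using x by simp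
  ultimately show ?case
    unfolding xs(1) by (simp add: koszul_basis[OF Suc.prems(1) _ LS'] koszul_basis[OF Suc.prems(2) _ LS'] del: koszul.simps)
qed

text \<open>Makes the condition that all arguments lie above \<open>m\<close> linear: basis elements
  above \<open>m\<close> are kept and the others are sent to zero. The contraction thereby remains
  multilinear.\<close>

definition tail_proj :: "'b \<Rightarrow> 'b \<Rightarrow> 'b" where
  "tail_proj m = lext L (\<lambda>a. if lt m a then a else \<zero>\<^bsub>L\<^esub>)"

lemma tail_proj_linear: "linear_map R L L (tail_proj m)"
  unfolding tail_proj_def by (rule lext_linear[OF module_self]) auto

lemma tail_proj_basis: "a \<in> X \<Longrightarrow> tail_proj m a = (if lt m a then a else \<zero>\<^bsub>L\<^esub>)"
  unfolding tail_proj_def by (rule lext_basis[OF module_self]) auto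

lemma tail_proj_S: assumes "x \<in> S" shows "tail_proj m x \<in> S"
proof -
  obtain l where l: "set l \<subseteq> carrier R \<times> (X \<inter> S)" "lincomb L id l = x" using S_span assms by blast
  have "tail_proj m x = lincomb L (\<lambda>a. if lt m a then a else \<zero>\<^bsub>L\<^esub>) l"
    unfolding tail_proj_def l(2)[symmetric] by (rule lext_eq[OF module_self]) (use l in auto)
  also have "\<dots> \<in> S" using l(1) by (induction l) (auto simp: S_zero S_add S_smult)
  finally show ?thesis .
qed

lemma C_tail_proj: "C q f \<Longrightarrow> C q (\<lambda>xs. f (map (tail_proj m) xs))"
  by (rule cochain_pullback[where T = S]) (auto simp: tail_proj_S linear_mapD[OF tail_proj_linear])

definition least_S :: "'b multiset \<Rightarrow> 'b" where
  "least_S \<mu> = (SOME m. m \<in># \<mu> \<and> m \<in> S \<and> (\<forall>a\<in>#\<mu>. a \<in> S \<longrightarrow> \<not> lt a m))"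

lemma least_S:
  assumes "a \<in># \<mu>" "a \<in> S"
  shows "least_S \<mu> \<in># \<mu>" "least_S \<mu> \<in> S" "\<And>b. \<lbrakk>b \<in># \<mu>; b \<in> S\<rbrakk> \<Longrightarrow> \<not> lt b (least_S \<mu>)"
proof -
  have "\<exists>m. m \<in># \<mu> \<and> m \<in> S \<and> (\<forall>a\<in>#\<mu>. a \<in> S \<longrightarrow> \<not> lt a m)"
    using ex_lt_min[of "set_mset \<mu> \<inter> S"] assms by auto
  from someI_ex[OF this] show "least_S \<mu> \<in># \<mu>" "least_S \<mu> \<in> S" "\<And>b. \<lbrakk>b \<in># \<mu>; b \<in> S\<rbrakk> \<Longrightarrow> \<not> lt b (least_S \<mu>)"
    unfolding least_S_def by auto
qed

lemma least_S_eq: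
  assumes "m \<in># \<mu>" "m \<in> S" "\<And>a. \<lbrakk>a \<in># \<mu>; a \<in> S\<rbrakk> \<Longrightarrow> \<not> lt a m"
  shows "least_S \<mu> = m"
  using least_S[OF assms(1,2)] assms lt_total by blast

text \<open>The contraction of the Koszul complex of \<open>S\<close> moves the smallest basis element of \<open>S\<close> occurring in a
  monomial into the exterior factor, provided that it is smaller than all elements there.\<close>

definition contract :: "nat \<Rightarrow> ('b list \<Rightarrow> 'b multiset \<Rightarrow> 'm) \<Rightarrow> 'b list \<Rightarrow> 'b multiset \<Rightarrow> 'm" where
  "contract n h ys \<nu> = (if size \<nu> = Suc n \<and> set_mset \<nu> \<subseteq> X \<and> (\<exists>a\<in>#\<nu>. a \<in> S)
     then h (least_S \<nu> # map (tail_proj (least_S \<nu>)) ys) (\<nu> - {#least_S \<nu>#}) else \<zero>\<^bsub>M\<^esub>)"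

lemma contract_CJ:
  assumes h: "CJ (Suc q) h" shows "CJ q (contract n h)"
proof (rule CJ_I)
  fix \<nu> assume \<nu>: "set_mset \<nu> \<subseteq> X"
  show "C q (\<lambda>ys. contract n h ys \<nu>)"
  proof (cases "size \<nu> = Suc n \<and> (\<exists>a\<in>#\<nu>. a \<in> S)")
    case True
    then have m: "least_S \<nu> \<in> S" using least_S by blast
    have "C q (\<lambda>ys. h (least_S \<nu> # ys) (\<nu> - {#least_S \<nu>#}))" by (rule C_inner[OF CJ_eval[OF h] m])
    from C_tail_proj[OF this] show ?thesis using True \<nu> by (simp add: contract_def)
  next
    case False
    then have "(\<lambda>ys. contract n h ys \<nu>) = (\<lambda>_. \<zero>\<^bsub>M\<^esub>)" by (auto simp: contract_def fun_eq_iff)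
    then show ?thesis using C_zero by simp
  qed
qed (simp add: contract_def)

text \<open>It suffices to test increasing tuples of basis elements. Below size \<open>n\<close>
  both summands vanish. In size \<open>n\<close>, if no letter of \<open>S\<close> in
  \<open>\<mu>\<close> precedes the first argument, a single Koszul term survives and it is
  \<open>- h\<close>. Otherwise the least letter \<open>m\<close> of \<open>S\<close> in
  \<open>\<mu>\<close> is moved from the monomial to the arguments, and closedness of
  \<open>h\<close> at the enlarged tuple identifies the Koszul sum with \<open>- h\<close>.\<close>

lemma contract_homotopy:
  assumes h: "CJ (Suc q) h" and closed: "\<And>xs. xs \<in> LS (Suc (Suc q)) \<Longrightarrow> dJ h xs = \<zero>\<^bsub>coind\<^esub>"
    and van: "\<And>ys \<nu>. \<lbrakk>ys \<in> LS (Suc q); set_mset \<nu> \<subseteq> X; size \<nu> < n\<rbrakk> \<Longrightarrow> h ys \<nu> = \<zero>\<^bsub>M\<^esub>"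
    and \<mu>: "set_mset \<mu> \<subseteq> X" "size \<mu> \<le> n" and xs: "xs \<in> LS (Suc q)"
  shows "dJ (contract n h) xs \<mu> \<oplus>\<^bsub>M\<^esub> h xs \<mu> = \<zero>\<^bsub>M\<^esub>"
proof (rule zero_of_sorted[OF _ _ xs])
  interpret J: lie_sub R L coind S by (rule coind_sub)
  let ?K = "contract n h"
  have K: "CJ q ?K" by (rule contract_CJ[OF h])
  show "C (Suc q) (\<lambda>xs. dJ ?K xs \<mu> \<oplus>\<^bsub>M\<^esub> h xs \<mu>)"
    by (intro C_add CJ_eval h J.d_C K)
  fix zs assume zs: "set zs \<subseteq> X \<inter> S" "length zs = Suc q" "sorted_wrt lt zs"
  obtain x xs where xxs: "zs = x # xs" "length xs = q" using zs(2) by (cases zs) auto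
  have x: "x \<in> X" "x \<in> S" and xs: "set xs \<subseteq> X \<inter> S" "\<And>a. a \<in> set xs \<Longrightarrow> lt x a" using zs xxs by auto
  have LSx: "xs \<in> LS q" "zs \<in> LS (Suc q)" using xs x xxs by (auto simp: lists_of_def)
  have d: "dJ ?K zs \<mu> = koszul ?K zs \<mu>"
    by (rule cobd_lead[OF \<mu> K _ LSx(2)]) (auto simp: contract_def)
  have proj: "map (tail_proj m) ys = ys" if "set ys \<subseteq> X" "\<And>a. a \<in> set ys \<Longrightarrow> lt m a" for m ys
    using that by (intro map_idI) (auto simp: tail_proj_basis)
  have hcl: "h zs \<mu> \<in> carrier M" using CJ_val[OF h LSx(2)] by simp
  show "dJ ?K zs \<mu> \<oplus>\<^bsub>M\<^esub> h zs \<mu> = \<zero>\<^bsub>M\<^esub>"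
  proof (cases "size \<mu> = n")
    case False
    have "koszul ?K zs \<mu> = \<zero>\<^bsub>M\<^esub>"
      by (rule koszul_zero[OF _ LSx(2)]) (use False in \<open>auto simp: contract_def\<close>)
    moreover have "h zs \<mu> = \<zero>\<^bsub>M\<^esub>" by (rule van[OF LSx(2) \<mu>(1)]) (use False \<mu>(2) in simp)
    ultimately show ?thesis using d by simp
  next
    case True
    show ?thesis
    proof (cases "\<exists>a\<in>#\<mu>. a \<in> S \<and> lt a x")
      case False
      have m: "least_S (add_mset x \<mu>) = x"
        by (rule least_S_eq) (use x False in auto)
      have 1: "?K xs (add_mset x \<mu>) = h zs \<mu>"
        using x \<mu> True m proj[of xs x] xs xxs by (auto simp: contract_def)
      have "koszul (\<lambda>zs. ?K (x # zs)) xs \<mu> = koszul (\<lambda>zs _. \<zero>\<^bsub>M\<^esub>) xs \<mu>"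
      proof (cases q)
        case 0 then show ?thesis using xxs by simp
      next
        case (Suc p)
        show ?thesis
        proof (rule koszul_cong[where q = p])
          show "CJ p (\<lambda>zs. ?K (x # zs))" using K x Suc by simp
          show "CJ p (\<lambda>zs _. \<zero>\<^bsub>M\<^esub>)" using J.C_zero by (simp add: coind_simps)
          fix a ys assume a: "a \<in> set xs" and ys: "set ys \<subseteq> set xs" "length ys = p"
          let ?\<nu> = "add_mset a \<mu>"
          have aS: "a \<in> S" "a \<in> X" using a xs by auto
          have lm: "least_S ?\<nu> \<in># ?\<nu>" "least_S ?\<nu> \<in> S" using least_S[of a ?\<nu>] aS by auto
          \<comment> \<open>The letter about to be contracted does not precede \<open>x\<close>, so
            the projection sends the argument \<open>x\<close> to zero and the whole term
            vanishes.\<close>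
          then have "\<not> lt (least_S ?\<nu>) x" using False xs(2)[OF a] lt_asym by auto
          then have "tail_proj (least_S ?\<nu>) x = \<zero>\<^bsub>L\<^esub>" using tail_proj_basis x by simp
          moreover have "h (least_S ?\<nu> # \<zero>\<^bsub>L\<^esub> # map (tail_proj (least_S ?\<nu>)) ys) (?\<nu> - {#least_S ?\<nu>#}) = \<zero>\<^bsub>M\<^esub>"
          proof (rule C_zero_head[where f = "\<lambda>zs. h (least_S ?\<nu> # zs) (?\<nu> - {#least_S ?\<nu>#})"])
            show "C (Suc p) (\<lambda>zs. h (least_S ?\<nu> # zs) (?\<nu> - {#least_S ?\<nu>#}))"
              using C_inner[OF CJ_eval[OF h] lm(2)] Suc by simp
            show "map (tail_proj (least_S ?\<nu>)) ys \<in> LS p"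
              using ys xs tail_proj_S by (auto simp: lists_of_def)
          qed
          ultimately show "?K (x # ys) ?\<nu> = \<zero>\<^bsub>M\<^esub>" by (simp add: contract_def)
        qed (use xs xxs Suc in auto)
      qed
      also have "\<dots> = \<zero>\<^bsub>M\<^esub>"
        using koszul_zero[where K = "\<lambda>_ _. \<zero>\<^bsub>M\<^esub>" and q = "q - 1"] LSx(1) xxs by (cases q) auto
      finally have 2: "koszul (\<lambda>zs. ?K (x # zs)) xs \<mu> = \<zero>\<^bsub>M\<^esub>" .
      show ?thesis unfolding d using koszul_basis[OF K x(1) LSx(1), of \<mu>] 1 2 hcl xxs
        by (simp add: a_minus_def M.M.a_inv_zero M.M.l_neg)
    next
      case True': True
      then obtain b where b: "b \<in># \<mu>" "b \<in> S" "lt b x" by blast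
      define m where "m = least_S \<mu>"
      have m: "m \<in># \<mu>" "m \<in> S" "\<And>b. \<lbrakk>b \<in># \<mu>; b \<in> S\<rbrakk> \<Longrightarrow> \<not> lt b m"
        using least_S[OF b(1,2)] by (auto simp: m_def)
      have mX: "m \<in> X" using m \<mu> by auto
      have mx: "lt m x" using m(3)[OF b(1,2)] b(3) lt_total[of m b] lt_trans by blast
      have mz: "lt m a" if "a \<in> set zs" for a using that xxs xs(2) mx lt_trans by auto
      obtain \<nu> where \<nu>: "\<mu> = add_mset m \<nu>" using m(1) by (metis insert_DiffM)
      have \<nu>X: "set_mset \<nu> \<subseteq> X" "size \<nu> < n" using \<mu> \<nu> True by auto
      have hm: "CJ q (\<lambda>zs. h (m # zs))" using h m by simp
      have "koszul ?K zs \<mu> = koszul (\<lambda>zs. h (m # zs)) zs \<nu>"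
      proof (rule koszul_cong[OF K hm zs(1,2)])
        fix a ys assume a: "a \<in> set zs" and ys: "set ys \<subseteq> set zs" "length ys = q"
        have l: "least_S (add_mset a \<mu>) = m"
          by (rule least_S_eq) (use m mz[OF a] lt_asym in auto)
        have "map (tail_proj m) ys = ys" by (rule proj) (use ys zs mz in auto)
        then show "?K ys (add_mset a \<mu>) = h (m # ys) (add_mset a \<nu>)"
          using l a zs \<mu> True m \<nu> by (auto simp: contract_def add_mset_commute)
      qed
      \<comment> \<open>As \<open>\<nu>\<close> has size less than \<open>n\<close>, the coboundary
        of \<open>h\<close> there reduces to its leading part, which closedness makes zero.\<close>
      moreover have "koszul h (m # zs) \<nu> = \<zero>\<^bsub>M\<^esub>"
      proof -
        have mzs: "m # zs \<in> LS (Suc (Suc q))" using m LSx by simp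
        have "dJ h (m # zs) \<nu> = koszul h (m # zs) \<nu>"
        proof (rule cobd_lead[OF \<nu>X(1) order_refl h _ mzs])
          fix ys \<rho> assume "ys \<in> LS (Suc q)" "set_mset \<rho> \<subseteq> X" "size \<rho> \<le> size \<nu>"
          then show "h ys \<rho> = \<zero>\<^bsub>M\<^esub>" using van \<nu>X by simp
        qed
        then show ?thesis using closed[OF mzs] by (simp add: coind_simps)
      qed
      ultimately have "\<ominus>\<^bsub>M\<^esub> h zs \<mu> \<ominus>\<^bsub>M\<^esub> koszul ?K zs \<mu> = \<zero>\<^bsub>M\<^esub>"
        using koszul_basis[OF h mX LSx(2), of \<nu>] \<nu> by simp
      moreover have "koszul ?K zs \<mu> \<in> carrier M" by (rule koszul_closed[OF K LSx(2)])
      ultimately have "koszul ?K zs \<mu> = \<ominus>\<^bsub>M\<^esub> h zs \<mu>"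
        using M.M.minus_zero_iff hcl by simp
      then show ?thesis unfolding d using hcl by (simp add: M.M.l_neg)
    qed
  qed
qed

text \<open>Successive approximation along the size of monomials: the \<open>n\<close>-th correction
  is supported in size \<open>n + 1\<close>, and its coboundary removes the error in size
  \<open>n\<close>.\<close>

primrec primitive :: "('b list \<Rightarrow> 'b multiset \<Rightarrow> 'm) \<Rightarrow> nat \<Rightarrow> 'b list \<Rightarrow> 'b multiset \<Rightarrow> 'm" where
  "primitive f 0 xs = \<zero>\<^bsub>coind\<^esub>"
| "primitive f (Suc n) xs = primitive f n xs \<ominus>\<^bsub>coind\<^esub> contract n (\<lambda>zs. f zs \<ominus>\<^bsub>coind\<^esub> dJ (primitive f n) zs) xs"

text \<open>The approximations become stationary at each monomial, and infinite support is allowed,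
  so they have a limit: its value at \<open>\<nu>\<close> is read off at stage
  \<open>size \<nu>\<close>. The contraction is applied afresh to the current error, which stays
  closed and vanishes in smaller sizes.\<close>

theorem coind_acyclic:
  assumes f: "CJ (Suc q) f" and closed: "\<And>xs. xs \<in> LS (Suc (Suc q)) \<Longrightarrow> dJ f xs = \<zero>\<^bsub>coind\<^esub>"
  shows "\<exists>g. CJ q g \<and> (\<forall>xs\<in>LS (Suc q). dJ g xs = f xs)"
proof -
  interpret J: lie_sub R L coind S by (rule coind_sub)
  let ?G = "primitive f"
  let ?h = "\<lambda>n zs. f zs \<ominus>\<^bsub>coind\<^esub> dJ (?G n) zs"
  have G: "CJ q (?G n)" for n
  proof (induction n)
    case 0 show ?case using J.C_zero by simp
  next
    case (Suc n)
    have "CJ (Suc q) (?h n)" by (intro J.C_minus f J.d_C Suc)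
    from contract_CJ[OF this, of n] show ?case using J.C_minus[OF Suc] by simp
  qed
  have h: "CJ (Suc q) (?h n)" for n by (intro J.C_minus f J.d_C G)
  have hclosed: "dJ (?h n) xs = \<zero>\<^bsub>coind\<^esub>" if "xs \<in> LS (Suc (Suc q))" for n xs
    using J.d_minus[OF f J.d_C[OF G] that, of n] closed[OF that] J.d_d[OF G that, of n]
    by (simp add: a_minus_def J.M.M.a_inv_zero)
  have van: "?h n xs \<mu> = \<zero>\<^bsub>M\<^esub>" if "xs \<in> LS (Suc q)" "set_mset \<mu> \<subseteq> X" "size \<mu> < n" for n xs \<mu>
    using that
  proof (induction n arbitrary: xs \<mu>)
    case (Suc n)
    note xs = Suc.prems(1)
    let ?K = "contract n (?h n)"
    have K: "CJ q ?K" by (rule contract_CJ[OF h])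
    have c: "f xs \<in> carrier fm" "dJ (?G n) xs \<in> carrier fm" "dJ ?K xs \<in> carrier fm"
      using CJ_val[OF f xs] CJ_val[OF J.d_C[OF G] xs] CJ_val[OF J.d_C[OF K] xs] by auto
    have "?G (Suc n) = (\<lambda>xs. ?G n xs \<ominus>\<^bsub>coind\<^esub> ?K xs)" by (rule ext) simp
    then have "dJ (?G (Suc n)) xs = dJ (?G n) xs \<ominus>\<^bsub>coind\<^esub> dJ ?K xs"
      using J.d_minus[OF G K xs] by simp
    then have "?h (Suc n) xs \<mu> = f xs \<mu> \<ominus>\<^bsub>M\<^esub> (dJ (?G n) xs \<mu> \<ominus>\<^bsub>M\<^esub> dJ ?K xs \<mu>)"
      using c coind_minus[OF c(2,3)] J.M.M.minus_closed[of "dJ (?G n) xs" "dJ ?K xs"]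
      by (simp add: coind_minus coind_simps(1))
    also have "\<dots> = dJ ?K xs \<mu> \<oplus>\<^bsub>M\<^esub> (f xs \<mu> \<ominus>\<^bsub>M\<^esub> dJ (?G n) xs \<mu>)"
    proof -
      have "u \<ominus>\<^bsub>M\<^esub> (v \<ominus>\<^bsub>M\<^esub> w) = w \<oplus>\<^bsub>M\<^esub> (u \<ominus>\<^bsub>M\<^esub> v)" if "u \<in> carrier M" "v \<in> carrier M" "w \<in> carrier M" for u v w
        using that by algebra
      then show ?thesis using c by simp
    qed
    also have "\<dots> = dJ ?K xs \<mu> \<oplus>\<^bsub>M\<^esub> ?h n xs \<mu>" using c by (simp add: coind_minus)
    also have "\<dots> = \<zero>\<^bsub>M\<^esub>"
      by (rule contract_homotopy[OF h hclosed Suc.IH Suc.prems(2) _ xs]) (use Suc.prems(3) in auto)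
    finally show ?case .
  qed simp
  have stable: "?G n xs \<nu> = ?G (size \<nu>) xs \<nu>" if "size \<nu> \<le> n" "xs \<in> LS q" for n xs \<nu>
    using that(1)
  proof (induction n)
    case (Suc n)
    show ?case
    proof (cases "size \<nu> = Suc n")
      case False
      have "contract n (?h n) xs \<nu> = \<zero>\<^bsub>M\<^esub>" using False by (simp add: contract_def)
      then have "?G (Suc n) xs \<nu> = ?G n xs \<nu>"
        using coind_minus[OF CJ_val[OF G that(2)] CJ_val[OF contract_CJ[OF h] that(2)]] CJ_val[OF G that(2)]
        by (simp add: M.M.minus_zero_right)
      then show ?thesis using Suc False by simp
    qed simp
  qed simp
  define g where "g xs \<nu> = ?G (size \<nu>) xs \<nu>" for xs \<nu>
  have g: "CJ q g"
    by (rule CJ_I) (use CJ_eval[OF G] fm_out[OF CJ_val[OF G]] in \<open>auto simp: g_def\<close>)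
  have "dJ g xs = f xs" if xs: "xs \<in> LS (Suc q)" for xs
  proof (rule fm_eqI)
    show c: "dJ g xs \<in> carrier fm" "f xs \<in> carrier fm"
      using CJ_val[OF J.d_C[OF g] xs] CJ_val[OF f xs] by auto
    fix \<mu> assume \<mu>: "set_mset \<mu> \<subseteq> X"
    \<comment> \<open>At \<open>\<mu>\<close> the coboundary sees monomials of size at most
      \<open>size \<mu> + 1\<close>. At this stage the approximation already equals the limit there,
      and its error at \<open>\<mu>\<close> is zero.\<close>
    let ?n = "Suc (size \<mu>)"
    let ?K = "\<lambda>zs. g zs \<ominus>\<^bsub>coind\<^esub> ?G ?n zs"
    have K: "CJ q ?K" by (intro J.C_minus g G)
    have Kv: "?K ys \<nu> = \<zero>\<^bsub>M\<^esub>" if "ys \<in> LS q" "size \<nu> \<le> ?n" for ys \<nu>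
      using coind_minus[OF CJ_val[OF g that(1)] CJ_val[OF G that(1)]] stable[OF that(2,1)] CJ_val[OF G that(1)]
      by (simp add: g_def M.M.minus_self del: primitive.simps)
    have "dJ ?K xs \<mu> = koszul ?K xs \<mu>"
      by (rule cobd_lead[OF \<mu> _ K _ xs, of ?n]) (use Kv in auto)
    also have "\<dots> = \<zero>\<^bsub>M\<^esub>" by (rule koszul_zero[OF _ xs]) (rule Kv, auto)
    finally have "dJ ?K xs \<mu> = \<zero>\<^bsub>M\<^esub>" .
    moreover have "dJ ?K xs = dJ g xs \<ominus>\<^bsub>coind\<^esub> dJ (?G ?n) xs" by (rule J.d_minus[OF g G xs])
    moreover have c': "dJ (?G ?n) xs \<in> carrier fm" using CJ_val[OF J.d_C[OF G] xs] .
    ultimately have "dJ g xs \<mu> = dJ (?G ?n) xs \<mu>"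
      using coind_minus[OF c(1) c'] M.M.minus_zero_iff c(1) c' by simp
    moreover have "f xs \<mu> = dJ (?G ?n) xs \<mu>"
      using van[OF xs \<mu>, of ?n] coind_minus[OF c(2) c'] M.M.minus_zero_iff c(2) c' by simp
    ultimately show "dJ g xs \<mu> = f xs \<mu>" by simp
  qed
  then show ?thesis using g by blast
qed

end

section \<open>Exactness of the Mayer-Vietoris sequence by dimension shifting\<close>

text \<open>Structure transported along \<open>p\<close>, with \<open>s\<close> choosing
  representatives. It serves as a quotient module without cosets, and also as a copy of a module on
  another element type.\<close>

definition image_module :: "('a, 'm, 'b, 'z) lie_module_scheme \<Rightarrow> ('m \<Rightarrow> 'n) \<Rightarrow> ('n \<Rightarrow> 'm) \<Rightarrow> ('a, 'n, 'b) lie_module" where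
  "image_module M p s = \<lparr>carrier = p ` carrier M, monoid.mult = undefined, one = undefined, zero = p \<zero>\<^bsub>M\<^esub>,
     add = (\<lambda>a b. p (s a \<oplus>\<^bsub>M\<^esub> s b)), smult = (\<lambda>c a. p (c \<odot>\<^bsub>M\<^esub> s a)), act = (\<lambda>x a. p (act M x (s a)))\<rparr>"

locale image_data = lie_module R L M
  for R :: "('a, 'x) ring_scheme" (structure) and L :: "('a, 'b, 'y) lie_algebra_scheme" (structure)
    and M :: "('a, 'm, 'b, 'z) lie_module_scheme" (structure) +
  fixes p :: "'m \<Rightarrow> 'n" and s :: "'n \<Rightarrow> 'm"
  assumes s_closed: "m \<in> carrier M \<Longrightarrow> s (p m) \<in> carrier M"
    and p_s: "m \<in> carrier M \<Longrightarrow> p (s (p m)) = p m"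
    and p_add: "\<lbrakk>m \<in> carrier M; n \<in> carrier M\<rbrakk> \<Longrightarrow> p (s (p m) \<oplus>\<^bsub>M\<^esub> s (p n)) = p (m \<oplus>\<^bsub>M\<^esub> n)"
    and p_smult: "\<lbrakk>c \<in> carrier R; m \<in> carrier M\<rbrakk> \<Longrightarrow> p (c \<odot>\<^bsub>M\<^esub> s (p m)) = p (c \<odot>\<^bsub>M\<^esub> m)"
    and p_act: "\<lbrakk>x \<in> carrier L; m \<in> carrier M\<rbrakk> \<Longrightarrow> p (act M x (s (p m))) = p (act M x m)"
begin

abbreviation "Q \<equiv> image_module M p s"

lemma image_simps:
  "carrier Q = p ` carrier M" "\<zero>\<^bsub>Q\<^esub> = p \<zero>\<^bsub>M\<^esub>"
  "\<lbrakk>m \<in> carrier M; n \<in> carrier M\<rbrakk> \<Longrightarrow> p m \<oplus>\<^bsub>Q\<^esub> p n = p (m \<oplus>\<^bsub>M\<^esub> n)"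
  "\<lbrakk>c \<in> carrier R; m \<in> carrier M\<rbrakk> \<Longrightarrow> c \<odot>\<^bsub>Q\<^esub> p m = p (c \<odot>\<^bsub>M\<^esub> m)"
  "\<lbrakk>x \<in> carrier L; m \<in> carrier M\<rbrakk> \<Longrightarrow> act Q x (p m) = p (act M x m)"
  by (simp_all add: image_module_def p_add p_smult p_act)

lemma image_Module: "Module.module R Q"
proof -
  have "abelian_group Q"
  proof (rule abelian_groupI)
    fix x assume "x \<in> carrier Q"
    then obtain m where m: "m \<in> carrier M" "x = p m" by (auto simp: image_simps)
    show "\<exists>y\<in>carrier Q. y \<oplus>\<^bsub>Q\<^esub> x = \<zero>\<^bsub>Q\<^esub>"
      by (rule bexI[of _ "p (\<ominus>\<^bsub>M\<^esub> m)"]) (use m in \<open>simp_all add: image_simps M.M.l_neg\<close>)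
  qed (auto simp: image_simps M.M.a_ac)
  then show ?thesis
    by (rule moduleI[OF R.is_cring])
      (auto simp: image_simps M.smult_l_distr M.smult_r_distr M.smult_assoc1)
qed

lemma image_lie_module: "lie_module R L Q"
proof (intro lie_module.intro lie_module_axioms.intro image_Module)
  interpret Q: Module.module R Q by (rule image_Module)
  show "lie_algebra R L" ..
  have pm: "p m \<ominus>\<^bsub>Q\<^esub> p n = p (m \<ominus>\<^bsub>M\<^esub> n)" if "m \<in> carrier M" "n \<in> carrier M" for m n
  proof -
    have "p (\<ominus>\<^bsub>M\<^esub> n) \<oplus>\<^bsub>Q\<^esub> p n = \<zero>\<^bsub>Q\<^esub>" using that by (simp add: image_simps M.M.l_neg)
    then have "\<ominus>\<^bsub>Q\<^esub> p n = p (\<ominus>\<^bsub>M\<^esub> n)" using Q.M.minus_equality that by (simp add: image_simps)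
    then show ?thesis using that by (simp add: a_minus_def image_simps)
  qed
  fix x y m assume "x \<in> carrier L" "y \<in> carrier L" "m \<in> carrier Q"
  then show "act Q (bracket L x y) m = act Q x (act Q y m) \<ominus>\<^bsub>Q\<^esub> act Q y (act Q x m)"
    by (auto simp: image_simps act_closed act_bracket bracket_closed pm)
qed (auto simp: image_simps act_closed act_add_left act_add_right act_smult_left act_smult_right)

lemma p_linear: "linear_map R M Q p"
  by (auto simp: linear_map_def image_simps)

end

text \<open>Exactness at \<open>H^(j+2)(L)\<close> on the level of cochains: if a class dies on
  \<open>A\<close> and on \<open>B\<close>, and its primitives differ on \<open>D\<close> by a
  coboundary, then it dies on \<open>L\<close>. The primitive \<open>e\<close> on \<open>D\<close>
  has degree \<open>j\<close>, so the smallest case \<open>j = 0\<close> concerns cocycles of degree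
  two.\<close>

definition mayer_vietoris :: "('a, 'x) ring_scheme \<Rightarrow> ('a, 'b, 'y) lie_algebra_scheme \<Rightarrow>
    ('a, 'm, 'b, 'z) lie_module_scheme \<Rightarrow> 'b set \<Rightarrow> 'b set \<Rightarrow> 'b set \<Rightarrow> nat \<Rightarrow> bool" where
  "mayer_vietoris R L M A B D j \<longleftrightarrow> (\<forall>f h1 h2 e.
     cochain R L M (carrier L) (Suc (Suc j)) f \<longrightarrow>
     (\<forall>xs\<in>lists_of (carrier L) (Suc (Suc (Suc j))). cobd L M f xs = \<zero>\<^bsub>M\<^esub>) \<longrightarrow>
     cochain R L M A (Suc j) h1 \<longrightarrow> (\<forall>xs\<in>lists_of A (Suc (Suc j)). cobd L M h1 xs = f xs) \<longrightarrow>
     cochain R L M B (Suc j) h2 \<longrightarrow> (\<forall>xs\<in>lists_of B (Suc (Suc j)). cobd L M h2 xs = f xs) \<longrightarrow>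
     cochain R L M D j e \<longrightarrow> (\<forall>xs\<in>lists_of D (Suc j). cobd L M e xs = h1 xs \<ominus>\<^bsub>M\<^esub> h2 xs) \<longrightarrow>
     (\<exists>g. cochain R L M (carrier L) (Suc j) g \<and> (\<forall>xs\<in>lists_of (carrier L) (Suc (Suc j)). cobd L M g xs = f xs)))"

lemma mayer_vietorisD:
  assumes "mayer_vietoris R L M A B D j"
    "cochain R L M (carrier L) (Suc (Suc j)) f"
    "\<And>xs. xs \<in> lists_of (carrier L) (Suc (Suc (Suc j))) \<Longrightarrow> cobd L M f xs = \<zero>\<^bsub>M\<^esub>"
    "cochain R L M A (Suc j) h1" "\<And>xs. xs \<in> lists_of A (Suc (Suc j)) \<Longrightarrow> cobd L M h1 xs = f xs"
    "cochain R L M B (Suc j) h2" "\<And>xs. xs \<in> lists_of B (Suc (Suc j)) \<Longrightarrow> cobd L M h2 xs = f xs"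
    "cochain R L M D j e" "\<And>xs. xs \<in> lists_of D (Suc j) \<Longrightarrow> cobd L M e xs = h1 xs \<ominus>\<^bsub>M\<^esub> h2 xs"
  obtains g where "cochain R L M (carrier L) (Suc j) g"
    "\<And>xs. xs \<in> lists_of (carrier L) (Suc (Suc j)) \<Longrightarrow> cobd L M g xs = f xs"
proof -
  have "\<exists>g. cochain R L M (carrier L) (Suc j) g \<and> (\<forall>xs\<in>lists_of (carrier L) (Suc (Suc j)). cobd L M g xs = f xs)"
    using assms(1)[unfolded mayer_vietoris_def, rule_format, of f h1 h2 e] assms(2-9) by blast
  then show ?thesis using that by blast
qed

lemma cochain_mono: "\<lbrakk>T \<subseteq> S; cochain R L M S q f\<rbrakk> \<Longrightarrow> cochain R L M T q f"
proof (induction q arbitrary: f)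
  case (Suc q)
  note sub = subsetD[OF Suc.prems(1)] lists_of_mono[OF Suc.prems(1)]
  show ?case unfolding cochain.simps
  proof (intro conjI ballI allI impI)
    show "cochain R L M T q (\<lambda>zs. f (x # zs))" if "x \<in> T" for x
      by (rule Suc.IH[OF Suc.prems(1)]) (use Suc.prems(2) sub that in simp)
  qed (use Suc.prems(2) in \<open>simp_all add: sub\<close>)
qed simp

locale subalgebras = lie_algebra R L + ordered_basis R L X lt
  for R :: "('a, 'x) ring_scheme" (structure) and L :: "('a, 'b, 'y) lie_algebra_scheme" (structure)
    and X :: "'b set" and lt :: "'b \<Rightarrow> 'b \<Rightarrow> bool" +
  fixes A B D :: "'b set"
  assumes sub: "S \<in> {A, B, D} \<Longrightarrow> S \<subseteq> carrier L \<and> \<zero>\<^bsub>L\<^esub> \<in> S \<and> (\<forall>x\<in>S. \<forall>y\<in>S. x \<oplus>\<^bsub>L\<^esub> y \<in> S) \<and>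
      (\<forall>c\<in>carrier R. \<forall>x\<in>S. c \<odot>\<^bsub>L\<^esub> x \<in> S) \<and> (\<forall>x\<in>S. \<forall>y\<in>S. bracket L x y \<in> S) \<and>
      (\<forall>x\<in>S. \<exists>l. set l \<subseteq> carrier R \<times> (X \<inter> S) \<and> lincomb L id l = x)"
    and D_sub: "D \<subseteq> A" "D \<subseteq> B"
begin

lemma pbw_sub_L: "lie_module R L M \<Longrightarrow> pbw_sub R L M X lt (carrier L)"
  for M :: "('a, 'm, 'b, 'z) lie_module_scheme"
proof (intro pbw_sub.intro pbw_module.intro lie_sub.intro ordered_basis_axioms)
  have "X \<inter> carrier L = X" using X_sub by blast
  then show "pbw_sub_axioms R L X (carrier L)"
    unfolding pbw_sub_axioms_def using basis_span by simp
  show "lie_sub_axioms R L (carrier L)"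
    unfolding lie_sub_axioms_def by (simp add: bracket_closed)
qed

lemma pbw_sub_S: "\<lbrakk>lie_module R L M; S \<in> {A, B, D}\<rbrakk> \<Longrightarrow> pbw_sub R L M X lt S"
  for M :: "('a, 'm, 'b, 'z) lie_module_scheme"
proof (intro pbw_sub.intro pbw_module.intro lie_sub.intro ordered_basis_axioms)
  assume S: "S \<in> {A, B, D}"
  show "pbw_sub_axioms R L X S" unfolding pbw_sub_axioms_def using sub[OF S] by blast
  show "lie_sub_axioms R L S" unfolding lie_sub_axioms_def using sub[OF S] by blast
qed

lemma lie_sub_L: "lie_module R L M \<Longrightarrow> lie_sub R L M (carrier L)"
  for M :: "('a, 'm, 'b, 'z) lie_module_scheme"
  by (rule pbw_sub.axioms(2)[OF pbw_sub_L])

lemma lie_sub_S: "\<lbrakk>lie_module R L M; S \<in> {A, B, D}\<rbrakk> \<Longrightarrow> lie_sub R L M S"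
  for M :: "('a, 'm, 'b, 'z) lie_module_scheme"
  by (rule pbw_sub.axioms(2)[OF pbw_sub_S])

text \<open>Dimension shift along \<open>0 -> M -> J -> Q -> 0\<close> with \<open>J\<close>
  coinduced and acyclic on \<open>L\<close>, \<open>A\<close>, \<open>B\<close> and
  \<open>D\<close>. In \<open>J\<close> the cocycle becomes \<open>d g\<close>, and the whole
  configuration turns into one for the image of \<open>g\<close> in \<open>Q\<close>, in degree one
  less. The maps \<open>enc\<close> and \<open>dec\<close> place functions on multisets in the
  element type of \<open>Q\<close>.\<close>

lemma mayer_vietoris_step:
  fixes M :: "('a, 'm, 'b, 'z) lie_module_scheme"
    and enc :: "('b multiset \<Rightarrow> 'm) \<Rightarrow> 'n" and dec :: "'n \<Rightarrow> 'b multiset \<Rightarrow> 'm"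
  assumes M: "lie_module R L M" and enc: "\<And>\<phi>. dec (enc \<phi>) = \<phi>"
    and IH: "\<And>Q :: ('a, 'n, 'b) lie_module. lie_module R L Q \<Longrightarrow> mayer_vietoris R L Q A B D j"
  shows "mayer_vietoris R L M A B D (Suc j)"
proof -
  interpret pbw_module R L M X lt by (intro pbw_module.intro M ordered_basis_axioms)
  let ?J = "coind"
  have J: "lie_module R L ?J" by (rule coind_lie_module)
  \<comment> \<open>Resetting the value at the empty monomial divides out the copy of
    \<open>M\<close>. The quotient is realised by functions vanishing there, so \<open>dec\<close>
    is a linear section and cochains lift from \<open>Q\<close> to \<open>J\<close>.\<close>
  let ?p = "\<lambda>\<phi>. enc (\<phi>({#} := \<zero>\<^bsub>M\<^esub>))"
  interpret Q: image_data R L ?J ?p dec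
  proof (intro image_data.intro J image_data_axioms.intro; unfold coind_simps(1))
    have upd: "\<phi>({#} := \<zero>\<^bsub>M\<^esub>) \<in> carrier fm" if "\<phi> \<in> carrier fm" for \<phi>
      by (rule fmI) (use that fm_out in auto)
    fix \<phi> assume \<phi>: "\<phi> \<in> carrier fm"
    show "dec (?p \<phi>) \<in> carrier fm" "?p (dec (?p \<phi>)) = ?p \<phi>" using upd[OF \<phi>] enc by auto
    show "?p (dec (?p \<phi>) \<oplus>\<^bsub>?J\<^esub> dec (?p \<psi>)) = ?p (\<phi> \<oplus>\<^bsub>?J\<^esub> \<psi>)" if "\<psi> \<in> carrier fm" for \<psi>
      by (rule arg_cong[where f = enc]) (auto simp: enc coind_simps)
    show "?p (c \<odot>\<^bsub>?J\<^esub> dec (?p \<phi>)) = ?p (c \<odot>\<^bsub>?J\<^esub> \<phi>)" if "c \<in> carrier R" for c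
      by (rule arg_cong[where f = enc]) (auto simp: enc coind_simps)
    fix x assume x: "x \<in> carrier L"
    let ?\<psi> = "\<phi>({#} := \<zero>\<^bsub>M\<^esub>)"
    have d: "\<phi> \<ominus>\<^bsub>fm\<^esub> ?\<psi> \<in> carrier fm" using \<phi> upd[OF \<phi>] F.M.minus_closed by blast
    \<comment> \<open>The truncation changes \<open>\<phi>\<close> by a function supported on the
      empty monomial, which \<open>Rx_constant\<close> sends to zero; hence the action descends to
      the quotient.\<close>
    have "Rx x (\<phi> \<ominus>\<^bsub>fm\<^esub> ?\<psi>) \<mu> = \<zero>\<^bsub>M\<^esub>" for \<mu>
      by (rule Rx_constant[OF x d]) (use fm_minus[OF \<phi> upd[OF \<phi>]] \<phi> in \<open>simp add: M.M.minus_self\<close>)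
    then have "Rx x \<phi> \<mu> = Rx x ?\<psi> \<mu>" for \<mu>
      using linear_map_minus[OF fm_module fm_module Rx_linear[OF x] \<phi> upd[OF \<phi>]]
        fm_minus[OF Rx_closed[OF x \<phi>] Rx_closed[OF x upd[OF \<phi>]]]
        M.M.minus_zero_iff[OF fm_val[OF Rx_closed[OF x \<phi>]] fm_val[OF Rx_closed[OF x upd[OF \<phi>]]]] by metis
    then show "?p (act ?J x (dec (?p \<phi>))) = ?p (act ?J x \<phi>)"
      by (intro arg_cong[where f = enc]) (auto simp: enc coind_simps)
  qed
  let ?Q = "image_module ?J ?p dec"
  have Q: "lie_module R L ?Q" by (rule Q.image_lie_module)
  have p_lin: "linear_map R ?J ?Q ?p" by (rule Q.p_linear)
  have p_eq: "\<And>x m. \<lbrakk>x \<in> carrier L; m \<in> carrier ?J\<rbrakk> \<Longrightarrow> ?p (act ?J x m) = act ?Q x (?p m)"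
    using Q.image_simps(5) by simp
  have dec_lin: "linear_map R ?Q ?J dec"
    unfolding linear_map_def
  proof (intro conjI ballI)
    fix a assume "a \<in> carrier ?Q"
    then obtain \<phi> where \<phi>: "\<phi> \<in> carrier ?J" "a = ?p \<phi>" by (auto simp: Q.image_simps(1))
    then show "dec a \<in> carrier ?J" using Q.s_closed by simp
    show "dec (c \<odot>\<^bsub>?Q\<^esub> a) = c \<odot>\<^bsub>?J\<^esub> dec a" if "c \<in> carrier R" for c
      using that \<phi> by (auto simp: Q.image_simps(4) enc coind_simps)
    fix b assume "b \<in> carrier ?Q"
    then obtain \<psi> where \<psi>: "\<psi> \<in> carrier ?J" "b = ?p \<psi>" by (auto simp: Q.image_simps(1))
    show "dec (a \<oplus>\<^bsub>?Q\<^esub> b) = dec a \<oplus>\<^bsub>?J\<^esub> dec b"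
      using Q.image_simps(3)[OF \<phi>(1) \<psi>(1)] \<phi> \<psi> by (auto simp: enc coind_simps)
  qed
  define \<iota> :: "'m \<Rightarrow> 'b multiset \<Rightarrow> 'm" where "\<iota> m = (\<lambda>\<mu>. if \<mu> = {#} then m else \<zero>\<^bsub>M\<^esub>)" for m
  have \<iota>_fm: "\<iota> m \<in> carrier fm" if "m \<in> carrier M" for m
    by (rule fmI) (use that in \<open>auto simp: \<iota>_def\<close>)
  have \<iota>_lin: "linear_map R M ?J \<iota>"
    using \<iota>_fm by (auto simp: linear_map_def coind_simps fun_eq_iff) (auto simp: \<iota>_def)
  have \<iota>_eq: "\<iota> (act M x m) = act ?J x (\<iota> m)" if "x \<in> carrier L" "m \<in> carrier M" for x m
  proof (rule ext)
    fix \<mu>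
    have "Rx x (\<iota> m) \<mu> = \<zero>\<^bsub>M\<^esub>"
      by (rule Rx_constant[OF that(1) \<iota>_fm[OF that(2)]]) (simp add: \<iota>_def)
    then show "\<iota> (act M x m) \<mu> = act ?J x (\<iota> m) \<mu>"
      using that act_zero act_closed by (auto simp: \<iota>_def coind_simps M.M.minus_zero_right)
  qed
  have p\<iota>: "?p (\<iota> m) = \<zero>\<^bsub>?Q\<^esub>" if "m \<in> carrier M" for m
    unfolding Q.image_simps(2) by (rule arg_cong[where f = enc]) (auto simp: \<iota>_def coind_simps)
  have ker: "\<iota> (\<phi> {#}) = \<phi>" if "?p \<phi> = \<zero>\<^bsub>?Q\<^esub>" for \<phi>
  proof -
    have "\<phi>({#} := \<zero>\<^bsub>M\<^esub>) = (\<lambda>_. \<zero>\<^bsub>M\<^esub>)({#} := \<zero>\<^bsub>M\<^esub>)"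
      using that enc unfolding Q.image_simps(2) coind_simps(2) by metis
    then have "(\<phi>({#} := \<zero>\<^bsub>M\<^esub>)) \<mu> = ((\<lambda>_. \<zero>\<^bsub>M\<^esub>)({#} := \<zero>\<^bsub>M\<^esub>)) \<mu>" for \<mu> by simp
    then have "\<phi> \<mu> = \<zero>\<^bsub>M\<^esub>" if "\<mu> \<noteq> {#}" for \<mu> using that by (metis fun_upd_apply)
    then show ?thesis by (auto simp: \<iota>_def)
  qed
  have T: "A \<in> {A, B, D}" "B \<in> {A, B, D}" "D \<in> {A, B, D}" by auto
  have subL: "S \<subseteq> carrier L" if "S \<in> {A, B, D}" for S using sub[OF that] by blast
  have resS: "cochain R L N S q f" if "cochain R L N (carrier L) q f" "S \<in> {A, B, D}"
    for N :: "('a, 'c, 'd) module_scheme" and q f S by (rule cochain_mono[OF subL[OF that(2)] that(1)])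
  have inL: "xs \<in> lists_of (carrier L) q" if "xs \<in> lists_of S q" "S \<in> {A, B, D}" for xs S q
    by (rule lists_of_mono[OF subL[OF that(2)] that(1)])
  note mapJ = cochain_map[OF lie_sub_S[OF M] lie_sub_S[OF J] \<iota>_lin] and dJ = cobd_map[OF lie_sub_S[OF M] lie_sub_S[OF J] \<iota>_lin]
  note mapQ = cochain_map[OF lie_sub_S[OF J] lie_sub_S[OF Q] p_lin] and dQ = cobd_map[OF lie_sub_S[OF J] lie_sub_S[OF Q] p_lin]
  interpret QM: Module.module R ?Q by (rule Q.image_Module)
  show ?thesis unfolding mayer_vietoris_def
  proof (intro allI impI)
    fix f h1 h2 e
    assume f: "cochain R L M (carrier L) (Suc (Suc (Suc j))) f"
      and df: "\<forall>xs\<in>lists_of (carrier L) (Suc (Suc (Suc (Suc j)))). cobd L M f xs = \<zero>\<^bsub>M\<^esub>"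
      and h1: "cochain R L M A (Suc (Suc j)) h1" and dh1: "\<forall>xs\<in>lists_of A (Suc (Suc (Suc j))). cobd L M h1 xs = f xs"
      and h2: "cochain R L M B (Suc (Suc j)) h2" and dh2: "\<forall>xs\<in>lists_of B (Suc (Suc (Suc j))). cobd L M h2 xs = f xs"
      and e: "cochain R L M D (Suc j) e" and de: "\<forall>xs\<in>lists_of D (Suc (Suc j)). cobd L M e xs = h1 xs \<ominus>\<^bsub>M\<^esub> h2 xs"
    interpret LM: lie_sub R L M "carrier L" by (rule lie_sub_L[OF M])
    interpret LJ: lie_sub R L ?J "carrier L" by (rule lie_sub_L[OF J])
    interpret LQ: lie_sub R L ?Q "carrier L" by (rule lie_sub_L[OF Q])
    have \<iota>f: "cochain R L ?J (carrier L) (Suc (Suc (Suc j))) (\<lambda>xs. \<iota> (f xs))"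
      by (rule cochain_map[OF lie_sub_L[OF M] lie_sub_L[OF J] \<iota>_lin f])
    have \<iota>0: "\<iota> \<zero>\<^bsub>M\<^esub> = \<zero>\<^bsub>?J\<^esub>" by (rule linear_map_zero[OF K_module coind_module \<iota>_lin])
    have d\<iota>f: "cobd L ?J (\<lambda>xs. \<iota> (f xs)) xs = \<zero>\<^bsub>?J\<^esub>" if "xs \<in> lists_of (carrier L) (Suc (Suc (Suc (Suc j))))" for xs
      using cobd_map[OF lie_sub_L[OF M] lie_sub_L[OF J] \<iota>_lin \<iota>_eq f that] df that \<iota>0 by simp
    obtain g where g: "cochain R L ?J (carrier L) (Suc (Suc j)) g"
      "\<And>xs. xs \<in> lists_of (carrier L) (Suc (Suc (Suc j))) \<Longrightarrow> cobd L ?J g xs = \<iota> (f xs)"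
      using pbw_sub.coind_acyclic[OF pbw_sub_L[OF M] \<iota>f d\<iota>f] by blast
    \<comment> \<open>Where \<open>h\<close> is a primitive of \<open>f\<close>, the cochain
      \<open>g - \<iota> h\<close> is closed in \<open>J\<close>, hence exact on the subalgebra by
      acyclicity. As \<open>\<iota> h\<close> vanishes in \<open>Q\<close>, the solution
      \<open>u\<close> is a primitive of the image of \<open>g\<close>.\<close>
    have lift: "\<exists>u. cochain R L ?J S (Suc j) u \<and>
        (\<forall>xs\<in>lists_of S (Suc (Suc j)). cobd L ?J u xs = g xs \<ominus>\<^bsub>?J\<^esub> \<iota> (h xs))"
      if S: "S \<in> {A, B, D}" and h: "cochain R L M S (Suc (Suc j)) h"
        and dh: "\<forall>xs\<in>lists_of S (Suc (Suc (Suc j))). cobd L M h xs = f xs" for S h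
    proof -
      interpret SJ: lie_sub R L ?J S by (rule lie_sub_S[OF J S])
      interpret SM: lie_sub R L M S by (rule lie_sub_S[OF M S])
      have gS: "cochain R L ?J S (Suc (Suc j)) g" by (rule resS[OF g(1) S])
      have \<iota>h: "cochain R L ?J S (Suc (Suc j)) (\<lambda>xs. \<iota> (h xs))" by (rule mapJ[OF S S h])
      have cl: "cobd L ?J (\<lambda>xs. g xs \<ominus>\<^bsub>?J\<^esub> \<iota> (h xs)) xs = \<zero>\<^bsub>?J\<^esub>" if xs: "xs \<in> lists_of S (Suc (Suc (Suc j)))" for xs
      proof -
        have "cobd L ?J (\<lambda>xs. \<iota> (h xs)) xs = \<iota> (cobd L M h xs)" by (rule dJ[OF S S \<iota>_eq h xs]) auto
        moreover have "\<iota> (f xs) \<in> carrier ?J" using SJ.d_closed[OF gS xs] g(2)[OF inL[OF xs S]] by simp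
        ultimately show ?thesis
          using SJ.d_minus[OF gS \<iota>h xs] g(2)[OF inL[OF xs S]] dh xs by (simp add: Q.M.M.minus_self)
      qed
      show ?thesis using pbw_sub.coind_acyclic[OF pbw_sub_S[OF M S] SJ.C_minus[OF gS \<iota>h] cl] by blast
    qed
    obtain u1 where u1: "cochain R L ?J A (Suc j) u1"
      "\<forall>xs\<in>lists_of A (Suc (Suc j)). cobd L ?J u1 xs = g xs \<ominus>\<^bsub>?J\<^esub> \<iota> (h1 xs)" using lift[OF T(1) h1 dh1] by blast
    obtain u2 where u2: "cochain R L ?J B (Suc j) u2"
      "\<forall>xs\<in>lists_of B (Suc (Suc j)). cobd L ?J u2 xs = g xs \<ominus>\<^bsub>?J\<^esub> \<iota> (h2 xs)" using lift[OF T(2) h2 dh2] by blast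
    interpret DJ: lie_sub R L ?J D by (rule lie_sub_S[OF J T(3)])
    interpret DM: lie_sub R L M D by (rule lie_sub_S[OF M T(3)])
    have uD: "cochain R L ?J D (Suc j) u1" "cochain R L ?J D (Suc j) u2"
      using cochain_mono[OF D_sub(1) u1(1)] cochain_mono[OF D_sub(2) u2(1)] by auto
    have \<iota>e: "cochain R L ?J D (Suc j) (\<lambda>xs. \<iota> (e xs))" by (rule mapJ[OF T(3) T(3) e])
    \<comment> \<open>On \<open>D\<close> the coboundary of \<open>u1 - u2\<close> is
      \<open>\<iota> h2 - \<iota> h1\<close>, and that of \<open>\<iota> e\<close> is its negative.
      A primitive \<open>z\<close> of the sum becomes, in \<open>Q\<close>, the required datum of
      degree \<open>j\<close>.\<close>
    let ?w = "\<lambda>xs. (u1 xs \<ominus>\<^bsub>?J\<^esub> u2 xs) \<oplus>\<^bsub>?J\<^esub> \<iota> (e xs)"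
    have w: "cochain R L ?J D (Suc j) ?w" by (intro DJ.C_add DJ.C_minus uD \<iota>e)
    have dw: "cobd L ?J ?w xs = \<zero>\<^bsub>?J\<^esub>" if xs: "xs \<in> lists_of D (Suc (Suc j))" for xs
    proof -
      have xA: "xs \<in> lists_of A (Suc (Suc j))" and xB: "xs \<in> lists_of B (Suc (Suc j))"
        using lists_of_mono[OF D_sub(1) xs] lists_of_mono[OF D_sub(2) xs] by auto
      have c: "g xs \<in> carrier ?J" "h1 xs \<in> carrier M" "h2 xs \<in> carrier M"
        using LJ.C_closed[OF g(1) inL[OF xs T(3)]] DM.C_closed[OF cochain_mono[OF D_sub(1) h1] xs]
          DM.C_closed[OF cochain_mono[OF D_sub(2) h2] xs] by auto
      have \<iota>c: "\<iota> (h1 xs) \<in> carrier ?J" "\<iota> (h2 xs) \<in> carrier ?J" using c \<iota>_fm by (auto simp: coind_simps(1))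
      have "cobd L ?J ?w xs = (cobd L ?J u1 xs \<ominus>\<^bsub>?J\<^esub> cobd L ?J u2 xs) \<oplus>\<^bsub>?J\<^esub> cobd L ?J (\<lambda>xs. \<iota> (e xs)) xs"
        using DJ.d_add[OF DJ.C_minus[OF uD] \<iota>e xs] DJ.d_minus[OF uD xs] by simp
      also have "cobd L ?J (\<lambda>xs. \<iota> (e xs)) xs = \<iota> (cobd L M e xs)" by (rule dJ[OF T(3) T(3) \<iota>_eq e xs]) auto
      also have "\<dots> = \<iota> (h1 xs) \<ominus>\<^bsub>?J\<^esub> \<iota> (h2 xs)"
        using de xs linear_map_minus[OF K_module coind_module \<iota>_lin c(2,3)] by simp
      also have "cobd L ?J u1 xs = g xs \<ominus>\<^bsub>?J\<^esub> \<iota> (h1 xs)" using u1(2) xA by blast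
      also have "cobd L ?J u2 xs = g xs \<ominus>\<^bsub>?J\<^esub> \<iota> (h2 xs)" using u2(2) xB by blast
      also have "((a \<ominus>\<^bsub>?J\<^esub> b) \<ominus>\<^bsub>?J\<^esub> (a \<ominus>\<^bsub>?J\<^esub> c)) \<oplus>\<^bsub>?J\<^esub> (b \<ominus>\<^bsub>?J\<^esub> c) = \<zero>\<^bsub>?J\<^esub>"
        if "a \<in> carrier ?J" "b \<in> carrier ?J" "c \<in> carrier ?J" for a b c
        using that by (simp add: a_minus_def Q.M.M.minus_add Q.M.M.a_ac Q.M.M.r_neg1 Q.M.M.r_neg2 Q.M.M.r_neg)
      note this[OF c(1) \<iota>c]
      finally show ?thesis .
    qed
    obtain z where z: "cochain R L ?J D j z" "\<forall>xs\<in>lists_of D (Suc j). cobd L ?J z xs = ?w xs"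
      using pbw_sub.coind_acyclic[OF pbw_sub_S[OF M T(3)] w dw] by blast
    have Qg: "cochain R L ?Q (carrier L) (Suc (Suc j)) (\<lambda>xs. ?p (g xs))"
      by (rule cochain_map[OF lie_sub_L[OF J] lie_sub_L[OF Q] p_lin g(1)])
    have dQg: "cobd L ?Q (\<lambda>xs. ?p (g xs)) xs = \<zero>\<^bsub>?Q\<^esub>" if xs: "xs \<in> lists_of (carrier L) (Suc (Suc (Suc j)))" for xs
      using cobd_map[OF lie_sub_L[OF J] lie_sub_L[OF Q] p_lin p_eq g(1) xs]
      unfolding g(2)[OF xs] p\<iota>[OF LM.C_closed[OF f xs]] by blast
    have Qu: "cobd L ?Q (\<lambda>xs. ?p (u xs)) xs = ?p (g xs)"
      if S: "S \<in> {A, B, D}" and u: "cochain R L ?J S (Suc j) u" and h: "cochain R L M S (Suc (Suc j)) h"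
        and du: "\<forall>xs\<in>lists_of S (Suc (Suc j)). cobd L ?J u xs = g xs \<ominus>\<^bsub>?J\<^esub> \<iota> (h xs)"
        and xs: "xs \<in> lists_of S (Suc (Suc j))" for S u h xs
    proof -
      interpret SM: lie_sub R L M S by (rule lie_sub_S[OF M S])
      have c: "g xs \<in> carrier ?J" "h xs \<in> carrier M" "\<iota> (h xs) \<in> carrier ?J"
        using LJ.C_closed[OF g(1) inL[OF xs S]] SM.C_closed[OF h xs] \<iota>_fm by (auto simp: coind_simps(1))
      have "cobd L ?Q (\<lambda>xs. ?p (u xs)) xs = ?p (cobd L ?J u xs)"
        by (rule dQ[OF S S p_eq u xs]) (use subL[OF S] in auto)
      also have "\<dots> = ?p (g xs) \<ominus>\<^bsub>?Q\<^esub> ?p (\<iota> (h xs))"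
        using du xs linear_map_minus[OF coind_module Q.image_Module p_lin c(1,3)] by simp
      also have "\<dots> = ?p (g xs)"
        using p\<iota>[OF c(2)] linear_mapD(1)[OF p_lin c(1)] QM.M.minus_zero_right by simp
      finally show ?thesis .
    qed
    have dz: "cobd L ?Q (\<lambda>xs. ?p (z xs)) xs = ?p (u1 xs) \<ominus>\<^bsub>?Q\<^esub> ?p (u2 xs)" if xs: "xs \<in> lists_of D (Suc j)" for xs
    proof -
      have c: "u1 xs \<in> carrier ?J" "u2 xs \<in> carrier ?J" "e xs \<in> carrier M" "\<iota> (e xs) \<in> carrier ?J"
        using DJ.C_closed[OF uD(1) xs] DJ.C_closed[OF uD(2) xs] DM.C_closed[OF e xs] \<iota>_fm by (auto simp: coind_simps(1))
      have "cobd L ?Q (\<lambda>xs. ?p (z xs)) xs = ?p (cobd L ?J z xs)"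
        by (rule dQ[OF T(3) T(3) p_eq z(1) xs]) auto
      also have "\<dots> = ?p (?w xs)" using z(2) xs by simp
      also have "\<dots> = ?p (u1 xs \<ominus>\<^bsub>?J\<^esub> u2 xs) \<oplus>\<^bsub>?Q\<^esub> ?p (\<iota> (e xs))"
        by (rule linear_mapD(2)[OF p_lin]) (use c in auto)
      also have "\<dots> = (?p (u1 xs) \<ominus>\<^bsub>?Q\<^esub> ?p (u2 xs)) \<oplus>\<^bsub>?Q\<^esub> \<zero>\<^bsub>?Q\<^esub>"
        using p\<iota>[OF c(3)] linear_map_minus[OF coind_module Q.image_Module p_lin c(1,2)] by simp
      also have "\<dots> = ?p (u1 xs) \<ominus>\<^bsub>?Q\<^esub> ?p (u2 xs)"
        using linear_mapD(1)[OF p_lin c(1)] linear_mapD(1)[OF p_lin c(2)] by simp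
      finally show ?thesis .
    qed
    obtain y where y: "cochain R L ?Q (carrier L) (Suc j) y"
      "\<And>xs. xs \<in> lists_of (carrier L) (Suc (Suc j)) \<Longrightarrow> cobd L ?Q y xs = ?p (g xs)"
      by (rule mayer_vietorisD[OF IH[OF Q] Qg dQg mapQ[OF T(1) T(1) u1(1)] Qu[OF T(1) u1(1) h1 u1(2)]
            mapQ[OF T(2) T(2) u2(1)] Qu[OF T(2) u2(1) h2 u2(2)] mapQ[OF T(3) T(3) z(1)] dz]) auto
    have dy: "cochain R L ?J (carrier L) (Suc j) (\<lambda>xs. dec (y xs))"
      by (rule cochain_map[OF lie_sub_L[OF Q] lie_sub_L[OF J] dec_lin y(1)])
    \<comment> \<open>Subtracting the coboundary of the lifted \<open>y\<close> makes
      \<open>g\<close> vanish modulo \<open>M\<close> without altering its coboundary. The value at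
      the empty monomial is then a primitive of \<open>f\<close> in \<open>M\<close>.\<close>
    let ?r = "\<lambda>xs. g xs \<ominus>\<^bsub>?J\<^esub> cobd L ?J (\<lambda>xs. dec (y xs)) xs"
    have r: "cochain R L ?J (carrier L) (Suc (Suc j)) ?r" by (intro LJ.C_minus g(1) LJ.d_C dy)
    have rker: "\<iota> (?r xs {#}) = ?r xs" if xs: "xs \<in> lists_of (carrier L) (Suc (Suc j))" for xs
    proof (rule ker)
      have c: "g xs \<in> carrier ?J" "cobd L ?J (\<lambda>xs. dec (y xs)) xs \<in> carrier ?J"
        using LJ.C_closed[OF g(1) xs] LJ.d_closed[OF dy xs] by auto
      have "cobd L ?Q (\<lambda>xs. ?p (dec (y xs))) xs = cobd L ?Q y xs"
      proof (rule LQ.d_cong[OF _ xs])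
        fix ys assume "ys \<in> lists_of (carrier L) (Suc j)"
        then have "y ys \<in> carrier ?Q" using LQ.C_closed[OF y(1)] by blast
        then show "?p (dec (y ys)) = y ys" using Q.p_s by (auto simp: Q.image_simps(1))
      qed
      then have "?p (cobd L ?J (\<lambda>xs. dec (y xs)) xs) = ?p (g xs)"
        using cobd_map[OF lie_sub_L[OF J] lie_sub_L[OF Q] p_lin p_eq dy xs] y(2)[OF xs] by (simp only:)
      then show "?p (?r xs) = \<zero>\<^bsub>?Q\<^esub>"
        using linear_map_minus[OF coind_module Q.image_Module p_lin c] linear_mapD(1)[OF p_lin c(1)]
        by (simp add: QM.M.minus_self)
    qed
    let ?g = "\<lambda>xs. ?r xs {#}"
    have gM: "cochain R L M (carrier L) (Suc (Suc j)) ?g"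
      by (rule cochain_map[OF lie_sub_L[OF J] lie_sub_L[OF M] coind_eval r])
    have "cobd L M ?g xs = f xs" if xs: "xs \<in> lists_of (carrier L) (Suc (Suc (Suc j)))" for xs
    proof -
      have fx: "f xs \<in> carrier M" "cobd L M ?g xs \<in> carrier M"
        using LM.C_closed[OF f xs] LM.d_closed[OF gM xs] by auto
      have "\<iota> (cobd L M ?g xs) = cobd L ?J (\<lambda>xs. \<iota> (?g xs)) xs"
        using cobd_map[OF lie_sub_L[OF M] lie_sub_L[OF J] \<iota>_lin \<iota>_eq gM xs] by simp
      also have "\<dots> = cobd L ?J ?r xs" by (rule LJ.d_cong[OF rker xs])
      also have "\<dots> = cobd L ?J g xs \<ominus>\<^bsub>?J\<^esub> cobd L ?J (cobd L ?J (\<lambda>xs. dec (y xs))) xs"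
        by (rule LJ.d_minus[OF g(1) LJ.d_C[OF dy] xs])
      also have "\<dots> = \<iota> (f xs)"
        using g(2)[OF xs] LJ.d_d[OF dy xs] \<iota>_fm[OF fx(1)] Q.M.M.minus_zero_right[of "\<iota> (f xs)"] by (simp add: coind_simps(1))
      finally have "\<iota> (cobd L M ?g xs) {#} = \<iota> (f xs) {#}" by simp
      then show ?thesis by (simp add: \<iota>_def)
    qed
    then show "\<exists>g. cochain R L M (carrier L) (Suc (Suc j)) g \<and>
        (\<forall>xs\<in>lists_of (carrier L) (Suc (Suc (Suc j))). cobd L M g xs = f xs)"
      using gM by blast
  qed
qed

end

text \<open>As \<open>s\<close> inverts \<open>p\<close> on the carrier, the image is an isomorphic
  copy of \<open>M\<close>. Used to change the element type of the coefficients.\<close>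

lemma (in image_data) mayer_vietoris_image:
  assumes sp: "\<And>m. m \<in> carrier M \<Longrightarrow> s (p m) = m"
    and sub: "\<And>S. S \<in> {carrier L, A, B, D} \<Longrightarrow> lie_sub R L M S" "D \<subseteq> A" "D \<subseteq> B"
    and mv: "mayer_vietoris R L Q A B D j"
  shows "mayer_vietoris R L M A B D j"
  unfolding mayer_vietoris_def
proof (intro allI impI)
  fix f h1 h2 e
  assume f: "cochain R L M (carrier L) (Suc (Suc j)) f"
    and df: "\<forall>xs\<in>lists_of (carrier L) (Suc (Suc (Suc j))). cobd L M f xs = \<zero>\<^bsub>M\<^esub>"
    and h1: "cochain R L M A (Suc j) h1" and dh1: "\<forall>xs\<in>lists_of A (Suc (Suc j)). cobd L M h1 xs = f xs"
    and h2: "cochain R L M B (Suc j) h2" and dh2: "\<forall>xs\<in>lists_of B (Suc (Suc j)). cobd L M h2 xs = f xs"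
    and e: "cochain R L M D j e" and de: "\<forall>xs\<in>lists_of D (Suc j). cobd L M e xs = h1 xs \<ominus>\<^bsub>M\<^esub> h2 xs"
  have Q: "lie_sub R L Q S" if "S \<in> {carrier L, A, B, D}" for S
    by (intro lie_sub.intro image_lie_module lie_sub.axioms(2)[OF sub(1)[OF that]])
  have T: "carrier L \<in> {carrier L, A, B, D}" "A \<in> {carrier L, A, B, D}" "B \<in> {carrier L, A, B, D}"
    "D \<in> {carrier L, A, B, D}" by auto
  have sL: "S \<subseteq> carrier L" if "S \<in> {carrier L, A, B, D}" for S
    using lie_sub.S_sub[OF sub(1)[OF that]] .
  have eq: "p (act M x m) = act Q x (p m)" if "x \<in> carrier L" "m \<in> carrier M" for x m
    using image_simps(5)[OF that] by simp
  have s_lin: "linear_map R Q M s"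
    by (auto simp: linear_map_def image_simps sp)
  have s_eq: "s (act Q x a) = act M x (s a)" if "x \<in> carrier L" "a \<in> carrier Q" for x a
    using that by (auto simp: image_simps sp act_closed)
  have M_mod: "Module.module R M" ..
  have map: "cochain R L Q S q (\<lambda>xs. p (g xs))" if "cochain R L M S q g" "S \<in> {carrier L, A, B, D}" for g S q
    by (rule cochain_map[OF sub(1)[OF that(2)] Q[OF that(2)] p_linear that(1)])
  have d: "cobd L Q (\<lambda>xs. p (g xs)) xs = p (cobd L M g xs)"
    if "cochain R L M S q g" "xs \<in> lists_of S (Suc q)" "S \<in> {carrier L, A, B, D}" for g S q xs
    by (rule cobd_map[OF sub(1)[OF that(3)] Q[OF that(3)] p_linear eq that(1,2)]) (use sL[OF that(3)] in auto)
  have minus: "p (a \<ominus>\<^bsub>M\<^esub> b) = p a \<ominus>\<^bsub>Q\<^esub> p b" if "a \<in> carrier M" "b \<in> carrier M" for a b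
    by (rule linear_map_minus[OF M_mod image_Module p_linear that])
  have hD: "h1 xs \<in> carrier M" "h2 xs \<in> carrier M" if "xs \<in> lists_of D (Suc j)" for xs
    using lie_sub.C_closed[OF sub(1)[OF T(2)] h1 lists_of_mono[OF sub(2) that]]
      lie_sub.C_closed[OF sub(1)[OF T(3)] h2 lists_of_mono[OF sub(3) that]] .
  obtain g where g: "cochain R L Q (carrier L) (Suc j) g"
    "\<And>xs. xs \<in> lists_of (carrier L) (Suc (Suc j)) \<Longrightarrow> cobd L Q g xs = p (f xs)"
    by (rule mayer_vietorisD[OF mv map[OF f T(1)] _ map[OF h1 T(2)] _ map[OF h2 T(3)] _ map[OF e T(4)]])
      (use df dh1 dh2 de hD in \<open>auto simp: d[OF f _ T(1)] d[OF h1 _ T(2)] d[OF h2 _ T(3)] d[OF e _ T(4)] minus image_simps(2)\<close>)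
  have sg: "cochain R L M (carrier L) (Suc j) (\<lambda>xs. s (g xs))"
    by (rule cochain_map[OF Q[OF T(1)] sub(1)[OF T(1)] s_lin g(1)])
  have "cobd L M (\<lambda>xs. s (g xs)) xs = f xs" if "xs \<in> lists_of (carrier L) (Suc (Suc j))" for xs
    using cobd_map[OF Q[OF T(1)] sub(1)[OF T(1)] s_lin s_eq g(1) that] g(2)[OF that]
      sp[OF lie_sub.C_closed[OF sub(1)[OF T(1)] f that]] by simp
  then show "\<exists>g. cochain R L M (carrier L) (Suc j) g \<and>
      (\<forall>xs\<in>lists_of (carrier L) (Suc (Suc j)). cobd L M g xs = f xs)" using sg by blast
qed

text \<open>Iterated dimension shifting needs a type of coefficients that contains the functions from multisets to
  itself, here \<open>'b multiset list \<Rightarrow> 'a\<close>.\<close>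

lemma (in subalgebras) mayer_vietoris_trivial:
  assumes base: "\<And>M :: ('a, 'b multiset list \<Rightarrow> 'a, 'b) lie_module. lie_module R L M \<Longrightarrow> mayer_vietoris R L M A B D 0"
    and triv: "lie_module R L (trivial_module R :: ('a, 'a, 'b) lie_module)"
  shows "mayer_vietoris R L (trivial_module R :: ('a, 'a, 'b) lie_module) A B D j"
proof -
  have all: "mayer_vietoris R L M A B D j" if "lie_module R L M" for M :: "('a, 'b multiset list \<Rightarrow> 'a, 'b) lie_module" and j
    using that
  proof (induction j arbitrary: M)
    case (Suc j)
    \<comment> \<open>Currying: a function of a multiset and a list is read as a function of a list
      with one more entry. The value at the empty list is a placeholder that \<open>dec\<close> does
      not look at.\<close>
    let ?enc = "\<lambda>\<phi> l. (case l of [] \<Rightarrow> undefined | \<mu> # l' \<Rightarrow> \<phi> \<mu> l') :: 'a"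
    show ?case
      by (rule mayer_vietoris_step[OF Suc.prems, where enc = ?enc and dec = "\<lambda>a \<mu> l. a (\<mu> # l)"])
        (use Suc.IH in auto)
  qed (rule base)
  \<comment> \<open>The ground field enters the large type as the constant functions, recovered by
    evaluation at the empty list.\<close>
  interpret I: image_data R L "trivial_module R :: ('a, 'a, 'b) lie_module" "\<lambda>c (_ :: 'b multiset list). c" "\<lambda>a. a []"
    by (intro image_data.intro triv image_data_axioms.intro) (auto simp: trivial_module_def)
  show ?thesis
    by (rule I.mayer_vietoris_image[OF _ _ D_sub all[OF I.image_lie_module]])
      (use lie_sub_L[OF triv] lie_sub_S[OF triv] in auto)
qed

section \<open>Homomorphisms and derivations on a RAAG Lie algebra\<close>

primrec eval_term :: "('a, 'b, 'z) lie_algebra_scheme \<Rightarrow> ('v \<Rightarrow> 'b) \<Rightarrow> ('a, 'v) lie_term \<Rightarrow> 'b" where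
  "eval_term H \<sigma> (Gen v) = \<sigma> v"
| "eval_term H \<sigma> Zero = \<zero>\<^bsub>H\<^esub>"
| "eval_term H \<sigma> (Add s t) = eval_term H \<sigma> s \<oplus>\<^bsub>H\<^esub> eval_term H \<sigma> t"
| "eval_term H \<sigma> (Smult c t) = c \<odot>\<^bsub>H\<^esub> eval_term H \<sigma> t"
| "eval_term H \<sigma> (Brack s t) = bracket H (eval_term H \<sigma> s) (eval_term H \<sigma> t)"

text \<open>Universal property of the presentation: every clause generating \<open>lie_cong\<close>
  holds for evaluation in \<open>H\<close>, so evaluation is constant on classes.\<close>

lemma presented_hom:
  assumes H: "lie_algebra k H" and \<sigma>: "\<And>v. v \<in> V \<Longrightarrow> \<sigma> v \<in> carrier H"
    and rel: "\<And>r. \<lbrakk>r \<in> S; r \<in> lie_terms k V\<rbrakk> \<Longrightarrow> eval_term H \<sigma> r = \<zero>\<^bsub>H\<^esub>"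
  shows "\<exists>\<phi>. \<phi> \<in> lie_hom k (presented_lie_algebra k V S) H \<and> (\<forall>v\<in>V. \<phi> (lie_class k V S (Gen v)) = \<sigma> v)"
proof -
  interpret H: lie_algebra k H by (rule H)
  have k: "cring k" by (rule H.R.is_cring)
  let ?P = "presented_lie_algebra k V S" and ?ev = "eval_term H \<sigma>"
  note [simp] = presented_simps[OF k] presented_carrier
  have cl [simp]: "?ev t \<in> carrier H" if "t \<in> lie_terms k V" for t
    using that by induction (auto simp: \<sigma> H.bracket_closed)
  have cong: "?ev s = ?ev t" if "lie_cong k V S s t" for s t
    using that
  proof induction
    case (add_minus t)
    then show ?case using H.smult_l_minus[of "\<one>\<^bsub>k\<^esub>" "?ev t"] by (simp add: H.M.l_neg)
  qed (auto simp: H.M.a_ac H.smult_l_distr H.smult_r_distr H.smult_assoc1 H.bracket_add_left H.bracket_add_right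
        H.bracket_smult_left H.bracket_smult_right H.bracket_self H.jacobi rel dest: lie_cong_terms[OF k])
  define \<phi> where "\<phi> = (\<lambda>X. the_elem (?ev ` X))"
  have \<phi>: "\<phi> (lie_class k V S t) = ?ev t" if "t \<in> lie_terms k V" for t
  proof -
    have "?ev s = ?ev t" if "s \<in> lie_class k V S t" for s
      using cong[of t s] that by (simp add: lie_class_def)
    then have "?ev ` lie_class k V S t = {?ev t}"
      using lie_class_self[OF that, of S] by (intro equalityI subsetI) (blast, blast)
    then show ?thesis by (simp add: \<phi>_def)
  qed
  have "\<phi> \<in> lie_hom k ?P H" unfolding lie_hom_def
    by (auto simp: \<phi> lie_terms.intros)
  moreover have "\<forall>v\<in>V. \<phi> (lie_class k V S (Gen v)) = \<sigma> v" by (simp add: \<phi> lie_terms.intros)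
  ultimately show ?thesis by blast
qed

lemma lie_hom_linear: "\<phi> \<in> lie_hom k L H \<Longrightarrow> linear_map k L H \<phi>"
  unfolding linear_map_def using lie_homD[of \<phi> k L H] by blast

locale raag =
  fixes k :: "('a, 'x) ring_scheme" and V :: "'v set" and E :: "'v set set"
  assumes k: "field k"
begin

abbreviation "L \<equiv> raag_lie_algebra k V E"
abbreviation "vx \<equiv> raag_vertex k V E"

lemma kc: "cring k"
proof -
  interpret field k by (rule k)
  show ?thesis ..
qed

lemma L_lie: "lie_algebra k L"
  unfolding raag_lie_algebra_def by (rule lie_algebra_presented[OF kc])

sublocale L: lie_algebra k L by (rule L_lie)

lemma vx_closed [simp]: "v \<in> V \<Longrightarrow> vx v \<in> carrier L"
  unfolding raag_vertex_def raag_lie_algebra_def presented_carrier by (auto intro: lie_terms.intros)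

lemma vx_edge:
  assumes "{v, w} \<in> E" "v \<in> V" "w \<in> V" shows "bracket L (vx v) (vx w) = \<zero>\<^bsub>L\<^esub>"
proof -
  have t: "Gen v \<in> lie_terms k V" "Gen w \<in> lie_terms k V" using assms by (auto intro: lie_terms.intros)
  have "lie_cong k V (raag_relators E) (Brack (Gen v) (Gen w)) Zero"
    by (rule lie_cong.relator) (use assms t in \<open>auto simp: raag_relators_def intro: lie_terms.intros\<close>)
  then show ?thesis
    unfolding raag_vertex_def raag_lie_algebra_def presented_simps(3)[OF kc t] presented_zero
    by (rule lie_class_eq[OF kc])
qed

lemma hom_exists:
  assumes "lie_algebra k H" "\<And>v. v \<in> V \<Longrightarrow> \<sigma> v \<in> carrier H"
    "\<And>v w. \<lbrakk>{v, w} \<in> E; v \<in> V; w \<in> V\<rbrakk> \<Longrightarrow> bracket H (\<sigma> v) (\<sigma> w) = \<zero>\<^bsub>H\<^esub>"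
  obtains \<phi> where "\<phi> \<in> lie_hom k L H" "\<And>v. v \<in> V \<Longrightarrow> \<phi> (vx v) = \<sigma> v"
proof -
  have "eval_term H \<sigma> r = \<zero>\<^bsub>H\<^esub>" if r: "r \<in> raag_relators E" "r \<in> lie_terms k V" for r
  proof -
    from r obtain v w where vw: "r = Brack (Gen v) (Gen w)" "{v, w} \<in> E" by (auto simp: raag_relators_def)
    have "v \<in> V" "w \<in> V" using r(2) unfolding vw by (auto elim: lie_terms.cases)
    then show ?thesis using assms(3) vw by simp
  qed
  from presented_hom[OF assms(1,2) this, where S = "raag_relators E"]
  show ?thesis using that unfolding raag_lie_algebra_def raag_vertex_def by blast
qed

lemma hom_unique:
  assumes H: "lie_algebra k H" and \<phi>: "\<phi> \<in> lie_hom k L H" and \<psi>: "\<psi> \<in> lie_hom k L H"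
    and eq: "\<And>v. v \<in> V \<Longrightarrow> \<phi> (vx v) = \<psi> (vx v)" and x: "x \<in> carrier L"
  shows "\<phi> x = \<psi> x"
proof -
  interpret H: lie_algebra k H by (rule H)
  let ?S = "raag_relators E :: ('a, 'v) lie_term set"
  let ?c = "lie_class k V ?S"
  have L: "L = presented_lie_algebra k V ?S" by (simp add: raag_lie_algebra_def)
  have inL: "?c t \<in> carrier L" if "t \<in> lie_terms k V" for t
    using that by (simp add: L presented_carrier)
  have mod: "Module.module k L" "Module.module k H" by unfold_locales
  note p = lie_homD[OF \<phi>] and q = lie_homD[OF \<psi>]
  note s = presented_simps[OF kc, where S = ?S and V = V, folded L]
  obtain t where t: "t \<in> lie_terms k V" "x = ?c t" using x by (auto simp: L presented_carrier)
  have "\<phi> (?c t) = \<psi> (?c t)" using t(1)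
  proof induction
    case (Gen v) then show ?case using eq by (simp add: raag_vertex_def)
  next
    case Zero
    have "\<zero>\<^bsub>L\<^esub> = ?c Zero" by (simp add: L presented_zero)
    then show ?case
      using linear_map_zero[OF mod lie_hom_linear[OF \<phi>]] linear_map_zero[OF mod lie_hom_linear[OF \<psi>]] by simp
  next
    case (Add a b) then show ?case
      using p(2)[OF inL inL, of a b] q(2)[OF inL inL, of a b] s(1)[of a b] by simp
  next
    case (Smult c a) then show ?case
      using p(3)[OF _ inL, of c a] q(3)[OF _ inL, of c a] s(2)[of a a c] by simp
  next
    case (Brack a b) then show ?case
      using p(4)[OF inL inL, of a b] q(4)[OF inL inL, of a b] s(3)[of a b] by simp
  qed
  then show ?thesis using t by simp
qed

end

subsection \<open>Abelian extensions\<close>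

text \<open>Extension of \<open>L\<close> with the abelian kernel \<open>M\<close>. The sign of
  \<open>f\<close> is chosen so that a section \<open>x -> (x, \<beta> x)\<close> is a homomorphism
  exactly when \<open>d \<beta> = f\<close>.\<close>

definition ext_algebra :: "('a, 'b, 'y) lie_algebra_scheme \<Rightarrow> ('a, 'm, 'b, 'z) lie_module_scheme \<Rightarrow>
    ('b list \<Rightarrow> 'm) \<Rightarrow> ('a, 'b \<times> 'm) lie_algebra" where
  "ext_algebra L M f = \<lparr>carrier = carrier L \<times> carrier M, monoid.mult = undefined, one = undefined,
     zero = (\<zero>\<^bsub>L\<^esub>, \<zero>\<^bsub>M\<^esub>), add = (\<lambda>p q. (fst p \<oplus>\<^bsub>L\<^esub> fst q, snd p \<oplus>\<^bsub>M\<^esub> snd q)),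
     smult = (\<lambda>c p. (c \<odot>\<^bsub>L\<^esub> fst p, c \<odot>\<^bsub>M\<^esub> snd p)),
     bracket = (\<lambda>p q. (bracket L (fst p) (fst q),
       (act M (fst p) (snd q) \<ominus>\<^bsub>M\<^esub> act M (fst q) (snd p)) \<ominus>\<^bsub>M\<^esub> f [fst p, fst q]))\<rparr>"

lemma ext_simps:
  "carrier (ext_algebra L M f) = carrier L \<times> carrier M" "\<zero>\<^bsub>ext_algebra L M f\<^esub> = (\<zero>\<^bsub>L\<^esub>, \<zero>\<^bsub>M\<^esub>)"
  "p \<oplus>\<^bsub>ext_algebra L M f\<^esub> q = (fst p \<oplus>\<^bsub>L\<^esub> fst q, snd p \<oplus>\<^bsub>M\<^esub> snd q)"
  "c \<odot>\<^bsub>ext_algebra L M f\<^esub> p = (c \<odot>\<^bsub>L\<^esub> fst p, c \<odot>\<^bsub>M\<^esub> snd p)"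
  "bracket (ext_algebra L M f) p q = (bracket L (fst p) (fst q),
       (act M (fst p) (snd q) \<ominus>\<^bsub>M\<^esub> act M (fst q) (snd p)) \<ominus>\<^bsub>M\<^esub> f [fst p, fst q])"
  by (simp_all add: ext_algebra_def)

context abelian_group begin

lemma jacobi_identity:
  assumes "a1 \<in> carrier G" "a2 \<in> carrier G" "a3 \<in> carrier G" "a4 \<in> carrier G" "a5 \<in> carrier G" "a6 \<in> carrier G"
    "b1 \<in> carrier G" "b2 \<in> carrier G" "b3 \<in> carrier G" "c1 \<in> carrier G" "c2 \<in> carrier G" "c3 \<in> carrier G"
    and cyc: "(b1 \<oplus> (b2 \<oplus> b3)) \<oplus> (c1 \<oplus> (c2 \<oplus> c3)) = \<zero>"
  shows "((((a1 \<ominus> a2) \<ominus> b1) \<ominus> (a3 \<ominus> a4)) \<ominus> c1) \<oplus>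
    (((((a3 \<ominus> a5) \<ominus> b2) \<ominus> (a6 \<ominus> a2)) \<ominus> c2) \<oplus> ((((a6 \<ominus> a4) \<ominus> b3) \<ominus> (a1 \<ominus> a5)) \<ominus> c3)) = \<zero>"
proof -
  have "((((a1 \<ominus> a2) \<ominus> b1) \<ominus> (a3 \<ominus> a4)) \<ominus> c1) \<oplus>
    (((((a3 \<ominus> a5) \<ominus> b2) \<ominus> (a6 \<ominus> a2)) \<ominus> c2) \<oplus> ((((a6 \<ominus> a4) \<ominus> b3) \<ominus> (a1 \<ominus> a5)) \<ominus> c3)) =
    \<ominus> ((b1 \<oplus> (b2 \<oplus> b3)) \<oplus> (c1 \<oplus> (c2 \<oplus> c3)))"
    using assms(1-12) by algebra
  then show ?thesis unfolding cyc by (simp add: a_inv_zero)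
qed

text \<open>The assumption is the vanishing of \<open>cobd L M f [x, y, z]\<close> as the recursion
  unfolds it after some uses of skew symmetry; the \<open>b\<close> stand for the action terms and
  the \<open>c\<close> for the bracket terms.\<close>

lemma cocycle_identity:
  assumes "b1 \<in> carrier G" "b2 \<in> carrier G" "b3 \<in> carrier G" "c1 \<in> carrier G" "c2 \<in> carrier G" "c3 \<in> carrier G"
    and "((b1 \<ominus> \<ominus> c2) \<ominus> \<ominus> c3) \<ominus> ((\<ominus> b2 \<ominus> c1) \<ominus> (b3 \<ominus> \<zero>)) = \<zero>"
  shows "(b1 \<oplus> (b2 \<oplus> b3)) \<oplus> (c1 \<oplus> (c2 \<oplus> c3)) = \<zero>"
proof -
  have "(b1 \<oplus> (b2 \<oplus> b3)) \<oplus> (c1 \<oplus> (c2 \<oplus> c3)) = ((b1 \<ominus> \<ominus> c2) \<ominus> \<ominus> c3) \<ominus> ((\<ominus> b2 \<ominus> c1) \<ominus> (b3 \<ominus> \<zero>))"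
    using assms(1-6) by algebra
  then show ?thesis unfolding assms(7) .
qed

end

lemma (in lie_module) lie_sub_carrier: "lie_sub R L M (carrier L)"
proof (intro lie_sub.intro lie_module_axioms)
  show "lie_sub_axioms R L (carrier L)" unfolding lie_sub_axioms_def by (simp add: bracket_closed)
qed

text \<open>In the second component the Jacobi sum reduces, by the module law, to the cyclic sum
  \<open>cyc\<close>, which is the cocycle condition on \<open>f\<close>. Alternation of
  \<open>f\<close> makes the bracket alternating.\<close>

lemma (in lie_module) ext_lie_algebra:
  assumes f: "cochain R L M (carrier L) (Suc (Suc 0)) f"
    and df: "\<And>xs. xs \<in> lists_of (carrier L) (Suc (Suc (Suc 0))) \<Longrightarrow> cobd L M f xs = \<zero>\<^bsub>M\<^esub>"
  shows "lie_algebra R (ext_algebra L M f)"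
proof -
  interpret S: lie_sub R L M "carrier L" by (rule lie_sub_carrier)
  let ?E = "ext_algebra L M f"
  have i: "cochain R L M (carrier L) (Suc 0) (\<lambda>zs. f (x # zs))" if "x \<in> carrier L" for x
    using S.C_inner[OF f that] .
  have F: "f [x, y] \<in> carrier M" if "x \<in> carrier L" "y \<in> carrier L" for x y
    using S.C_closed[OF f] that by simp
  have F_add: "f [x \<oplus>\<^bsub>L\<^esub> y, z] = f [x, z] \<oplus>\<^bsub>M\<^esub> f [y, z]" "f [z, x \<oplus>\<^bsub>L\<^esub> y] = f [z, x] \<oplus>\<^bsub>M\<^esub> f [z, y]"
    if "x \<in> carrier L" "y \<in> carrier L" "z \<in> carrier L" for x y z
    using S.C_add_head[OF f, of x y "[z]"] S.C_add_head[OF i[OF that(3)], of x y "[]"] that by simp_all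
  have F_smult: "f [c \<odot>\<^bsub>L\<^esub> x, z] = c \<odot>\<^bsub>M\<^esub> f [x, z]" "f [z, c \<odot>\<^bsub>L\<^esub> x] = c \<odot>\<^bsub>M\<^esub> f [z, x]"
    if "c \<in> carrier R" "x \<in> carrier L" "z \<in> carrier L" for c x z
    using S.C_smult_head[OF f, of c x "[z]"] S.C_smult_head[OF i[OF that(3)], of c x "[]"] that by simp_all
  have F_self: "f [x, x] = \<zero>\<^bsub>M\<^esub>" if "x \<in> carrier L" for x
    using S.C_self[OF f, of x "[]"] that by simp
  have F_skew: "f [x, y] = \<ominus>\<^bsub>M\<^esub> f [y, x]" if "x \<in> carrier L" "y \<in> carrier L" for x y
    using S.C_skew[OF f, of x y "[]"] that by simp
  have F_neg: "f [x, \<ominus>\<^bsub>L\<^esub> y] = \<ominus>\<^bsub>M\<^esub> f [x, y]" if "x \<in> carrier L" "y \<in> carrier L" for x y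
    using S.C_neg_head[OF i[OF that(1)], of y "[]"] that by simp
  have act_lin: "linear_map R M M (act M x)" if "x \<in> carrier L" for x
    using that by (simp add: linear_map_def act_closed act_add_right act_smult_right)
  have M_mod: "Module.module R M" ..
  have act_minus: "act M x (m \<ominus>\<^bsub>M\<^esub> n) = act M x m \<ominus>\<^bsub>M\<^esub> act M x n"
    if "x \<in> carrier L" "m \<in> carrier M" "n \<in> carrier M" for x m n
    by (rule linear_map_minus[OF M_mod M_mod act_lin]) (use that in auto)
  have act_neg: "act M x (\<ominus>\<^bsub>M\<^esub> n) = \<ominus>\<^bsub>M\<^esub> act M x n" if "x \<in> carrier L" "n \<in> carrier M" for x n
    using act_minus[OF that(1) M.M.zero_closed that(2)] linear_map_zero[OF M_mod M_mod act_lin[OF that(1)]] that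
    by (simp add: a_minus_def act_closed)
  have cyc: "(act M x (f [y, z]) \<oplus>\<^bsub>M\<^esub> (act M y (f [z, x]) \<oplus>\<^bsub>M\<^esub> act M z (f [x, y]))) \<oplus>\<^bsub>M\<^esub>
      (f [x, bracket L y z] \<oplus>\<^bsub>M\<^esub> (f [y, bracket L z x] \<oplus>\<^bsub>M\<^esub> f [z, bracket L x y])) = \<zero>\<^bsub>M\<^esub>"
    if x: "x \<in> carrier L" and y: "y \<in> carrier L" and z: "z \<in> carrier L" for x y z
  proof (rule M.M.cocycle_identity)
    have 1: "f [y, bracket L x z] = \<ominus>\<^bsub>M\<^esub> f [y, bracket L z x]"
      unfolding bracket_skew[OF x z] by (rule F_neg) (use y z x bracket_closed in auto)
    have 2: "f [bracket L x y, z] = \<ominus>\<^bsub>M\<^esub> f [z, bracket L x y]"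
      by (rule F_skew) (use x y z bracket_closed in auto)
    have 3: "act M y (f [x, z]) = \<ominus>\<^bsub>M\<^esub> act M y (f [z, x])"
      unfolding F_skew[OF x z] by (rule act_neg[OF y F[OF z x]])
    have "cobd L M f [x, y, z] = \<zero>\<^bsub>M\<^esub>" by (rule df) (use x y z in simp)
    then show "((act M x (f [y, z]) \<ominus>\<^bsub>M\<^esub> \<ominus>\<^bsub>M\<^esub> f [y, bracket L z x]) \<ominus>\<^bsub>M\<^esub> \<ominus>\<^bsub>M\<^esub> f [z, bracket L x y]) \<ominus>\<^bsub>M\<^esub>
       ((\<ominus>\<^bsub>M\<^esub> act M y (f [z, x]) \<ominus>\<^bsub>M\<^esub> f [x, bracket L y z]) \<ominus>\<^bsub>M\<^esub> (act M z (f [x, y]) \<ominus>\<^bsub>M\<^esub> \<zero>\<^bsub>M\<^esub>)) = \<zero>\<^bsub>M\<^esub>"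
      by (simp add: 1 2 3)
  qed (use x y z F act_closed bracket_closed in auto)
  have "abelian_group ?E"
  proof (rule abelian_groupI)
    fix p assume p: "p \<in> carrier ?E"
    show "\<exists>q\<in>carrier ?E. q \<oplus>\<^bsub>?E\<^esub> p = \<zero>\<^bsub>?E\<^esub>"
      by (rule bexI[of _ "(\<ominus>\<^bsub>L\<^esub> fst p, \<ominus>\<^bsub>M\<^esub> snd p)"])
        (use p in \<open>auto simp: ext_simps L_l_neg M.M.l_neg\<close>)
  qed (auto simp: ext_simps L_a_ac M.M.a_ac)
  then have mod: "Module.module R ?E"
    by (rule moduleI[OF R.is_cring])
      (auto simp: ext_simps smult_l_distr smult_r_distr smult_assoc1 M.smult_l_distr M.smult_r_distr M.smult_assoc1)
  show ?thesis
  proof (intro lie_algebra.intro mod lie_algebra_axioms.intro)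
    fix p q r assume "p \<in> carrier ?E" "q \<in> carrier ?E" "r \<in> carrier ?E"
    then obtain x m y n z l where *: "p = (x, m)" "q = (y, n)" "r = (z, l)"
      "x \<in> carrier L" "y \<in> carrier L" "z \<in> carrier L" "m \<in> carrier M" "n \<in> carrier M" "l \<in> carrier M"
      by (auto simp: ext_simps)
    have id: "(a \<oplus>\<^bsub>M\<^esub> b \<ominus>\<^bsub>M\<^esub> (c \<oplus>\<^bsub>M\<^esub> d)) \<ominus>\<^bsub>M\<^esub> (u \<oplus>\<^bsub>M\<^esub> v) = ((a \<ominus>\<^bsub>M\<^esub> c) \<ominus>\<^bsub>M\<^esub> u) \<oplus>\<^bsub>M\<^esub> ((b \<ominus>\<^bsub>M\<^esub> d) \<ominus>\<^bsub>M\<^esub> v)"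
      if "a \<in> carrier M" "b \<in> carrier M" "c \<in> carrier M" "d \<in> carrier M" "u \<in> carrier M" "v \<in> carrier M" for a b c d u v
      using that by algebra
    show "bracket ?E (p \<oplus>\<^bsub>?E\<^esub> q) r = bracket ?E p r \<oplus>\<^bsub>?E\<^esub> bracket ?E q r"
      using * F by (simp add: ext_simps bracket_add_left act_add_left act_add_right F_add id act_closed)
    show "bracket ?E p (q \<oplus>\<^bsub>?E\<^esub> r) = bracket ?E p q \<oplus>\<^bsub>?E\<^esub> bracket ?E p r"
      using * F by (simp add: ext_simps bracket_add_right act_add_left act_add_right F_add id act_closed)
    have dbl: "snd (bracket ?E (x, m) (bracket ?E (y, n) (z, l))) =
        (((act M x (act M y l) \<ominus>\<^bsub>M\<^esub> act M x (act M z n)) \<ominus>\<^bsub>M\<^esub> act M x (f [y, z]))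
          \<ominus>\<^bsub>M\<^esub> (act M y (act M z m) \<ominus>\<^bsub>M\<^esub> act M z (act M y m))) \<ominus>\<^bsub>M\<^esub> f [x, bracket L y z]"
      if "x \<in> carrier L" "y \<in> carrier L" "z \<in> carrier L" "m \<in> carrier M" "n \<in> carrier M" "l \<in> carrier M"
      for x y z m n l
      using that F by (simp add: ext_simps act_bracket act_minus act_closed)
    show "bracket ?E p (bracket ?E q r) \<oplus>\<^bsub>?E\<^esub> (bracket ?E q (bracket ?E r p) \<oplus>\<^bsub>?E\<^esub> bracket ?E r (bracket ?E p q)) = \<zero>\<^bsub>?E\<^esub>"
    proof (rule prod_eqI)
      show "fst (bracket ?E p (bracket ?E q r) \<oplus>\<^bsub>?E\<^esub> (bracket ?E q (bracket ?E r p) \<oplus>\<^bsub>?E\<^esub> bracket ?E r (bracket ?E p q))) = fst \<zero>\<^bsub>?E\<^esub>"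
        using * by (simp add: ext_simps jacobi)
      have "snd (bracket ?E p (bracket ?E q r)) \<oplus>\<^bsub>M\<^esub> (snd (bracket ?E q (bracket ?E r p)) \<oplus>\<^bsub>M\<^esub> snd (bracket ?E r (bracket ?E p q))) = \<zero>\<^bsub>M\<^esub>"
        unfolding *(1-3) dbl[OF *(4-9)] dbl[OF *(5,6,4,8,9,7)] dbl[OF *(6,4,5,9,7,8)]
        by (rule M.M.jacobi_identity) (use * F act_closed bracket_closed cyc in auto)
      then show "snd (bracket ?E p (bracket ?E q r) \<oplus>\<^bsub>?E\<^esub> (bracket ?E q (bracket ?E r p) \<oplus>\<^bsub>?E\<^esub> bracket ?E r (bracket ?E p q))) = snd \<zero>\<^bsub>?E\<^esub>"
        by (simp add: ext_simps)
    qed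
    show "bracket ?E p q \<in> carrier ?E" using * F by (simp add: ext_simps bracket_closed act_closed)
    show "bracket ?E p p = \<zero>\<^bsub>?E\<^esub>" using * by (simp add: ext_simps bracket_self F_self M.M.minus_self act_closed)
    fix c assume c: "c \<in> carrier R"
    show "bracket ?E (c \<odot>\<^bsub>?E\<^esub> p) q = c \<odot>\<^bsub>?E\<^esub> bracket ?E p q" "bracket ?E p (c \<odot>\<^bsub>?E\<^esub> q) = c \<odot>\<^bsub>?E\<^esub> bracket ?E p q"
      using * c F by (simp_all add: ext_simps bracket_smult_left bracket_smult_right act_smult_left act_smult_right F_smult
        a_minus_def M.smult_r_distr M.smult_r_minus act_closed)
  qed
qed

context raag begin

text \<open>The universal property of \<open>L\<close> applied to the extension: lifts of the
  vertices may be prescribed once they satisfy the edge relators. The first component of the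
  resulting homomorphism fixes the vertices, hence is the identity, and the second is the map
  sought. With \<open>f = 0\<close> this constructs derivations.\<close>

lemma twisted_derivation:
  fixes M :: "('a, 'm, ('a, 'v) lie_term set, 'z) lie_module_scheme"
  assumes M: "lie_module k L M"
    and f: "cochain k L M (carrier L) (Suc (Suc 0)) f"
    and df: "\<And>xs. xs \<in> lists_of (carrier L) (Suc (Suc (Suc 0))) \<Longrightarrow> cobd L M f xs = \<zero>\<^bsub>M\<^esub>"
    and b: "\<And>v. v \<in> V \<Longrightarrow> b v \<in> carrier M"
    and rel: "\<And>v w. \<lbrakk>{v, w} \<in> E; v \<in> V; w \<in> V\<rbrakk> \<Longrightarrow>
       (act M (vx v) (b w) \<ominus>\<^bsub>M\<^esub> act M (vx w) (b v)) \<ominus>\<^bsub>M\<^esub> f [vx v, vx w] = \<zero>\<^bsub>M\<^esub>"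
  obtains \<beta> where "linear_map k L M \<beta>" "\<And>v. v \<in> V \<Longrightarrow> \<beta> (vx v) = b v"
    "\<And>x y. \<lbrakk>x \<in> carrier L; y \<in> carrier L\<rbrakk> \<Longrightarrow>
      \<beta> (bracket L x y) = (act M x (\<beta> y) \<ominus>\<^bsub>M\<^esub> act M y (\<beta> x)) \<ominus>\<^bsub>M\<^esub> f [x, y]"
proof -
  let ?E = "ext_algebra L M f"
  have HE: "lie_algebra k ?E" by (rule lie_module.ext_lie_algebra[OF M f df])
  obtain \<phi> where \<phi>: "\<phi> \<in> lie_hom k L ?E" "\<And>v. v \<in> V \<Longrightarrow> \<phi> (vx v) = (vx v, b v)"
    by (rule hom_exists[OF HE, of "\<lambda>v. (vx v, b v)"]) (auto simp: ext_simps b vx_edge rel)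
  note h = lie_homD[OF \<phi>(1)]
  have "(\<lambda>x. fst (\<phi> x)) \<in> lie_hom k L L"
    using h by (auto simp: lie_hom_def ext_simps mem_Times_iff)
  moreover have "(\<lambda>x. x) \<in> lie_hom k L L" by (auto simp: lie_hom_def)
  ultimately have fst: "fst (\<phi> x) = x" if "x \<in> carrier L" for x
    using hom_unique[OF L_lie, of "\<lambda>x. fst (\<phi> x)" "\<lambda>x. x"] \<phi>(2) that by simp
  show ?thesis
  proof (rule that[of "\<lambda>x. snd (\<phi> x)"])
    show "linear_map k L M (\<lambda>x. snd (\<phi> x))" using h by (auto simp: linear_map_def ext_simps mem_Times_iff)
    show "snd (\<phi> (bracket L x y)) = (act M x (snd (\<phi> y)) \<ominus>\<^bsub>M\<^esub> act M y (snd (\<phi> x))) \<ominus>\<^bsub>M\<^esub> f [x, y]"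
      if "x \<in> carrier L" "y \<in> carrier L" for x y
      using h(4)[OF that] fst that by (simp add: ext_simps)
  qed (use \<phi>(2) in simp)
qed

text \<open>Instead of an amalgam, its defining property is used: each vertex and each edge lies in
  \<open>A\<close> or in \<open>B\<close>. Primitives that agree on \<open>D\<close> prescribe
  values on the vertices; every relator is satisfied because it holds inside one of the two
  subalgebras.\<close>

lemma mayer_vietoris_base:
  fixes M :: "('a, 'm, ('a, 'v) lie_term set, 'z) lie_module_scheme"
  assumes M: "lie_module k L M" and sub: "\<And>S. S \<in> {A, B, D} \<Longrightarrow> lie_sub k L M S" and D: "D = A \<inter> B"
    and vert: "\<And>v. v \<in> V \<Longrightarrow> vx v \<in> A \<or> vx v \<in> B"
    and edge: "\<And>v w. \<lbrakk>{v, w} \<in> E; v \<in> V; w \<in> V\<rbrakk> \<Longrightarrow> vx v \<in> A \<and> vx w \<in> A \<or> vx v \<in> B \<and> vx w \<in> B"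
  shows "mayer_vietoris k L M A B D 0"
  unfolding mayer_vietoris_def
proof (intro allI impI)
  fix f h1 h2 e
  assume f: "cochain k L M (carrier L) (Suc (Suc 0)) f"
    and df: "\<forall>xs\<in>lists_of (carrier L) (Suc (Suc (Suc 0))). cobd L M f xs = \<zero>\<^bsub>M\<^esub>"
    and h1: "cochain k L M A (Suc 0) h1" and dh1: "\<forall>xs\<in>lists_of A (Suc (Suc 0)). cobd L M h1 xs = f xs"
    and h2: "cochain k L M B (Suc 0) h2" and dh2: "\<forall>xs\<in>lists_of B (Suc (Suc 0)). cobd L M h2 xs = f xs"
    and e: "cochain k L M D 0 e" and de: "\<forall>xs\<in>lists_of D (Suc 0). cobd L M e xs = h1 xs \<ominus>\<^bsub>M\<^esub> h2 xs"
  interpret M: lie_module k L M by (rule M)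
  interpret SL: lie_sub k L M "carrier L" by (rule M.lie_sub_carrier)
  interpret SA: lie_sub k L M A by (rule sub) simp
  interpret SB: lie_sub k L M B by (rule sub) simp
  have eA: "cochain k L M A 0 e" using e by simp
  \<comment> \<open>A 0-cochain is an element of \<open>M\<close>, so \<open>e\<close> makes sense
    on all of \<open>A\<close>. Subtracting its coboundary makes the first primitive agree with
    \<open>h2\<close> on the intersection.\<close>
  define h where "h xs = h1 xs \<ominus>\<^bsub>M\<^esub> cobd L M e xs" for xs
  have h: "cochain k L M A (Suc 0) h"
    unfolding h_def by (intro SA.C_minus h1 SA.d_C eA)
  have dh: "cobd L M h xs = f xs" if xs: "xs \<in> lists_of A (Suc (Suc 0))" for xs
    using SA.d_minus[OF h1 SA.d_C[OF eA] xs] SA.d_d[OF eA xs] dh1 xs SA.d_closed[OF h1 xs]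
    by (simp add: h_def[abs_def] M.M.M.minus_zero_right)
  have hh: "h [x] = h2 [x]" if "x \<in> A" "x \<in> B" for x
  proof -
    have "[x] \<in> lists_of D (Suc 0)" using that D by simp
    then have *: "cobd L M e [x] = h1 [x] \<ominus>\<^bsub>M\<^esub> h2 [x]" using de by blast
    have "a \<ominus>\<^bsub>M\<^esub> (a \<ominus>\<^bsub>M\<^esub> c) = c" if "a \<in> carrier M" "c \<in> carrier M" for a c
      using that by algebra
    then show ?thesis unfolding h_def *
      using SA.C_closed[OF h1, of "[x]"] SB.C_closed[OF h2, of "[x]"] that by simp
  qed
  define b where "b v = (if vx v \<in> A then h [vx v] else h2 [vx v])" for v
  have bB: "b v = h2 [vx v]" if "vx v \<in> B" for v using hh that by (simp add: b_def)
  have bc: "b v \<in> carrier M" if "v \<in> V" for v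
    using vert[OF that] SA.C_closed[OF h, of "[vx v]"] SB.C_closed[OF h2, of "[vx v]"] bB[of v] by (auto simp: b_def)
  have relS: "(act M x (g [y]) \<ominus>\<^bsub>M\<^esub> act M y (g [x])) \<ominus>\<^bsub>M\<^esub> f [x, y] = \<zero>\<^bsub>M\<^esub>"
    if S: "lie_sub k L M S" and g: "cochain k L M S (Suc 0) g" and dg: "\<And>xs. xs \<in> lists_of S (Suc (Suc 0)) \<Longrightarrow> cobd L M g xs = f xs"
      and xy: "x \<in> S" "y \<in> S" "bracket L x y = \<zero>\<^bsub>L\<^esub>" for S g x y
  proof -
    interpret S: lie_sub k L M S by (rule S)
    have c: "g [x] \<in> carrier M" "g [y] \<in> carrier M" using S.C_closed[OF g] xy by auto
    have ac: "act M x (g [y]) \<in> carrier M" "act M y (g [x]) \<in> carrier M" using c xy M.act_closed by auto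
    have "g [\<zero>\<^bsub>L\<^esub>] = \<zero>\<^bsub>M\<^esub>" using S.C_zero_head[OF g, of "[]"] by simp
    then have "f [x, y] = act M x (g [y]) \<ominus>\<^bsub>M\<^esub> act M y (g [x])"
      using dg[of "[x, y]"] xy ac by (simp add: M.M.M.minus_zero_right)
    then show ?thesis using ac by (simp add: M.M.M.minus_self)
  qed
  obtain \<beta> where \<beta>: "linear_map k L M \<beta>"
    "\<And>x y. \<lbrakk>x \<in> carrier L; y \<in> carrier L\<rbrakk> \<Longrightarrow> \<beta> (bracket L x y) = (act M x (\<beta> y) \<ominus>\<^bsub>M\<^esub> act M y (\<beta> x)) \<ominus>\<^bsub>M\<^esub> f [x, y]"
  proof (rule twisted_derivation[OF M f _ bc])
    fix v w assume vw: "{v, w} \<in> E" "v \<in> V" "w \<in> V"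
    show "(act M (vx v) (b w) \<ominus>\<^bsub>M\<^esub> act M (vx w) (b v)) \<ominus>\<^bsub>M\<^esub> f [vx v, vx w] = \<zero>\<^bsub>M\<^esub>"
      using edge[OF vw]
    proof
      assume "vx v \<in> A \<and> vx w \<in> A"
      then show ?thesis using relS[OF SA.lie_sub_axioms h dh, of "vx v" "vx w"] vx_edge[OF vw]
        by (simp add: b_def)
    next
      assume "vx v \<in> B \<and> vx w \<in> B"
      then show ?thesis using relS[OF SB.lie_sub_axioms h2, of "vx v" "vx w"] dh2 vx_edge[OF vw]
        by (simp add: bB)
    qed
  qed (use df in auto)
  define g where "g xs = \<beta> (hd xs)" for xs
  have g: "cochain k L M (carrier L) (Suc 0) g"
    using linear_mapD[OF \<beta>(1)] by (simp add: g_def)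
  have "cobd L M g xs = f xs" if "xs \<in> lists_of (carrier L) (Suc (Suc 0))" for xs
  proof -
    from that obtain x ys where "xs = x # ys" and x: "x \<in> carrier L" and ys: "ys \<in> lists_of (carrier L) (Suc 0)"
      by (rule lists_of_SucE)
    moreover from ys obtain y where "ys = [y]" "y \<in> carrier L" by (rule lists_of_1E)
    ultimately have xs: "xs = [x, y]" "x \<in> carrier L" "y \<in> carrier L" by auto
    have id: "(a \<ominus>\<^bsub>M\<^esub> ((a \<ominus>\<^bsub>M\<^esub> c) \<ominus>\<^bsub>M\<^esub> u)) \<ominus>\<^bsub>M\<^esub> (c \<ominus>\<^bsub>M\<^esub> \<zero>\<^bsub>M\<^esub>) = u"
      if "a \<in> carrier M" "c \<in> carrier M" "u \<in> carrier M" for a c u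
      using that by algebra
    show ?thesis
      using id xs linear_mapD(1)[OF \<beta>(1)] SL.C_closed[OF f, of "[x, y]"] M.act_closed by (simp add: g_def \<beta>(2))
  qed
  then show "\<exists>g. cochain k L M (carrier L) (Suc 0) g \<and>
      (\<forall>xs\<in>lists_of (carrier L) (Suc (Suc 0)). cobd L M g xs = f xs)" using g by blast
qed

end

section \<open>A basis adapted to two subalgebras\<close>

lemma lincomb_subst:
  fixes N :: "('a, 'b, 'z) module_scheme" and Y Z :: "'b set" and l :: "('a \<times> 'b) list"
  assumes N: "Module.module R N" and Z: "Z \<subseteq> carrier N" and l: "set l \<subseteq> carrier R \<times> Y"
    and Y: "\<And>y. y \<in> Y \<Longrightarrow> \<exists>l'. set l' \<subseteq> carrier R \<times> Z \<and> lincomb N id l' = y"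
  shows "\<exists>l'. set l' \<subseteq> carrier R \<times> Z \<and> lincomb N id l' = lincomb N id l"
  using l
proof (induction l)
  case Nil
  show ?case by (rule exI[of _ "[]"]) simp
next
  case (Cons p l)
  interpret N: Module.module R N by (rule N)
  have id: "\<And>a. a \<in> Z \<Longrightarrow> id a \<in> carrier N" using Z by auto
  have "set l \<subseteq> carrier R \<times> Y" using Cons.prems by auto
  from Cons.IH[OF this] obtain l1 where l1: "set l1 \<subseteq> carrier R \<times> Z" "lincomb N id l1 = lincomb N id l" by blast
  have p: "fst p \<in> carrier R" "snd p \<in> Y" using Cons.prems by auto
  from Y[OF p(2)] obtain l2 where l2: "set l2 \<subseteq> carrier R \<times> Z" "lincomb N id l2 = snd p" by blast
  let ?l2 = "map (\<lambda>q. (fst p \<otimes>\<^bsub>R\<^esub> fst q, snd q)) l2"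
  have s: "set ?l2 \<subseteq> carrier R \<times> Z" using l2(1) p(1) by auto
  have "lincomb N id (?l2 @ l1) = fst p \<odot>\<^bsub>N\<^esub> snd p \<oplus>\<^bsub>N\<^esub> lincomb N id l"
  proof -
    have "lincomb N id (?l2 @ l1) = lincomb N id ?l2 \<oplus>\<^bsub>N\<^esub> lincomb N id l1"
      by (rule lincomb_append[OF N _ s l1(1)]) (rule id)
    also have "lincomb N id ?l2 = fst p \<odot>\<^bsub>N\<^esub> lincomb N id l2"
      by (rule lincomb_scale[OF N _ l2(1) p(1)]) (rule id)
    finally show ?thesis unfolding l1(2) l2(2) .
  qed
  moreover have "set (?l2 @ l1) \<subseteq> carrier R \<times> Z" using s l1(1) by simp
  moreover have "lincomb N id (p # l) = fst p \<odot>\<^bsub>N\<^esub> snd p \<oplus>\<^bsub>N\<^esub> lincomb N id l" by simp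
  ultimately have "set (?l2 @ l1) \<subseteq> carrier R \<times> Z \<and> lincomb N id (?l2 @ l1) = lincomb N id (p # l)" by (simp only:)
  then show ?case by (rule exI)
qed

text \<open>Elements are ordered first by rank: \<open>A \<inter> B\<close>, the rest of
  \<open>A\<close>, the rest of \<open>B\<close>, everything else. The basis consists of the
  elements that are not combinations of earlier ones. For \<open>A \<inter> B\<close> and
  \<open>A\<close> all earlier elements belong to the same subalgebra. An element of
  \<open>B\<close> may be preceded by elements of \<open>A\<close> outside \<open>B\<close>;
  applying \<open>\<rho>\<close> to the combination replaces them by elements of
  \<open>A \<inter> B\<close>, still earlier, and fixes the value since it lies in
  \<open>B\<close>.\<close>

lemma adapted_basis:
  fixes L :: "('a, 'b, 'y) lie_algebra_scheme"
  assumes L: "lie_algebra k L" and k: "field k"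
    and sub: "\<And>S. S \<in> {A, B} \<Longrightarrow> S \<subseteq> carrier L \<and> \<zero>\<^bsub>L\<^esub> \<in> S \<and> (\<forall>x\<in>S. \<forall>y\<in>S. x \<oplus>\<^bsub>L\<^esub> y \<in> S) \<and>
      (\<forall>c\<in>carrier k. \<forall>x\<in>S. c \<odot>\<^bsub>L\<^esub> x \<in> S) \<and> (\<forall>x\<in>S. \<forall>y\<in>S. bracket L x y \<in> S)"
    and \<rho>: "linear_map k L L \<rho>" "\<And>x. x \<in> A \<Longrightarrow> \<rho> x \<in> A \<inter> B" "\<And>x. x \<in> B \<Longrightarrow> \<rho> x = x"
  shows "\<exists>X lt. subalgebras k L X lt A B (A \<inter> B)"
proof -
  interpret lie_algebra k L by (rule L)
  interpret k: field k by (rule k)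
  have L_mod: "Module.module k L" by unfold_locales
  obtain r :: "'b rel" where r: "well_order_on UNIV r" using well_order_on[of UNIV] by blast
  define cls :: "'b \<Rightarrow> nat" where "cls x = (if x \<in> A \<inter> B then 0 else if x \<in> A then 1 else if x \<in> B then 2 else 3)" for x
  define lt where "lt x y \<longleftrightarrow> cls x < cls y \<or> cls x = cls y \<and> (x, y) \<in> r - Id" for x y
  have r': "wf (r - Id)" "trans r" "antisym r" "total_on UNIV r"
    using r by (auto simp: well_order_on_def linear_order_on_def partial_order_on_def preorder_on_def)
  have "wf (inv_image (less_than <*lex*> (r - Id)) (\<lambda>x. (cls x, x)))" using r'(1) by auto
  moreover have "inv_image (less_than <*lex*> (r - Id)) (\<lambda>x. (cls x, x)) = {(x, y). lt x y}"
    by (auto simp: lt_def inv_image_def)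
  ultimately have wf: "wf {(x, y). lt x y}" by simp
  have tr: "lt x z" if "lt x y" "lt y z" for x y z
    using that transD[OF trans_diff_Id[OF r'(2,3)], of x y z] unfolding lt_def by auto
  have tot: "lt x y \<or> lt y x" if "x \<noteq> y" for x y
    using that r'(4) unfolding lt_def total_on_def by (cases "cls x" "cls y" rule: linorder_cases) auto
  define X where "X = {x \<in> carrier L. \<not> (\<exists>l. set l \<subseteq> carrier k \<times> {y \<in> carrier L. lt y x} \<and> lincomb L id l = x)}"
  have span: "\<exists>l. set l \<subseteq> carrier k \<times> (X \<inter> S) \<and> lincomb L id l = x"
    if S: "S \<subseteq> carrier L"
      and step: "\<And>x l. \<lbrakk>x \<in> S; set l \<subseteq> carrier k \<times> {y \<in> carrier L. lt y x}; lincomb L id l = x\<rbrakk> \<Longrightarrow>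
        \<exists>l. set l \<subseteq> carrier k \<times> {y \<in> S. lt y x} \<and> lincomb L id l = x"
      and "x \<in> S" for S x
    using wf that(3)
  proof (induction x rule: wf_induct_rule)
    case (less x)
    show ?case
    proof (cases "x \<in> X")
      case True
      then have "lincomb L id [(\<one>\<^bsub>k\<^esub>, x)] = x" by (simp add: X_def)
      then show ?thesis using True less.prems by (intro exI[of _ "[(\<one>\<^bsub>k\<^esub>, x)]"]) auto
    next
      case False
      then obtain l where "set l \<subseteq> carrier k \<times> {y \<in> carrier L. lt y x}" "lincomb L id l = x"
        using less.prems S by (auto simp: X_def)
      from step[OF less.prems this] obtain l where l: "set l \<subseteq> carrier k \<times> {y \<in> S. lt y x}" "lincomb L id l = x"
        by blast
      have "\<exists>l'. set l' \<subseteq> carrier k \<times> (X \<inter> S) \<and> lincomb L id l' = lincomb L id l"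
      proof (rule lincomb_subst[OF L_mod _ l(1)])
        show "X \<inter> S \<subseteq> carrier L" using S by blast
        fix y assume "y \<in> {y \<in> S. lt y x}"
        then show "\<exists>l'. set l' \<subseteq> carrier k \<times> (X \<inter> S) \<and> lincomb L id l' = y"
          by (intro less.IH) simp_all
      qed
      then show ?thesis unfolding l(2) .
    qed
  qed
  have easy: "\<exists>l. set l \<subseteq> carrier k \<times> {y \<in> S. lt y x} \<and> lincomb L id l = x"
    if "set l \<subseteq> carrier k \<times> {y \<in> carrier L. lt y x}" "lincomb L id l = x"
      "\<And>y. \<lbrakk>y \<in> carrier L; lt y x\<rbrakk> \<Longrightarrow> y \<in> S" for S x l
    using that by (intro exI[of _ l]) auto
  have cls_le: "cls y \<le> cls x" if "lt y x" for x y using that by (auto simp: lt_def)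
  have stepB: "\<exists>l. set l \<subseteq> carrier k \<times> {y \<in> B. lt y x} \<and> lincomb L id l = x"
    if x: "x \<in> B" and l: "set l \<subseteq> carrier k \<times> {y \<in> carrier L. lt y x}" "lincomb L id l = x" for x l
  proof -
    have im: "\<rho> y \<in> B \<and> lt (\<rho> y) x" if y: "y \<in> carrier L" "lt y x" for y
    proof (cases "y \<in> B")
      case True then show ?thesis using \<rho>(3) y by simp
    next
      case False
      have "cls x \<le> 2" using x by (simp add: cls_def)
      then have "y \<in> A" using cls_le[OF y(2)] False by (auto simp: cls_def split: if_splits)
      then have *: "cls y = 1" "\<rho> y \<in> A \<inter> B" using False \<rho>(2) by (auto simp: cls_def)
      moreover have "cls (\<rho> y) = 0" using *(2) by (auto simp: cls_def)
      ultimately show ?thesis using cls_le[OF y(2)] by (auto simp: lt_def)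
    qed
    have "x = \<rho> (lincomb L id l)" using l(2) \<rho>(3)[OF x] by simp
    also have "\<dots> = lincomb L (\<lambda>a. \<rho> (id a)) l"
      by (rule lincomb_linear_map[OF L_mod L_mod \<rho>(1) _ l(1)]) auto
    also have "\<dots> = lincomb L id (map (\<lambda>p. (fst p, \<rho> (snd p))) l)"
      by (induction l) auto
    finally have "lincomb L id (map (\<lambda>p. (fst p, \<rho> (snd p))) l) = x" by (rule HOL.sym)
    moreover have "set (map (\<lambda>p. (fst p, \<rho> (snd p))) l) \<subseteq> carrier k \<times> {y \<in> B. lt y x}"
    proof
      fix q assume "q \<in> set (map (\<lambda>p. (fst p, \<rho> (snd p))) l)"
      then obtain p where p: "p \<in> set l" "q = (fst p, \<rho> (snd p))" by auto
      then have "fst p \<in> carrier k" "snd p \<in> carrier L" "lt (snd p) x" using l(1) by auto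
      then show "q \<in> carrier k \<times> {y \<in> B. lt y x}" using im p(2) by auto
    qed
    ultimately show ?thesis by blast
  qed
  have stepA: "\<exists>l. set l \<subseteq> carrier k \<times> {y \<in> A. lt y x} \<and> lincomb L id l = x"
    if x: "x \<in> A" and l: "set l \<subseteq> carrier k \<times> {y \<in> carrier L. lt y x}" "lincomb L id l = x" for x l
  proof (rule easy[OF l])
    fix y assume y: "lt y x"
    have "cls x \<le> 1" using x by (simp add: cls_def)
    then show "y \<in> A" using cls_le[OF y] by (auto simp: cls_def split: if_splits)
  qed
  have stepD: "\<exists>l. set l \<subseteq> carrier k \<times> {y \<in> A \<inter> B. lt y x} \<and> lincomb L id l = x"
    if x: "x \<in> A \<inter> B" and l: "set l \<subseteq> carrier k \<times> {y \<in> carrier L. lt y x}" "lincomb L id l = x" for x l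
  proof (rule easy[OF l])
    fix y assume y: "lt y x"
    have "cls x = 0" using x by (simp add: cls_def)
    then show "y \<in> A \<inter> B" using cls_le[OF y] by (auto simp: cls_def split: if_splits)
  qed
  have mem: "A \<in> {A, B}" "B \<in> {A, B}" by simp_all
  note sA = sub[OF mem(1)] and sB = sub[OF mem(2)]
  have subL: "A \<subseteq> carrier L" "B \<subseteq> carrier L" "A \<inter> B \<subseteq> carrier L"
    using sA[THEN conjunct1] sB[THEN conjunct1] by blast+
  have "subalgebras k L X lt A B (A \<inter> B)"
  proof (intro subalgebras.intro ordered_basis.intro ordered_basis_axioms.intro subalgebras_axioms.intro L k L_mod)
    show "X \<subseteq> carrier L" by (auto simp: X_def)
    show "wfP lt" using wf by (simp add: wfp_def)
    show "lincomb L id l \<noteq> a" if "a \<in> X" "set l \<subseteq> carrier k \<times> {y \<in> X. lt y a}" for a l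
    proof -
      have "{y \<in> X. lt y a} \<subseteq> {y \<in> carrier L. lt y a}" unfolding X_def by blast
      then have "set l \<subseteq> carrier k \<times> {y \<in> carrier L. lt y a}" using that(2) by blast
      then show ?thesis using that(1) unfolding X_def by blast
    qed
    show "\<exists>l. set l \<subseteq> carrier k \<times> X \<and> lincomb L id l = x" if "x \<in> carrier L" for x
    proof -
      have "\<exists>l. set l \<subseteq> carrier k \<times> (X \<inter> carrier L) \<and> lincomb L id l = x"
        by (rule span[OF order_refl _ that]) blast
      then show ?thesis by blast
    qed
    fix S assume S: "S \<in> {A, B, A \<inter> B}"
    have "\<forall>x\<in>S. \<exists>l. set l \<subseteq> carrier k \<times> (X \<inter> S) \<and> lincomb L id l = x"
    proof
      fix x assume x: "x \<in> S"
      from S consider "S = A" | "S = B" | "S = A \<inter> B" by blast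
      then show "\<exists>l. set l \<subseteq> carrier k \<times> (X \<inter> S) \<and> lincomb L id l = x"
      proof cases
        case 1 show ?thesis unfolding 1 by (rule span[OF subL(1) stepA]) (use x 1 in simp_all)
      next
        case 2 show ?thesis unfolding 2 by (rule span[OF subL(2) stepB]) (use x 2 in simp_all)
      next
        case 3 show ?thesis unfolding 3 by (rule span[OF subL(3) stepD]) (use x 3 in simp_all)
      qed
    qed
    moreover have "S \<subseteq> carrier L \<and> \<zero>\<^bsub>L\<^esub> \<in> S \<and> (\<forall>x\<in>S. \<forall>y\<in>S. x \<oplus>\<^bsub>L\<^esub> y \<in> S) \<and>
      (\<forall>c\<in>carrier k. \<forall>x\<in>S. c \<odot>\<^bsub>L\<^esub> x \<in> S) \<and> (\<forall>x\<in>S. \<forall>y\<in>S. bracket L x y \<in> S)"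
    proof -
      from S consider "S = A" | "S = B" | "S = A \<inter> B" by blast
      then show ?thesis
      proof cases
        case 3
        have "\<zero>\<^bsub>L\<^esub> \<in> A \<inter> B" using sA sB by simp
        moreover have "x \<oplus>\<^bsub>L\<^esub> y \<in> A \<inter> B" "bracket L x y \<in> A \<inter> B" if "x \<in> A \<inter> B" "y \<in> A \<inter> B" for x y
          using sA sB that by simp_all
        moreover have "c \<odot>\<^bsub>L\<^esub> x \<in> A \<inter> B" if "c \<in> carrier k" "x \<in> A \<inter> B" for c x
          using sA sB that by simp
        ultimately show ?thesis unfolding 3 using subL(3) by blast
      qed (use sA sB in simp_all)
    qed
    ultimately show "S \<subseteq> carrier L \<and> \<zero>\<^bsub>L\<^esub> \<in> S \<and> (\<forall>x\<in>S. \<forall>y\<in>S. x \<oplus>\<^bsub>L\<^esub> y \<in> S) \<and>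
      (\<forall>c\<in>carrier k. \<forall>x\<in>S. c \<odot>\<^bsub>L\<^esub> x \<in> S) \<and> (\<forall>x\<in>S. \<forall>y\<in>S. bracket L x y \<in> S) \<and>
      (\<forall>x\<in>S. \<exists>l. set l \<subseteq> carrier k \<times> (X \<inter> S) \<and> lincomb L id l = x)" by blast
  qed (use tr tot in blast)+
  then show ?thesis by blast
qed

section \<open>Deleting a vertex\<close>

lemma (in lie_algebra) trivial_lie_module: "lie_module R L (trivial_module R :: ('a, 'a, 'b) lie_module)"
proof (intro lie_module.intro lie_module_axioms.intro)
  show "lie_algebra R L" ..
  have "abelian_group (trivial_module R :: ('a, 'a, 'b) lie_module)"
  proof (rule abelian_groupI)
    fix x assume "x \<in> carrier (trivial_module R :: ('a, 'a, 'b) lie_module)"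
    then show "\<exists>y\<in>carrier (trivial_module R :: ('a, 'a, 'b) lie_module). y \<oplus>\<^bsub>trivial_module R :: ('a, 'a, 'b) lie_module\<^esub> x =
        \<zero>\<^bsub>trivial_module R :: ('a, 'a, 'b) lie_module\<^esub>"
      by (intro bexI[of _ "\<ominus> x"]) (auto simp: trivial_module_def R.l_neg)
  qed (auto simp: trivial_module_def R.a_ac)
  then show m: "Module.module R (trivial_module R :: ('a, 'a, 'b) lie_module)"
    by (rule moduleI[OF R.is_cring]) (auto simp: trivial_module_def R.l_distr R.r_distr R.m_assoc)
  interpret T: Module.module R "trivial_module R :: ('a, 'a, 'b) lie_module" by (rule m)
  fix x y m
  show "act (trivial_module R :: ('a, 'a, 'b) lie_module) (bracket L x y) m =
     act (trivial_module R) x (act (trivial_module R) y m) \<ominus>\<^bsub>trivial_module R :: ('a, 'a, 'b) lie_module\<^esub>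
     act (trivial_module R) y (act (trivial_module R) x m)"
    using T.M.minus_self[OF T.M.zero_closed] by (simp add: trivial_module_def)
qed (auto simp: trivial_module_def)

lemma (in lie_algebra) bracket_zero: "x \<in> carrier L \<Longrightarrow> bracket L \<zero>\<^bsub>L\<^esub> x = \<zero>\<^bsub>L\<^esub>" "x \<in> carrier L \<Longrightarrow> bracket L x \<zero>\<^bsub>L\<^esub> = \<zero>\<^bsub>L\<^esub>"
  using bracket_smult_left[of \<zero> "\<zero>\<^bsub>L\<^esub>" x] bracket_smult_right[of \<zero> x "\<zero>\<^bsub>L\<^esub>"] L_zero_closed bracket_closed by simp_all

context raag begin

definition delete :: "'v \<Rightarrow> ('a, 'v) lie_term set \<Rightarrow> ('a, 'v) lie_term set" where
  "delete v = (SOME \<phi>. \<phi> \<in> lie_hom k L L \<and> (\<forall>u\<in>V. \<phi> (vx u) = (if u = v then \<zero>\<^bsub>L\<^esub> else vx u)))"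

text \<open>Sending a generator to zero respects the relators, because a bracket with zero is
  zero.\<close>

lemma delete: "delete v \<in> lie_hom k L L" "u \<in> V \<Longrightarrow> delete v (vx u) = (if u = v then \<zero>\<^bsub>L\<^esub> else vx u)"
proof -
  obtain \<phi> where "\<phi> \<in> lie_hom k L L" "\<And>u. u \<in> V \<Longrightarrow> \<phi> (vx u) = (if u = v then \<zero>\<^bsub>L\<^esub> else vx u)"
    by (rule hom_exists[OF L_lie, of "\<lambda>u. if u = v then \<zero>\<^bsub>L\<^esub> else vx u"])
      (auto simp: L.L_zero_closed L.bracket_zero vx_edge)
  then have "\<exists>\<phi>. \<phi> \<in> lie_hom k L L \<and> (\<forall>u\<in>V. \<phi> (vx u) = (if u = v then \<zero>\<^bsub>L\<^esub> else vx u))" by blast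
  from someI_ex[OF this] show "delete v \<in> lie_hom k L L" "u \<in> V \<Longrightarrow> delete v (vx u) = (if u = v then \<zero>\<^bsub>L\<^esub> else vx u)"
    unfolding delete_def by auto
qed

lemmas deleteD = lie_homD[OF delete(1)]

lemma L_mod: "Module.module k L" by unfold_locales

lemma delete_zero: "delete v \<zero>\<^bsub>L\<^esub> = \<zero>\<^bsub>L\<^esub>"
  by (rule linear_map_zero[OF L_mod L_mod lie_hom_linear[OF delete(1)]])

lemma lie_hom_comp: "\<lbrakk>\<phi> \<in> lie_hom k L L; \<psi> \<in> lie_hom k L H\<rbrakk> \<Longrightarrow> (\<lambda>x. \<psi> (\<phi> x)) \<in> lie_hom k L H"
  unfolding lie_hom_def by (simp add: Pi_iff)

lemma delete_idem: "x \<in> carrier L \<Longrightarrow> delete v (delete v x) = delete v x"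
  by (rule hom_unique[OF L_lie lie_hom_comp[OF delete(1) delete(1)] delete(1)]) (auto simp: delete delete_zero)

lemma delete_commute: "x \<in> carrier L \<Longrightarrow> delete v (delete w x) = delete w (delete v x)"
  by (rule hom_unique[OF L_lie lie_hom_comp[OF delete(1) delete(1)] lie_hom_comp[OF delete(1) delete(1)]])
    (auto simp: delete delete_zero)

text \<open>The subalgebra generated by the vertices other than \<open>v\<close>, given as the fixed
  points of the retraction \<open>delete v\<close>. This form makes closure under the operations
  immediate, and since two deletions commute, \<open>delete w\<close> maps \<open>avoiding v\<close>
  to the intersection with \<open>avoiding w\<close>.\<close>

definition avoiding :: "'v \<Rightarrow> ('a, 'v) lie_term set set" where
  "avoiding v = {x \<in> carrier L. delete v x = x}"

lemma avoiding_sub: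
  "avoiding v \<subseteq> carrier L \<and> \<zero>\<^bsub>L\<^esub> \<in> avoiding v \<and> (\<forall>x\<in>avoiding v. \<forall>y\<in>avoiding v. x \<oplus>\<^bsub>L\<^esub> y \<in> avoiding v) \<and>
    (\<forall>c\<in>carrier k. \<forall>x\<in>avoiding v. c \<odot>\<^bsub>L\<^esub> x \<in> avoiding v) \<and> (\<forall>x\<in>avoiding v. \<forall>y\<in>avoiding v. bracket L x y \<in> avoiding v)"
  unfolding avoiding_def by (auto simp: deleteD delete_zero L.L_zero_closed L.bracket_closed)

lemma vx_avoiding: "\<lbrakk>u \<in> V; u \<noteq> v\<rbrakk> \<Longrightarrow> vx u \<in> avoiding v"
  by (simp add: avoiding_def delete)

lemma lie_sub_avoiding:
  assumes "lie_module k L M" "S \<in> {carrier L, avoiding v, avoiding w, avoiding v \<inter> avoiding w}"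
  shows "lie_sub k L M S"
proof (intro lie_sub.intro assms(1))
  show "lie_sub_axioms k L S"
    using assms(2) avoiding_sub[of v] avoiding_sub[of w] unfolding lie_sub_axioms_def
    by (auto simp: L.L_zero_closed L.bracket_closed)
qed

abbreviation "triv \<equiv> trivial_module k :: ('a, 'a, ('a, 'v) lie_term set) lie_module"

text \<open>Nonadjacency enters here: no edge contains both \<open>v\<close> and \<open>w\<close>,
  so each edge misses one of them and lies in the corresponding subalgebra.\<close>

lemma mayer_vietoris_nonadjacent:
  assumes vw: "v \<in> V" "w \<in> V" "v \<noteq> w" "{v, w} \<notin> E"
  shows "mayer_vietoris k L triv (avoiding v) (avoiding w) (avoiding v \<inter> avoiding w) j"
proof -
  have "delete w x \<in> avoiding v \<inter> avoiding w" if "x \<in> avoiding v" for x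
    using that deleteD(1)[of x w] delete_idem[of x w] delete_commute[of x v w] by (simp add: avoiding_def)
  then have "\<exists>X lt. subalgebras k L X lt (avoiding v) (avoiding w) (avoiding v \<inter> avoiding w)"
    by (intro adapted_basis[OF L_lie k _ lie_hom_linear[OF delete(1)]])
      (use avoiding_sub in \<open>auto simp: avoiding_def\<close>)
  then obtain X lt where "subalgebras k L X lt (avoiding v) (avoiding w) (avoiding v \<inter> avoiding w)" by blast
  then show ?thesis
  proof (rule subalgebras.mayer_vietoris_trivial)
    show "lie_module k L triv" by (rule L.trivial_lie_module)
    fix M :: "('a, ('a, 'v) lie_term set multiset list \<Rightarrow> 'a, ('a, 'v) lie_term set) lie_module"
    assume M: "lie_module k L M"
    show "mayer_vietoris k L M (avoiding v) (avoiding w) (avoiding v \<inter> avoiding w) 0"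
    proof (rule mayer_vietoris_base[OF M _ HOL.refl])
      show "lie_sub k L M S" if "S \<in> {avoiding v, avoiding w, avoiding v \<inter> avoiding w}" for S
        by (rule lie_sub_avoiding[OF M, of S v w]) (use that in auto)
      show "vx u \<in> avoiding v \<or> vx u \<in> avoiding w" if "u \<in> V" for u
        using vx_avoiding[OF that, of v] vx_avoiding[OF that, of w] vw(3) by blast
      show "vx u \<in> avoiding v \<and> vx u' \<in> avoiding v \<or> vx u \<in> avoiding w \<and> vx u' \<in> avoiding w"
        if "{u, u'} \<in> E" "u \<in> V" "u' \<in> V" for u u'
      proof -
        have "\<not> (v \<in> {u, u'} \<and> w \<in> {u, u'})" using that(1) vw(3,4) by (auto simp: insert_commute)
        then show ?thesis
          using vx_avoiding[OF that(2), of v] vx_avoiding[OF that(2), of w] vx_avoiding[OF that(3), of v]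
            vx_avoiding[OF that(3), of w] by blast
      qed
    qed
  qed
qed

end

section \<open>Comparison with the Chevalley-Eilenberg complex\<close>

context lie_sub begin

text \<open>The recursive definition asks for vanishing when the first two entries agree. The
  leading entry is moved inward by skew symmetry until it meets its copy.\<close>

lemma C_repeat: "\<lbrakk>C (Suc q) f; y \<in> set ys; ys \<in> LS q\<rbrakk> \<Longrightarrow> f (y # ys) = \<zero>\<^bsub>M\<^esub>"
proof (induction q arbitrary: f ys)
  case (Suc q)
  from Suc.prems(3) obtain z zs where ys: "ys = z # zs" "z \<in> S" "zs \<in> LS q" by (rule lists_of_SucE)
  have y: "y \<in> S" using Suc.prems(2,3) by (auto simp: lists_of_def)
  show ?case
  proof (cases "y = z")
    case True then show ?thesis using C_self[OF Suc.prems(1)] ys by simp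
  next
    case False
    have "f (z # y # zs) = \<zero>\<^bsub>M\<^esub>"
      by (rule Suc.IH[OF C_inner[OF Suc.prems(1) ys(2)] _ ys(3)]) (use False Suc.prems(2) ys in simp)
    then show ?thesis using C_skew[OF Suc.prems(1) y ys(2,3)] ys by (simp add: M.M.a_inv_zero)
  qed
qed simp

lemma nth_LS: "\<lbrakk>xs \<in> LS n; i < n\<rbrakk> \<Longrightarrow> xs ! i \<in> S"
  unfolding lists_of_def using nth_mem by blast

lemma C_slot:
  "\<lbrakk>C n f; xs \<in> LS n; i < n; x \<in> S; y \<in> S\<rbrakk> \<Longrightarrow> f (xs[i := x \<oplus>\<^bsub>L\<^esub> y]) = f (xs[i := x]) \<oplus>\<^bsub>M\<^esub> f (xs[i := y])"
  "\<lbrakk>C n f; xs \<in> LS n; i < n; c \<in> carrier R; x \<in> S\<rbrakk> \<Longrightarrow> f (xs[i := c \<odot>\<^bsub>L\<^esub> x]) = c \<odot>\<^bsub>M\<^esub> f (xs[i := x])"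
proof (induction n arbitrary: f xs i)
  case (Suc n)
  {
    case 1
    from 1(2) obtain z zs where xs: "xs = z # zs" "z \<in> S" "zs \<in> LS n" by (rule lists_of_SucE)
    show ?case
    proof (cases i)
      case 0 then show ?thesis using 1 xs by simp
    next
      case (Suc i')
      then show ?thesis using Suc.IH(1)[OF C_inner[OF 1(1) xs(2)] xs(3), of i'] 1 xs by simp
    qed
  next
    case 2
    from 2(2) obtain z zs where xs: "xs = z # zs" "z \<in> S" "zs \<in> LS n" by (rule lists_of_SucE)
    show ?case
    proof (cases i)
      case 0 then show ?thesis using 2 xs by simp
    next
      case (Suc i')
      then show ?thesis using Suc.IH(2)[OF C_inner[OF 2(1) xs(2)] xs(3), of i'] 2 xs by simp
    qed
  }
qed simp_all

lemma C_repeat_nth: "\<lbrakk>C n f; xs \<in> LS n; i < n; j < n; i \<noteq> j; xs ! i = xs ! j\<rbrakk> \<Longrightarrow> f xs = \<zero>\<^bsub>M\<^esub>"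
proof (induction n arbitrary: f xs i j)
  case (Suc n)
  from Suc.prems(2) obtain z zs where xs: "xs = z # zs" "z \<in> S" "zs \<in> LS n" by (rule lists_of_SucE)
  have len: "length zs = n" using xs(3) by (simp add: lists_of_def)
  have r: "f (z # zs) = \<zero>\<^bsub>M\<^esub>" if "z \<in> set zs"
    by (rule C_repeat[OF Suc.prems(1) that xs(3)])
  show ?case
  proof (cases i)
    case 0
    then obtain j' where "j = Suc j'" "j' < n" "zs ! j' = z" using Suc.prems xs by (cases j) auto
    then show ?thesis using r nth_mem[of j' zs] len xs by auto
  next
    case (Suc i')
    show ?thesis
    proof (cases j)
      case 0
      then have "i' < n" "zs ! i' = z" using Suc.prems xs Suc by auto
      then show ?thesis using r nth_mem[of i' zs] len xs by auto
    next
      case (Suc j')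
      then show ?thesis
        using Suc.IH[OF C_inner[OF Suc.prems(1) xs(2)] xs(3), of i' j'] Suc.prems xs \<open>i = Suc i'\<close> by simp
    qed
  qed
qed simp

lemma C_of_slots:
  assumes "\<And>xs. xs \<in> LS n \<Longrightarrow> f xs \<in> carrier M"
    "\<And>xs i x y. \<lbrakk>xs \<in> LS n; i < n; x \<in> S; y \<in> S\<rbrakk> \<Longrightarrow> f (xs[i := x \<oplus>\<^bsub>L\<^esub> y]) = f (xs[i := x]) \<oplus>\<^bsub>M\<^esub> f (xs[i := y])"
    "\<And>xs i c x. \<lbrakk>xs \<in> LS n; i < n; c \<in> carrier R; x \<in> S\<rbrakk> \<Longrightarrow> f (xs[i := c \<odot>\<^bsub>L\<^esub> x]) = c \<odot>\<^bsub>M\<^esub> f (xs[i := x])"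
    "\<And>xs i j. \<lbrakk>xs \<in> LS n; i < n; j < n; i \<noteq> j; xs ! i = xs ! j\<rbrakk> \<Longrightarrow> f xs = \<zero>\<^bsub>M\<^esub>"
  shows "C n f"
  using assms
proof (induction n arbitrary: f)
  case 0
  then show ?case by simp
next
  case (Suc n)
  show ?case unfolding cochain.simps
  proof (intro conjI ballI allI impI)
    fix x assume x: "x \<in> S"
    show "C n (\<lambda>zs. f (x # zs))"
    proof (rule Suc.IH)
      fix xs assume xs: "xs \<in> LS n"
      show "f (x # xs) \<in> carrier M" using Suc.prems(1) x xs by simp
      fix i assume i: "i < n"
      show "f (x # xs[i := y \<oplus>\<^bsub>L\<^esub> z]) = f (x # xs[i := y]) \<oplus>\<^bsub>M\<^esub> f (x # xs[i := z])" if "y \<in> S" "z \<in> S" for y z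
        using Suc.prems(2)[of "x # xs" "Suc i" y z] x xs i that by simp
      show "f (x # xs[i := c \<odot>\<^bsub>L\<^esub> y]) = c \<odot>\<^bsub>M\<^esub> f (x # xs[i := y])" if "c \<in> carrier R" "y \<in> S" for c y
        using Suc.prems(3)[of "x # xs" "Suc i" c y] x xs i that by simp
      show "f (x # xs) = \<zero>\<^bsub>M\<^esub>" if "j < n" "i \<noteq> j" "xs ! i = xs ! j" for j
        using Suc.prems(4)[of "x # xs" "Suc i" "Suc j"] x xs i that by simp
    qed
  next
    fix x y zs assume a: "x \<in> S" "y \<in> S" "zs \<in> LS n"
    show "f ((x \<oplus>\<^bsub>L\<^esub> y) # zs) = f (x # zs) \<oplus>\<^bsub>M\<^esub> f (y # zs)"
      using Suc.prems(2)[of "x # zs" 0 x y] a by simp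
  next
    fix c x zs assume a: "c \<in> carrier R" "x \<in> S" "zs \<in> LS n"
    show "f ((c \<odot>\<^bsub>L\<^esub> x) # zs) = c \<odot>\<^bsub>M\<^esub> f (x # zs)"
      using Suc.prems(3)[of "x # zs" 0 c x] a by simp
  next
    fix x p zs assume a: "x \<in> S" "n = Suc p" "zs \<in> LS p"
    show "f (x # x # zs) = \<zero>\<^bsub>M\<^esub>"
      using Suc.prems(4)[of "x # x # zs" 0 1] a by simp
  qed
qed

text \<open>Translates between the slotwise multilinear extensional maps of the cohomology
  definition, on a separate record \<open>B\<close>, and the recursive cochains on the subset
  \<open>S\<close>.\<close>

lemma cochains_iff:
  assumes B: "carrier B = S" "add B = add L" "smult B = smult L"
  shows "f \<in> cochains R B M n \<longleftrightarrow> f \<in> extensional (LS n) \<and> C n f"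
proof -
  have t: "tuples B n = LS n" by (simp add: tuples_def lists_of_def B(1))
  show ?thesis
  proof
    assume f: "f \<in> cochains R B M n"
    have "C n f"
      by (rule C_of_slots) (use f in \<open>auto simp: cochains_def t B PiE_iff\<close>)
    then show "f \<in> extensional (LS n) \<and> C n f" using f by (auto simp: cochains_def t PiE_iff)
  next
    assume f: "f \<in> extensional (LS n) \<and> C n f"
    then show "f \<in> cochains R B M n"
      using C_slot[of n f] C_closed[of n f] C_repeat_nth[of n f]
      by (auto simp: cochains_def t B PiE_iff)
  qed
qed

end

lemma (in abelian_monoid) finsum_lessThan_Suc2:
  "f \<in> {..<Suc n} \<rightarrow> carrier G \<Longrightarrow> finsum G f {..<Suc n} = f 0 \<oplus> finsum G (\<lambda>i. f (Suc i)) {..<n}"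
  using finsum_Suc2[of f "n - 1"] by (cases n) (auto simp: lessThan_Suc_atMost a_comm Pi_iff)

lemma (in abelian_group) finsum_uminus:
  "f \<in> A \<rightarrow> carrier G \<Longrightarrow> finsum G (\<lambda>i. \<ominus> f i) A = \<ominus> finsum G f A"
proof (induction A rule: infinite_finite_induct)
  case (insert x F)
  then have "f x \<in> carrier G" "f \<in> F \<rightarrow> carrier G" by auto
  then show ?case using insert by (simp add: minus_add Pi_iff)
qed (simp_all add: a_inv_zero)

section \<open>The coboundary with trivial coefficients as a signed sum\<close>

locale trivial_coefficients = lie_sub R L "trivial_module R :: ('a, 'a, 'b) lie_module" S
  for R :: "('a, 'x) ring_scheme" (structure) and L :: "('a, 'b, 'y) lie_algebra_scheme" (structure)
    and S :: "'b set"
begin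

abbreviation "triv \<equiv> trivial_module R :: ('a, 'a, 'b) lie_module"

lemma triv_simps [simp]:
  "carrier triv = carrier R" "\<zero>\<^bsub>triv\<^esub> = \<zero>" "add triv = add R" "smult triv = monoid.mult R" "act triv x = (\<lambda>m. \<zero>)"
  by (simp_all add: trivial_module_def)

lemma triv_neg [simp]: "a_inv triv = a_inv R"
  by (rule HOL.ext) (simp add: a_inv_def m_inv_def)

lemma triv_minus [simp]: "a_minus triv = a_minus R"
  by (intro HOL.ext) (simp add: a_minus_def)

lemma triv_finsum: "finsum triv f I = finsum R f I"
  unfolding finsum_def finprod_def by (simp add: trivial_module_def)

lemma sign_pow_closed [simp]: "sign_pow R i \<in> carrier R"
  by (simp add: sign_pow_def)

lemma sign_pow_Suc: "sign_pow R (Suc i) = \<ominus> sign_pow R i"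
  by (simp add: sign_pow_def R.r_minus)

lemma sign_pow_0 [simp]: "sign_pow R 0 = \<one>"
  by (simp add: sign_pow_def)

lemma nths_LS: "\<lbrakk>xs \<in> LS (Suc n); i \<le> n\<rbrakk> \<Longrightarrow> nths xs (- {i}) \<in> LS n"
proof (induction n arbitrary: xs i)
  case (Suc n)
  from Suc.prems(1) obtain y ys where xs: "xs = y # ys" "y \<in> S" "ys \<in> LS (Suc n)" by (rule lists_of_SucE)
  show ?case
  proof (cases i)
    case 0
    have "{j. Suc j \<in> - {0 :: nat}} = UNIV" by auto
    then show ?thesis using xs 0 by (simp add: nths_Cons nths_all)
  next
    case (Suc i')
    have "{j. Suc j \<in> - {Suc i'}} = - {i'}" by auto
    then show ?thesis using Suc.IH[OF xs(3), of i'] xs Suc Suc.prems by (simp add: nths_Cons)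
  qed
qed (auto elim!: lists_of_1E simp: nths_Cons)

lemma nths_Cons_0: "nths (y # ys) (- {0}) = ys"
proof -
  have "{j. Suc j \<in> - {0 :: nat}} = UNIV" by auto
  then show ?thesis by (simp add: nths_Cons nths_all)
qed

lemma nths_Cons_Suc: "nths (y # ys) (- {Suc i}) = y # nths ys (- {i})"
proof -
  have "{j. Suc j \<in> - {Suc i}} = - {i}" by auto
  then show ?thesis by (simp add: nths_Cons)
qed

lemma nths_Cons_0_Suc: "nths (y # ys) (- {0, Suc j}) = nths ys (- {j})"
proof -
  have "{i. Suc i \<in> - {0, Suc j}} = - {j}" by auto
  then show ?thesis by (simp add: nths_Cons)
qed

lemma nths_Cons_Suc_Suc: "nths (y # ys) (- {Suc i, Suc j}) = y # nths ys (- {i, j})"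
proof -
  have "{l. Suc l \<in> - {Suc i, Suc j}} = - {i, j}" by auto
  then show ?thesis by (simp add: nths_Cons)
qed

lemma nths_LS2: "\<lbrakk>xs \<in> LS (Suc (Suc n)); i < j; j \<le> Suc n\<rbrakk> \<Longrightarrow> nths xs (- {i, j}) \<in> LS n"
proof (induction n arbitrary: xs i j)
  case 0
  then have "i = 0" "j = Suc 0" by auto
  moreover from 0(1) obtain y ys where xs: "xs = y # ys" "ys \<in> LS (Suc 0)" by (blast elim: lists_of_SucE)
  moreover from xs(2) obtain z where "ys = [z]" by (blast elim: lists_of_1E)
  ultimately show ?case by (simp add: nths_Cons_0_Suc nths_Cons)
next
  case (Suc n)
  from Suc.prems(1) obtain y ys where xs: "xs = y # ys" "y \<in> S" "ys \<in> LS (Suc (Suc n))" by (rule lists_of_SucE)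
  obtain j' where j: "j = Suc j'" using Suc.prems(2) by (cases j) auto
  show ?case
  proof (cases i)
    case 0 then show ?thesis using xs j nths_LS[OF xs(3), of j'] Suc.prems by (simp add: nths_Cons_0_Suc)
  next
    case (Suc i')
    then show ?thesis using xs j Suc.IH[OF xs(3), of i' j'] Suc.prems by (simp add: nths_Cons_Suc_Suc)
  qed
qed

text \<open>Each step of the recursion moves the bracket past one argument \<open>y\<close>; the
  sign from skew symmetry is the one by which consecutive values of \<open>sign_pow\<close>
  differ.\<close>

lemma LX_sum:
  "\<lbrakk>C n f; xs \<in> LS n; x \<in> S\<rbrakk> \<Longrightarrow>
    LX x f xs = \<ominus> (\<Oplus>j\<in>{..<n}. sign_pow R j \<otimes> f (bracket L x (xs ! j) # nths xs (- {j})))"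
proof (induction n arbitrary: f xs)
  case (Suc n)
  note f = Suc.prems(1) and x = Suc.prems(3)
  from Suc.prems(2) obtain y ys where xs: "xs = y # ys" "y \<in> S" "ys \<in> LS n" by (rule lists_of_SucE)
  have fc: "f zs \<in> carrier R" if "zs \<in> LS (Suc n)" for zs using C_closed[OF f that] by simp
  have i: "C n (\<lambda>zs. f (y # zs))" using C_inner[OF f xs(2)] .
  have br: "bracket L x z \<in> S" if "z \<in> S" for z using S_bracket x that by simp
  let ?T = "\<lambda>j. sign_pow R j \<otimes> f (bracket L x (xs ! j) # nths xs (- {j}))"
  have T: "?T \<in> {..<Suc n} \<rightarrow> carrier R"
    using nths_LS[OF Suc.prems(2)] nth_LS[OF Suc.prems(2)] br by (auto intro!: R.m_closed fc)
  have t: "?T (Suc j) = sign_pow R j \<otimes> f (y # bracket L x (ys ! j) # nths ys (- {j}))" if j: "j < n" for j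
  proof -
    obtain n' where n: "n = Suc n'" using j by (cases n) auto
    have z: "nths ys (- {j}) \<in> LS n'" using nths_LS[of ys n' j] xs(3) j n by simp
    have yj: "bracket L x (ys ! j) \<in> S" by (rule br) (rule nth_LS[OF xs(3) j])
    have "f (bracket L x (ys ! j) # y # nths ys (- {j})) = \<ominus> f (y # bracket L x (ys ! j) # nths ys (- {j}))"
      using C_skew[OF f[unfolded n] yj xs(2) z] fc[of "y # bracket L x (ys ! j) # nths ys (- {j})"] z yj xs(2) n by simp
    moreover have "f (y # bracket L x (ys ! j) # nths ys (- {j})) \<in> carrier R" using z yj xs(2) n by (intro fc) simp
    ultimately show ?thesis using xs by (simp add: nths_Cons_Suc sign_pow_Suc R.l_minus R.r_minus)
  qed
  have closed: "sign_pow R j \<otimes> f (y # bracket L x (ys ! j) # nths ys (- {j})) \<in> carrier R" if j: "j < n" for j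
  proof -
    obtain n' where n: "n = Suc n'" using j by (cases n) auto
    show ?thesis using nths_LS[of ys n' j] xs(2,3) j n br[OF nth_LS[OF xs(3) j]]
      by (intro R.m_closed sign_pow_closed fc) simp
  qed
  have "finsum R ?T {..<Suc n} = ?T 0 \<oplus> finsum R (\<lambda>j. ?T (Suc j)) {..<n}"
    by (rule R.finsum_lessThan_Suc2[OF T])
  also have "finsum R (\<lambda>j. ?T (Suc j)) {..<n} =
      (\<Oplus>j\<in>{..<n}. sign_pow R j \<otimes> f (y # bracket L x (ys ! j) # nths ys (- {j})))" (is "_ = ?U")
    by (rule R.finsum_cong') (use t closed in auto)
  also have "?T 0 = f (bracket L x y # ys)" using xs fc br by (simp add: nths_Cons_0)
  finally have s: "finsum R ?T {..<Suc n} = f (bracket L x y # ys) \<oplus> ?U" .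
  have U: "?U \<in> carrier R" by (rule R.finsum_closed) (use closed in auto)
  have b: "f (bracket L x y # ys) \<in> carrier R" using fc br xs by simp
  have "LX x f xs = \<ominus> ?U \<ominus> f (bracket L x y # ys)"
    unfolding xs(1) lie_der.simps Suc.IH[OF i xs(3) x] using U b by simp
  also have "\<dots> = \<ominus> (f (bracket L x y # ys) \<oplus> ?U)" using U b by (simp add: a_minus_def R.minus_add R.a_comm)
  finally show ?case unfolding s .
qed simp

text \<open>The double sum is split at \<open>i = 0\<close>. The terms with \<open>i = 0\<close> are
  the Lie derivative by \<open>LX_sum\<close>. In the others the first argument \<open>x\<close> is
  moved in front of the bracket, which gives the negative of the same sum for the contracted
  cochain, as in Cartan's formula.\<close>

lemma d_sum:
  "\<lbrakk>C n f; xs \<in> LS (Suc n)\<rbrakk> \<Longrightarrow>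
    d f xs = (\<Oplus>j\<in>{..n}. \<Oplus>i\<in>{..<j}. sign_pow R (i + j) \<otimes> f (bracket L (xs ! i) (xs ! j) # nths xs (- {i, j})))"
proof (induction n arbitrary: f xs)
  case 0
  then obtain x where "xs = [x]" "x \<in> S" by (blast elim: lists_of_1E)
  then show ?case by (simp add: R.minus_self)
next
  case (Suc n)
  note f = Suc.prems(1)
  from Suc.prems(2) obtain x ys where xs: "xs = x # ys" "x \<in> S" "ys \<in> LS (Suc n)" by (rule lists_of_SucE)
  have fc: "f zs \<in> carrier R" if "zs \<in> LS (Suc n)" for zs using C_closed[OF f that] by simp
  have i: "C n (\<lambda>zs. f (x # zs))" using C_inner[OF f xs(2)] .
  let ?T = "\<lambda>i j. sign_pow R (i + j) \<otimes> f (bracket L (xs ! i) (xs ! j) # nths xs (- {i, j}))"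
  let ?U = "\<lambda>i j. sign_pow R (i + j) \<otimes> f (x # bracket L (ys ! i) (ys ! j) # nths ys (- {i, j}))"
  let ?A = "\<lambda>j. sign_pow R j \<otimes> f (bracket L x (ys ! j) # nths ys (- {j}))"
  have Tc: "?T i j \<in> carrier R" if "i < j" "j \<le> Suc n" for i j
    using nths_LS2[OF Suc.prems(2) that] nth_LS[OF Suc.prems(2), of i] nth_LS[OF Suc.prems(2), of j] that S_bracket
    by (intro R.m_closed sign_pow_closed fc) simp
  have U: "?U i j \<in> carrier R \<and> ?T (Suc i) (Suc j) = \<ominus> ?U i j" if ij: "i < j" "j \<le> n" for i j
  proof -
    obtain n' where n: "n = Suc n'" using ij by (cases n) auto
    have z: "nths ys (- {i, j}) \<in> LS n'" using nths_LS2[of ys n' i j] xs(3) ij n by simp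
    have b: "bracket L (ys ! i) (ys ! j) \<in> S"
      by (intro S_bracket nth_LS[OF xs(3)]) (use ij in auto)
    have c: "f (x # bracket L (ys ! i) (ys ! j) # nths ys (- {i, j})) \<in> carrier R" using z b xs(2) n by (intro fc) simp
    have "f (bracket L (ys ! i) (ys ! j) # x # nths ys (- {i, j})) = \<ominus> f (x # bracket L (ys ! i) (ys ! j) # nths ys (- {i, j}))"
      using C_skew[OF f[unfolded n] b xs(2) z] c by simp
    then show ?thesis using xs(1) c by (simp add: nths_Cons_Suc_Suc sign_pow_Suc R.r_minus R.l_minus)
  qed
  have A: "?A j \<in> carrier R \<and> ?T 0 (Suc j) = \<ominus> ?A j" if j: "j \<le> n" for j
  proof -
    have c: "f (bracket L x (ys ! j) # nths ys (- {j})) \<in> carrier R"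
      using nths_LS[OF xs(3) j] nth_LS[OF xs(3), of j] j S_bracket xs(2) by (intro fc) simp
    then show ?thesis using xs(1) by (simp add: nths_Cons_0_Suc sign_pow_Suc R.l_minus)
  qed
  have inner: "(\<Oplus>i\<in>{..<Suc j}. ?T i (Suc j)) = \<ominus> ?A j \<oplus> \<ominus> (\<Oplus>i\<in>{..<j}. ?U i j)" if j: "j \<le> n" for j
  proof -
    have "(\<Oplus>i\<in>{..<Suc j}. ?T i (Suc j)) = ?T 0 (Suc j) \<oplus> (\<Oplus>i\<in>{..<j}. ?T (Suc i) (Suc j))"
      by (rule R.finsum_lessThan_Suc2, rule Pi_I, rule Tc) (use j in auto)
    also have "(\<Oplus>i\<in>{..<j}. ?T (Suc i) (Suc j)) = (\<Oplus>i\<in>{..<j}. \<ominus> ?U i j)"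
      by (rule R.finsum_cong') (use U j in auto)
    also have "\<dots> = \<ominus> (\<Oplus>i\<in>{..<j}. ?U i j)"
      by (rule R.finsum_uminus) (use U j in auto)
    finally show ?thesis using A[OF j] by simp
  qed
  have Us: "(\<Oplus>i\<in>{..<j}. ?U i j) \<in> carrier R" if "j \<le> n" for j
    by (rule R.finsum_closed) (use U that in auto)
  have "(\<Oplus>j\<in>{..Suc n}. \<Oplus>i\<in>{..<j}. ?T i j) = (\<Oplus>j\<in>{..n}. \<Oplus>i\<in>{..<Suc j}. ?T i (Suc j)) \<oplus> (\<Oplus>i\<in>{..<0}. ?T i 0)"
    by (rule R.finsum_Suc2) (auto intro!: R.finsum_closed simp: Tc)
  also have "\<dots> = (\<Oplus>j\<in>{..n}. \<Oplus>i\<in>{..<Suc j}. ?T i (Suc j))"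
  proof -
    have "(\<Oplus>j\<in>{..n}. \<Oplus>i\<in>{..<Suc j}. ?T i (Suc j)) \<in> carrier R"
      by (rule R.finsum_closed, rule Pi_I, rule R.finsum_closed, rule Pi_I, rule Tc) auto
    then show ?thesis by simp
  qed
  also have "\<dots> = (\<Oplus>j\<in>{..n}. \<ominus> ?A j \<oplus> \<ominus> (\<Oplus>i\<in>{..<j}. ?U i j))"
    by (rule R.finsum_cong') (use inner A Us in auto)
  also have "\<dots> = (\<Oplus>j\<in>{..n}. \<ominus> ?A j) \<oplus> (\<Oplus>j\<in>{..n}. \<ominus> (\<Oplus>i\<in>{..<j}. ?U i j))"
    by (rule R.finsum_addf) (use A Us in auto)
  also have "(\<Oplus>j\<in>{..n}. \<ominus> ?A j) = \<ominus> (\<Oplus>j\<in>{..n}. ?A j)"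
    by (rule R.finsum_uminus) (use A in auto)
  also have "(\<Oplus>j\<in>{..n}. \<ominus> (\<Oplus>i\<in>{..<j}. ?U i j)) = \<ominus> (\<Oplus>j\<in>{..n}. \<Oplus>i\<in>{..<j}. ?U i j)"
    by (rule R.finsum_uminus) (use Us in auto)
  also have "(\<Oplus>j\<in>{..n}. \<Oplus>i\<in>{..<j}. ?U i j) = d (\<lambda>zs. f (x # zs)) ys"
    using Suc.IH[OF i xs(3)] by simp
  also have "\<ominus> (\<Oplus>j\<in>{..n}. ?A j) = LX x f ys"
    using LX_sum[OF f xs(3,2)] by (simp add: lessThan_Suc_atMost)
  finally have "(\<Oplus>j\<in>{..Suc n}. \<Oplus>i\<in>{..<j}. ?T i j) = LX x f ys \<oplus> \<ominus> d (\<lambda>zs. f (x # zs)) ys" .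
  then show ?case
    using LD_closed[OF admissible_act[OF xs(2)] f xs(3)] d_closed[OF i xs(3)] unfolding xs(1) cobd.simps
    by (simp add: a_minus_def)
qed

end

text \<open>The subset \<open>S\<close> viewed as a Lie algebra record \<open>B\<close> in its own
  right, which is the form in which Poincare duality is assumed.\<close>

locale ce_bridge = trivial_coefficients R L S
  for R :: "('a, 'x) ring_scheme" (structure) and L :: "('a, 'b, 'y) lie_algebra_scheme" (structure)
    and S :: "'b set" +
  fixes B :: "('a, 'b, 'w) lie_algebra_scheme"
  assumes B: "carrier B = S" "add B = add L" "smult B = smult L" "bracket B = bracket L"
begin

lemma tuples_B: "tuples B n = LS n"
  by (simp add: tuples_def lists_of_def B(1))

lemma coboundary_map_eq:
  assumes f: "C n f"
  shows "coboundary_map R B triv n f = restrict (d f) (LS (Suc n))"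
proof (rule ext)
  fix xs
  show "coboundary_map R B triv n f xs = restrict (d f) (LS (Suc n)) xs"
  proof (cases "xs \<in> LS (Suc n)")
    case True
    have "(\<Oplus>i\<in>{..n}. sign_pow R i \<otimes> \<zero>) = \<zero>"
      by (rule R.add.finprod_one_eqI) simp
    then show ?thesis using True d_sum[OF f True] d_closed[OF f True]
      by (simp add: coboundary_map_def tuples_B triv_finsum B(4))
  qed (simp add: coboundary_map_def tuples_B)
qed

end

section \<open>Wedging with a character\<close>

fun wedge :: "('a, 'x) ring_scheme \<Rightarrow> ('b \<Rightarrow> 'a) \<Rightarrow> ('b list \<Rightarrow> 'a) \<Rightarrow> 'b list \<Rightarrow> 'a" where
  "wedge R \<chi> g [] = \<zero>\<^bsub>R\<^esub>"
| "wedge R \<chi> g (x # xs) = \<chi> x \<otimes>\<^bsub>R\<^esub> g xs \<ominus>\<^bsub>R\<^esub> wedge R \<chi> (\<lambda>zs. g (x # zs)) xs"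

lemma lie_der_pullback:
  assumes "\<And>y. y \<in> T \<Longrightarrow> \<rho> (\<delta> y) = \<delta>' (\<rho> y)"
  shows "set xs \<subseteq> T \<Longrightarrow> lie_der M a \<delta> (\<lambda>zs. f (map \<rho> zs)) xs = lie_der M a \<delta>' f (map \<rho> xs)"
proof (induction xs arbitrary: f)
  case (Cons y ys)
  then show ?case using Cons.IH[of "\<lambda>zs. f (\<rho> y # zs)"] assms[of y] by simp
qed simp

context trivial_coefficients begin

lemma LT_closed [simp]: "\<lbrakk>admissible (\<lambda>m. \<zero>) \<delta>; C q f; xs \<in> LS q\<rbrakk> \<Longrightarrow> LD (\<lambda>m. \<zero>) \<delta> f xs \<in> carrier R"
  using LD_closed[of "\<lambda>m. \<zero>" \<delta> q f xs] by simp

lemma admissible_zero_iff: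
  "admissible (\<lambda>m. \<zero>) \<delta> \<longleftrightarrow> (\<forall>x\<in>S. \<delta> x \<in> S) \<and> (\<forall>x\<in>S. \<forall>y\<in>S. \<delta> (x \<oplus>\<^bsub>L\<^esub> y) = \<delta> x \<oplus>\<^bsub>L\<^esub> \<delta> y) \<and>
     (\<forall>c\<in>carrier R. \<forall>x\<in>S. \<delta> (c \<odot>\<^bsub>L\<^esub> x) = c \<odot>\<^bsub>L\<^esub> \<delta> x)"
  unfolding admissible_def by auto

lemma cobd_pullback:
  assumes "\<And>x y. \<lbrakk>x \<in> S; y \<in> S\<rbrakk> \<Longrightarrow> \<rho> (bracket L x y) = bracket L (\<rho> x) (\<rho> y)"
  shows "set xs \<subseteq> S \<Longrightarrow> d (\<lambda>zs. f (map \<rho> zs)) xs = d f (map \<rho> xs)"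
proof (induction xs arbitrary: f)
  case (Cons x xs)
  have "lie_der triv (\<lambda>m. \<zero>) (bracket L x) (\<lambda>zs. f (map \<rho> zs)) xs = lie_der triv (\<lambda>m. \<zero>) (bracket L (\<rho> x)) f (map \<rho> xs)"
    by (rule lie_der_pullback[where T = S]) (use Cons.prems assms in auto)
  then show ?case using Cons.IH[of "\<lambda>zs. f (\<rho> x # zs)"] Cons.prems by simp
qed simp

definition linear_form :: "('b \<Rightarrow> 'a) \<Rightarrow> bool" where
  "linear_form \<chi> \<longleftrightarrow> (\<forall>x\<in>S. \<chi> x \<in> carrier R) \<and> (\<forall>x\<in>S. \<forall>y\<in>S. \<chi> (x \<oplus>\<^bsub>L\<^esub> y) = \<chi> x \<oplus> \<chi> y) \<and>
     (\<forall>c\<in>carrier R. \<forall>x\<in>S. \<chi> (c \<odot>\<^bsub>L\<^esub> x) = c \<otimes> \<chi> x)"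

lemma linear_formD:
  assumes "linear_form \<chi>"
  shows "x \<in> S \<Longrightarrow> \<chi> x \<in> carrier R" "\<lbrakk>x \<in> S; y \<in> S\<rbrakk> \<Longrightarrow> \<chi> (x \<oplus>\<^bsub>L\<^esub> y) = \<chi> x \<oplus> \<chi> y"
    "\<lbrakk>c \<in> carrier R; x \<in> S\<rbrakk> \<Longrightarrow> \<chi> (c \<odot>\<^bsub>L\<^esub> x) = c \<otimes> \<chi> x"
  using assms unfolding linear_form_def by auto

abbreviation "W \<equiv> wedge R"

lemma wedge_cong: "\<lbrakk>\<And>zs. zs \<in> LS q \<Longrightarrow> f zs = g zs; xs \<in> LS (Suc q)\<rbrakk> \<Longrightarrow> W \<chi> f xs = W \<chi> g xs"
proof (induction q arbitrary: f g xs)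
  case 0
  then obtain x where "xs = [x]" "x \<in> S" by (blast elim: lists_of_1E)
  then show ?case using 0 by simp
next
  case (Suc q)
  from Suc.prems(2) obtain y ys where xs: "xs = y # ys" "y \<in> S" "ys \<in> LS (Suc q)" by (rule lists_of_SucE)
  have "W \<chi> (\<lambda>zs. f (y # zs)) ys = W \<chi> (\<lambda>zs. g (y # zs)) ys"
    by (rule Suc.IH) (use Suc.prems xs in auto)
  then show ?case using xs Suc.prems(1) by simp
qed

lemma wedge_closed: "\<lbrakk>linear_form \<chi>; C q f; xs \<in> LS (Suc q)\<rbrakk> \<Longrightarrow> W \<chi> f xs \<in> carrier R"
proof (induction q arbitrary: f xs)
  case 0
  then obtain x where "xs = [x]" "x \<in> S" by (blast elim: lists_of_1E)
  then show ?case using 0 linear_formD(1)[OF 0(1)] by simp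
next
  case (Suc q)
  from Suc.prems(3) obtain y ys where xs: "xs = y # ys" "y \<in> S" "ys \<in> LS (Suc q)" by (rule lists_of_SucE)
  have "W \<chi> (\<lambda>zs. f (y # zs)) ys \<in> carrier R"
    by (rule Suc.IH) (use Suc.prems xs in auto)
  then show ?case using xs C_closed[OF Suc.prems(2) xs(3)] linear_formD(1)[OF Suc.prems(1)] by simp
qed

lemma wedge_add: "\<lbrakk>linear_form \<chi>; C q f; C q g; xs \<in> LS (Suc q)\<rbrakk> \<Longrightarrow>
    W \<chi> (\<lambda>zs. f zs \<oplus> g zs) xs = W \<chi> f xs \<oplus> W \<chi> g xs"
proof (induction q arbitrary: f g xs)
  case 0
  then obtain x where "xs = [x]" "x \<in> S" by (blast elim: lists_of_1E)
  then show ?case using 0 linear_formD(1)[OF 0(1)] by (simp add: R.r_distr R.minus_zero_right)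
next
  case (Suc q)
  from Suc.prems(4) obtain y ys where xs: "xs = y # ys" "y \<in> S" "ys \<in> LS (Suc q)" by (rule lists_of_SucE)
  have i: "C q (\<lambda>zs. f (y # zs))" "C q (\<lambda>zs. g (y # zs))" using Suc.prems xs by auto
  show ?case unfolding xs(1) wedge.simps Suc.IH[OF Suc.prems(1) i xs(3)]
    using C_closed[OF Suc.prems(2) xs(3)] C_closed[OF Suc.prems(3) xs(3)] linear_formD(1)[OF Suc.prems(1) xs(2)]
      wedge_closed[OF Suc.prems(1) i(1) xs(3)] wedge_closed[OF Suc.prems(1) i(2) xs(3)]
    by (simp add: R.r_distr R.add_minus_add)
qed

lemma wedge_smult: "\<lbrakk>linear_form \<chi>; c \<in> carrier R; C q f; xs \<in> LS (Suc q)\<rbrakk> \<Longrightarrow>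
    W \<chi> (\<lambda>zs. c \<otimes> f zs) xs = c \<otimes> W \<chi> f xs"
proof (induction q arbitrary: f xs)
  case 0
  then obtain x where "xs = [x]" "x \<in> S" by (blast elim: lists_of_1E)
  then show ?case using 0 linear_formD(1)[OF 0(1)] by (simp add: R.minus_zero_right R.m_lcomm)
next
  case (Suc q)
  from Suc.prems(4) obtain y ys where xs: "xs = y # ys" "y \<in> S" "ys \<in> LS (Suc q)" by (rule lists_of_SucE)
  have i: "C q (\<lambda>zs. f (y # zs))" using Suc.prems xs by auto
  show ?case unfolding xs(1) wedge.simps Suc.IH[OF Suc.prems(1,2) i xs(3)]
    using C_closed[OF Suc.prems(3) xs(3)] linear_formD(1)[OF Suc.prems(1) xs(2)]
      wedge_closed[OF Suc.prems(1) i xs(3)] Suc.prems(2)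
    by (simp add: a_minus_def R.r_distr R.r_minus R.m_lcomm)
qed

lemma wedge_zero:
  assumes \<chi>: "linear_form \<chi>" and f: "\<And>zs. zs \<in> LS q \<Longrightarrow> f zs = \<zero>" and xs: "xs \<in> LS (Suc q)"
  shows "W \<chi> f xs = \<zero>"
proof -
  have "W \<chi> f xs = W \<chi> (\<lambda>zs. \<zero> \<otimes> \<zero>) xs" by (rule wedge_cong[OF _ xs]) (simp add: f)
  also have "\<dots> = \<zero>"
    using wedge_smult[OF \<chi> R.zero_closed C_zero[of q] xs] wedge_closed[OF \<chi> C_zero[of q] xs] by simp
  finally show ?thesis .
qed

lemma minus_as_mult: "\<lbrakk>x \<in> carrier R; y \<in> carrier R\<rbrakk> \<Longrightarrow> x \<ominus> y = x \<oplus> (\<ominus> \<one>) \<otimes> y"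
  by (simp add: a_minus_def R.l_minus)

lemma wedge_minus:
  assumes \<chi>: "linear_form \<chi>" and f: "C q f" and g: "C q g" and xs: "xs \<in> LS (Suc q)"
  shows "W \<chi> (\<lambda>zs. f zs \<ominus> g zs) xs = W \<chi> f xs \<ominus> W \<chi> g xs"
proof -
  have "W \<chi> (\<lambda>zs. f zs \<ominus> g zs) xs = W \<chi> (\<lambda>zs. f zs \<oplus> (\<ominus> \<one>) \<otimes> g zs) xs"
    by (rule wedge_cong[where q = q])
      (use xs C_closed[OF f] C_closed[OF g] in \<open>auto intro!: minus_as_mult\<close>)
  also have "\<dots> = W \<chi> f xs \<oplus> (\<ominus> \<one>) \<otimes> W \<chi> g xs"
    using wedge_add[OF \<chi> f _ xs, of "\<lambda>zs. (\<ominus> \<one>) \<otimes> g zs"] C_smult[OF _ g, of "\<ominus> \<one>"] wedge_smult[OF \<chi> _ g xs] by simp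
  finally show ?thesis using wedge_closed[OF \<chi> f xs] wedge_closed[OF \<chi> g xs] by (simp add: minus_as_mult)
qed

lemma wedge_vanish: "\<lbrakk>\<And>x. x \<in> set xs \<Longrightarrow> \<chi> x = \<zero>; set xs \<subseteq> S; C q f; length xs = Suc q\<rbrakk> \<Longrightarrow> W \<chi> f xs = \<zero>"
proof (induction q arbitrary: f xs)
  case 0
  then obtain x where "xs = [x]" by (cases xs) auto
  then show ?case using 0 by (simp add: R.minus_self)
next
  case (Suc q)
  then obtain y ys where xs: "xs = y # ys" "length ys = Suc q" by (cases xs) auto
  have "W \<chi> (\<lambda>zs. f (y # zs)) ys = \<zero>"
    by (rule Suc.IH) (use Suc.prems xs in auto)
  moreover have "f ys \<in> carrier R" using C_closed[OF Suc.prems(3), of ys] Suc.prems xs by (simp add: lists_of_def)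
  ultimately show ?case using xs Suc.prems(1) by (simp add: R.minus_self)
qed

lemma wedge_C: "\<lbrakk>linear_form \<chi>; C q f\<rbrakk> \<Longrightarrow> C (Suc q) (W \<chi> f)"
proof (induction q arbitrary: f)
  case 0
  note l = linear_formD[OF 0(1)]
  show ?case using 0(2) l
    by (auto simp: R.minus_zero_right R.l_distr S_add S_smult R.m_assoc)
next
  case (Suc q)
  note \<chi> = Suc.prems(1) and f = Suc.prems(2)
  note l = linear_formD[OF \<chi>]
  have i: "C q (\<lambda>zs. f (x # zs))" if "x \<in> S" for x using f that by auto
  have fc: "f zs \<in> carrier R" if "zs \<in> LS (Suc q)" for zs using C_closed[OF f that] by simp
  have wc: "W \<chi> (\<lambda>zs. f (x # zs)) zs \<in> carrier R" if "x \<in> S" "zs \<in> LS (Suc q)" for x zs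
    by (rule wedge_closed[OF \<chi> i[OF that(1)] that(2)])
  show ?case unfolding cochain.simps(2)[of R L triv S "Suc q"]
  proof (intro conjI ballI allI impI)
    fix x assume x: "x \<in> S"
    show "C (Suc q) (\<lambda>zs. W \<chi> f (x # zs))"
      using C_minus[OF C_smult[OF l(1)[OF x] f] Suc.IH[OF \<chi> i[OF x]]] by simp
  next
    fix x y zs assume a: "x \<in> S" "y \<in> S" "zs \<in> LS (Suc q)"
    have "W \<chi> (\<lambda>zs. f ((x \<oplus>\<^bsub>L\<^esub> y) # zs)) zs = W \<chi> (\<lambda>zs. f (x # zs) \<oplus> f (y # zs)) zs"
      by (rule wedge_cong[where q = q]) (use f a in auto)
    then show "W \<chi> f ((x \<oplus>\<^bsub>L\<^esub> y) # zs) = W \<chi> f (x # zs) \<oplus>\<^bsub>triv\<^esub> W \<chi> f (y # zs)"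
      using a l wedge_add[OF \<chi> i i, of x y zs] wc[of x zs] wc[of y zs] fc[of zs]
      by (simp add: R.l_distr R.add_minus_add)
  next
    fix c x zs assume a: "c \<in> carrier R" "x \<in> S" "zs \<in> LS (Suc q)"
    have "W \<chi> (\<lambda>zs. f ((c \<odot>\<^bsub>L\<^esub> x) # zs)) zs = W \<chi> (\<lambda>zs. c \<otimes> f (x # zs)) zs"
      by (rule wedge_cong[where q = q]) (use f a in auto)
    then show "W \<chi> f ((c \<odot>\<^bsub>L\<^esub> x) # zs) = c \<odot>\<^bsub>triv\<^esub> W \<chi> f (x # zs)"
      using a l wedge_smult[OF \<chi> _ i, of c x zs] wc[of x zs] fc[of zs]
      by (simp add: R.m_assoc a_minus_def R.r_distr R.r_minus)
  next
    fix x p zs assume a: "x \<in> S" "Suc q = Suc p" "zs \<in> LS p"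
    have "W \<chi> (\<lambda>zs. f (x # x # zs)) zs = \<zero>"
    proof (cases q)
      case 0 then show ?thesis using a by simp
    next
      case (Suc r)
      show ?thesis by (rule wedge_zero[OF \<chi>, where q = r]) (use a f Suc in auto)
    qed
    moreover have "f (x # zs) \<in> carrier R" using fc a by simp
    ultimately show "W \<chi> f (x # x # zs) = \<zero>\<^bsub>triv\<^esub>"
      using l(1)[OF a(1)] by (simp add: R.minus_zero_right R.minus_self)
  qed
qed

lemma LT_wedge:
  assumes \<chi>: "linear_form \<chi>" and ad: "admissible (\<lambda>m. \<zero>) \<delta>" and 0: "\<And>y. y \<in> S \<Longrightarrow> \<chi> (\<delta> y) = \<zero>"
  shows "\<lbrakk>C q f; xs \<in> LS (Suc q)\<rbrakk> \<Longrightarrow> LD (\<lambda>m. \<zero>) \<delta> (W \<chi> f) xs = W \<chi> (LD (\<lambda>m. \<zero>) \<delta> f) xs"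
proof (induction q arbitrary: f xs)
  case 0
  then obtain x where xs: "xs = [x]" "x \<in> S" by (blast elim: lists_of_1E)
  then show ?case using 0 \<open>\<And>y. y \<in> S \<Longrightarrow> \<chi> (\<delta> y) = \<zero>\<close> linear_formD(1)[OF \<chi>] by (simp add: R.minus_self)
next
  case (Suc q)
  from Suc.prems(2) obtain y ys where xs: "xs = y # ys" "y \<in> S" "ys \<in> LS (Suc q)" by (rule lists_of_SucE)
  note f = Suc.prems(1)
  have i: "C q (\<lambda>zs. f (x # zs))" if "x \<in> S" for x using f that by auto
  have dy: "\<delta> y \<in> S" using ad xs(2) by (simp add: admissible_zero_iff)
  have wi: "C (Suc q) (W \<chi> (\<lambda>zs. f (y # zs)))" by (rule wedge_C[OF \<chi> i[OF xs(2)]])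
  have y: "\<chi> y \<in> carrier R" by (rule linear_formD(1)[OF \<chi> xs(2)])
  have sm: "C (Suc q) (\<lambda>zs. \<chi> y \<otimes> f zs)" using C_smult[OF _ f] y by simp
  have "LD (\<lambda>m. \<zero>) \<delta> (\<lambda>zs. \<chi> y \<otimes> f zs \<ominus> W \<chi> (\<lambda>zs. f (y # zs)) zs) ys =
      \<chi> y \<otimes> LD (\<lambda>m. \<zero>) \<delta> f ys \<ominus> W \<chi> (LD (\<lambda>m. \<zero>) \<delta> (\<lambda>zs. f (y # zs))) ys"
    using LD_minus[OF ad sm wi xs(3)] LD_smult[OF ad y f xs(3)] Suc.IH[OF i[OF xs(2)] xs(3)] by simp
  moreover have "W \<chi> (\<lambda>zs. LD (\<lambda>m. \<zero>) \<delta> (\<lambda>zs. f (y # zs)) zs \<ominus> f (\<delta> y # zs)) ys =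
      W \<chi> (LD (\<lambda>m. \<zero>) \<delta> (\<lambda>zs. f (y # zs))) ys \<ominus> W \<chi> (\<lambda>zs. f (\<delta> y # zs)) ys"
    by (rule wedge_minus[OF \<chi> LD_C[OF ad i[OF xs(2)]] i[OF dy] xs(3)])
  moreover have id: "(a \<ominus> b) \<ominus> (\<zero> \<ominus> e) = a \<ominus> (b \<ominus> e)" if "a \<in> carrier R" "b \<in> carrier R" "e \<in> carrier R" for a b e
    using that by algebra
  ultimately show ?case unfolding xs(1)
    using 0[OF xs(2)] y C_closed[OF f xs(3)] LT_closed[OF ad f xs(3)] wedge_closed[OF \<chi> LD_C[OF ad i[OF xs(2)]] xs(3)]
      wedge_closed[OF \<chi> i[OF dy] xs(3)] by simp
qed

text \<open>The form \<open>\<chi>\<close> is closed because it vanishes on brackets. In the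
  recursion this appears as \<open>L_x\<close> commuting with the wedge by
  \<open>\<chi>\<close>.\<close>

lemma d_wedge:
  assumes \<chi>: "linear_form \<chi>" and br: "\<And>x y. \<lbrakk>x \<in> S; y \<in> S\<rbrakk> \<Longrightarrow> \<chi> (bracket L x y) = \<zero>"
  shows "\<lbrakk>C q f; xs \<in> LS (Suc (Suc q))\<rbrakk> \<Longrightarrow> d (W \<chi> f) xs = \<ominus> W \<chi> (d f) xs"
proof (induction q arbitrary: f xs)
  case 0
  from 0(2) obtain x y where xs: "xs = [x, y]" "x \<in> S" "y \<in> S" by (elim lists_of_SucE) auto
  then show ?case using 0 br[of x y] linear_formD(1)[OF \<chi>] by (simp add: R.minus_self R.a_inv_zero)
next
  case (Suc q)
  from Suc.prems(2) obtain x ys where xs: "xs = x # ys" "x \<in> S" "ys \<in> LS (Suc (Suc q))" by (rule lists_of_SucE)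
  note f = Suc.prems(1)
  have i: "C q (\<lambda>zs. f (x # zs))" using f xs(2) by auto
  have ad: "admissible (\<lambda>m. \<zero>) (bracket L x)" using admissible_act[OF xs(2)] by simp
  have x: "\<chi> x \<in> carrier R" by (rule linear_formD(1)[OF \<chi> xs(2)])
  have wi: "C (Suc q) (W \<chi> (\<lambda>zs. f (x # zs)))" by (rule wedge_C[OF \<chi> i])
  have sm: "C (Suc q) (\<lambda>zs. \<chi> x \<otimes> f zs)" using C_smult[OF _ f] x by simp
  have "LD (\<lambda>m. \<zero>) (bracket L x) (W \<chi> f) ys = W \<chi> (LD (\<lambda>m. \<zero>) (bracket L x) f) ys"
    by (rule LT_wedge[OF \<chi> ad br[OF xs(2)] f xs(3)])
  moreover have "d (\<lambda>zs. \<chi> x \<otimes> f zs \<ominus> W \<chi> (\<lambda>zs. f (x # zs)) zs) ys =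
      \<chi> x \<otimes> d f ys \<ominus> \<ominus> W \<chi> (d (\<lambda>zs. f (x # zs))) ys"
    using d_minus[OF sm wi xs(3)] d_smult[OF x f xs(3)] Suc.IH[OF i xs(3)] x by simp
  moreover have "W \<chi> (\<lambda>zs. LD (\<lambda>m. \<zero>) (bracket L x) f zs \<ominus> d (\<lambda>zs. f (x # zs)) zs) ys =
      W \<chi> (LD (\<lambda>m. \<zero>) (bracket L x) f) ys \<ominus> W \<chi> (d (\<lambda>zs. f (x # zs))) ys"
    by (rule wedge_minus[OF \<chi> LD_C[OF ad f] d_C[OF i] xs(3)])
  moreover have id: "a \<ominus> (b \<ominus> \<ominus> e) = \<ominus> (b \<ominus> (a \<ominus> e))" if "a \<in> carrier R" "b \<in> carrier R" "e \<in> carrier R" for a b e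
    using that by algebra
  ultimately show ?case unfolding xs(1)
    using x d_closed[OF f xs(3)] wedge_closed[OF \<chi> LD_C[OF ad f] xs(3)]
      wedge_closed[OF \<chi> d_C[OF i] xs(3)] by simp
qed

end

section \<open>Consequences of Poincare duality\<close>

context trivial_coefficients begin

lemma wedge_sum:
  "\<lbrakk>linear_form \<chi>; C n f; xs \<in> LS (Suc n)\<rbrakk> \<Longrightarrow>
    W \<chi> f xs = (\<Oplus>i\<in>{..<Suc n}. sign_pow R i \<otimes> (\<chi> (xs ! i) \<otimes> f (nths xs (- {i}))))"
proof (induction n arbitrary: f xs)
  case 0
  then obtain x where "xs = [x]" "x \<in> S" by (blast elim: lists_of_1E)
  then show ?case using 0 linear_formD(1)[OF 0(1)] by (simp add: R.minus_zero_right lessThan_Suc nths_Cons_0)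
next
  case (Suc n)
  note \<chi> = linear_formD(1)[OF Suc.prems(1)] and f = Suc.prems(2)
  from Suc.prems(3) obtain y ys where xs: "xs = y # ys" "y \<in> S" "ys \<in> LS (Suc n)" by (rule lists_of_SucE)
  have fc: "f zs \<in> carrier R" if "zs \<in> LS (Suc n)" for zs using C_closed[OF f that] by simp
  have i: "C n (\<lambda>zs. f (y # zs))" using C_inner[OF f xs(2)] .
  let ?T = "\<lambda>i. sign_pow R i \<otimes> (\<chi> (xs ! i) \<otimes> f (nths xs (- {i})))"
  let ?U = "\<lambda>i. sign_pow R i \<otimes> (\<chi> (ys ! i) \<otimes> f (y # nths ys (- {i})))"
  have T: "?T \<in> {..<Suc (Suc n)} \<rightarrow> carrier R"
    using nths_LS[OF Suc.prems(3)] nth_LS[OF Suc.prems(3)] by (auto intro!: R.m_closed fc \<chi>)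
  have U: "?U j \<in> carrier R \<and> ?T (Suc j) = \<ominus> ?U j" if j: "j < Suc n" for j
  proof -
    have "nths ys (- {j}) \<in> LS n" "\<chi> (ys ! j) \<in> carrier R"
      using nths_LS[OF xs(3), of j] nth_LS[OF xs(3) j] j \<chi> by auto
    moreover from this have "f (y # nths ys (- {j})) \<in> carrier R" using xs(2) by (intro fc) simp
    ultimately show ?thesis using xs(1) by (simp add: nths_Cons_Suc sign_pow_Suc R.l_minus)
  qed
  have "finsum R ?T {..<Suc (Suc n)} = ?T 0 \<oplus> finsum R (\<lambda>j. ?T (Suc j)) {..<Suc n}"
    by (rule R.finsum_lessThan_Suc2[OF T])
  also have "finsum R (\<lambda>j. ?T (Suc j)) {..<Suc n} = (\<Oplus>j\<in>{..<Suc n}. \<ominus> ?U j)"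
    by (rule R.finsum_cong') (use U in auto)
  also have "\<dots> = \<ominus> finsum R ?U {..<Suc n}"
    by (rule R.finsum_uminus) (use U in auto)
  also have "finsum R ?U {..<Suc n} = W \<chi> (\<lambda>zs. f (y # zs)) ys"
    using Suc.IH[OF Suc.prems(1) i xs(3)] by simp
  also have "?T 0 = \<chi> y \<otimes> f ys" using xs fc \<chi> by (simp add: nths_Cons_0)
  finally show ?case unfolding xs(1) wedge.simps by (simp add: a_minus_def)
qed

definition cocycle :: "nat \<Rightarrow> ('b list \<Rightarrow> 'a) \<Rightarrow> bool" where
  "cocycle n f \<longleftrightarrow> C n f \<and> (\<forall>xs\<in>LS (Suc n). d f xs = \<zero>)"

text \<open>The index is the degree of the primitive, so \<open>f\<close> itself has degree
  \<open>m + 1\<close>.\<close>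

definition exact :: "nat \<Rightarrow> ('b list \<Rightarrow> 'a) \<Rightarrow> bool" where
  "exact m f \<longleftrightarrow> (\<exists>g. C m g \<and> (\<forall>xs\<in>LS (Suc m). d g xs = f xs))"

lemma exactI: "\<lbrakk>C m g; \<And>xs. xs \<in> LS (Suc m) \<Longrightarrow> d g xs = f xs\<rbrakk> \<Longrightarrow> exact m f"
  unfolding exact_def by blast

lemma exact_cong: "\<lbrakk>exact m f; \<And>xs. xs \<in> LS (Suc m) \<Longrightarrow> f xs = g xs\<rbrakk> \<Longrightarrow> exact m g"
  unfolding exact_def by auto

lemma exactE:
  assumes "exact m f"
  obtains g where "C m g" "\<forall>xs\<in>LS (Suc m). d g xs = f xs"
  using assms unfolding exact_def by blast

lemma exact_add:
  assumes "exact m f" "exact m g" shows "exact m (\<lambda>xs. f xs \<oplus> g xs)"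
proof -
  from assms(1) obtain f' where f: "C m f'" "\<forall>xs\<in>LS (Suc m). d f' xs = f xs" by (rule exactE)
  from assms(2) obtain g' where g: "C m g'" "\<forall>xs\<in>LS (Suc m). d g' xs = g xs" by (rule exactE)
  show ?thesis using exactI[OF C_add[OF f(1) g(1)]] d_add[OF f(1) g(1)] f(2) g(2) by simp
qed

lemma exact_minus:
  assumes "exact m f" "exact m g" shows "exact m (\<lambda>xs. f xs \<ominus> g xs)"
proof -
  from assms(1) obtain f' where f: "C m f'" "\<forall>xs\<in>LS (Suc m). d f' xs = f xs" by (rule exactE)
  from assms(2) obtain g' where g: "C m g'" "\<forall>xs\<in>LS (Suc m). d g' xs = g xs" by (rule exactE)
  show ?thesis using exactI[OF C_minus[OF f(1) g(1)]] d_minus[OF f(1) g(1)] f(2) g(2) by simp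
qed

lemma exact_smult:
  assumes c: "c \<in> carrier R" and "exact m f" shows "exact m (\<lambda>xs. c \<otimes> f xs)"
proof -
  from assms(2) obtain f' where f: "C m f'" "\<forall>xs\<in>LS (Suc m). d f' xs = f xs" by (rule exactE)
  show ?thesis using exactI[OF C_smult[OF c f(1)]] d_smult[OF c f(1)] f(2) by simp
qed

lemma exact_LT:
  assumes ad: "admissible (\<lambda>m. \<zero>) \<delta>"
    and der: "\<And>x y. \<lbrakk>x \<in> S; y \<in> S\<rbrakk> \<Longrightarrow> \<delta> (bracket L x y) = bracket L (\<delta> x) y \<oplus>\<^bsub>L\<^esub> bracket L x (\<delta> y)"
    and "exact m f"
  shows "exact m (LD (\<lambda>m. \<zero>) \<delta> f)"
proof -
  obtain g where g: "C m g" "\<And>xs. xs \<in> LS (Suc m) \<Longrightarrow> d g xs = f xs" using assms(3) by (auto simp: exact_def)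
  have "d (LD (\<lambda>m. \<zero>) \<delta> g) xs = LD (\<lambda>m. \<zero>) \<delta> f xs" if xs: "xs \<in> LS (Suc m)" for xs
  proof -
    have "d (LD (\<lambda>m. \<zero>) \<delta> g) xs = LD (\<lambda>m. \<zero>) \<delta> (d g) xs"
      by (rule d_LD[OF ad der _ g(1) xs]) simp_all
    also have "\<dots> = LD (\<lambda>m. \<zero>) \<delta> f xs"
      by (rule LD_cong[OF _ g(2) xs]) (use ad in \<open>simp_all add: admissible_zero_iff\<close>)
    finally show ?thesis .
  qed
  then show ?thesis by (rule exactI[OF LD_C[OF ad g(1)]])
qed

lemma exact_C:
  assumes "exact m f" shows "C (Suc m) f"
proof -
  obtain g where "C m g" "\<And>xs. xs \<in> LS (Suc m) \<Longrightarrow> d g xs = f xs" using assms by (auto simp: exact_def)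
  then show ?thesis using d_C[of m g] C_cong[of "Suc m" "d g" f] by simp
qed

end

text \<open>The exponent in the sign of the shuffle that moves position \<open>i\<close> to the
  front.\<close>

lemma card_below: "card {(s, t). s \<in> {i :: nat} \<and> t \<notin> {i} \<and> t < s} = i"
proof -
  have "{(s, t). s \<in> {i :: nat} \<and> t \<notin> {i} \<and> t < s} = {i} \<times> {..<i}" by auto
  then show ?thesis by (simp add: card_cartesian_product)
qed

lemma nths_singleton: "i < length xs \<Longrightarrow> nths xs {i} = [xs ! i]"
proof (induction xs arbitrary: i)
  case (Cons x xs)
  have "{j. Suc j \<in> {Suc i}} = {i}" for i by auto
  then show ?case using Cons by (cases i) (auto simp: nths_Cons)
qed simp

section \<open>From cosets to representing cochains\<close>

context ce_bridge begin

text \<open>A shuffle of type \<open>(1, m)\<close> is the choice of a single position, so the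
  shuffle sum is the expansion \<open>wedge_sum\<close>.\<close>

lemma cup_cochain_eq:
  assumes f: "linear_form (\<lambda>x. f [x])" and g: "C m g"
  shows "cup_cochain R B 1 m f g = restrict (W (\<lambda>x. f [x]) g) (LS (Suc m))"
proof (rule HOL.ext)
  fix xs
  show "cup_cochain R B 1 m f g xs = restrict (W (\<lambda>x. f [x]) g) (LS (Suc m)) xs"
  proof (cases "xs \<in> LS (Suc m)")
    case True
    have len: "length xs = Suc m" using True by (simp add: lists_of_def)
    have I: "{S. S \<subseteq> {..<1 + m} \<and> card S = 1} = (\<lambda>i. {i}) ` {..<Suc m}"
      by (auto simp: card_Suc_eq)
    let ?T = "\<lambda>S. sign_pow R (card {(s, t). s \<in> S \<and> t \<notin> S \<and> t < s}) \<otimes> (f (nths xs S) \<otimes> g (nths xs (- S)))"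
    let ?U = "\<lambda>i. sign_pow R i \<otimes> (f [xs ! i] \<otimes> g (nths xs (- {i})))"
    have T: "?T {i} = ?U i" if "i < Suc m" for i
      unfolding card_below using that len by (simp add: nths_singleton)
    have U: "?U i \<in> carrier R" if "i < Suc m" for i
      using nths_LS[OF True, of i] nth_LS[OF True, of i] C_closed[OF g] linear_formD(1)[OF f] that by simp
    have "cup_cochain R B 1 m f g xs = finsum R ?T ((\<lambda>i. {i}) ` {..<Suc m})"
      unfolding cup_cochain_def I using True by (simp add: tuples_B)
    also have "\<dots> = finsum R (\<lambda>i. ?T {i}) {..<Suc m}"
      by (rule R.finsum_reindex) (use T U in auto)
    also have "\<dots> = finsum R ?U {..<Suc m}"
      by (rule R.finsum_cong') (use T U in auto)
    also have "\<dots> = W (\<lambda>x. f [x]) g xs" using wedge_sum[OF f g True] by simp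
    finally show ?thesis using True by simp
  qed (simp add: cup_cochain_def tuples_B)
qed

abbreviation "Z n \<equiv> cocycle_module R B triv n"
abbreviation "Bd n \<equiv> coboundaries R B triv n"

lemma Z_carrier: "f \<in> carrier (Z n) \<longleftrightarrow> f \<in> extensional (LS n) \<and> cocycle n f"
proof -
  have "f \<in> carrier (Z n) \<longleftrightarrow> (f \<in> extensional (LS n) \<and> C n f) \<and>
      coboundary_map R B triv n f = (\<lambda>xs\<in>LS (Suc n). \<zero>)"
    by (simp add: cocycle_module_def cochain_module_def cochains_iff[OF B(1-3)] tuples_B)
  also have "\<dots> \<longleftrightarrow> f \<in> extensional (LS n) \<and> cocycle n f"
  proof (cases "C n f")
    case True
    have "restrict (d f) (LS (Suc n)) = (\<lambda>xs\<in>LS (Suc n). \<zero>) \<longleftrightarrow> (\<forall>xs\<in>LS (Suc n). d f xs = \<zero>)"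
      unfolding restrict_def fun_eq_iff by auto
    then show ?thesis using True unfolding coboundary_map_eq[OF True] cocycle_def by blast
  qed (simp add: cocycle_def)
  finally show ?thesis .
qed

lemma Z_add: "f \<oplus>\<^bsub>Z n\<^esub> g = (\<lambda>xs\<in>LS n. f xs \<oplus> g xs)"
  and Z_smult: "c \<odot>\<^bsub>Z n\<^esub> f = (\<lambda>xs\<in>LS n. c \<otimes> f xs)"
  by (simp_all add: cocycle_module_def cochain_module_def tuples_B)

lemma Bd_Suc: "f \<in> Bd (Suc m) \<longleftrightarrow> f \<in> extensional (LS (Suc m)) \<and> exact m f"
proof
  assume "f \<in> Bd (Suc m)"
  then obtain g where g: "g \<in> cochains R B triv m" "f = coboundary_map R B triv m g" by auto
  then have "C m g" by (simp add: cochains_iff[OF B(1-3)])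
  then show "f \<in> extensional (LS (Suc m)) \<and> exact m f"
    using g(2) coboundary_map_eq[of m g] by (auto intro: exactI[of m g])
next
  assume f: "f \<in> extensional (LS (Suc m)) \<and> exact m f"
  then obtain g where g: "C m g" "\<And>xs. xs \<in> LS (Suc m) \<Longrightarrow> d g xs = f xs" by (auto simp: exact_def)
  let ?g = "restrict g (LS m)"
  have C: "C m ?g" using g(1) C_cong[of m g ?g] by simp
  then have "?g \<in> cochains R B triv m" by (simp add: cochains_iff[OF B(1-3)])
  moreover have "coboundary_map R B triv m ?g = f"
    unfolding coboundary_map_eq[OF C]
  proof (rule extensionalityI[of _ "LS (Suc m)"])
    fix xs assume xs: "xs \<in> LS (Suc m)"
    have "d ?g xs = d g xs" by (rule d_cong[OF _ xs]) simp
    then show "restrict (d ?g) (LS (Suc m)) xs = f xs" using g(2) xs by simp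
  qed (use f in auto)
  ultimately show "f \<in> Bd (Suc m)" by auto
qed

lemma Bd_0: "Bd 0 = {\<lambda>xs\<in>LS 0. \<zero>}"
  by (simp add: cochain_module_def tuples_B)

lemma zero_Bd: "(\<lambda>xs\<in>LS n. \<zero>) \<in> Bd n"
proof (cases n)
  case 0 then show ?thesis by (simp only: Bd_0 singleton_iff)
next
  case (Suc m)
  have "exact m (\<lambda>xs\<in>LS (Suc m). \<zero>)"
    by (rule exactI[of m "\<lambda>_. \<zero>"]) (use C_zero[of m] d_zero[of m "\<lambda>_. \<zero>"] in simp_all)
  then show ?thesis unfolding Suc Bd_Suc by simp
qed

lemma coset_iff: "f \<in> Bd n +>\<^bsub>Z n\<^esub> a \<longleftrightarrow> (\<exists>b\<in>Bd n. f = (\<lambda>xs\<in>LS n. b xs \<oplus> a xs))"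
  by (auto simp: a_r_coset_def' Z_add)

lemma coset_self:
  assumes a: "a \<in> extensional (LS n)" "C n a" shows "a \<in> Bd n +>\<^bsub>Z n\<^esub> a"
  unfolding coset_iff
proof (rule bexI[OF _ zero_Bd])
  show "a = (\<lambda>xs\<in>LS n. (\<lambda>xs\<in>LS n. \<zero>) xs \<oplus> a xs)"
    by (rule extensionalityI[of _ "LS n"]) (use a C_closed[OF a(2)] in auto)
qed

lemma coset_Bd:
  assumes a: "exact m a"
  shows "Bd (Suc m) +>\<^bsub>Z (Suc m)\<^esub> a = Bd (Suc m)"
proof (intro equalityI subsetI)
  fix f assume "f \<in> Bd (Suc m) +>\<^bsub>Z (Suc m)\<^esub> a"
  then obtain b where b: "b \<in> Bd (Suc m)" "f = (\<lambda>xs\<in>LS (Suc m). b xs \<oplus> a xs)" unfolding coset_iff by blast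
  have "exact m (\<lambda>xs. b xs \<oplus> a xs)" using b(1) a by (simp add: Bd_Suc exact_add del: coboundaries.simps)
  then have "exact m f" by (rule exact_cong) (simp add: b(2))
  then show "f \<in> Bd (Suc m)" unfolding Bd_Suc b(2) by simp
next
  fix f assume f: "f \<in> Bd (Suc m)"
  then have fe: "f \<in> extensional (LS (Suc m))" "exact m f" by (simp_all add: Bd_Suc del: coboundaries.simps)
  have "exact m (\<lambda>xs. f xs \<ominus> a xs)" by (rule exact_minus[OF fe(2) a])
  then have "exact m (\<lambda>xs\<in>LS (Suc m). f xs \<ominus> a xs)" by (rule exact_cong) simp
  then have "(\<lambda>xs\<in>LS (Suc m). f xs \<ominus> a xs) \<in> Bd (Suc m)" unfolding Bd_Suc by simp
  moreover have "f = (\<lambda>xs\<in>LS (Suc m). (\<lambda>xs\<in>LS (Suc m). f xs \<ominus> a xs) xs \<oplus> a xs)"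
    by (rule extensionalityI[of _ "LS (Suc m)"])
      (use fe C_closed[OF exact_C[OF a]] C_closed[OF exact_C[OF fe(2)]] in \<open>auto simp: R.minus_add_cancel\<close>)
  ultimately show "f \<in> Bd (Suc m) +>\<^bsub>Z (Suc m)\<^esub> a" unfolding coset_iff by (intro bexI)
qed

lemma cohomology_carrier: "carrier (cohomology R B triv n) = {Bd n +>\<^bsub>Z n\<^esub> a | a. a \<in> carrier (Z n)}"
  and cohomology_zero: "\<zero>\<^bsub>cohomology R B triv n\<^esub> = Bd n"
  and cohomology_smult: "c \<odot>\<^bsub>cohomology R B triv n\<^esub> X = (\<Union>f\<in>X. Bd n +>\<^bsub>Z n\<^esub> (c \<odot>\<^bsub>Z n\<^esub> f))"
  by (auto simp: cohomology_def Let_def A_RCOSETS_def')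

lemma restrict_cocycle: "cocycle n f \<Longrightarrow> restrict f (LS n) \<in> carrier (Z n)"
proof -
  assume f: "cocycle n f"
  have "C n (restrict f (LS n))" using f C_cong[of n f "restrict f (LS n)"] by (simp add: cocycle_def)
  moreover have "d (restrict f (LS n)) xs = \<zero>" if "xs \<in> LS (Suc n)" for xs
    using d_cong[of n "restrict f (LS n)" f xs] f that by (simp add: cocycle_def)
  ultimately show ?thesis by (simp add: Z_carrier cocycle_def)
qed

text \<open>Chooses a representative \<open>f\<close> of a generator. Scalar multiplication of
  classes is a union over representatives, so the comparison of \<open>a\<close> with a multiple of
  \<open>f\<close> picks up two coboundaries, \<open>b1\<close> and \<open>b2\<close>.\<close>

lemma fundamental_class:
  assumes "one_dimensional R (cohomology R B triv (Suc m))"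
  obtains f where "cocycle (Suc m) f" "\<not> exact m f"
    "\<And>a. cocycle (Suc m) a \<Longrightarrow> \<exists>c\<in>carrier R. exact m (\<lambda>xs. a xs \<ominus> c \<otimes> f xs)"
proof -
  let ?n = "Suc m"
  from assms obtain w where w: "w \<in> carrier (cohomology R B triv ?n)" "w \<noteq> Bd ?n"
    and all: "carrier (cohomology R B triv ?n) = {c \<odot>\<^bsub>cohomology R B triv ?n\<^esub> w | c. c \<in> carrier R}"
    unfolding one_dimensional_def cohomology_zero by blast
  from w(1) obtain f where f: "f \<in> carrier (Z ?n)" "w = Bd ?n +>\<^bsub>Z ?n\<^esub> f" unfolding cohomology_carrier by blast
  have f': "f \<in> extensional (LS ?n)" "cocycle ?n f" "C ?n f" using f(1) by (auto simp: Z_carrier cocycle_def)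
  have fc: "f xs \<in> carrier R" if "xs \<in> LS ?n" for xs using C_closed[OF f'(3) that] by simp
  show ?thesis
  proof (rule that[OF f'(2)])
    show "\<not> exact m f" using coset_Bd[of m f] w(2) f(2) by blast
    fix a assume a: "cocycle ?n a"
    have ac: "a xs \<in> carrier R" if "xs \<in> LS ?n" for xs
      using a C_closed[OF _ that, of a] by (simp add: cocycle_def)
    let ?a = "restrict a (LS ?n)"
    have az: "?a \<in> carrier (Z ?n)" by (rule restrict_cocycle[OF a])
    have "Bd ?n +>\<^bsub>Z ?n\<^esub> ?a \<in> carrier (cohomology R B triv ?n)" unfolding cohomology_carrier using az by blast
    then obtain c where c: "c \<in> carrier R" "Bd ?n +>\<^bsub>Z ?n\<^esub> ?a = (\<Union>f\<in>w. Bd ?n +>\<^bsub>Z ?n\<^esub> (c \<odot>\<^bsub>Z ?n\<^esub> f))"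
      unfolding all cohomology_smult by blast
    have "?a \<in> Bd ?n +>\<^bsub>Z ?n\<^esub> ?a"
      by (rule coset_self) (use az in \<open>auto simp: Z_carrier cocycle_def\<close>)
    then obtain f1 where f1: "f1 \<in> w" "?a \<in> Bd ?n +>\<^bsub>Z ?n\<^esub> (c \<odot>\<^bsub>Z ?n\<^esub> f1)" unfolding c(2) by blast
    from f1(1) obtain b1 where b1: "b1 \<in> Bd ?n" "f1 = (\<lambda>xs\<in>LS ?n. b1 xs \<oplus> f xs)" unfolding f(2) coset_iff by blast
    from f1(2) obtain b2 where b2: "b2 \<in> Bd ?n" "?a = (\<lambda>xs\<in>LS ?n. b2 xs \<oplus> (c \<odot>\<^bsub>Z ?n\<^esub> f1) xs)" unfolding coset_iff by blast
    have e: "exact m b1" "exact m b2" using b1(1) b2(1) by (simp_all add: Bd_Suc del: coboundaries.simps)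
    have "exact m (\<lambda>xs. b2 xs \<oplus> c \<otimes> b1 xs)" by (rule exact_add[OF e(2) exact_smult[OF c(1) e(1)]])
    then have "exact m (\<lambda>xs. a xs \<ominus> c \<otimes> f xs)"
    proof (rule exact_cong)
      fix xs assume xs: "xs \<in> LS ?n"
      have b: "b1 xs \<in> carrier R" "b2 xs \<in> carrier R" using C_closed[OF exact_C[OF e(1)] xs] C_closed[OF exact_C[OF e(2)] xs] by simp_all
      have "a xs = b2 xs \<oplus> (c \<otimes> (b1 xs \<oplus> f xs))"
        using fun_cong[OF b2(2), of xs] xs by (simp add: Z_smult b1(2))
      then have "a xs = (b2 xs \<oplus> c \<otimes> b1 xs) \<oplus> c \<otimes> f xs" using b fc[OF xs] c(1) by (simp add: R.r_distr R.a_assoc)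
      then show "b2 xs \<oplus> c \<otimes> b1 xs = a xs \<ominus> c \<otimes> f xs" using b fc[OF xs] c(1) by (simp add: R.add_minus_cancel)
    qed
    then show "\<exists>c\<in>carrier R. exact m (\<lambda>xs. a xs \<ominus> c \<otimes> f xs)" using c(1) by blast
  qed
qed

text \<open>With trivial coefficients the coboundary is zero on 0-cochains.\<close>

lemma Bd_1: "f \<in> Bd (Suc 0) \<Longrightarrow> f = (\<lambda>xs\<in>LS (Suc 0). \<zero>)"
proof (rule extensionalityI[of _ "LS (Suc 0)"])
  assume "f \<in> Bd (Suc 0)"
  then have f: "f \<in> extensional (LS (Suc 0))" "exact 0 f" by (simp_all add: Bd_Suc del: coboundaries.simps)
  show "f \<in> extensional (LS (Suc 0))" by (rule f(1))
  fix xs assume xs: "xs \<in> LS (Suc 0)"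
  obtain g where g: "d g xs = f xs" using f(2) xs by (auto simp: exact_def)
  from xs obtain x where "xs = [x]" by (blast elim: lists_of_1E)
  then show "f xs = (\<lambda>xs\<in>LS (Suc 0). \<zero>) xs" using g xs by (simp add: R.minus_self)
qed simp

text \<open>Since 1-coboundaries vanish, a nonzero character is a nonzero class in
  \<open>H^1\<close>. If all its products were exact, this class would be in the kernel of the
  pairing, against nondegeneracy in the first argument.\<close>

lemma dual_class:
  assumes nd: "nondegenerate_pairing (cohomology R B triv 1) (cohomology R B triv m) (cohomology R B triv (Suc m))
      (cup_product R B 1 m)"
    and \<chi>: "linear_form \<chi>" and br: "\<And>x y. \<lbrakk>x \<in> S; y \<in> S\<rbrakk> \<Longrightarrow> \<chi> (bracket L x y) = \<zero>"
    and x0: "x0 \<in> S" "\<chi> x0 \<noteq> \<zero>"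
  shows "\<exists>g. cocycle m g \<and> \<not> exact m (W \<chi> g)"
proof (rule ccontr)
  assume "\<nexists>g. cocycle m g \<and> \<not> exact m (W \<chi> g)"
  then have ex: "exact m (W \<chi> g)" if "cocycle m g" for g using that by blast
  define \<phi> where "\<phi> = (\<lambda>xs\<in>LS (Suc 0). \<chi> (hd xs))"
  note l = linear_formD[OF \<chi>]
  have C1: "C (Suc 0) (\<lambda>xs. \<chi> (hd xs))" using l by simp
  have "cocycle (Suc 0) (\<lambda>xs. \<chi> (hd xs))"
    unfolding cocycle_def
  proof (intro conjI C1 ballI)
    fix xs assume "xs \<in> LS (Suc (Suc 0))"
    then obtain x y where "xs = [x, y]" "x \<in> S" "y \<in> S" by (elim lists_of_SucE) auto
    then show "d (\<lambda>xs. \<chi> (hd xs)) xs = \<zero>" using br[of x y] by (simp add: R.minus_self)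
  qed
  then have \<phi>: "\<phi> \<in> carrier (Z (Suc 0))" unfolding \<phi>_def by (rule restrict_cocycle)
  let ?X = "Bd (Suc 0) +>\<^bsub>Z (Suc 0)\<^esub> \<phi>"
  have X: "?X = {\<phi>}"
  proof -
    have "\<phi> \<in> ?X" by (rule coset_self) (use \<phi> in \<open>auto simp: Z_carrier cocycle_def\<close>)
    moreover have "f = \<phi>" if "f \<in> ?X" for f
    proof -
      from that obtain b where b: "b \<in> Bd (Suc 0)" "f = (\<lambda>xs\<in>LS (Suc 0). b xs \<oplus> \<phi> xs)" unfolding coset_iff by blast
      show ?thesis unfolding b(2) Bd_1[OF b(1)]
      proof (rule extensionalityI[of _ "LS (Suc 0)"])
        fix xs assume xs: "xs \<in> LS (Suc 0)"
        then have "\<phi> xs \<in> carrier R" using l(1) by (auto simp: \<phi>_def elim: lists_of_1E)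
        then show "(\<lambda>xs\<in>LS (Suc 0). (\<lambda>xs\<in>LS (Suc 0). \<zero>) xs \<oplus> \<phi> xs) xs = \<phi> xs" using xs by simp
      qed (simp_all add: \<phi>_def)
    qed
    ultimately show ?thesis by blast
  qed
  have "?X \<in> carrier (cohomology R B triv 1)" unfolding cohomology_carrier using \<phi> by auto
  moreover have "cup_product R B 1 m ?X Y = Bd (Suc m)" if "Y \<in> carrier (cohomology R B triv m)" for Y
  proof -
    from that obtain g where g: "g \<in> carrier (Z m)" "Y = Bd m +>\<^bsub>Z m\<^esub> g" unfolding cohomology_carrier by blast
    have "g \<in> Y" unfolding g(2) by (rule coset_self) (use g(1) in \<open>auto simp: Z_carrier cocycle_def\<close>)
    \<comment> \<open>The cup product of classes is a union over all representatives, so each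
      \<open>g'\<close> in the class has to yield the trivial coset.\<close>
    moreover have "Bd (1 + m) +>\<^bsub>Z (1 + m)\<^esub> cup_cochain R B 1 m \<phi> g' = Bd (Suc m)" if "g' \<in> Y" for g'
    proof -
      from that obtain b where b: "b \<in> Bd m" "g' = (\<lambda>xs\<in>LS m. b xs \<oplus> g xs)" unfolding g(2) coset_iff by blast
      have g'': "C m g" "\<And>xs. xs \<in> LS (Suc m) \<Longrightarrow> d g xs = \<zero>" using g(1) by (auto simp: Z_carrier cocycle_def)
      have bz: "C m b \<and> (\<forall>xs\<in>LS (Suc m). d b xs = \<zero>)"
      proof (cases m)
        case 0
        then have "b = (\<lambda>xs\<in>LS m. \<zero>)" using b(1) by (simp only: Bd_0 singleton_iff)
        then show ?thesis using d_zero[of m b] C_cong[of m b "\<lambda>_. \<zero>"] C_zero[of m] by simp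
      next
        case (Suc m')
        then have "exact m' b" using b(1) by (simp add: Bd_Suc del: coboundaries.simps)
        then obtain h where h: "C m' h" "\<And>xs. xs \<in> LS (Suc m') \<Longrightarrow> d h xs = b xs" by (auto simp: exact_def)
        have "d b xs = \<zero>" if "xs \<in> LS (Suc m)" for xs
          using d_cong[of m "d h" b xs] d_d[OF h(1), of xs] h(2) that Suc by simp
        then show ?thesis using exact_C[OF \<open>exact m' b\<close>] Suc by simp
      qed
      have gb: "C m (\<lambda>xs. b xs \<oplus> g xs)" using C_add[of m b g] bz g'' by simp
      have "cocycle m (\<lambda>xs. b xs \<oplus> g xs)"
        unfolding cocycle_def using gb d_add[of m b g] bz g'' by simp
      then have 1: "exact m (W \<chi> (\<lambda>xs. b xs \<oplus> g xs))" by (rule ex)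
      have 2: "C m g'" using gb C_cong[of m "\<lambda>xs. b xs \<oplus> g xs" g'] b(2) by simp
      have 3: "W \<chi> g' xs = W \<chi> (\<lambda>xs. b xs \<oplus> g xs) xs" if "xs \<in> LS (Suc m)" for xs
        by (rule wedge_cong[OF _ that]) (simp add: b(2))
      have 4: "W (\<lambda>x. \<phi> [x]) h xs = W \<chi> h xs" if "set xs \<subseteq> S" for xs h
        using that by (induction xs arbitrary: h) (simp_all add: \<phi>_def)
      have 5: "linear_form (\<lambda>x. \<phi> [x])" using l S_add S_smult by (simp add: linear_form_def \<phi>_def)
      have e: "exact m (cup_cochain R B 1 m \<phi> g')"
      proof (rule exact_cong[OF 1])
        fix xs assume xs: "xs \<in> LS (Suc m)"
        then have "set xs \<subseteq> S" by (simp add: lists_of_def)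
        then show "W \<chi> (\<lambda>xs. b xs \<oplus> g xs) xs = cup_cochain R B 1 m \<phi> g' xs"
          unfolding cup_cochain_eq[OF 5 2] using xs 3[OF xs] 4 by simp
      qed
      show ?thesis using coset_Bd[OF e] by simp
    qed
    ultimately show ?thesis unfolding cup_product_def X by auto
  qed
  ultimately have "?X = Bd 1"
    using bspec[OF conjunct1[OF nd[unfolded nondegenerate_pairing_def cohomology_zero]], of ?X] by simp
  then have "\<phi> \<in> Bd (Suc 0)" using X by simp
  then have "\<phi> = (\<lambda>xs\<in>LS (Suc 0). \<zero>)" by (rule Bd_1)
  then have "\<phi> [x0] = (\<lambda>xs\<in>LS (Suc 0). \<zero>) [x0]" by (rule fun_cong)
  then show False using x0 by (simp add: \<phi>_def)
qed

end

context trivial_coefficients begin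

lemma cocycle_LT:
  assumes ad: "admissible (\<lambda>m. \<zero>) \<delta>"
    and der: "\<And>x y. \<lbrakk>x \<in> S; y \<in> S\<rbrakk> \<Longrightarrow> \<delta> (bracket L x y) = bracket L (\<delta> x) y \<oplus>\<^bsub>L\<^esub> bracket L x (\<delta> y)"
    and f: "cocycle n f"
  shows "cocycle n (LD (\<lambda>m. \<zero>) \<delta> f)"
proof -
  have C: "C n f" and 0: "\<And>xs. xs \<in> LS (Suc n) \<Longrightarrow> d f xs = \<zero>" using f by (auto simp: cocycle_def)
  have "d (LD (\<lambda>m. \<zero>) \<delta> f) xs = \<zero>" if xs: "xs \<in> LS (Suc n)" for xs
  proof -
    have "d (LD (\<lambda>m. \<zero>) \<delta> f) xs = LD (\<lambda>m. \<zero>) \<delta> (d f) xs"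
      by (rule d_LD[OF ad der _ C xs]) simp_all
    also have "\<dots> = \<zero>" using LD_zero[OF ad xs, of "d f"] 0 by simp
    finally show ?thesis .
  qed
  then show ?thesis using LD_C[OF ad C] by (simp add: cocycle_def)
qed

text \<open>Derivations act on a one-dimensional cohomology group by scalars, which commute.\<close>

lemma exact_LT_commutator:
  assumes f: "cocycle (Suc m) f"
    and span: "\<And>a. cocycle (Suc m) a \<Longrightarrow> \<exists>c\<in>carrier R. exact m (\<lambda>xs. a xs \<ominus> c \<otimes> f xs)"
    and ad: "admissible (\<lambda>m. \<zero>) \<delta>" "admissible (\<lambda>m. \<zero>) \<epsilon>"
    and der: "\<And>x y. \<lbrakk>x \<in> S; y \<in> S\<rbrakk> \<Longrightarrow> \<delta> (bracket L x y) = bracket L (\<delta> x) y \<oplus>\<^bsub>L\<^esub> bracket L x (\<delta> y)"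
      "\<And>x y. \<lbrakk>x \<in> S; y \<in> S\<rbrakk> \<Longrightarrow> \<epsilon> (bracket L x y) = bracket L (\<epsilon> x) y \<oplus>\<^bsub>L\<^esub> bracket L x (\<epsilon> y)"
  shows "exact m (LD (\<lambda>m. \<zero>) (\<lambda>x. \<delta> (\<epsilon> x) \<ominus>\<^bsub>L\<^esub> \<epsilon> (\<delta> x)) f)"
proof -
  have C: "C (Suc m) f" using f by (simp add: cocycle_def)
  let ?D = "LD (\<lambda>m. \<zero>) \<delta> f" and ?E = "LD (\<lambda>m. \<zero>) \<epsilon> f"
  from span[OF cocycle_LT[OF ad(1) der(1) f]] obtain a where a: "a \<in> carrier R" "exact m (\<lambda>xs. ?D xs \<ominus> a \<otimes> f xs)" by blast
  from span[OF cocycle_LT[OF ad(2) der(2) f]] obtain b where b: "b \<in> carrier R" "exact m (\<lambda>xs. ?E xs \<ominus> b \<otimes> f xs)" by blast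
  have sm: "C (Suc m) (\<lambda>xs. c \<otimes> f xs)" if "c \<in> carrier R" for c using C_smult[OF that C] by simp
  let ?d = "\<lambda>xs. LD (\<lambda>m. \<zero>) \<delta> ?E xs \<ominus> b \<otimes> ?D xs" and ?e = "\<lambda>xs. LD (\<lambda>m. \<zero>) \<epsilon> ?D xs \<ominus> a \<otimes> ?E xs"
  have d1: "exact m ?d"
  proof (rule exact_cong[OF exact_LT[OF ad(1) der(1) b(2)]])
    fix xs assume xs: "xs \<in> LS (Suc m)"
    show "LD (\<lambda>m. \<zero>) \<delta> (\<lambda>xs. ?E xs \<ominus> b \<otimes> f xs) xs = LD (\<lambda>m. \<zero>) \<delta> ?E xs \<ominus> b \<otimes> ?D xs"
      using LD_minus[OF ad(1) LD_C[OF ad(2) C] sm[OF b(1)] xs] LD_smult[OF ad(1) b(1) C xs] by simp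
  qed
  have d2: "exact m ?e"
  proof (rule exact_cong[OF exact_LT[OF ad(2) der(2) a(2)]])
    fix xs assume xs: "xs \<in> LS (Suc m)"
    show "LD (\<lambda>m. \<zero>) \<epsilon> (\<lambda>xs. ?D xs \<ominus> a \<otimes> f xs) xs = LD (\<lambda>m. \<zero>) \<epsilon> ?D xs \<ominus> a \<otimes> ?E xs"
      using LD_minus[OF ad(2) LD_C[OF ad(1) C] sm[OF a(1)] xs] LD_smult[OF ad(2) a(1) C xs] by simp
  qed
  \<comment> \<open>A combination of exact cochains in which the products of the two scalars with
    \<open>f\<close> and the first order terms cancel, leaving the commutator.\<close>
  have "exact m (\<lambda>xs. ((?d xs \<oplus> b \<otimes> (?D xs \<ominus> a \<otimes> f xs)) \<ominus> ?e xs) \<ominus> a \<otimes> (?E xs \<ominus> b \<otimes> f xs))"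
    by (intro exact_add exact_minus exact_smult d1 d2 a b)
  then show ?thesis
  proof (rule exact_cong)
    fix xs assume xs: "xs \<in> LS (Suc m)"
    have c: "f xs \<in> carrier R" "?D xs \<in> carrier R" "?E xs \<in> carrier R"
      "LD (\<lambda>m. \<zero>) \<delta> ?E xs \<in> carrier R" "LD (\<lambda>m. \<zero>) \<epsilon> ?D xs \<in> carrier R"
      using C_closed[OF C xs] LT_closed[OF ad(1) C xs] LT_closed[OF ad(2) C xs]
        LT_closed[OF ad(1) LD_C[OF ad(2) C] xs] LT_closed[OF ad(2) LD_C[OF ad(1) C] xs] by simp_all
    have id: "(((p \<ominus> bD) \<oplus> (bD \<ominus> y)) \<ominus> (q \<ominus> aE)) \<ominus> (aE \<ominus> y) = p \<ominus> q"
      if "p \<in> carrier R" "q \<in> carrier R" "bD \<in> carrier R" "aE \<in> carrier R" "y \<in> carrier R" for p q bD aE y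
      using that by algebra
    have "LD (\<lambda>m. \<zero>) (\<lambda>x. \<delta> (\<epsilon> x) \<ominus>\<^bsub>L\<^esub> \<epsilon> (\<delta> x)) f xs =
        LD (\<lambda>m. \<zero> \<ominus>\<^bsub>triv\<^esub> \<zero>) (\<lambda>x. \<delta> (\<epsilon> x) \<ominus>\<^bsub>L\<^esub> \<epsilon> (\<delta> x)) f xs"
      by (rule LD_op_cong[OF _ HOL.refl C xs]) (simp add: R.minus_self)
    also have "\<dots> = LD (\<lambda>m. \<zero>) \<delta> ?E xs \<ominus>\<^bsub>triv\<^esub> LD (\<lambda>m. \<zero>) \<epsilon> ?D xs"
      by (rule LD_commutator[OF ad C xs])
    also have "\<dots> = ((?d xs \<oplus> b \<otimes> (?D xs \<ominus> a \<otimes> f xs)) \<ominus> ?e xs) \<ominus> a \<otimes> (?E xs \<ominus> b \<otimes> f xs)"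
    proof -
      have 1: "b \<otimes> (?D xs \<ominus> a \<otimes> f xs) = b \<otimes> ?D xs \<ominus> a \<otimes> (b \<otimes> f xs)"
        using a(1) b(1) c by (simp add: a_minus_def R.r_distr R.r_minus R.m_lcomm)
      have 2: "a \<otimes> (?E xs \<ominus> b \<otimes> f xs) = a \<otimes> ?E xs \<ominus> a \<otimes> (b \<otimes> f xs)"
        using a(1) b(1) c by (simp add: a_minus_def R.r_distr R.r_minus)
      show ?thesis unfolding 1 2 triv_minus by (rule id[symmetric]) (use a(1) b(1) c in simp_all)
    qed
    finally show "((?d xs \<oplus> b \<otimes> (?D xs \<ominus> a \<otimes> f xs)) \<ominus> ?e xs) \<ominus> a \<otimes> (?E xs \<ominus> b \<otimes> f xs) =
        LD (\<lambda>m. \<zero>) (\<lambda>x. \<delta> (\<epsilon> x) \<ominus>\<^bsub>L\<^esub> \<epsilon> (\<delta> x)) f xs" by (rule HOL.sym)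
  qed
qed

end

section \<open>Extending cochains from the kernel of a character\<close>

locale lie_character = trivial_coefficients R L S
  for R :: "('a, 'x) ring_scheme" (structure) and L :: "('a, 'b, 'y) lie_algebra_scheme" (structure)
    and S :: "'b set" +
  fixes \<chi> :: "'b \<Rightarrow> 'a"
  assumes \<chi>: "linear_form \<chi>" and \<chi>_bracket: "\<lbrakk>x \<in> S; y \<in> S\<rbrakk> \<Longrightarrow> \<chi> (bracket L x y) = \<zero>"
begin

abbreviation "S0 \<equiv> {x \<in> S. \<chi> x = \<zero>}"

lemmas \<chi>D = linear_formD[OF \<chi>]

lemma trivial_coefficients_kernel: "trivial_coefficients R L S0"
proof (intro trivial_coefficients.intro lie_sub.intro)
  show "lie_module R L triv" ..
  have "\<chi> \<zero>\<^bsub>L\<^esub> = \<zero>" using \<chi>D(3)[of \<zero> "\<zero>\<^bsub>L\<^esub>"] \<chi>D(1)[OF S_zero] S_zero by simp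
  then show "lie_sub_axioms R L S0"
    unfolding lie_sub_axioms_def using S_zero by (auto simp: S_add S_smult S_bracket \<chi>D \<chi>_bracket)
qed

lemma lists_S0: "xs \<in> lists_of S0 q \<Longrightarrow> xs \<in> LS q \<and> set xs \<subseteq> S \<and> (\<forall>x\<in>set xs. \<chi> x = \<zero>) \<and> length xs = q"
  by (auto simp: lists_of_def)

definition proj :: "'b \<Rightarrow> 'b \<Rightarrow> 'b" where
  "proj t x = x \<ominus>\<^bsub>L\<^esub> \<chi> x \<odot>\<^bsub>L\<^esub> t"

lemma \<chi>_minus: "\<lbrakk>x \<in> S; y \<in> S\<rbrakk> \<Longrightarrow> \<chi> (x \<ominus>\<^bsub>L\<^esub> y) = \<chi> x \<ominus> \<chi> y"
proof -
  assume xy: "x \<in> S" "y \<in> S"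
  have "\<ominus>\<^bsub>L\<^esub> y = \<ominus> \<one> \<odot>\<^bsub>L\<^esub> y" using xy smult_l_minus[of \<one> y] by simp
  then have "\<chi> (\<ominus>\<^bsub>L\<^esub> y) = \<ominus> \<chi> y" using xy \<chi>D(3)[of "\<ominus> \<one>" y] \<chi>D(1)[OF xy(2)] by (simp add: R.l_minus)
  then show ?thesis using xy S_neg by (simp add: a_minus_def \<chi>D)
qed

lemma proj:
  assumes t: "t \<in> S" "\<chi> t = \<one>"
  shows "x \<in> S \<Longrightarrow> proj t x \<in> S0" "\<lbrakk>x \<in> S; y \<in> S\<rbrakk> \<Longrightarrow> proj t (x \<oplus>\<^bsub>L\<^esub> y) = proj t x \<oplus>\<^bsub>L\<^esub> proj t y"
    "\<lbrakk>c \<in> carrier R; x \<in> S\<rbrakk> \<Longrightarrow> proj t (c \<odot>\<^bsub>L\<^esub> x) = c \<odot>\<^bsub>L\<^esub> proj t x" "x \<in> S0 \<Longrightarrow> proj t x = x"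
    "x \<in> S \<Longrightarrow> x = proj t x \<oplus>\<^bsub>L\<^esub> \<chi> x \<odot>\<^bsub>L\<^esub> t"
proof -
  note [simp] = \<chi>D S_smult S_minus S_add \<chi>_minus t
  show "x \<in> S \<Longrightarrow> proj t x \<in> S0" by (simp add: proj_def R.minus_self)
  show "\<lbrakk>x \<in> S; y \<in> S\<rbrakk> \<Longrightarrow> proj t (x \<oplus>\<^bsub>L\<^esub> y) = proj t x \<oplus>\<^bsub>L\<^esub> proj t y"
    by (simp add: proj_def smult_l_distr L_add_minus_add)
  show "\<lbrakk>c \<in> carrier R; x \<in> S\<rbrakk> \<Longrightarrow> proj t (c \<odot>\<^bsub>L\<^esub> x) = c \<odot>\<^bsub>L\<^esub> proj t x"
    by (simp add: proj_def a_minus_def smult_r_distr smult_r_minus smult_assoc1)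
  show "x \<in> S0 \<Longrightarrow> proj t x = x" by (simp add: proj_def L_minus_zero_right)
  show "x \<in> S \<Longrightarrow> x = proj t x \<oplus>\<^bsub>L\<^esub> \<chi> x \<odot>\<^bsub>L\<^esub> t" by (simp add: proj_def L_minus_add_cancel)
qed

text \<open>\<open>S\<close> is the sum of \<open>S0\<close> and the line through \<open>t\<close>.
  By alternation \<open>t\<close> counts at most once in a tuple, and skew symmetry brings it to the
  front.\<close>

lemma cochain_eqI:
  assumes t: "t \<in> S" "\<chi> t = \<one>"
  shows "\<lbrakk>C q f; C q g; \<And>xs. xs \<in> lists_of S0 q \<Longrightarrow> f xs = g xs;
    \<And>p xs. \<lbrakk>q = Suc p; xs \<in> lists_of S0 p\<rbrakk> \<Longrightarrow> f (t # xs) = g (t # xs); xs \<in> LS q\<rbrakk> \<Longrightarrow> f xs = g xs"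
proof (induction q arbitrary: f g xs)
  case (Suc q)
  from Suc.prems(5) obtain x ys where xs: "xs = x # ys" "x \<in> S" "ys \<in> LS q" by (rule lists_of_SucE)
  note f = Suc.prems(1) and g = Suc.prems(2)
  have i: "C q (\<lambda>zs. f (y # zs))" "C q (\<lambda>zs. g (y # zs))" if "y \<in> S" for y using f g that by auto
  have "f (t # ys) = g (t # ys)"
  proof (rule Suc.IH[OF i[OF t(1)] _ _ xs(3)])
    show "f (t # zs) = g (t # zs)" if "zs \<in> lists_of S0 q" for zs by (rule Suc.prems(4)[OF HOL.refl that])
    show "f (t # t # zs) = g (t # t # zs)" if "q = Suc p" "zs \<in> lists_of S0 p" for p zs
      using C_self[of p f t zs] C_self[of p g t zs] f g lists_S0[OF that(2)] that(1) t by simp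
  qed
  moreover have "f (proj t x # ys) = g (proj t x # ys)"
  proof -
    have x0: "proj t x \<in> S0" by (rule proj(1)[OF t xs(2)])
    then have x1: "proj t x \<in> S" by simp
    show ?thesis
    proof (rule Suc.IH[OF i[OF x1] _ _ xs(3)])
      show "f (proj t x # zs) = g (proj t x # zs)" if "zs \<in> lists_of S0 q" for zs
        by (rule Suc.prems(3)) (use that x0 in simp)
      show "f (proj t x # t # zs) = g (proj t x # t # zs)" if "q = Suc p" "zs \<in> lists_of S0 p" for p zs
      proof -
        have "f (t # proj t x # zs) = g (t # proj t x # zs)"
          by (rule Suc.prems(4)[OF HOL.refl]) (use that x0 in simp)
        then show ?thesis
          using C_skew[OF f[unfolded that(1)] x1 t(1), of zs] C_skew[OF g[unfolded that(1)] x1 t(1), of zs] lists_S0[OF that(2)] by simp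
      qed
    qed
  qed
  moreover have dec: "h (x # ys) = h (proj t x # ys) \<oplus> \<chi> x \<otimes> h (t # ys)" if h: "C (Suc q) h" for h
  proof -
    have "h (x # ys) = h ((proj t x \<oplus>\<^bsub>L\<^esub> \<chi> x \<odot>\<^bsub>L\<^esub> t) # ys)" using proj(5)[OF t xs(2)] by simp
    also have "\<dots> = h (proj t x # ys) \<oplus>\<^bsub>triv\<^esub> h ((\<chi> x \<odot>\<^bsub>L\<^esub> t) # ys)"
      by (rule C_add_head[OF h _ _ xs(3)]) (use proj(1)[OF t xs(2)] S_smult \<chi>D xs t in auto)
    also have "h ((\<chi> x \<odot>\<^bsub>L\<^esub> t) # ys) = \<chi> x \<odot>\<^bsub>triv\<^esub> h (t # ys)"
      by (rule C_smult_head[OF h _ _ xs(3)]) (use \<chi>D xs t in auto)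
    finally show ?thesis by simp
  qed
  ultimately show ?case unfolding xs(1) dec[OF f] dec[OF g] by simp
qed simp

text \<open>The wedge of \<open>\<chi>\<close> with the pullback of \<open>g\<close> along the
  projection to the kernel. It is applied both to the cocycle on the kernel and to its partial
  primitives.\<close>

definition extend :: "'b \<Rightarrow> ('b list \<Rightarrow> 'a) \<Rightarrow> 'b list \<Rightarrow> 'a" where
  "extend t g = W \<chi> (\<lambda>zs. g (map (proj t) zs))"

lemma map_proj: "\<lbrakk>t \<in> S; \<chi> t = \<one>; xs \<in> lists_of S0 q\<rbrakk> \<Longrightarrow> map (proj t) xs = xs"
  by (rule map_idI) (auto simp: lists_of_def intro: proj(4))

text \<open>On the kernel \<open>\<chi>\<close> vanishes, and after contraction with an element of
  character one only \<open>g\<close> is left. That element \<open>s\<close> may differ from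
  \<open>t\<close>: one and the same extension is contracted with different vertices on different
  subalgebras. The sign in the last conclusion comes from \<open>d_wedge\<close>.\<close>

lemma extend:
  assumes t: "t \<in> S" "\<chi> t = \<one>" and g: "cochain R L triv S0 q g"
  shows "C (Suc q) (extend t g)"
    and "xs \<in> lists_of S0 (Suc q) \<Longrightarrow> extend t g xs = \<zero>"
    and "\<lbrakk>s \<in> S; \<chi> s = \<one>; xs \<in> lists_of S0 q\<rbrakk> \<Longrightarrow> extend t g (s # xs) = g xs"
    and "xs \<in> lists_of S0 (Suc (Suc q)) \<Longrightarrow> d (extend t g) xs = \<zero>"
    and "\<lbrakk>s \<in> S; \<chi> s = \<one>; xs \<in> lists_of S0 (Suc q)\<rbrakk> \<Longrightarrow> d (extend t g) (s # xs) = \<ominus> d g xs"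
proof -
  interpret K: trivial_coefficients R L S0 by (rule trivial_coefficients_kernel)
  let ?g = "\<lambda>zs. g (map (proj t) zs)"
  have C: "C q ?g"
    by (rule cochain_pullback[where T = S0, OF _ _ _ g]) (use proj[OF t] in auto)
  have van: "W \<chi> h xs = \<zero>" if "xs \<in> lists_of S0 (Suc q)" "C q h" for xs h q
    by (rule wedge_vanish[OF _ _ that(2)]) (use lists_S0[OF that(1)] in auto)
  show "C (Suc q) (extend t g)" unfolding extend_def by (rule wedge_C[OF \<chi> C])
  show "extend t g xs = \<zero>" if "xs \<in> lists_of S0 (Suc q)"
    unfolding extend_def by (rule van[OF that C])
  show "d (extend t g) xs = \<zero>" if xs: "xs \<in> lists_of S0 (Suc (Suc q))"
  proof -
    have "d (extend t g) xs = \<ominus> W \<chi> (d ?g) xs"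
      unfolding extend_def by (rule d_wedge[OF \<chi> \<chi>_bracket C]) (use lists_S0[OF xs] in auto)
    then show ?thesis using van[OF xs d_C[OF C]] by (simp add: R.a_inv_zero)
  qed
  {
    assume s: "s \<in> S" "\<chi> s = \<one>" and xs: "xs \<in> lists_of S0 q"
    have gc: "g xs \<in> carrier R" using K.C_closed[OF g xs] by simp
    have z: "W \<chi> (\<lambda>zs. ?g (s # zs)) xs = \<zero>"
    proof (cases q)
      case 0 then show ?thesis using xs by simp
    next
      case (Suc p)
      show ?thesis by (rule van[of xs p]) (use xs Suc C s in auto)
    qed
    show "extend t g (s # xs) = g xs"
      unfolding extend_def using s gc map_proj[OF t xs] z by (simp add: R.minus_zero_right)
  }
  {
    assume s: "s \<in> S" "\<chi> s = \<one>" and xs: "xs \<in> lists_of S0 (Suc q)"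
    have xs': "xs \<in> LS (Suc q)" using lists_S0[OF xs] by simp
    have "d (extend t g) (s # xs) = \<ominus> W \<chi> (d ?g) (s # xs)"
      unfolding extend_def by (rule d_wedge[OF \<chi> \<chi>_bracket C]) (use xs' s in auto)
    also have "W \<chi> (d ?g) (s # xs) = d ?g xs"
      using van[OF xs C_inner[OF d_C[OF C] s(1)]] s(2) d_closed[OF C xs'] by (simp add: R.minus_zero_right)
    also have "d ?g xs = d g xs"
      by (rule K.d_cong[OF _ xs]) (simp add: map_proj[OF t])
    finally show "d (extend t g) (s # xs) = \<ominus> d g xs" .
  }
qed

end

section \<open>The Bestvina-Brady Lie algebra of a graph with two nonadjacent vertices\<close>

lemma (in cring) ground_lie: "lie_algebra R (ground_lie_algebra R)"
proof -
  have "abelian_group (ground_lie_algebra R)"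
  proof (rule abelian_groupI)
    fix x assume "x \<in> carrier (ground_lie_algebra R)"
    then show "\<exists>y\<in>carrier (ground_lie_algebra R). y \<oplus>\<^bsub>ground_lie_algebra R\<^esub> x = \<zero>\<^bsub>ground_lie_algebra R\<^esub>"
      by (intro bexI[of _ "\<ominus> x"]) (auto simp: l_neg)
  qed (auto simp: a_ac)
  then have "Module.module R (ground_lie_algebra R)"
    by (rule moduleI[OF is_cring]) (auto simp: l_distr r_distr m_assoc)
  then show ?thesis by (intro lie_algebra.intro lie_algebra_axioms.intro) auto
qed

definition adjoint_module :: "('a, 'b, 'y) lie_algebra_scheme \<Rightarrow> ('a, 'b, 'b) lie_module" where
  "adjoint_module L = \<lparr>carrier = carrier L, monoid.mult = undefined, one = undefined, zero = \<zero>\<^bsub>L\<^esub>, add = add L,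
     smult = smult L, act = bracket L\<rparr>"

lemma adjoint_simps [simp]:
  "carrier (adjoint_module L) = carrier L" "\<zero>\<^bsub>adjoint_module L\<^esub> = \<zero>\<^bsub>L\<^esub>" "add (adjoint_module L) = add L"
  "smult (adjoint_module L) = smult L" "act (adjoint_module L) = bracket L"
  by (simp_all add: adjoint_module_def)

lemma adjoint_minus [simp]: "a_minus (adjoint_module L) = a_minus L"
  by (intro HOL.ext) (simp add: a_minus_def a_inv_def m_inv_def)

lemma (in lie_algebra) adjoint_lie_module: "lie_module R L (adjoint_module L)"
proof (intro lie_module.intro lie_module_axioms.intro)
  show "lie_algebra R L" ..
  have "abelian_group (adjoint_module L)"
  proof (rule abelian_groupI)
    fix x assume "x \<in> carrier (adjoint_module L)"
    then show "\<exists>y\<in>carrier (adjoint_module L). y \<oplus>\<^bsub>adjoint_module L\<^esub> x = \<zero>\<^bsub>adjoint_module L\<^esub>"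
      by (intro bexI[of _ "\<ominus>\<^bsub>L\<^esub> x"]) (auto simp: L_l_neg)
  qed (auto simp: L_a_ac)
  then show "Module.module R (adjoint_module L)"
    by (rule moduleI[OF R.is_cring]) (auto simp: smult_l_distr smult_r_distr smult_assoc1)
  fix x y z assume a: "x \<in> carrier L" "y \<in> carrier L" "z \<in> carrier (adjoint_module L)"
  show "act (adjoint_module L) (bracket L x y) z = act (adjoint_module L) x (act (adjoint_module L) y z)
      \<ominus>\<^bsub>adjoint_module L\<^esub> act (adjoint_module L) y (act (adjoint_module L) x z)"
    using a bracket_leibniz[of x y z] by (simp add: L_add_minus_cancel bracket_closed)
qed (auto simp: bracket_closed bracket_add_left bracket_add_right bracket_smult_left bracket_smult_right)

section \<open>Coordinates, the Euler derivation and the exactness argument\<close>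

context raag begin

abbreviation "aug \<equiv> raag_augmentation k V E"
abbreviation "BB \<equiv> bestvina_brady_lie_algebra k V E"
abbreviation "ker \<equiv> {x \<in> carrier L. aug x = \<zero>\<^bsub>k\<^esub>}"

lemmas aug = lie_homD[OF raag_augmentation(1)[OF kc, of V E], simplified] raag_augmentation(2)[OF kc, of _ V E]

lemma trivial_coefficients_avoiding:
  "S \<in> {carrier L, avoiding v, avoiding w, avoiding v \<inter> avoiding w} \<Longrightarrow> trivial_coefficients k L S"
  by (intro trivial_coefficients.intro lie_sub_avoiding[OF L.trivial_lie_module])

lemma lie_character:
  assumes "S \<in> {carrier L, avoiding v}" and "\<xi> \<in> lie_hom k L (ground_lie_algebra k)"
  shows "lie_character k L S \<xi>"
proof -
  interpret C: trivial_coefficients k L S by (rule trivial_coefficients_avoiding[of _ v v]) (use assms in auto)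
  have S: "x \<in> carrier L" if "x \<in> S" for x using that C.S_sub by blast
  show ?thesis
    by (intro lie_character.intro lie_character_axioms.intro C.trivial_coefficients_axioms)
      (use lie_homD[OF assms(2)] S in \<open>auto simp: C.linear_form_def\<close>)
qed

lemma L_character: "lie_character k L (carrier L) aug"
  by (rule lie_character[OF _ raag_augmentation(1)[OF kc]]) simp

lemma ce_bridge_BB: "ce_bridge k L ker BB"
proof (intro ce_bridge.intro ce_bridge_axioms.intro)
  show "trivial_coefficients k L ker"
    by (rule lie_character.trivial_coefficients_kernel[OF L_character])
qed (simp_all add: bestvina_brady_lie_algebra_def a_kernel_def')

text \<open>The 1-form dual to the vertex \<open>v\<close>. Composed with \<open>delete v\<close> it
  is a homomorphism that is zero on all vertices, hence zero; so it vanishes on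
  \<open>avoiding v\<close>.\<close>

lemma coordinate:
  obtains \<xi> where "\<xi> \<in> lie_hom k L (ground_lie_algebra k)"
    "\<And>u. u \<in> V \<Longrightarrow> \<xi> (vx u) = (if u = v then \<one>\<^bsub>k\<^esub> else \<zero>\<^bsub>k\<^esub>)" "\<And>x. x \<in> avoiding v \<Longrightarrow> \<xi> x = \<zero>\<^bsub>k\<^esub>"
proof -
  note G = cring.ground_lie[OF kc]
  obtain \<xi> where \<xi>: "\<xi> \<in> lie_hom k L (ground_lie_algebra k)"
    "\<And>u. u \<in> V \<Longrightarrow> \<xi> (vx u) = (if u = v then \<one>\<^bsub>k\<^esub> else \<zero>\<^bsub>k\<^esub>)"
    by (rule hom_exists[OF G, of "\<lambda>u. if u = v then \<one>\<^bsub>k\<^esub> else \<zero>\<^bsub>k\<^esub>"]) auto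
  have 0: "(\<lambda>x. \<zero>\<^bsub>k\<^esub>) \<in> lie_hom k L (ground_lie_algebra k)" by (auto simp: lie_hom_def)
  have z: "\<xi> \<zero>\<^bsub>L\<^esub> = \<zero>\<^bsub>k\<^esub>"
    using lie_homD(3)[OF \<xi>(1), of "\<zero>\<^bsub>k\<^esub>" "\<zero>\<^bsub>L\<^esub>"] lie_homD(1)[OF \<xi>(1), of "\<zero>\<^bsub>L\<^esub>"] by (simp add: L.L_zero_closed)
  have "\<xi> (delete v x) = \<zero>\<^bsub>k\<^esub>" if "x \<in> carrier L" for x
    by (rule hom_unique[OF G lie_hom_comp[OF delete(1) \<xi>(1)] 0 _ that]) (auto simp: delete \<xi>(2) z)
  then have "\<xi> x = \<zero>\<^bsub>k\<^esub>" if "x \<in> avoiding v" for x using that unfolding avoiding_def by force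
  then show ?thesis using that \<xi> by blast
qed

text \<open>A derivation is a twisted derivation for the zero cocycle with adjoint coefficients.
  Fixing all vertices respects the edges because adjacent vertices commute. The composite of
  \<open>e\<close> with \<open>aug\<close> kills brackets, so it is a homomorphism, and it agrees
  with \<open>aug\<close> on vertices.\<close>

lemma euler_derivation:
  obtains e where "linear_map k L L e" "\<And>v. v \<in> V \<Longrightarrow> e (vx v) = vx v"
    "\<And>x y. \<lbrakk>x \<in> carrier L; y \<in> carrier L\<rbrakk> \<Longrightarrow> e (bracket L x y) = bracket L (e x) y \<oplus>\<^bsub>L\<^esub> bracket L x (e y)"
    "\<And>x. x \<in> carrier L \<Longrightarrow> aug (e x) = aug x"
proof -
  let ?A = "adjoint_module L"
  have A: "lie_module k L ?A" by (rule L.adjoint_lie_module)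
  interpret A: lie_sub k L ?A "carrier L" by (rule lie_module.lie_sub_carrier[OF A])
  have rel: "(bracket L (vx v) (vx w) \<ominus>\<^bsub>L\<^esub> bracket L (vx w) (vx v)) \<ominus>\<^bsub>L\<^esub> \<zero>\<^bsub>L\<^esub> = \<zero>\<^bsub>L\<^esub>"
    if "{v, w} \<in> E" "v \<in> V" "w \<in> V" for v w
    using vx_edge[of v w] vx_edge[of w v] that by (simp add: insert_commute L.L_minus_zero_right L.L_zero_closed)
  obtain e where e: "linear_map k L ?A e" "\<And>v. v \<in> V \<Longrightarrow> e (vx v) = vx v"
    "\<And>x y. \<lbrakk>x \<in> carrier L; y \<in> carrier L\<rbrakk> \<Longrightarrow>
      e (bracket L x y) = (act ?A x (e y) \<ominus>\<^bsub>?A\<^esub> act ?A y (e x)) \<ominus>\<^bsub>?A\<^esub> \<zero>\<^bsub>?A\<^esub>"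
    by (rule twisted_derivation[OF A A.C_zero, where b = vx]) (use A.d_zero rel in auto)
  have lin: "linear_map k L L e" using e(1) by (simp add: linear_map_def)
  note l = linear_mapD[OF lin]
  have der: "e (bracket L x y) = bracket L (e x) y \<oplus>\<^bsub>L\<^esub> bracket L x (e y)"
    if "x \<in> carrier L" "y \<in> carrier L" for x y
    using e(3)[OF that] l(1) that L.bracket_skew[of "e x" y]
    by (simp add: L.bracket_closed L.L_minus_zero_right a_minus_def L.L_a_ac)
  note G = cring.ground_lie[OF kc]
  have hom: "(\<lambda>x. aug (e x)) \<in> lie_hom k L (ground_lie_algebra k)"
    unfolding lie_hom_def using l(1) by (auto simp: l(2,3) der aug L.bracket_closed)
  have "aug (e x) = aug x" if "x \<in> carrier L" for x
    by (rule hom_unique[OF G hom raag_augmentation(1)[OF kc] _ that]) (simp add: e(2))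
  then show ?thesis using that lin e(2) der by blast
qed

text \<open>On the intersection \<open>h1 - h2\<close> is a cocycle. Pulled back along the
  retraction \<open>delete w\<close> it becomes a cocycle on all of \<open>avoiding v\<close>;
  subtracting it from \<open>h1\<close> leaves a primitive of \<open>F\<close> that equals
  \<open>h2\<close> on the intersection, so zero serves as the datum \<open>e\<close> of
  Mayer-Vietoris.\<close>

lemma exact_of_avoiding:
  assumes vw: "v \<in> V" "w \<in> V" "v \<noteq> w" "{v, w} \<notin> E"
    and F: "cochain k L triv (carrier L) (Suc (Suc m)) F"
      "\<And>xs. xs \<in> lists_of (carrier L) (Suc (Suc (Suc m))) \<Longrightarrow> cobd L triv F xs = \<zero>\<^bsub>k\<^esub>"
    and h1: "cochain k L triv (avoiding v) (Suc m) h1"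
      "\<And>xs. xs \<in> lists_of (avoiding v) (Suc (Suc m)) \<Longrightarrow> cobd L triv h1 xs = F xs"
    and h2: "cochain k L triv (avoiding w) (Suc m) h2"
      "\<And>xs. xs \<in> lists_of (avoiding w) (Suc (Suc m)) \<Longrightarrow> cobd L triv h2 xs = F xs"
  obtains g where "cochain k L triv (carrier L) (Suc m) g"
    "\<And>xs. xs \<in> lists_of (carrier L) (Suc (Suc m)) \<Longrightarrow> cobd L triv g xs = F xs"
proof -
  let ?D = "avoiding v \<inter> avoiding w" and ?\<rho> = "delete w"
  have \<rho>: "?\<rho> x \<in> ?D" if "x \<in> avoiding v" for x
    using that deleteD(1)[of x w] delete_idem[of x w] delete_commute[of x v w] by (simp add: avoiding_def)
  have \<rho>D: "map ?\<rho> xs = xs" if "xs \<in> lists_of ?D q" for xs q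
    by (rule map_idI) (use that in \<open>auto simp: lists_of_def avoiding_def\<close>)
  interpret A: trivial_coefficients k L "avoiding v" by (rule trivial_coefficients_avoiding[of _ v w]) simp
  interpret A2: trivial_coefficients k L "avoiding w" by (rule trivial_coefficients_avoiding[of _ v w]) simp
  interpret D: trivial_coefficients k L ?D by (rule trivial_coefficients_avoiding[of _ v w]) simp
  have D: "?D \<subseteq> avoiding v" "?D \<subseteq> avoiding w" by auto
  note mono = lists_of_mono[OF D(1)] lists_of_mono[OF D(2)]
  have hD: "D.C (Suc m) h1" "D.C (Suc m) h2" by (rule cochain_mono[OF D(1) h1(1)], rule cochain_mono[OF D(2) h2(1)])
  let ?k = "\<lambda>xs. h1 xs \<ominus>\<^bsub>k\<^esub> h2 xs"
  have kD: "D.C (Suc m) ?k" using D.C_minus[OF hD] by simp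
  have dk: "D.d ?k xs = \<zero>\<^bsub>k\<^esub>" if "xs \<in> D.LS (Suc (Suc m))" for xs
    using D.d_minus[OF hD that] h1(2)[OF mono(1)[OF that]] h2(2)[OF mono(2)[OF that]] D.d_closed[OF hD(1) that]
    by (simp add: L.R.minus_self)
  let ?k' = "\<lambda>xs. ?k (map ?\<rho> xs)"
  have k': "A.C (Suc m) ?k'"
    by (rule cochain_pullback[OF \<rho> _ _ kD]) (auto simp: deleteD)
  have dk': "A.d ?k' xs = \<zero>\<^bsub>k\<^esub>" if xs: "xs \<in> A.LS (Suc (Suc m))" for xs
  proof -
    have "A.d ?k' xs = A.d ?k (map ?\<rho> xs)"
      by (rule A.cobd_pullback) (use xs in \<open>auto simp: deleteD lists_of_def\<close>)
    also have "\<dots> = \<zero>\<^bsub>k\<^esub>" by (rule dk) (use xs \<rho> in \<open>auto simp: lists_of_def\<close>)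
    finally show ?thesis .
  qed
  have h1': "A.C (Suc m) (\<lambda>xs. h1 xs \<ominus>\<^bsub>k\<^esub> ?k' xs)" using A.C_minus[OF h1(1) k'] by simp
  have dh1': "A.d (\<lambda>xs. h1 xs \<ominus>\<^bsub>k\<^esub> ?k' xs) xs = F xs" if xs: "xs \<in> A.LS (Suc (Suc m))" for xs
    using A.d_minus[OF h1(1) k' xs] dk'[OF xs] h1(2)[OF xs] A.d_closed[OF h1(1) xs] by (simp add: L.R.minus_zero_right)
  have e: "cobd L triv (\<lambda>_. \<zero>\<^bsub>triv\<^esub>) xs = (h1 xs \<ominus>\<^bsub>k\<^esub> ?k' xs) \<ominus>\<^bsub>triv\<^esub> h2 xs" if xs: "xs \<in> D.LS (Suc m)" for xs
  proof -
    have id: "\<zero>\<^bsub>k\<^esub> = (a \<ominus>\<^bsub>k\<^esub> (a \<ominus>\<^bsub>k\<^esub> b)) \<ominus>\<^bsub>k\<^esub> b" if "a \<in> carrier k" "b \<in> carrier k" for a b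
      using that by (simp add: a_minus_def L.R.minus_add L.R.a_assoc[symmetric] L.R.r_neg)
    have "h1 xs \<in> carrier k" "h2 xs \<in> carrier k" using D.C_closed[OF hD(1) xs] D.C_closed[OF hD(2) xs] by simp_all
    from id[OF this] show ?thesis
      using D.d_zero[of m "\<lambda>_. \<zero>\<^bsub>triv\<^esub>", OF _ xs] unfolding \<rho>D[OF xs] D.triv_simps(2) D.triv_minus by (simp only:)
  qed
  show ?thesis
    by (rule mayer_vietorisD[OF mayer_vietoris_nonadjacent[OF vw, of m] F(1) _ h1' dh1' h2 D.C_zero e])
      (use F(2) that in auto)
qed

text \<open>The sign in the assumption on \<open>g\<close> is the one that
  \<open>d (extend t g) (s # xs) = - d g xs\<close> introduces.\<close>

lemma no_fundamental_class:
  assumes vw: "v \<in> V" "w \<in> V" "v \<noteq> w" "{v, w} \<notin> E"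
    and f: "trivial_coefficients.cocycle k L ker (Suc m) f"
    and nex: "\<not> trivial_coefficients.exact k L ker m f"
    and span: "\<And>a. trivial_coefficients.cocycle k L ker (Suc m) a \<Longrightarrow>
      \<exists>c\<in>carrier k. trivial_coefficients.exact k L ker m (\<lambda>xs. a xs \<ominus>\<^bsub>k\<^esub> c \<otimes>\<^bsub>k\<^esub> f xs)"
    and g: "\<And>u. u \<in> {v, w} \<Longrightarrow> \<exists>g. cochain k L triv ker m g \<and>
      (\<forall>xs\<in>lists_of {x \<in> avoiding u. aug x = \<zero>\<^bsub>k\<^esub>} (Suc m). cobd L triv g xs = \<ominus>\<^bsub>k\<^esub> f xs)"
  shows False
proof -
  interpret T: lie_character k L "carrier L" aug by (rule L_character)
  interpret K: trivial_coefficients k L ker by (rule T.trivial_coefficients_kernel)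
  note K.S_L [simp del]
  let ?t = "vx v"
  have t: "?t \<in> carrier L" "aug ?t = \<one>\<^bsub>k\<^esub>" using vw aug by simp_all
  have Cf: "K.C (Suc m) f" and df: "\<And>xs. xs \<in> K.LS (Suc (Suc m)) \<Longrightarrow> K.d f xs = \<zero>\<^bsub>k\<^esub>"
    using f by (auto simp: K.cocycle_def)
  let ?F = "T.extend ?t f"
  note F = T.extend[OF t Cf]
  have dF: "T.d ?F xs = \<zero>\<^bsub>k\<^esub>" if "xs \<in> T.LS (Suc (Suc (Suc m)))" for xs
  proof (rule T.cochain_eqI[OF t T.d_C[OF F(1)] _ _ _ that])
    show "T.C (Suc (Suc (Suc m))) (\<lambda>_. \<zero>\<^bsub>k\<^esub>)" using T.C_zero by simp
    show "T.d ?F xs = \<zero>\<^bsub>k\<^esub>" if "xs \<in> K.LS (Suc (Suc (Suc m)))" for xs by (rule F(4)[OF that])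
    show "T.d ?F (?t # xs) = \<zero>\<^bsub>k\<^esub>" if "Suc (Suc (Suc m)) = Suc p" "xs \<in> K.LS p" for p xs
      using F(5)[OF t, of xs] df[of xs] that by (simp add: L.R.a_inv_zero)
  qed
  \<comment> \<open>The partial primitive is extended from the kernel to \<open>avoiding a\<close>
    with the help of the other vertex \<open>b\<close>. Its coboundary agrees with \<open>?F\<close>
    on the kernel, where both are zero, and after contraction with \<open>vx b\<close>, where both
    give \<open>f\<close>; \<open>cochain_eqI\<close> does the rest.\<close>
  have piece: "\<exists>h. cochain k L triv (avoiding a) (Suc m) h \<and>
      (\<forall>xs\<in>lists_of (avoiding a) (Suc (Suc m)). cobd L triv h xs = ?F xs)"
    if ab: "a \<in> {v, w}" "b \<in> V" "a \<noteq> b" for a b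
  proof -
    have sub: "{x \<in> avoiding a. aug x = \<zero>\<^bsub>k\<^esub>} \<subseteq> ker" "avoiding a \<subseteq> carrier L" by (auto simp: avoiding_def)
    interpret A: lie_character k L "avoiding a" aug
      by (rule lie_character[of _ a, OF _ raag_augmentation(1)[OF kc]]) simp
    have s: "vx b \<in> avoiding a" "aug (vx b) = \<one>\<^bsub>k\<^esub>" using vx_avoiding[of b a] aug ab by auto
    from g[OF ab(1)] obtain g where g: "cochain k L triv ker m g"
      "\<And>xs. xs \<in> lists_of {x \<in> avoiding a. aug x = \<zero>\<^bsub>k\<^esub>} (Suc m) \<Longrightarrow> cobd L triv g xs = \<ominus>\<^bsub>k\<^esub> f xs" by blast
    note H = A.extend[OF s cochain_mono[OF sub(1) g(1)]]
    have "A.d (A.extend (vx b) g) xs = ?F xs" if "xs \<in> A.LS (Suc (Suc m))" for xs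
    proof (rule A.cochain_eqI[OF s A.d_C[OF H(1)] cochain_mono[OF sub(2) F(1)] _ _ that])
      show "A.d (A.extend (vx b) g) xs = ?F xs" if "xs \<in> lists_of A.S0 (Suc (Suc m))" for xs
        using H(4)[OF that] F(2)[OF lists_of_mono[OF sub(1) that]] by simp
      show "A.d (A.extend (vx b) g) (vx b # xs) = ?F (vx b # xs)" if "Suc (Suc m) = Suc p" "xs \<in> lists_of A.S0 p" for p xs
      proof -
        have xs: "xs \<in> lists_of A.S0 (Suc m)" using that by simp
        show ?thesis
          using H(5)[OF s xs] F(3)[of "vx b", OF _ s(2) lists_of_mono[OF sub(1) xs]] g(2)[OF xs]
            K.C_closed[OF Cf lists_of_mono[OF sub(1) xs]] ab by simp
      qed
    qed
    then show ?thesis using H(1) by blast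
  qed
  obtain h1 h2 where h1: "cochain k L triv (avoiding v) (Suc m) h1"
      "\<forall>xs\<in>lists_of (avoiding v) (Suc (Suc m)). cobd L triv h1 xs = ?F xs"
    and h2: "cochain k L triv (avoiding w) (Suc m) h2"
      "\<forall>xs\<in>lists_of (avoiding w) (Suc (Suc m)). cobd L triv h2 xs = ?F xs"
    using piece[of v w] piece[of w v] vw by auto
  obtain G where G: "T.C (Suc m) G" "\<And>xs. xs \<in> T.LS (Suc (Suc m)) \<Longrightarrow> T.d G xs = ?F xs"
    by (rule exact_of_avoiding[OF vw F(1) dF h1(1) _ h2(1)]) (use h1(2) h2(2) in auto)
  have sub: "ker \<subseteq> carrier L" by auto
  have GK: "K.C (Suc m) G" by (rule cochain_mono[OF sub G(1)])
  have "K.cocycle (Suc m) G"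
    unfolding K.cocycle_def
  proof (intro conjI GK ballI)
    fix xs assume xs: "xs \<in> K.LS (Suc (Suc m))"
    show "K.d G xs = \<zero>\<^bsub>k\<^esub>" using G(2)[OF lists_of_mono[OF sub xs]] F(2)[OF xs] by simp
  qed
  \<comment> \<open>Since \<open>?F\<close> is zero on the kernel, \<open>G\<close> restricts there
    to a cocycle of the same degree as \<open>f\<close>, hence to a multiple of \<open>f\<close> up
    to an exact cochain.\<close>
  from span[OF this] obtain c where c: "c \<in> carrier k" "K.exact m (\<lambda>xs. G xs \<ominus>\<^bsub>k\<^esub> c \<otimes>\<^bsub>k\<^esub> f xs)" by blast
  have ad: "K.admissible (\<lambda>m. \<zero>\<^bsub>k\<^esub>) (bracket L ?t)"
    unfolding K.admissible_zero_iff using t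
    by (auto simp: L.bracket_closed aug L.bracket_add_right L.bracket_smult_right)
  have der: "bracket L ?t (bracket L x y) = bracket L (bracket L ?t x) y \<oplus>\<^bsub>L\<^esub> bracket L x (bracket L ?t y)"
    if "x \<in> ker" "y \<in> ker" for x y
    by (rule L.bracket_leibniz) (use that t in auto)
  obtain e where e: "linear_map k L L e" "\<And>v. v \<in> V \<Longrightarrow> e (vx v) = vx v"
    "\<And>x y. \<lbrakk>x \<in> carrier L; y \<in> carrier L\<rbrakk> \<Longrightarrow> e (bracket L x y) = bracket L (e x) y \<oplus>\<^bsub>L\<^esub> bracket L x (e y)"
    "\<And>x. x \<in> carrier L \<Longrightarrow> aug (e x) = aug x"
    by (rule euler_derivation) blast
  note el = linear_mapD[OF e(1)]
  have ade: "K.admissible (\<lambda>m. \<zero>\<^bsub>k\<^esub>) e"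
    unfolding K.admissible_zero_iff by (auto simp: el e(4))
  let ?D = "lie_der triv (\<lambda>m. \<zero>\<^bsub>k\<^esub>) (bracket L ?t)"
  have "K.exact m (lie_der triv (\<lambda>m. \<zero>\<^bsub>k\<^esub>) (\<lambda>x. e (bracket L ?t x) \<ominus>\<^bsub>L\<^esub> bracket L ?t (e x)) f)"
    by (rule K.exact_LT_commutator[OF f span ade ad]) (use e(3) der in auto)
  then have Df: "K.exact m (?D f)"
  proof (rule K.exact_cong)
    fix xs assume xs: "xs \<in> K.LS (Suc m)"
    show "lie_der triv (\<lambda>m. \<zero>\<^bsub>k\<^esub>) (\<lambda>x. e (bracket L ?t x) \<ominus>\<^bsub>L\<^esub> bracket L ?t (e x)) f xs = ?D f xs"
    proof (rule K.LD_op_cong[OF HOL.refl _ Cf xs])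
      fix x assume "x \<in> ker"
      \<comment> \<open>The derivation rule gives \<open>e [t, x] = [t, x] + [t, e x]\<close>,
        because \<open>e\<close> fixes the vertex \<open>t\<close>.\<close>
      then show "e (bracket L ?t x) \<ominus>\<^bsub>L\<^esub> bracket L ?t (e x) = bracket L ?t x"
        using e(2)[OF vw(1)] e(3)[of ?t x] t el(1)[of x] by (simp add: L.L_add_minus_cancel L.bracket_closed)
    qed
  qed
  have cf: "K.C (Suc m) (\<lambda>xs. c \<otimes>\<^bsub>k\<^esub> f xs)" using K.C_smult[OF c(1) Cf] by simp
  \<comment> \<open>The Lie derivative preserves exact cochains and makes \<open>f\<close> exact, so
    it makes \<open>G\<close>, which is \<open>c f\<close> plus an exact cochain, exact too.\<close>
  have "K.exact m (\<lambda>xs. ?D (\<lambda>xs. G xs \<ominus>\<^bsub>k\<^esub> c \<otimes>\<^bsub>k\<^esub> f xs) xs \<oplus>\<^bsub>k\<^esub> c \<otimes>\<^bsub>k\<^esub> ?D f xs)"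
    by (intro K.exact_add K.exact_smult K.exact_LT[OF ad der c(2)] c(1) Df)
  then have DG: "K.exact m (?D G)"
  proof (rule K.exact_cong)
    fix xs assume xs: "xs \<in> K.LS (Suc m)"
    show "?D (\<lambda>xs. G xs \<ominus>\<^bsub>k\<^esub> c \<otimes>\<^bsub>k\<^esub> f xs) xs \<oplus>\<^bsub>k\<^esub> c \<otimes>\<^bsub>k\<^esub> ?D f xs = ?D G xs"
      using K.LD_minus[OF ad GK cf xs] K.LD_smult[OF ad c(1) Cf xs] K.LT_closed[OF ad GK xs] K.LT_closed[OF ad Cf xs] c(1)
      by (simp add: L.R.minus_add_cancel)
  qed
  have Gt: "K.C m (\<lambda>zs. G (?t # zs))" by (rule cochain_mono[OF sub T.C_inner[OF G(1) t(1)]])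
  have "K.exact m (K.d (\<lambda>zs. G (?t # zs)))" by (rule K.exactI[OF Gt HOL.refl])
  \<comment> \<open>Cartan's formula for \<open>d G = ?F\<close>, contracted with \<open>t\<close>:
    \<open>f = i_t ?F = L_t G - d (i_t G)\<close>, where both terms are exact on the kernel.\<close>
  from K.exact_minus[OF DG this] have "K.exact m f"
  proof (rule K.exact_cong)
    fix xs assume xs: "xs \<in> K.LS (Suc m)"
    have "?F (?t # xs) = T.d G (?t # xs)" using G(2)[of "?t # xs"] t lists_of_mono[OF sub xs] by simp
    then show "?D G xs \<ominus>\<^bsub>k\<^esub> K.d (\<lambda>zs. G (?t # zs)) xs = f xs" using F(3)[OF t xs] by simp
  qed
  then show False using nex by blast
qed

text \<open>Duality gives \<open>\<xi> g - c f = d h\<close> with \<open>c\<close> nonzero. On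
  tuples avoiding \<open>v\<close> the wedge with the coordinate \<open>\<xi>\<close> vanishes, so
  \<open>h\<close> divided by \<open>c\<close> is a primitive of \<open>- f\<close> there.\<close>

lemma primitive_of_dual:
  assumes v: "v \<in> V" "w \<in> V" "v \<noteq> w"
    and nd: "nondegenerate_pairing (cohomology k BB triv 1) (cohomology k BB triv m) (cohomology k BB triv (Suc m))
      (cup_product k BB 1 m)"
    and span: "\<And>a. trivial_coefficients.cocycle k L ker (Suc m) a \<Longrightarrow>
      \<exists>c\<in>carrier k. trivial_coefficients.exact k L ker m (\<lambda>xs. a xs \<ominus>\<^bsub>k\<^esub> c \<otimes>\<^bsub>k\<^esub> f xs)"
    and f: "trivial_coefficients.cocycle k L ker (Suc m) f"
  shows "\<exists>g. cochain k L triv ker m g \<and>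
      (\<forall>xs\<in>lists_of {x \<in> avoiding v. aug x = \<zero>\<^bsub>k\<^esub>} (Suc m). cobd L triv g xs = \<ominus>\<^bsub>k\<^esub> f xs)"
proof -
  interpret K: ce_bridge k L ker BB by (rule ce_bridge_BB)
  note K.S_L [simp del]
  interpret k: field k by (rule k)
  obtain \<xi> where \<xi>: "\<xi> \<in> lie_hom k L (ground_lie_algebra k)"
    "\<And>u. u \<in> V \<Longrightarrow> \<xi> (vx u) = (if u = v then \<one>\<^bsub>k\<^esub> else \<zero>\<^bsub>k\<^esub>)" "\<And>x. x \<in> avoiding v \<Longrightarrow> \<xi> x = \<zero>\<^bsub>k\<^esub>"
    by (rule coordinate[of v]) blast
  interpret T: lie_character k L "carrier L" \<xi> by (rule lie_character[OF _ \<xi>(1)]) simp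
  interpret T': lie_character k L "carrier L" aug by (rule L_character)
  have lf: "K.linear_form \<xi>" using T.\<chi>D by (simp add: K.linear_form_def)
  have br: "\<xi> (bracket L x y) = \<zero>\<^bsub>k\<^esub>" if "x \<in> ker" "y \<in> ker" for x y using T.\<chi>_bracket that by simp
  \<comment> \<open>The second vertex supplies an element of the kernel whose
    \<open>v\<close>-coordinate is one, so the coordinate form remains nonzero after restriction to
    the kernel.\<close>
  let ?x = "vx v \<ominus>\<^bsub>L\<^esub> vx w"
  have x: "?x \<in> ker" "\<xi> ?x = \<one>\<^bsub>k\<^esub>"
    using T'.\<chi>_minus[of "vx v" "vx w"] T.\<chi>_minus[of "vx v" "vx w"] v aug \<xi>(2)
    by (auto simp: L.R.minus_self L.R.minus_zero_right T.S_minus)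
  then obtain g where g: "K.cocycle m g" "\<not> K.exact m (wedge k \<xi> g)"
    using K.dual_class[OF nd lf br x(1)] by auto
  have gC: "K.C m g" "\<And>xs. xs \<in> K.LS (Suc m) \<Longrightarrow> K.d g xs = \<zero>\<^bsub>k\<^esub>" using g(1) by (auto simp: K.cocycle_def)
  note WC = K.wedge_C[OF lf gC(1)]
  have "K.cocycle (Suc m) (wedge k \<xi> g)"
    unfolding K.cocycle_def
  proof (intro conjI WC ballI)
    fix xs assume xs: "xs \<in> K.LS (Suc (Suc m))"
    show "K.d (wedge k \<xi> g) xs = \<zero>\<^bsub>k\<^esub>"
      using K.d_wedge[OF lf br gC(1) xs] K.wedge_zero[OF lf gC(2) xs] by (simp add: L.R.a_inv_zero)
  qed
  from span[OF this] obtain c where c: "c \<in> carrier k"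
    "K.exact m (\<lambda>xs. wedge k \<xi> g xs \<ominus>\<^bsub>k\<^esub> c \<otimes>\<^bsub>k\<^esub> f xs)" by blast
  have fc: "f xs \<in> carrier k" if "xs \<in> K.LS (Suc m)" for xs
    using f K.C_closed[OF _ that] by (simp add: K.cocycle_def)
  \<comment> \<open>With \<open>c\<close> zero the wedge itself would be exact, contrary to the
    choice of \<open>g\<close>.\<close>
  have c0: "c \<noteq> \<zero>\<^bsub>k\<^esub>"
  proof
    assume c0: "c = \<zero>\<^bsub>k\<^esub>"
    have "K.exact m (wedge k \<xi> g)"
      by (rule K.exact_cong[OF c(2)]) (use fc c0 K.C_closed[OF WC] in \<open>simp add: L.R.minus_zero_right\<close>)
    then show False using g(2) by blast
  qed
  from c(2) obtain h where h: "K.C m h" "\<forall>xs\<in>K.LS (Suc m). K.d h xs = wedge k \<xi> g xs \<ominus>\<^bsub>k\<^esub> c \<otimes>\<^bsub>k\<^esub> f xs"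
    by (rule K.exactE)
  have ci: "inv\<^bsub>k\<^esub> c \<in> carrier k" "inv\<^bsub>k\<^esub> c \<otimes>\<^bsub>k\<^esub> c = \<one>\<^bsub>k\<^esub>" using c(1) c0 k.field_Units by auto
  show ?thesis
  proof (intro exI conjI ballI)
    show "K.C m (\<lambda>xs. inv\<^bsub>k\<^esub> c \<otimes>\<^bsub>k\<^esub> h xs)" using K.C_smult[OF ci(1) h(1)] by simp
    fix xs assume xs: "xs \<in> lists_of {x \<in> avoiding v. aug x = \<zero>\<^bsub>k\<^esub>} (Suc m)"
    have xs': "xs \<in> K.LS (Suc m)" by (rule lists_of_mono[OF _ xs]) (auto simp: avoiding_def)
    have "wedge k \<xi> g xs = \<zero>\<^bsub>k\<^esub>"
      by (rule K.wedge_vanish[OF _ _ gC(1)]) (use xs xs' \<xi>(3) in \<open>auto simp: lists_of_def\<close>)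
    then have "K.d h xs = \<ominus>\<^bsub>k\<^esub> (c \<otimes>\<^bsub>k\<^esub> f xs)" using h(2) xs' c(1) fc[OF xs'] by (simp add: a_minus_def)
    then show "K.d (\<lambda>xs. inv\<^bsub>k\<^esub> c \<otimes>\<^bsub>k\<^esub> h xs) xs = \<ominus>\<^bsub>k\<^esub> f xs"
      using K.d_smult[OF ci(1) h(1) xs'] ci c(1) fc[OF xs'] by (simp add: L.R.r_minus L.R.m_assoc[symmetric])
  qed
qed

end

text \<open>A nonzero character is a nonzero class in \<open>H^1\<close> with trivial coefficients,
  because the 1-coboundaries vanish. The ground field has to be copied to the element type over
  which \<open>cohomological_dimension\<close> quantifies.\<close>

lemma cohomological_dimension_positive:
  fixes B :: "('a, 'b, 'y) lie_algebra_scheme"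
  assumes B: "lie_algebra R B" and \<xi>: "\<xi> \<in> lie_hom R B (ground_lie_algebra R)"
    and x0: "x0 \<in> carrier B" "\<xi> x0 \<noteq> \<zero>\<^bsub>R\<^esub>"
  shows "cohomological_dimension R B \<noteq> 0"
proof -
  interpret B: lie_algebra R B by (rule B)
  note \<xi>D = lie_homD[OF \<xi>, simplified]
  let ?T = "trivial_module R :: ('a, 'a, 'b) lie_module"
  have T: "lie_module R B ?T" by (rule B.trivial_lie_module)
  interpret T: trivial_coefficients R B "carrier B"
    by (intro trivial_coefficients.intro lie_module.lie_sub_carrier T)
  \<comment> \<open>The copy consists of the constant functions on lists, and evaluation at the
    empty list recovers the scalar.\<close>
  define p :: "'a \<Rightarrow> 'b list \<Rightarrow> 'a" where "p c = (\<lambda>_. c)" for c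
  define s :: "('b list \<Rightarrow> 'a) \<Rightarrow> 'a" where "s a = a []" for a
  interpret Q: image_data R B ?T p s
    by unfold_locales (auto simp: p_def s_def)
  let ?Q = "image_module ?T p s"
  have Q: "lie_module R B ?Q" by (rule Q.image_lie_module)
  interpret M: lie_sub R B ?Q "carrier B" by (rule lie_module.lie_sub_carrier[OF Q])
  note sim = Q.image_simps[simplified]
  have act0: "act ?Q x a = \<zero>\<^bsub>?Q\<^esub>" if "x \<in> carrier B" "a \<in> carrier ?Q" for x a
    using that sim(1,2,5) by auto
  have ch: "f \<in> cochains R B ?Q n \<longleftrightarrow> f \<in> extensional (M.LS n) \<and> M.C n f" for f n
    by (rule M.cochains_iff) simp_all
  have tup: "tuples B n = M.LS n" for n by (simp add: tuples_def lists_of_def)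
  let ?\<phi> = "\<lambda>xs\<in>M.LS 1. p (\<xi> (hd xs))"
  have \<phi>C: "M.C 1 ?\<phi>"
    using \<xi>D(1) by (simp add: sim \<xi>D B.bracket_closed)
  have cb0: "coboundary_map R B ?Q 0 f = (\<lambda>xs\<in>M.LS (Suc 0). \<zero>\<^bsub>?Q\<^esub>)" if "M.C 0 f" for f
  proof (rule HOL.ext)
    fix xs
    show "coboundary_map R B ?Q 0 f xs = (\<lambda>xs\<in>M.LS (Suc 0). \<zero>\<^bsub>?Q\<^esub>) xs"
    proof (cases "xs \<in> M.LS (Suc 0)")
      case True
      then obtain x where x: "xs = [x]" "x \<in> carrier B" by (blast elim: lists_of_1E)
      then show ?thesis using True that act0[OF x(2)]
        by (simp add: coboundary_map_def tup nths_Cons sign_pow_def)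
    qed (simp add: coboundary_map_def tup)
  qed
  have cb1: "coboundary_map R B ?Q 1 ?\<phi> = (\<lambda>xs\<in>M.LS (Suc 1). \<zero>\<^bsub>?Q\<^esub>)"
  proof (rule HOL.ext)
    fix xs
    show "coboundary_map R B ?Q 1 ?\<phi> xs = (\<lambda>xs\<in>M.LS (Suc 1). \<zero>\<^bsub>?Q\<^esub>) xs"
    proof (cases "xs \<in> M.LS (Suc 1)")
      case True
      then obtain x y where x: "xs = [x, y]" "x \<in> carrier B" "y \<in> carrier B" by (auto elim!: lists_of_SucE)
      have n: "nths xs (- {0}) = [y]" "nths xs (- {Suc 0}) = [x]" "nths xs (- {0, Suc 0}) = []"
        using x by (auto simp: nths_Cons)
      have v: "?\<phi> [z] \<in> carrier ?Q" if "z \<in> carrier B" for z using that \<xi>D(1) unfolding sim(1) by simp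
      have b: "?\<phi> [bracket B x y] = \<zero>\<^bsub>?Q\<^esub>" using x unfolding sim(2) by (simp add: \<xi>D B.bracket_closed)
      have c: "sign_pow R i \<odot>\<^bsub>?Q\<^esub> \<zero>\<^bsub>?Q\<^esub> = \<zero>\<^bsub>?Q\<^esub>" for i
        by (rule M.M.smult_r_null) (simp add: sign_pow_def)
      have 1: "sign_pow R i \<odot>\<^bsub>?Q\<^esub> act ?Q (xs ! i) (?\<phi> (nths xs (- {i}))) = \<zero>\<^bsub>?Q\<^esub>" if "i \<le> 1" for i
      proof -
        have "i = 0 \<or> i = Suc 0" using that by auto
        then have "act ?Q (xs ! i) (?\<phi> (nths xs (- {i}))) = \<zero>\<^bsub>?Q\<^esub>"
        proof
          assume i: "i = 0"
          show ?thesis unfolding i n(1) by (rule act0[OF _ v[OF x(3)]]) (simp add: x)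
        next
          assume i: "i = Suc 0"
          show ?thesis unfolding i n(2) by (rule act0[OF _ v[OF x(2)]]) (simp add: x)
        qed
        then show ?thesis using c by (simp only:)
      qed
      have 2: "sign_pow R (i + j) \<odot>\<^bsub>?Q\<^esub> ?\<phi> (bracket B (xs ! i) (xs ! j) # nths xs (- {i, j})) = \<zero>\<^bsub>?Q\<^esub>"
        if "i < j" "j \<le> 1" for i j
      proof -
        have ij: "i = 0" "j = Suc 0" using that by auto
        have "?\<phi> (bracket B (xs ! i) (xs ! j) # nths xs (- {i, j})) = \<zero>\<^bsub>?Q\<^esub>"
          using b unfolding ij n(3) by (simp add: x(1))
        then show ?thesis using c by (simp only:)
      qed
      have "(\<Oplus>\<^bsub>?Q\<^esub>i\<in>{..1}. sign_pow R i \<odot>\<^bsub>?Q\<^esub> act ?Q (xs ! i) (?\<phi> (nths xs (- {i})))) = \<zero>\<^bsub>?Q\<^esub>"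
        by (rule M.M.add.finprod_one_eqI[simplified]) (use 1 in blast)
      moreover have "(\<Oplus>\<^bsub>?Q\<^esub>j\<in>{..1}. \<Oplus>\<^bsub>?Q\<^esub>i\<in>{..<j}.
          sign_pow R (i + j) \<odot>\<^bsub>?Q\<^esub> ?\<phi> (bracket B (xs ! i) (xs ! j) # nths xs (- {i, j}))) = \<zero>\<^bsub>?Q\<^esub>"
        by (rule M.M.add.finprod_one_eqI[simplified], rule M.M.add.finprod_one_eqI[simplified], rule 2) auto
      ultimately show ?thesis using True unfolding coboundary_map_def tup
        by (simp only: restrict_apply if_True M.M.l_zero M.M.zero_closed)
    qed (simp add: coboundary_map_def tup)
  qed
  let ?Z = "cocycle_module R B ?Q 1" and ?Bd = "coboundaries R B ?Q 1"
  have \<phi>Z: "?\<phi> \<in> carrier ?Z"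
    using cb1 \<phi>C ch[of ?\<phi> 1] by (simp add: cocycle_module_def cochain_module_def tup)
  have Bd: "?Bd = {\<lambda>xs\<in>M.LS (Suc 0). \<zero>\<^bsub>?Q\<^esub>}"
  proof -
    have "(\<lambda>xs\<in>M.LS 0. \<zero>\<^bsub>?Q\<^esub>) \<in> cochains R B ?Q 0" by (simp add: ch)
    moreover have "coboundary_map R B ?Q 0 f = (\<lambda>xs\<in>M.LS (Suc 0). \<zero>\<^bsub>?Q\<^esub>)" if "f \<in> cochains R B ?Q 0" for f
      using that cb0 ch by blast
    ultimately show ?thesis by (auto simp: image_iff)
  qed
  have "?Bd +>\<^bsub>?Z\<^esub> ?\<phi> \<in> carrier (cohomology R B ?Q 1)"
    using \<phi>Z by (auto simp: cohomology_def Let_def A_RCOSETS_def')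
  moreover have "?Bd +>\<^bsub>?Z\<^esub> ?\<phi> \<noteq> ?Bd"
  proof
    assume "?Bd +>\<^bsub>?Z\<^esub> ?\<phi> = ?Bd"
    then have "(\<lambda>xs\<in>M.LS (Suc 0). \<zero>\<^bsub>?Q\<^esub>) \<oplus>\<^bsub>?Z\<^esub> ?\<phi> = (\<lambda>xs\<in>M.LS (Suc 0). \<zero>\<^bsub>?Q\<^esub>)"
      unfolding Bd by (auto simp: a_r_coset_def')
    from fun_cong[OF this, of "[x0]"] have "p (\<xi> x0) = \<zero>\<^bsub>?Q\<^esub>"
      using x0 \<xi>D(1)[OF x0(1)] by (simp add: cocycle_module_def cochain_module_def tup sim)
    then show False using x0(2) by (simp add: sim p_def fun_eq_iff)
  qed
  ultimately have "carrier (cohomology R B ?Q 1) \<noteq> {\<zero>\<^bsub>cohomology R B ?Q 1\<^esub>}"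
    by (auto simp: cohomology_def Let_def)
  then have "enat 1 \<in> {enat n | n. \<exists>M :: ('a, 'b list \<Rightarrow> 'a, 'b) lie_module.
            lie_module R B M \<and> carrier (cohomology R B M n) \<noteq> {\<zero>\<^bsub>cohomology R B M n\<^esub>}}"
    using Q by blast
  then have "enat 1 \<le> cohomological_dimension R B"
    unfolding cohomological_dimension_def by (rule Sup_upper)
  then show ?thesis by (auto simp: zero_enat_def one_enat_def)
qed

section \<open>Complete graphs and the conclusion\<close>

context raag begin

lemma raag_induct [consumes 1, case_names vertex zero add smult bracket]:
  assumes x: "x \<in> carrier L"
    and "\<And>v. v \<in> V \<Longrightarrow> P (vx v)" "P \<zero>\<^bsub>L\<^esub>"
    "\<And>x y. \<lbrakk>x \<in> carrier L; y \<in> carrier L; P x; P y\<rbrakk> \<Longrightarrow> P (x \<oplus>\<^bsub>L\<^esub> y)"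
    "\<And>c x. \<lbrakk>c \<in> carrier k; x \<in> carrier L; P x\<rbrakk> \<Longrightarrow> P (c \<odot>\<^bsub>L\<^esub> x)"
    "\<And>x y. \<lbrakk>x \<in> carrier L; y \<in> carrier L; P x; P y\<rbrakk> \<Longrightarrow> P (bracket L x y)"
  shows "P x"
proof -
  let ?c = "lie_class k V (raag_relators E :: ('a, 'v) lie_term set)"
  have inL: "?c t \<in> carrier L" if "t \<in> lie_terms k V" for t
    using that unfolding raag_lie_algebra_def presented_carrier by blast
  note sim = presented_simps[OF kc, where V = V and S = "raag_relators E", folded raag_lie_algebra_def]
  have "P (?c t)" if "t \<in> lie_terms k V" for t
    using that
  proof induction
    case (Gen v)
    then show ?case using assms(2) by (simp add: raag_vertex_def)
  next
    case Zero
    then show ?case using assms(3) by (simp add: raag_lie_algebra_def presented_zero)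
  next
    case (Add s t)
    then show ?case using assms(4)[OF inL inL, of s t] sim(1)[of s t] by simp
  next
    case (Smult c t)
    then show ?case using assms(5)[OF _ inL, of c t] sim(2)[of t t c] by simp
  next
    case (Brack s t)
    then show ?case using assms(6)[OF inL inL, of s t] sim(3)[of s t] by simp
  qed
  then show ?thesis using x unfolding raag_lie_algebra_def presented_carrier by blast
qed

text \<open>Centralisers are subalgebras: \<open>step\<close> treats brackets, linearity the rest. A
  vertex commutes with all vertices, hence with all of \<open>L\<close>; induction over the first
  argument then covers all elements.\<close>

lemma abelian_of_complete:
  assumes complete: "\<And>v w. \<lbrakk>v \<in> V; w \<in> V; v \<noteq> w\<rbrakk> \<Longrightarrow> {v, w} \<in> E"
    and "x \<in> carrier L" "y \<in> carrier L"
  shows "bracket L x y = \<zero>\<^bsub>L\<^esub>"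
proof -
  have vertices: "bracket L (vx v) (vx w) = \<zero>\<^bsub>L\<^esub>" if "v \<in> V" "w \<in> V" for v w
    using vx_edge[of v w] complete[OF that] L.bracket_self[of "vx v"] that by (cases "v = w") auto
  have z: "\<zero>\<^bsub>L\<^esub> \<oplus>\<^bsub>L\<^esub> \<zero>\<^bsub>L\<^esub> = \<zero>\<^bsub>L\<^esub>" "c \<odot>\<^bsub>L\<^esub> \<zero>\<^bsub>L\<^esub> = \<zero>\<^bsub>L\<^esub>" if "c \<in> carrier k" for c using that by simp_all
  have step: "bracket L z (bracket L x y) = \<zero>\<^bsub>L\<^esub>"
    if "x \<in> carrier L" "y \<in> carrier L" "z \<in> carrier L" "bracket L z x = \<zero>\<^bsub>L\<^esub>" "bracket L z y = \<zero>\<^bsub>L\<^esub>" for x y z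
    using L.bracket_leibniz[of z x y] that by (simp add: L.bracket_zero)
  have 1: "bracket L (vx v) y = \<zero>\<^bsub>L\<^esub>" if v: "v \<in> V" and "y \<in> carrier L" for v y
    using that(2) by (induction rule: raag_induct)
      (use v in \<open>simp_all add: vertices L.bracket_zero L.bracket_add_right L.bracket_smult_right step\<close>)
  show ?thesis
    using assms(2)
  proof (induction rule: raag_induct)
    case (bracket x' x'')
    then have "bracket L y x' = \<zero>\<^bsub>L\<^esub>" "bracket L y x'' = \<zero>\<^bsub>L\<^esub>"
      using L.bracket_skew[of y x'] L.bracket_skew[of y x''] assms(3) by (simp_all add: L.L_a_inv_zero)
    then show ?case
      using step[OF bracket(1,2) assms(3)] L.bracket_skew[of "bracket L x' x''" y] bracket assms(3)
      by (simp add: L.bracket_closed L.L_a_inv_zero)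
  qed (use assms(3) 1 in \<open>simp_all add: L.bracket_zero L.bracket_add_left L.bracket_smult_left\<close>)
qed

text \<open>For a missing edge the duality between \<open>H^1\<close> and \<open>H^(n-1)\<close> is
  applied once for each endpoint, the other endpoint acting as the second vertex.\<close>

lemma complete_of_poincare_duality:
  assumes pd: "poincare_duality_lie_algebra k BB n" and vw: "v \<in> V" "w \<in> V" "v \<noteq> w"
  shows "{v, w} \<in> E"
proof (rule ccontr)
  assume ne: "{v, w} \<notin> E"
  interpret K: ce_bridge k L ker BB by (rule ce_bridge_BB)
  note K.S_L [simp del]
  have pd': "cohomological_dimension k BB = enat n" "one_dimensional k (cohomology k BB triv n)"
    "\<And>i. i \<le> n \<Longrightarrow> nondegenerate_pairing (cohomology k BB triv i) (cohomology k BB triv (n - i))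
        (cohomology k BB triv n) (cup_product k BB i (n - i))"
    using pd by (auto simp: poincare_duality_lie_algebra_def)
  obtain \<xi> where \<xi>: "\<xi> \<in> lie_hom k L (ground_lie_algebra k)"
    "\<And>u. u \<in> V \<Longrightarrow> \<xi> (vx u) = (if u = v then \<one>\<^bsub>k\<^esub> else \<zero>\<^bsub>k\<^esub>)" "\<And>x. x \<in> avoiding v \<Longrightarrow> \<xi> x = \<zero>\<^bsub>k\<^esub>"
    by (rule coordinate[of v]) blast
  interpret T: lie_character k L "carrier L" \<xi> by (rule lie_character[OF _ \<xi>(1)]) simp
  interpret T': lie_character k L "carrier L" aug by (rule L_character)
  interpret k: field k by (rule k)
  let ?x = "vx v \<ominus>\<^bsub>L\<^esub> vx w"
  have x: "?x \<in> ker" "\<xi> ?x \<noteq> \<zero>\<^bsub>k\<^esub>"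
    using T'.\<chi>_minus[of "vx v" "vx w"] T.\<chi>_minus[of "vx v" "vx w"] vw aug \<xi>(2)
    by (auto simp: L.R.minus_self L.R.minus_zero_right T.S_minus)
  have "\<xi> \<in> lie_hom k BB (ground_lie_algebra k)"
    using \<xi>(1) by (auto simp: lie_hom_def K.B)
  \<comment> \<open>Excludes \<open>n = 0\<close>: the kernel has a nonzero character, so the degree
    of duality can be written \<open>Suc m\<close> and a pairing with \<open>H^1\<close> is
    available.\<close>
  then have "cohomological_dimension k BB \<noteq> 0"
    by (rule cohomological_dimension_positive[OF lie_algebra_bestvina_brady[OF kc]]) (use x K.B in auto)
  then obtain m where n: "n = Suc m" using pd'(1) by (cases n) (auto simp: zero_enat_def)
  obtain f where f: "K.cocycle (Suc m) f" "\<not> K.exact m f"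
    "\<And>a. K.cocycle (Suc m) a \<Longrightarrow> \<exists>c\<in>carrier k. K.exact m (\<lambda>xs. a xs \<ominus>\<^bsub>k\<^esub> c \<otimes>\<^bsub>k\<^esub> f xs)"
    using pd'(2) unfolding n by (rule K.fundamental_class) blast
  have nd: "nondegenerate_pairing (cohomology k BB triv 1) (cohomology k BB triv m) (cohomology k BB triv (Suc m))
      (cup_product k BB 1 m)"
    using pd'(3)[of 1] n by simp
  show False
  proof (rule no_fundamental_class[OF vw ne f])
    fix u assume "u \<in> {v, w}"
    then obtain u' where "u \<in> V" "u' \<in> V" "u \<noteq> u'" using vw by auto
    then show "\<exists>g. cochain k L triv ker m g \<and>
      (\<forall>xs\<in>lists_of {x \<in> avoiding u. aug x = \<zero>\<^bsub>k\<^esub>} (Suc m). cobd L triv g xs = \<ominus>\<^bsub>k\<^esub> f xs)"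
      by (rule primitive_of_dual[OF _ _ _ nd f(3,1)])
  qed
qed

end

theorem proposition3p2:
  fixes k :: "('a, 'x) ring_scheme"
    and V :: "'v set" and E :: "'v set set" and n :: nat
  assumes "field k"
    and "finite V" and "simplicial_graph V E"
    and "poincare_duality_lie_algebra k (bestvina_brady_lie_algebra k V E) n"
  shows "abelian_lie_algebra (bestvina_brady_lie_algebra k V E)"
proof -
  interpret raag k V E by (rule raag.intro) (rule assms(1))
  \<comment> \<open>The ambient algebra \<open>L\<close> is itself abelian once all edges are
    present, and the kernel inherits its bracket.\<close>
  have "bracket L x y = \<zero>\<^bsub>L\<^esub>" if "x \<in> carrier L" "y \<in> carrier L" for x y
    by (rule abelian_of_complete[OF complete_of_poincare_duality[OF assms(4)] that])
  then show ?thesis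
    by (simp add: abelian_lie_algebra_def bestvina_brady_lie_algebra_def a_kernel_def')
qed

end
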